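(* Assume that the initial data $(\rho_0,u_0,f_0)$ satisfies $$\inf_{x\in\mathbb{T}}\rho_0(x)>0,\quad \rho_0\in W^{1,\infty}(\mathbb{T}),\quad u_0\in H^1(\mathbb{T}),\quad 0\le f_0\in L^\infty(\mathbb{T}\times\mathbb{R}),\quad \mathrm{Supp}_v f_0(x,\cdot)\subset\{v\in\mathbb{R}: |v|\le R_0\},\ x\in\mathbb{T},$$ where $R_0>0$ is a constant, and let $(\rho,u,f)$ be the unique global weak solution of (NSV) on $\mathbb{T}$ described in the context. Set $$\overline{\rho_0}=\int_{\mathbb{T}}\rho_0(x)\,dx,\qquad u_s=\frac{\int_{\mathbb{T}}\rho_0u_0(x)\,dx+\int_{\mathbb{T}\times\mathbb{R}}vf_0(x,v)\,dv\,dx}{\int_{\mathbb{T}}\rho_0(x)\,dx+\int_{\mathbb{T}\times\mathbb{R}}f_0(x,v)\,dv\,dx},\qquad n(x,t)=\int_{\mathbb{R}}f(x,v,t)\,dv.$$ Then there are two constants $C_1>0$ and $\lambda>0$ independent of time such that for all $t\ge 0$ $$\|(\rho-\overline{\rho_0})(t)\|_{C^0(\mathbb{T})}+\|(u-u_s)(t)\|_{L^2(\mathbb{T})}\le C_1e^{-\lambda t},$$ $$\big\|\big(\sqrt f\,(v-u_s)\big)(t)\big\|_{L^2(\mathbb{T}\times\mathbb{R})}+\mathrm{W}_1\big(f(t),(n\,\delta(v-u_s))(t)\big)\le C_1e^{-\lambda t},$$ $$\mathrm{Supp}_v f(x,\cdot,t)\subset\{v\in\mathbb{R}: |v-u_s|\le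 C_1e^{-\lambda t}\},\quad (x,t)\in\mathbb{T}\times\mathbb{R}_+.$$
   Context: $\mathbb{T}=\mathbb{R}/\mathbb{Z}$. Let $\gamma>1$, $\beta\ge0$ be constants and $\mu(\rho)=1+\rho^\beta$. The initial value problem (NSV) on $\Omega$ (here $\Omega=\mathbb{T}$) for unknowns $\rho=\rho(x,t)$, $u=u(x,t)$, $f=f(x,v,t)$ is $$\rho_t+(\rho u)_x=0,$$ $$(\rho u)_t+(\rho u^2)_x+(\rho^\gamma)_x=(\mu(\rho)u_x)_x-\int_{\mathbb{R}}\rho(u-v)f\,dv,$$ $$f_t+vf_x+(\rho(u-v)f)_v=0,\qquad (x,v)\in\Omega\times\mathbb{R},\ t>0,$$ with initial data $(\rho,u)(x,0)=(\rho_0,u_0)(x)$, $f(x,v,0)=f_0(x,v)$. A weak solution satisfies the equations in the sense of distributions and attains the initial data. Under the stated assumptions on the data, (NSV) on $\mathbb{T}$ has a unique global weak solution such that for any $T>0$: $\rho\in C([0,T];H^1(\mathbb{T}))\cap L^\infty(0,T;W^{1,\infty}(\mathbb{T}))$; $u\in C([0,T];H^1(\mathbb{T}))\cap L^2(0,T;H^2(\mathbb{T}))$, $u_t\in L^2(0,T;L^2(\mathbb{T}))$; $f\in C([0,T];L^1(\mathbb{T}\times\mathbb{R}))\cap L^\infty(0,T;L^\infty(\mathbb{T}\times\mathbb{R}))$; and $0<\rho_-\le\rho\le\rho_+$, $\sup_{t\in[0,T]}\|\rho(t)\|_{H^1}\le C_0$, $0\le f\le e^{\rho_+T}\|f_0\|_{L^\infty(\mathbb{T}\times\mathbb{R})}$,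 $\mathrm{Supp}_v f(x,\cdot,t)\subset\{|v|\le R_1\}$ for $(x,t)\in\mathbb{T}\times[0,T]$, with positive constants $\rho_-,\rho_+,C_0,R_1$ independent of $T$. This is the solution meant in the claim. $\mathrm{Supp}_v f(x,\cdot,t)$ is the support of $v\mapsto f(x,v,t)$. $\delta$ is the Dirac measure, so $(n\delta(v-u_s))(t)$ is the measure $n(x,t)dx\otimes\delta_{u_s}(dv)$ on $X=\mathbb{T}\times\mathbb{R}$. For two nonnegative Borel measures $f_1,f_2$ on $X$ of equal finite mass, the Wasserstein distance of order 1 is $$\mathrm{W}_1(f_1,f_2)=\sup\Big\{\int_X\phi\,df_1-\int_X\phi\,df_2:\ \phi\in \mathrm{Lip}(X),\ \|\nabla\phi\|_{L^\infty(X)}\le1\Big\}.$$ *)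

theory Defs
  imports "HOL-Probability.Probability"
begin

text \<open>
  Functions on the torus \<open>\<real>/\<int>\<close> are 1-periodic functions on the real line, with integrals over
  the torus taken over \<open>{0..1}\<close>.  Functions of several variables are curried in the order
  \<open>\<rho> x t\<close>, \<open>u x t\<close>, \<open>f x v t\<close>.
\<close>

definition periodic1 :: "(real \<Rightarrow> 'b) \<Rightarrow> bool" where
  "periodic1 g \<longleftrightarrow> (\<forall>x. g (x + 1) = g x)"

abbreviation TxR :: "(real \<times> real) set" where
  "TxR \<equiv> {0..1} \<times> UNIV"

subsection \<open>Smooth functions and test functions\<close>

primrec Ck :: "nat \<Rightarrow> ('a::euclidean_space \<Rightarrow> real) \<Rightarrow> bool" where
  "Ck 0 g = continuous_on UNIV g"
| "Ck (Suc k) g = ((\<forall>x. g differentiable (at x)) \<and> (\<forall>h. Ck k (\<lambda>x. frechet_derivative g (at x) h)))"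

definition smooth :: "('a::euclidean_space \<Rightarrow> real) \<Rightarrow> bool" where
  "smooth g \<longleftrightarrow> (\<forall>k. Ck k g)"

definition test_x :: "(real \<Rightarrow> real) \<Rightarrow> bool" where
  "test_x \<phi> \<longleftrightarrow> smooth \<phi> \<and> periodic1 \<phi>"

definition test_xt :: "real set \<Rightarrow> (real \<Rightarrow> real \<Rightarrow> real) \<Rightarrow> bool" where
  "test_xt I \<phi> \<longleftrightarrow> smooth (\<lambda>(x, t). \<phi> x t) \<and> periodic1 \<phi> \<and>
     (\<exists>a b. {a..b} \<subseteq> I \<and> (\<forall>x t. t \<notin> {a..b} \<longrightarrow> \<phi> x t = 0))"

definition test_xvt :: "real set \<Rightarrow> (real \<Rightarrow> real \<Rightarrow> real \<Rightarrow> real) \<Rightarrow> bool" where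
  "test_xvt I \<psi> \<longleftrightarrow> smooth (\<lambda>(x, v, t). \<psi> x v t) \<and> periodic1 \<psi> \<and>
     (\<exists>a b R. {a..b} \<subseteq> I \<and> (\<forall>x v t. t \<notin> {a..b} \<or> \<bar>v\<bar> > R \<longrightarrow> \<psi> x v t = 0))"

subsection \<open>Lebesgue and Sobolev spaces\<close>

definition L2_norm :: "'a::euclidean_space set \<Rightarrow> ('a \<Rightarrow> real) \<Rightarrow> real" where
  "L2_norm A g = sqrt (LINT z:A|lborel. (g z)\<^sup>2)"

text \<open>For functions periodic in \<open>x\<close>, the essential supremum over the whole line is the one
  over the torus.\<close>

definition Linf_norm :: "('a::euclidean_space \<Rightarrow> real) \<Rightarrow> ereal" where
  "Linf_norm g = esssup lborel (\<lambda>z. ereal \<bar>g z\<bar>)"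

definition L2_T :: "(real \<Rightarrow> real) \<Rightarrow> bool" where
  "L2_T g \<longleftrightarrow> periodic1 g \<and> g \<in> borel_measurable borel \<and> set_integrable lborel {0..1} (\<lambda>x. (g x)\<^sup>2)"

definition Linf_T :: "(real \<Rightarrow> real) \<Rightarrow> bool" where
  "Linf_T g \<longleftrightarrow> periodic1 g \<and> g \<in> borel_measurable borel \<and> Linf_norm g < \<infinity>"

definition L1_TxR :: "(real \<Rightarrow> real \<Rightarrow> real) \<Rightarrow> bool" where
  "L1_TxR g \<longleftrightarrow> periodic1 g \<and> (\<lambda>(x, v). g x v) \<in> borel_measurable borel \<and>
     set_integrable lborel TxR (\<lambda>(x, v). g x v)"

definition Linf_TxR :: "(real \<Rightarrow> real \<Rightarrow> real) \<Rightarrow> bool" where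
  "Linf_TxR g \<longleftrightarrow> periodic1 g \<and> (\<lambda>(x, v). g x v) \<in> borel_measurable borel \<and>
     Linf_norm (\<lambda>(x, v). g x v) < \<infinity>"

definition weak_deriv :: "(real \<Rightarrow> real) \<Rightarrow> (real \<Rightarrow> real) \<Rightarrow> bool" where
  "weak_deriv g h \<longleftrightarrow> periodic1 g \<and> periodic1 h \<and>
     set_integrable lborel {0..1} g \<and> set_integrable lborel {0..1} h \<and>
     (\<forall>\<phi>. test_x \<phi> \<longrightarrow>
        (LINT x:{0..1}|lborel. g x * deriv \<phi> x) = - (LINT x:{0..1}|lborel. h x * \<phi> x))"

text \<open>The weak derivative is unique only up to null sets; \<open>wderiv\<close> picks one representative,
  so it may only be used where the choice of representative does not matter.\<close>

definition wderiv :: "(real \<Rightarrow> real) \<Rightarrow> real \<Rightarrow> real" where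
  "wderiv g = (SOME h. weak_deriv g h)"

definition H1_T :: "(real \<Rightarrow> real) \<Rightarrow> bool" where
  "H1_T g \<longleftrightarrow> L2_T g \<and> (\<exists>h. weak_deriv g h \<and> L2_T h)"

definition H1_norm :: "(real \<Rightarrow> real) \<Rightarrow> real" where
  "H1_norm g = sqrt ((L2_norm {0..1} g)\<^sup>2 + (L2_norm {0..1} (wderiv g))\<^sup>2)"

definition H2_T :: "(real \<Rightarrow> real) \<Rightarrow> bool" where
  "H2_T g \<longleftrightarrow> L2_T g \<and> (\<exists>h. weak_deriv g h \<and> H1_T h)"

definition H2_norm :: "(real \<Rightarrow> real) \<Rightarrow> real" where
  "H2_norm g = sqrt ((L2_norm {0..1} g)\<^sup>2 + (L2_norm {0..1} (wderiv g))\<^sup>2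
                     + (L2_norm {0..1} (wderiv (wderiv g)))\<^sup>2)"

definition W1inf_T :: "(real \<Rightarrow> real) \<Rightarrow> bool" where
  "W1inf_T g \<longleftrightarrow> Linf_T g \<and> (\<exists>h. weak_deriv g h \<and> Linf_T h)"

definition W1inf_norm :: "(real \<Rightarrow> real) \<Rightarrow> ereal" where
  "W1inf_norm g = Linf_norm g + Linf_norm (wderiv g)"

definition C0_norm :: "(real \<Rightarrow> real) \<Rightarrow> real" where
  "C0_norm g = (SUP x\<in>{0..1}. \<bar>g x\<bar>)"

text \<open>Support of an almost-everywhere class of functions: the complement of the largest open
  set on which the function vanishes almost everywhere.\<close>

definition ess_supp :: "(real \<Rightarrow> real) \<Rightarrow> real set" where
  "ess_supp g = - \<Union>{U. open U \<and> (AE v in lborel. v \<in> U \<longrightarrow> g v = 0)}"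

subsection \<open>Spaces of time-dependent functions\<close>

definition C_H1 :: "real \<Rightarrow> (real \<Rightarrow> real \<Rightarrow> real) \<Rightarrow> bool" where
  "C_H1 T g \<longleftrightarrow> (\<forall>t\<in>{0..T}. H1_T (\<lambda>x. g x t)) \<and>
     (\<forall>s\<in>{0..T}. ((\<lambda>t. H1_norm (\<lambda>x. g x t - g x s)) \<longlongrightarrow> 0) (at s within {0..T}))"

definition Linf_W1inf :: "real \<Rightarrow> (real \<Rightarrow> real \<Rightarrow> real) \<Rightarrow> bool" where
  "Linf_W1inf T g \<longleftrightarrow> (AE t in lborel. t \<in> {0..T} \<longrightarrow> W1inf_T (\<lambda>x. g x t)) \<and>
     (\<exists>M::real. AE t in lborel. t \<in> {0..T} \<longrightarrow> W1inf_norm (\<lambda>x. g x t) \<le> ereal M)"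

text \<open>The completed measure is used because \<open>H2_norm\<close> is arbitrary on the null set of times at
  which the slice is not in \<open>H2_T\<close>.\<close>

definition L2_H2 :: "real \<Rightarrow> (real \<Rightarrow> real \<Rightarrow> real) \<Rightarrow> bool" where
  "L2_H2 T g \<longleftrightarrow> (AE t in lborel. t \<in> {0..T} \<longrightarrow> H2_T (\<lambda>x. g x t)) \<and>
     set_integrable lebesgue {0..T} (\<lambda>t. (H2_norm (\<lambda>x. g x t))\<^sup>2)"

definition dt_L2_L2 :: "real \<Rightarrow> (real \<Rightarrow> real \<Rightarrow> real) \<Rightarrow> bool" where
  "dt_L2_L2 T g \<longleftrightarrow> (\<exists>w. periodic1 w \<and> (\<lambda>(x, t). w x t) \<in> borel_measurable borel \<and>
     set_integrable lborel ({0..1} \<times> {0..T}) (\<lambda>(x, t). (w x t)\<^sup>2) \<and>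
     (\<forall>\<phi>. test_xt {0<..<T} \<phi> \<longrightarrow>
        (LINT t:{0..T}|lborel. LINT x:{0..1}|lborel. g x t * deriv (\<lambda>s. \<phi> x s) t) =
        - (LINT t:{0..T}|lborel. LINT x:{0..1}|lborel. w x t * \<phi> x t)))"

definition C_L1 :: "real \<Rightarrow> (real \<Rightarrow> real \<Rightarrow> real \<Rightarrow> real) \<Rightarrow> bool" where
  "C_L1 T f \<longleftrightarrow> (\<forall>t\<in>{0..T}. L1_TxR (\<lambda>x v. f x v t)) \<and>
     (\<forall>s\<in>{0..T}. ((\<lambda>t. LINT (x, v):TxR|lborel. \<bar>f x v t - f x v s\<bar>) \<longlongrightarrow> 0) (at s within {0..T}))"

definition Linf_Linf :: "real \<Rightarrow> (real \<Rightarrow> real \<Rightarrow> real \<Rightarrow> real) \<Rightarrow> bool" where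
  "Linf_Linf T f \<longleftrightarrow> (\<exists>M::real. AE t in lborel. t \<in> {0..T} \<longrightarrow> Linf_norm (\<lambda>(x, v). f x v t) \<le> ereal M)"

subsection \<open>The Navier--Stokes--Vlasov system\<close>

definition viscosity :: "real \<Rightarrow> real \<Rightarrow> real" where
  "viscosity \<beta> r = 1 + r powr \<beta>"

text \<open>Distributional form on the torus times \<open>(0,\<infinity>)\<close>.  The space-time integrals are iterated with
  time outermost, since the slicewise \<open>wderiv (\<lambda>y. u y t)\<close> is an arbitrary representative
  of \<open>u\<^sub>x(t)\<close> for each \<open>t\<close> and need not be jointly measurable.\<close>

definition continuity_eq :: "(real \<Rightarrow> real \<Rightarrow> real) \<Rightarrow> (real \<Rightarrow> real \<Rightarrow> real) \<Rightarrow> bool" where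
  "continuity_eq \<rho> u \<longleftrightarrow> (\<forall>\<phi>. test_xt {0<..} \<phi> \<longrightarrow>
     (LINT t:{0..}|lborel. LINT x:{0..1}|lborel.
        \<rho> x t * deriv (\<lambda>s. \<phi> x s) t + \<rho> x t * u x t * deriv (\<lambda>y. \<phi> y t) x) = 0)"

definition momentum_eq ::
  "real \<Rightarrow> real \<Rightarrow> (real \<Rightarrow> real \<Rightarrow> real) \<Rightarrow> (real \<Rightarrow> real \<Rightarrow> real) \<Rightarrow> (real \<Rightarrow> real \<Rightarrow> real \<Rightarrow> real) \<Rightarrow> bool" where
  "momentum_eq \<gamma> \<beta> \<rho> u f \<longleftrightarrow> (\<forall>\<phi>. test_xt {0<..} \<phi> \<longrightarrow>
     (LINT t:{0..}|lborel. LINT x:{0..1}|lborel.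
        \<rho> x t * u x t * deriv (\<lambda>s. \<phi> x s) t
        + (\<rho> x t * (u x t)\<^sup>2 + \<rho> x t powr \<gamma> - viscosity \<beta> (\<rho> x t) * wderiv (\<lambda>y. u y t) x)
            * deriv (\<lambda>y. \<phi> y t) x
        - (LINT v|lborel. \<rho> x t * (u x t - v) * f x v t) * \<phi> x t) = 0)"

definition vlasov_eq ::
  "(real \<Rightarrow> real \<Rightarrow> real) \<Rightarrow> (real \<Rightarrow> real \<Rightarrow> real) \<Rightarrow> (real \<Rightarrow> real \<Rightarrow> real \<Rightarrow> real) \<Rightarrow> bool" where
  "vlasov_eq \<rho> u f \<longleftrightarrow> (\<forall>\<psi>. test_xvt {0<..} \<psi> \<longrightarrow>
     (LINT t:{0..}|lborel. LINT (x, v):TxR|lborel.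
        f x v t * deriv (\<lambda>s. \<psi> x v s) t
        + v * f x v t * deriv (\<lambda>y. \<psi> y v t) x
        + \<rho> x t * (u x t - v) * f x v t * deriv (\<lambda>w. \<psi> x w t) v) = 0)"

definition initial_cond ::
  "(real \<Rightarrow> real) \<Rightarrow> (real \<Rightarrow> real) \<Rightarrow> (real \<Rightarrow> real \<Rightarrow> real) \<Rightarrow>
   (real \<Rightarrow> real \<Rightarrow> real) \<Rightarrow> (real \<Rightarrow> real \<Rightarrow> real) \<Rightarrow> (real \<Rightarrow> real \<Rightarrow> real \<Rightarrow> real) \<Rightarrow> bool" where
  "initial_cond \<rho>0 u0 f0 \<rho> u f \<longleftrightarrow>
     (AE x in lborel. \<rho> x 0 = \<rho>0 x) \<and> (AE x in lborel. u x 0 = u0 x) \<and>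
     (AE (x, v) in lborel. f x v 0 = f0 x v)"

text \<open>\<open>\<rho>(t)\<close> and \<open>u(t)\<close>, elements of \<open>H\<^sup>1\<close> of the torus, are given by their continuous
  representatives; \<open>f(t)\<close> is only determined almost everywhere.\<close>

definition regularity ::
  "(real \<Rightarrow> real \<Rightarrow> real) \<Rightarrow> (real \<Rightarrow> real \<Rightarrow> real) \<Rightarrow> (real \<Rightarrow> real \<Rightarrow> real \<Rightarrow> real) \<Rightarrow> bool" where
  "regularity \<rho> u f \<longleftrightarrow>
     (\<forall>t\<ge>0. continuous_on UNIV (\<lambda>x. \<rho> x t) \<and> continuous_on UNIV (\<lambda>x. u x t)) \<and>
     (\<forall>T>0. C_H1 T \<rho> \<and> Linf_W1inf T \<rho> \<and>
            C_H1 T u \<and> L2_H2 T u \<and> dt_L2_L2 T u \<and>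
            C_L1 T f \<and> Linf_Linf T f)"

definition uniform_bounds ::
  "(real \<Rightarrow> real \<Rightarrow> real) \<Rightarrow> (real \<Rightarrow> real \<Rightarrow> real) \<Rightarrow> (real \<Rightarrow> real \<Rightarrow> real \<Rightarrow> real) \<Rightarrow> bool" where
  "uniform_bounds f0 \<rho> f \<longleftrightarrow>
     (\<exists>\<rho>m>0. \<exists>\<rho>p>0. \<exists>C0>0. \<exists>R1>0. \<forall>T>0. \<forall>t\<in>{0..T}.
        (\<forall>x. \<rho>m \<le> \<rho> x t \<and> \<rho> x t \<le> \<rho>p) \<and>
        H1_norm (\<lambda>x. \<rho> x t) \<le> C0 \<and>
        (AE (x, v) in lborel. 0 \<le> f x v t \<and>
           ereal (f x v t) \<le> ereal (exp (\<rho>p * T)) * Linf_norm (\<lambda>(x, v). f0 x v)) \<and>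
        (AE x in lborel. ess_supp (\<lambda>v. f x v t) \<subseteq> {v. \<bar>v\<bar> \<le> R1}))"

definition NSV_global_weak_solution ::
  "real \<Rightarrow> real \<Rightarrow> (real \<Rightarrow> real) \<Rightarrow> (real \<Rightarrow> real) \<Rightarrow> (real \<Rightarrow> real \<Rightarrow> real) \<Rightarrow>
   (real \<Rightarrow> real \<Rightarrow> real) \<Rightarrow> (real \<Rightarrow> real \<Rightarrow> real) \<Rightarrow> (real \<Rightarrow> real \<Rightarrow> real \<Rightarrow> real) \<Rightarrow> bool" where
  "NSV_global_weak_solution \<gamma> \<beta> \<rho>0 u0 f0 \<rho> u f \<longleftrightarrow>
     continuity_eq \<rho> u \<and> momentum_eq \<gamma> \<beta> \<rho> u f \<and> vlasov_eq \<rho> u f \<and>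
     initial_cond \<rho>0 u0 f0 \<rho> u f \<and> regularity \<rho> u f \<and> uniform_bounds f0 \<rho> f"

subsection \<open>Asymptotic profile\<close>

definition mean_density :: "(real \<Rightarrow> real) \<Rightarrow> real" where
  "mean_density \<rho>0 = (LINT x:{0..1}|lborel. \<rho>0 x)"

definition u_inf :: "(real \<Rightarrow> real) \<Rightarrow> (real \<Rightarrow> real) \<Rightarrow> (real \<Rightarrow> real \<Rightarrow> real) \<Rightarrow> real" where
  "u_inf \<rho>0 u0 f0 =
     ((LINT x:{0..1}|lborel. \<rho>0 x * u0 x) + (LINT (x, v):TxR|lborel. v * f0 x v))
     / ((LINT x:{0..1}|lborel. \<rho>0 x) + (LINT (x, v):TxR|lborel. f0 x v))"

definition num_density :: "(real \<Rightarrow> real \<Rightarrow> real \<Rightarrow> real) \<Rightarrow> real \<Rightarrow> real \<Rightarrow> real" where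
  "num_density f x t = (LINT v|lborel. f x v t)"

text \<open>Borel measures on the torus times \<open>\<real>\<close> are represented on the fundamental domain
  \<open>[0,1) \<times> \<real>\<close>.\<close>

definition kinetic_measure :: "(real \<Rightarrow> real \<Rightarrow> real) \<Rightarrow> (real \<times> real) measure" where
  "kinetic_measure g = density lborel (\<lambda>(x, v). indicator {0..<1} x * ennreal (g x v))"

definition monokinetic_measure :: "(real \<Rightarrow> real) \<Rightarrow> real \<Rightarrow> (real \<times> real) measure" where
  "monokinetic_measure n w =
     density lborel (\<lambda>x. indicator {0..<1} x * ennreal (n x)) \<Otimes>\<^sub>M return borel w"

text \<open>Lipschitz functions on the torus times \<open>\<real>\<close> are the Lipschitz functions on the plane that are
  1-periodic in the first variable.  Being Lipschitz, they are differentiable almost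
  everywhere; the operator norm of the derivative is the Euclidean norm of the gradient.\<close>

definition W1_test :: "(real \<times> real \<Rightarrow> real) set" where
  "W1_test = {\<phi>. (\<forall>x v. \<phi> (x + 1, v) = \<phi> (x, v)) \<and> (\<exists>L. L-lipschitz_on UNIV \<phi>) \<and>
     (AE z in lborel. \<exists>D. (\<phi> has_derivative D) (at z) \<and> onorm D \<le> 1)}"

definition W1 :: "(real \<times> real) measure \<Rightarrow> (real \<times> real) measure \<Rightarrow> ereal" where
  "W1 \<mu> \<nu> = (SUP \<phi>\<in>W1_test. ereal ((LINT z|\<mu>. \<phi> z) - (LINT z|\<nu>. \<phi> z)))"

end

theory Submission
  imports Defs
begin

text \<open>
  Write \<open>w = u - u\<^sub>s\<close> and \<open>\<xi> = v - u\<^sub>s\<close>, and let \<open>P r = r\<^sup>\<gamma> / (\<gamma> - 1)\<close>.  The energy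
  \<open>\<integral> \<rho> w\<^sup>2 / 2 + \<integral> (P \<rho> - P (mean \<rho>)) + \<integral> \<xi>\<^sup>2 f / 2\<close> decreases at the rate
  \<open>D = \<integral> \<mu>(\<rho>) u\<^sub>x\<^sup>2 + \<integral> \<rho> (u - v)\<^sup>2 f\<close> (\<open>energy_derivative\<close>).  The total momentum of fluid and
  particles vanishes in the frame that moves with \<open>u\<^sub>s\<close>; with the Poincare inequality this gives
  \<open>sup w\<^sup>2 \<le> C D\<close> (\<open>w_le\<close>), so that \<open>D\<close> dominates both kinetic energies.  It does not see the
  fluctuation of the density.  Therefore a small multiple of \<open>\<integral> \<rho> w \<psi>\<close> is subtracted, where \<open>\<psi>\<close> has
  mean zero and \<open>\<psi>\<^sub>x = \<rho> - mean \<rho>\<close>: the momentum equation tested with \<open>\<psi>\<close> contains the coercive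
  term \<open>\<integral> \<rho>\<^sup>\<gamma> (\<rho> - mean \<rho>)\<close> (\<open>X'_lower\<close>).  The resulting functional \<open>L\<close> satisfies
  \<open>L' \<le> - \<lambda> L - D / 4\<close> (\<open>lyapunov\<close>).  It dominates \<open>w\<close> and \<open>\<rho> - mean \<rho>\<close> in \<open>L\<^sup>2\<close>, and the uniform
  \<open>H\<^sup>1\<close> bound on \<open>\<rho>\<close> turns the \<open>L\<^sup>2\<close> decay of the density into uniform decay.

  Particles obey \<open>\<xi>' = \<rho> (w - \<xi>)\<close>: their velocities contract at least at the rate \<open>\<rho>\<^sub>-\<close>, up to a
  forcing of size \<open>\<rho>\<^sub>+ sup |w|\<close>, and this forcing is controlled by the term \<open>D / 4\<close> kept above.  The
  argument is carried out for the weak solution itself by comparing all even moments of \<open>\<xi>\<close> with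
  the powers of one explicit decaying radius (\<open>support_le_radius\<close>).  As the mass of \<open>f\<close> is
  conserved, the weighted \<open>L\<^sup>2\<close> norm and the Wasserstein distance are then bounded by multiples of
  this radius; for the latter, a test function varies by at most \<open>\<bar>v - u\<^sub>s\<bar>\<close> between \<open>(x, v)\<close> and
  \<open>(x, u\<^sub>s)\<close> (\<open>W1_test_vertical\<close>).

  The equations hold only in the sense of distributions.  Tested with products \<open>\<phi>(x) \<theta>(t)\<close> they
  say, because the solution is continuous in time, that its integrals against a fixed function of
  space are differentiable in time (\<open>du_Bois_Reymond\<close>).  The energy and the cross term are
  quadratic in the solution, so the test functions have to move with time as well;
  \<open>balance_law_difference_quotient\<close> passes to test functions that converge in \<open>H\<^sup>1\<close>, and all
  product rules in time are reduced to it.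
\<close>

section \<open>Smooth functions\<close>

lemma Ck_Suc_has_derivative:
  assumes "\<And>x. (g has_derivative g' x) (at x)" "\<And>h. Ck k (\<lambda>x. g' x h)"
  shows "Ck (Suc k) g"
proof -
  have "frechet_derivative g (at x) = g' x" for x
    using frechet_derivative_at[OF assms(1)] by simp
  then show ?thesis using assms by (auto simp: differentiable_def)
qed

lemma Ck_Suc_imp_has_derivative:
  "Ck (Suc k) g \<Longrightarrow> (g has_derivative frechet_derivative g (at x)) (at x)"
  by (simp add: frechet_derivative_works)

lemma Ck_Suc_imp_Ck: "Ck (Suc k) g \<Longrightarrow> Ck k g"
proof (induction k arbitrary: g)
  case 0
  then show ?case
    by (simp add: continuous_on_eq_continuous_at differentiable_imp_continuous_within)
next
  case (Suc k)
  then show ?case by simp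
qed

lemma Ck_imp_continuous: "Ck k g \<Longrightarrow> continuous_on UNIV g"
proof (induction k)
  case (Suc k)
  then show ?case using Ck_Suc_imp_Ck by blast
qed simp

lemma Ck_const: "Ck k (\<lambda>_. c)"
proof (induction k arbitrary: c)
  case (Suc k)
  show ?case by (rule Ck_Suc_has_derivative[where g'="\<lambda>_ _. 0"]) (auto intro: Suc)
qed auto

lemma Ck_bounded_linear: "bounded_linear g \<Longrightarrow> Ck k g"
proof (cases k)
  case 0
  assume "bounded_linear g" with 0 show ?thesis
    by (simp add: linear_continuous_on)
next
  case (Suc n)
  assume "bounded_linear g" with Suc show ?thesis
    using Ck_Suc_has_derivative[of g "\<lambda>_. g"] bounded_linear_imp_has_derivative Ck_const by blast
qed

lemma Ck_add: "Ck k f \<Longrightarrow> Ck k g \<Longrightarrow> Ck k (\<lambda>x. f x + g x)"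
proof (induction k arbitrary: f g)
  case 0 then show ?case by (simp add: continuous_on_add)
next
  case (Suc k)
  show ?case
  proof (rule Ck_Suc_has_derivative)
    show "((\<lambda>x. f x + g x) has_derivative
        (\<lambda>h. frechet_derivative f (at x) h + frechet_derivative g (at x) h)) (at x)" for x
      using Suc.prems by (intro has_derivative_add Ck_Suc_imp_has_derivative)
    show "Ck k (\<lambda>x. frechet_derivative f (at x) h + frechet_derivative g (at x) h)" for h
      using Suc by simp
  qed
qed

lemma Ck_mult: "Ck k f \<Longrightarrow> Ck k g \<Longrightarrow> Ck k (\<lambda>x. f x * g x)"
proof (induction k arbitrary: f g)
  case 0 then show ?case by (simp add: continuous_on_mult)
next
  case (Suc k)
  have "Ck k f" "Ck k g" using Suc.prems Ck_Suc_imp_Ck by blast+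
  show ?case
  proof (rule Ck_Suc_has_derivative)
    show "((\<lambda>x. f x * g x) has_derivative
        (\<lambda>h. f x * frechet_derivative g (at x) h + frechet_derivative f (at x) h * g x)) (at x)" for x
      using Suc.prems by (intro has_derivative_mult Ck_Suc_imp_has_derivative)
    show "Ck k (\<lambda>x. f x * frechet_derivative g (at x) h + frechet_derivative f (at x) h * g x)" for h
      using Suc.prems \<open>Ck k f\<close> \<open>Ck k g\<close> by (intro Ck_add Suc.IH) simp_all
  qed
qed

lemma Ck_Suc_real:
  fixes g :: "real \<Rightarrow> real"
  assumes "\<And>x. (g has_real_derivative g' x) (at x)" "Ck k g'"
  shows "Ck (Suc k) g"
  by (rule Ck_Suc_has_derivative[where g'="\<lambda>x h. g' x * h"])
     (use assms in \<open>auto simp: has_field_derivative_def intro: Ck_mult Ck_const\<close>)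

lemma Ck_Suc_realD:
  fixes g :: "real \<Rightarrow> real"
  assumes "Ck (Suc k) g"
  shows "(g has_real_derivative deriv g x) (at x)" "Ck k (deriv g)"
proof -
  have d: "g differentiable (at x)" for x using assms by simp
  show *: "(g has_real_derivative deriv g x) (at x)" for x
    using d DERIV_deriv_iff_real_differentiable by blast
  have "frechet_derivative g (at x) 1 = deriv g x" for x
    using frechet_derivative_at[OF *[unfolded has_field_derivative_def]]
    by (metis mult.right_neutral)
  then have "deriv g = (\<lambda>x. frechet_derivative g (at x) 1)" by auto
  then show "Ck k (deriv g)" using assms by simp
qed

lemma Ck_compose:
  fixes f :: "real \<Rightarrow> real"
  shows "Ck k f \<Longrightarrow> Ck k g \<Longrightarrow> Ck k (\<lambda>x. f (g x))"
proof (induction k arbitrary: f g)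
  case 0 then show ?case by (auto intro: continuous_on_compose2)
next
  case (Suc k)
  have g: "Ck k g" using Suc.prems Ck_Suc_imp_Ck by blast
  note f = Ck_Suc_realD[OF Suc.prems(1)]
  show ?case
  proof (rule Ck_Suc_has_derivative)
    show "((\<lambda>x. f (g x)) has_derivative (\<lambda>h. frechet_derivative g (at x) h * deriv f (g x))) (at x)" for x
      using DERIV_compose_FDERIV[OF f(1)[of "g x"] Ck_Suc_imp_has_derivative[OF Suc.prems(2)]] .
    show "Ck k (\<lambda>x. frechet_derivative g (at x) h * deriv f (g x))" for h
      using Suc.prems(2) by (intro Ck_mult[OF _ Suc.IH[OF f(2) g]]) simp
  qed
qed

lemma smooth_const: "smooth (\<lambda>_. c)" by (simp add: smooth_def Ck_const)
lemma smooth_add: "smooth f \<Longrightarrow> smooth g \<Longrightarrow> smooth (\<lambda>x. f x + g x)" by (simp add: smooth_def Ck_add)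
lemma smooth_mult: "smooth f \<Longrightarrow> smooth g \<Longrightarrow> smooth (\<lambda>x. f x * g x)" by (simp add: smooth_def Ck_mult)
lemma smooth_bounded_linear: "bounded_linear g \<Longrightarrow> smooth g" by (simp add: smooth_def Ck_bounded_linear)
lemma smooth_compose: "smooth f \<Longrightarrow> smooth g \<Longrightarrow> smooth (\<lambda>x. (f :: real \<Rightarrow> real) (g x))"
  by (simp add: smooth_def Ck_compose)
lemma smooth_ident: "smooth (\<lambda>x::real. x)" by (rule smooth_bounded_linear) simp
lemma smooth_diff: "smooth f \<Longrightarrow> smooth g \<Longrightarrow> smooth (\<lambda>x. f x - g x)"
  using smooth_add[of f "\<lambda>x. -1 * g x"] smooth_mult[OF smooth_const[of "-1"]] by auto
lemma smooth_power: "smooth f \<Longrightarrow> smooth (\<lambda>x. f x ^ n)"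
  by (induction n) (auto intro: smooth_const smooth_mult)
lemma smoothD:
  fixes g :: "real \<Rightarrow> real"
  assumes "smooth g"
  shows "(g has_real_derivative deriv g x) (at x)" "smooth (deriv g)" "continuous_on A g"
    "continuous_on A (deriv g)"
proof -
  have S: "Ck (Suc k) g" for k using assms by (simp only: smooth_def)
  show "(g has_real_derivative deriv g x) (at x)" by (rule Ck_Suc_realD(1)[OF S])
  show s: "smooth (deriv g)" unfolding smooth_def using Ck_Suc_realD(2)[OF S] by simp
  show "continuous_on A g"
    by (rule continuous_on_subset[OF Ck_imp_continuous[OF S] subset_UNIV])
  show "continuous_on A (deriv g)"
    by (rule continuous_on_subset[OF Ck_imp_continuous[OF Ck_Suc_realD(2)[OF S]] subset_UNIV])
qed

lemma smooth_real_derivI: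
  fixes g :: "real \<Rightarrow> real"
  assumes d: "\<And>x. (g has_real_derivative g' x) (at x)" and s: "smooth g'"
  shows "smooth g"
  unfolding smooth_def
proof
  fix k
  have "Ck k g'" using s by (simp only: smooth_def)
  from Ck_Suc_imp_Ck[OF Ck_Suc_real[OF d this]] show "Ck k g" .
qed

lemma smooth_sin_cos: "smooth (sin :: real \<Rightarrow> real)" "smooth (cos :: real \<Rightarrow> real)"
proof -
  have "Ck k (sin :: real \<Rightarrow> real) \<and> Ck k (cos :: real \<Rightarrow> real)" for k
  proof (induction k)
    case (Suc k)
    have "Ck k (\<lambda>x::real. -1 * sin x)" using Suc by (intro Ck_mult Ck_const) auto
    then have "Ck (Suc k) (cos::real\<Rightarrow>real)"
      by (intro Ck_Suc_real[of cos "\<lambda>x. -1 * sin x"]) (auto intro!: derivative_eq_intros)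
    moreover have "Ck (Suc k) (sin::real\<Rightarrow>real)"
      using Suc by (intro Ck_Suc_real[of sin cos]) (auto intro!: derivative_eq_intros)
    ultimately show ?case by blast
  qed (auto intro: continuous_intros)
  then show "smooth (sin :: real \<Rightarrow> real)" "smooth (cos :: real \<Rightarrow> real)" by (auto simp: smooth_def)
qed

text \<open>The derivatives of the flat function \<open>exp (-1/x)\<close> stay in the class of functions
  \<open>P (1/x) * exp (-1/x)\<close> with a polynomial \<open>P\<close>, so one differentiation step proves smoothness.\<close>

definition flat :: "real poly \<Rightarrow> real \<Rightarrow> real" where
  "flat P x = (if x > 0 then poly P (inverse x) * exp (- inverse x) else 0)"

lemma poly_times_exp_minus_tendsto_0: "((\<lambda>y::real. poly P y * exp (- y)) \<longlongrightarrow> 0) at_top"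
proof -
  have "((\<lambda>y. \<Sum>i\<le>degree P. coeff P i * (y ^ i / exp y)) \<longlongrightarrow> (\<Sum>i\<le>degree P. coeff P i * 0)) at_top"
    by (intro tendsto_sum tendsto_mult tendsto_const tendsto_power_div_exp_0)
  moreover have "(\<Sum>i\<le>degree P. coeff P i * (y ^ i / exp y)) = poly P y * exp (- y)" for y
    by (simp add: poly_altdef exp_minus divide_inverse sum_distrib_right mult.assoc)
  ultimately show ?thesis by simp
qed

lemma flat_has_derivative:
  "(flat P has_real_derivative flat ([:0,0,1:] * (P - pderiv P)) x) (at x)"
proof -
  consider "x < 0" | "x > 0" | "x = 0" by linarith
  then show ?thesis
  proof cases
    case 1
    have "eventually (\<lambda>y. flat P y = 0) (nhds x)"
      using eventually_nhds_in_open[of "{..<0}" x] 1 by (auto simp: flat_def elim!: eventually_mono)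
    then show ?thesis using 1 by (subst DERIV_cong_ev[OF refl _ refl]) (auto simp: flat_def)
  next
    case 2
    have "eventually (\<lambda>y. flat P y = poly P (inverse y) * exp (- inverse y)) (nhds x)"
      using eventually_nhds_in_open[of "{0<..}" x] 2 by (auto simp: flat_def elim!: eventually_mono)
    moreover have "((\<lambda>y. poly P (inverse y) * exp (- inverse y)) has_real_derivative
        flat ([:0,0,1:] * (P - pderiv P)) x) (at x)"
    proof -
      have i: "(inverse has_real_derivative - (inverse x * inverse x)) (at x)"
        using DERIV_inverse[of x UNIV] 2 by (simp add: power2_eq_square)
      have e: "((\<lambda>y. exp (- inverse y)) has_real_derivative exp (- inverse x) * (inverse x * inverse x)) (at x)"
        using DERIV_chain2[OF DERIV_exp DERIV_minus[OF i]] by simp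
      have "((\<lambda>y. poly P (inverse y) * exp (- inverse y)) has_real_derivative
          poly (pderiv P) (inverse x) * - (inverse x * inverse x) * exp (- inverse x)
          + exp (- inverse x) * (inverse x * inverse x) * poly P (inverse x)) (at x)"
        by (rule DERIV_mult[OF DERIV_chain2[OF poly_DERIV i] e])
      then show ?thesis using 2 by (simp add: flat_def algebra_simps)
    qed
    ultimately show ?thesis by (subst DERIV_cong_ev[OF refl _ refl]) auto
  next
    case 3
    have "((\<lambda>y. flat P y / y) \<longlongrightarrow> 0) (at 0)"
    proof (rule filterlim_split_at)
      show "((\<lambda>y. flat P y / y) \<longlongrightarrow> 0) (at_left 0)"
        by (rule tendsto_eventually)
           (auto simp: eventually_at_filter flat_def)
      have "((\<lambda>y. poly ([:0,1:] * P) (inverse y) * exp (- inverse y)) \<longlongrightarrow> 0) (at_right 0)"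
        by (rule filterlim_compose[OF poly_times_exp_minus_tendsto_0 filterlim_inverse_at_top_right])
      then show "((\<lambda>y. flat P y / y) \<longlongrightarrow> 0) (at_right 0)"
        by (rule Lim_transform_eventually)
           (auto simp: eventually_at_filter flat_def divide_inverse)
    qed
    then show ?thesis using 3 by (simp add: has_field_derivative_iff flat_def)
  qed
qed

lemma smooth_flat: "smooth (flat P)"
proof -
  have "Ck k (flat P)" for k
  proof (induction k arbitrary: P)
    case 0
    then show ?case
      using DERIV_isCont[OF flat_has_derivative] by (simp add: continuous_on_eq_continuous_at)
  next
    case (Suc k)
    then show ?case using Ck_Suc_real[OF flat_has_derivative] by blast
  qed
  then show ?thesis by (simp add: smooth_def)
qed

lemma continuous_has_antiderivative:
  fixes g :: "real \<Rightarrow> real"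
  assumes "continuous_on UNIV g"
  obtains G where "\<And>x. (G has_real_derivative g x) (at x)"
  using einterval_antiderivative[of "-\<infinity>" "\<infinity>" g] assms
  by (auto simp: continuous_on_eq_continuous_at has_real_derivative_iff_has_vector_derivative)

text \<open>A smooth step is the normalised primitive of the bump \<open>flat 1 x * flat 1 (1 - x)\<close>, which is
  positive exactly on \<open>(0, 1)\<close>.\<close>

lemma smooth_step_exists:
  "\<exists>S :: real \<Rightarrow> real. smooth S \<and> mono S \<and> (\<forall>x\<le>0. S x = 0) \<and> (\<forall>x\<ge>1. S x = 1)"
proof -
  define b where "b x = flat 1 x * flat 1 (1 - x)" for x
  have sb: "smooth b" unfolding b_def
    by (intro smooth_mult smooth_flat smooth_compose[OF smooth_flat] smooth_diff smooth_const smooth_ident)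
  obtain G where G: "\<And>x. (G has_real_derivative b x) (at x)"
    using continuous_has_antiderivative[OF smoothD(3)[OF sb]] by blast
  have b0: "b x \<ge> 0" for x by (auto simp: b_def flat_def)
  have mono: "x \<le> y \<Longrightarrow> G x \<le> G y" for x y
    using DERIV_nonneg_imp_nondecreasing[of x y G] G b0 by blast
  have lt: "G 0 < G 1"
  proof -
    obtain z where z: "0 < z" "z < 1" "G 1 - G 0 = (1 - 0) * b z"
      using MVT2[of 0 1 G b] G by auto
    then have "b z > 0" by (simp add: b_def flat_def)
    then show ?thesis using z(3) by simp
  qed
  have left: "x \<le> 0 \<Longrightarrow> G x = G 0" for x
  proof (rule antisym[OF mono], assumption)
    assume "x \<le> 0"
    then show "G 0 \<le> G x"
    proof (cases "x = 0")
      case False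
      with \<open>x \<le> 0\<close> obtain z where "x < z" "z < 0" "G 0 - G x = (0 - x) * b z"
        using MVT2[of x 0 G b] G by auto
      then show ?thesis by (simp add: b_def flat_def)
    qed simp
  qed
  have right: "x \<ge> 1 \<Longrightarrow> G x = G 1" for x
  proof (rule antisym[OF _ mono])
    assume "x \<ge> 1"
    then show "G x \<le> G 1"
    proof (cases "x = 1")
      case False
      with \<open>x \<ge> 1\<close> obtain z where "1 < z" "z < x" "G x - G 1 = (x - 1) * b z"
        using MVT2[of 1 x G b] G by auto
      then show ?thesis by (simp add: b_def flat_def)
    qed simp
  qed
  define S where "S x = 1 / (G 1 - G 0) * (G x - G 0)" for x
  have s1: "smooth S" unfolding S_def
    by (intro smooth_mult smooth_const smooth_diff smooth_real_derivI[OF G sb])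
  have s2: "mono S" unfolding S_def using lt mono by (auto intro!: monoI divide_right_mono)
  have s3: "S x = 0" if "x \<le> 0" for x using left[OF that] by (simp add: S_def)
  have s4: "S x = 1" if "x \<ge> 1" for x using right[OF that] lt by (simp add: S_def)
  show ?thesis by (rule exI[of _ S]) (simp add: s1 s2 s3 s4)
qed

definition sstep :: "real \<Rightarrow> real" where
  "sstep = (SOME S. smooth S \<and> mono S \<and> (\<forall>x\<le>0. S x = 0) \<and> (\<forall>x\<ge>1. S x = 1))"

lemma sstep: "smooth sstep" "mono sstep" "x \<le> 0 \<Longrightarrow> sstep x = 0" "x \<ge> 1 \<Longrightarrow> sstep x = 1"
proof -
  from smooth_step_exists
  have "smooth sstep \<and> mono sstep \<and> (\<forall>x\<le>0. sstep x = 0) \<and> (\<forall>x\<ge>1. sstep x = 1)"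
    unfolding sstep_def by (rule someI_ex)
  then show "smooth sstep" "mono sstep" "x \<le> 0 \<Longrightarrow> sstep x = 0" "x \<ge> 1 \<Longrightarrow> sstep x = 1" by auto
qed

lemma sstep_bounds: "0 \<le> sstep x" "sstep x \<le> 1"
proof -
  show "0 \<le> sstep x" using monoD[OF sstep(2), of "min x 0" x] sstep(3)[of "min x 0"] by simp
  show "sstep x \<le> 1" using monoD[OF sstep(2), of x "max x 1"] sstep(4)[of "max x 1"] by simp
qed

section \<open>Square-integrable functions and strong limits\<close>

definition sq_integrable :: "'a measure \<Rightarrow> ('a \<Rightarrow> real) \<Rightarrow> bool" where
  "sq_integrable M g \<longleftrightarrow> g \<in> borel_measurable M \<and> integrable M (\<lambda>x. (g x)\<^sup>2)"

definition l2 :: "'a measure \<Rightarrow> ('a \<Rightarrow> real) \<Rightarrow> real" where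
  "l2 M g = sqrt (\<integral>x. (g x)\<^sup>2 \<partial>M)"

lemma l2_nonneg[simp]: "0 \<le> l2 M g"
  by (simp add: l2_def)

lemma l2_power2: "(l2 M g)\<^sup>2 = (\<integral>x. (g x)\<^sup>2 \<partial>M)"
  by (simp add: l2_def)

lemma sq_integrable_measurable: "sq_integrable M g \<Longrightarrow> g \<in> borel_measurable M"
  by (simp add: sq_integrable_def)

lemma sq_integrable_integrable_mult:
  assumes "sq_integrable M f" "sq_integrable M g"
  shows "integrable M (\<lambda>x. f x * g x)"
proof (rule Bochner_Integration.integrable_bound[where f="\<lambda>x. (f x)\<^sup>2 + (g x)\<^sup>2"])
  have "\<bar>a * b\<bar> \<le> a\<^sup>2 + b\<^sup>2" for a b :: real
  proof -
    have "2 * \<bar>a\<bar> * \<bar>b\<bar> \<le> a\<^sup>2 + b\<^sup>2" using sum_squares_bound[of "\<bar>a\<bar>" "\<bar>b\<bar>"] by simp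
    moreover have "0 \<le> \<bar>a\<bar> * \<bar>b\<bar>" by simp
    ultimately show ?thesis unfolding abs_mult by linarith
  qed
  then show "AE x in M. norm (f x * g x) \<le> norm ((f x)\<^sup>2 + (g x)\<^sup>2)" by auto
qed (use assms in \<open>auto simp: sq_integrable_def\<close>)

text \<open>The infimum of \<open>s A + B / s\<close> over \<open>s > 0\<close> is \<open>2 sqrt (A B)\<close>.  This turns a pointwise Young
  inequality with a free parameter into the Cauchy--Schwarz inequality, including the case of
  vanishing norms.\<close>

lemma le_sqrt_mult_sqrt:
  fixes A B c :: real
  assumes "A \<ge> 0" "B \<ge> 0" and le: "\<And>s. s > 0 \<Longrightarrow> 2 * c \<le> s * A + B / s"
  shows "c \<le> sqrt A * sqrt B"
proof (cases "A = 0 \<or> B = 0")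
  case True
  have "2 * c \<le> e" if "e > 0" for e
  proof -
    have pos: "e / (A + 1) > 0" "(B + 1) / e > 0" using that assms by (auto intro!: divide_pos_pos)
    from True show ?thesis
    proof
      assume "B = 0"
      have "e / (A + 1) * A \<le> e" using that assms by (simp add: field_simps)
      with le[OF pos(1)] \<open>B = 0\<close> show ?thesis by simp
    next
      assume "A = 0"
      have "B / ((B + 1) / e) \<le> e" using that assms by (simp add: field_simps)
      with le[OF pos(2)] \<open>A = 0\<close> show ?thesis by simp
    qed
  qed
  then have "2 * c \<le> 0" using field_le_epsilon[of "2 * c" 0] by simp
  then show ?thesis using True assms by auto
next
  case False
  then have pos: "A > 0" "B > 0" using assms by auto
  define a b where "a = sqrt A" and "b = sqrt B"
  have ab: "a > 0" "b > 0" "A = a * a" "B = b * b" using pos by (auto simp: a_def b_def)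
  have "2 * c \<le> b / a * A + B / (b / a)" by (rule le) (use ab in simp)
  also have "\<dots> = 2 * (a * b)" using ab by (simp add: field_simps)
  finally show ?thesis by (simp add: a_def b_def)
qed

lemma l2_Cauchy_Schwarz_abs:
  assumes "sq_integrable M f" "sq_integrable M g"
  shows "(\<integral>x. \<bar>f x * g x\<bar> \<partial>M) \<le> l2 M f * l2 M g"
  unfolding l2_def
proof (rule le_sqrt_mult_sqrt)
  fix s :: real assume s: "s > 0"
  have "2 * (\<integral>x. \<bar>f x * g x\<bar> \<partial>M) = (\<integral>x. 2 * \<bar>f x * g x\<bar> \<partial>M)" by simp
  also have "\<dots> \<le> (\<integral>x. s * (f x)\<^sup>2 + (g x)\<^sup>2 / s \<partial>M)"
  proof (rule integral_mono)
    show "integrable M (\<lambda>x. 2 * \<bar>f x * g x\<bar>)"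
      using sq_integrable_integrable_mult[OF assms] by simp
    show "integrable M (\<lambda>x. s * (f x)\<^sup>2 + (g x)\<^sup>2 / s)"
      using assms by (auto simp: sq_integrable_def)
    fix x
    have "0 \<le> (s * \<bar>f x\<bar> - \<bar>g x\<bar>)\<^sup>2 / s" using s by simp
    also have "\<dots> = s * \<bar>f x\<bar>\<^sup>2 + \<bar>g x\<bar>\<^sup>2 / s - 2 * (\<bar>f x\<bar> * \<bar>g x\<bar>)"
      using s by (simp add: power2_diff power_mult_distrib field_simps power2_eq_square[of s] del: power2_abs)
    finally show "2 * \<bar>f x * g x\<bar> \<le> s * (f x)\<^sup>2 + (g x)\<^sup>2 / s"
      by (simp add: abs_mult)
  qed
  also have "\<dots> = s * (\<integral>x. (f x)\<^sup>2 \<partial>M) + (\<integral>x. (g x)\<^sup>2 \<partial>M) / s"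
    using assms by (simp add: sq_integrable_def)
  finally show "2 * (\<integral>x. \<bar>f x * g x\<bar> \<partial>M) \<le> s * (\<integral>x. (f x)\<^sup>2 \<partial>M) + (\<integral>x. (g x)\<^sup>2 \<partial>M) / s" .
qed auto

lemma l2_Cauchy_Schwarz:
  assumes "sq_integrable M f" "sq_integrable M g"
  shows "\<bar>\<integral>x. f x * g x \<partial>M\<bar> \<le> l2 M f * l2 M g"
  using integral_abs_bound[of M "\<lambda>x. f x * g x"] l2_Cauchy_Schwarz_abs[OF assms] by linarith

lemma sq_integrable_cmult: "sq_integrable M f \<Longrightarrow> sq_integrable M (\<lambda>x. c * f x)"
  by (auto simp: sq_integrable_def power_mult_distrib)

lemma sq_integrable_add: "sq_integrable M f \<Longrightarrow> sq_integrable M g \<Longrightarrow> sq_integrable M (\<lambda>x. f x + g x)"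
proof -
  assume fg: "sq_integrable M f" "sq_integrable M g"
  have "integrable M (\<lambda>x. (f x)\<^sup>2 + (g x)\<^sup>2 + 2 * (f x * g x))"
    using fg sq_integrable_integrable_mult[OF fg] by (auto simp: sq_integrable_def)
  then show ?thesis using fg by (auto simp: sq_integrable_def power2_sum mult.assoc)
qed

lemma sq_integrable_diff: "sq_integrable M f \<Longrightarrow> sq_integrable M g \<Longrightarrow> sq_integrable M (\<lambda>x. f x - g x)"
  using sq_integrable_add[of M f "\<lambda>x. -1 * g x"] sq_integrable_cmult[of M g "-1"] by simp

lemma sq_integrable_bounded_mult:
  assumes a: "a \<in> borel_measurable M" "\<And>x. x \<in> space M \<Longrightarrow> \<bar>a x\<bar> \<le> C" and f: "sq_integrable M f"
  shows "sq_integrable M (\<lambda>x. a x * f x)" "l2 M (\<lambda>x. a x * f x) \<le> C * l2 M f"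
proof -
  have le: "(a x * f x)\<^sup>2 \<le> C\<^sup>2 * (f x)\<^sup>2" if "x \<in> space M" for x
  proof -
    have "\<bar>a x\<bar>\<^sup>2 \<le> C\<^sup>2" by (rule power_mono[OF a(2)[OF that]]) simp
    then show ?thesis by (simp add: power_mult_distrib mult_right_mono)
  qed
  have i: "integrable M (\<lambda>x. (a x * f x)\<^sup>2)"
    by (rule Bochner_Integration.integrable_bound[where f="\<lambda>x. C\<^sup>2 * (f x)\<^sup>2"])
       (use f a(1) le in \<open>auto simp: sq_integrable_def\<close>)
  show "sq_integrable M (\<lambda>x. a x * f x)" using i f a(1) by (auto simp: sq_integrable_def)
  have "(\<integral>x. (a x * f x)\<^sup>2 \<partial>M) \<le> (\<integral>x. C\<^sup>2 * (f x)\<^sup>2 \<partial>M)"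
    by (rule integral_mono[OF i]) (use f le in \<open>auto simp: sq_integrable_def\<close>)
  then have "l2 M (\<lambda>x. a x * f x) \<le> \<bar>C\<bar> * l2 M f"
    unfolding l2_def by (simp flip: real_sqrt_abs add: real_sqrt_mult[symmetric] del: real_sqrt_abs)
  moreover have "\<bar>C\<bar> * l2 M f \<le> C * l2 M f"
  proof (cases "space M = {}")
    case True
    then have "(\<integral>x. (f x)\<^sup>2 \<partial>M) = (\<integral>x. 0 \<partial>M)" by (intro Bochner_Integration.integral_cong) auto
    then have "l2 M f = 0" by (simp add: l2_def)
    then show ?thesis by simp
  next
    case False
    then have "C \<ge> 0" using a(2) by fastforce
    then show ?thesis by simp
  qed
  ultimately show "l2 M (\<lambda>x. a x * f x) \<le> C * l2 M f" by linarith
qed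

lemma (in finite_measure) sq_integrable_bounded:
  assumes a: "a \<in> borel_measurable M" "\<And>x. x \<in> space M \<Longrightarrow> \<bar>a x\<bar> \<le> C"
  shows "sq_integrable M a"
  using sq_integrable_bounded_mult[OF a, of "\<lambda>_. 1"] by (simp add: sq_integrable_def)

lemma (in finite_measure) sq_integrable_const: "sq_integrable M (\<lambda>_. c)"
  by (simp add: sq_integrable_def)

lemma (in finite_measure) sq_integrable_integrable: "sq_integrable M f \<Longrightarrow> integrable M f"
  using sq_integrable_integrable_mult[of M f "\<lambda>_. 1"] by (simp add: sq_integrable_const)

lemma l2_triangle:
  assumes "sq_integrable M f" "sq_integrable M g"
  shows "l2 M (\<lambda>x. f x + g x) \<le> l2 M f + l2 M g"
proof (rule power2_le_imp_le)
  have "(l2 M (\<lambda>x. f x + g x))\<^sup>2 = (\<integral>x. (f x)\<^sup>2 + (g x)\<^sup>2 + 2 * (f x * g x) \<partial>M)"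
    by (simp add: l2_power2 power2_sum mult.assoc)
  also have "\<dots> = (l2 M f)\<^sup>2 + (l2 M g)\<^sup>2 + 2 * (\<integral>x. f x * g x \<partial>M)"
    using assms sq_integrable_integrable_mult[OF assms] by (simp add: l2_power2 sq_integrable_def)
  also have "\<dots> \<le> (l2 M f)\<^sup>2 + (l2 M g)\<^sup>2 + 2 * (l2 M f * l2 M g)"
    using l2_Cauchy_Schwarz[OF assms] by linarith
  also have "\<dots> = (l2 M f + l2 M g)\<^sup>2" by (simp add: power2_sum)
  finally show "(l2 M (\<lambda>x. f x + g x))\<^sup>2 \<le> (l2 M f + l2 M g)\<^sup>2" .
qed simp

lemma l2_uminus[simp]: "l2 M (\<lambda>x. - f x) = l2 M f"
  by (simp add: l2_def)

lemma l2_cmult: "l2 M (\<lambda>x. c * f x) = \<bar>c\<bar> * l2 M f"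
  by (simp add: l2_def power_mult_distrib real_sqrt_mult)

lemma l2_commute: "l2 M (\<lambda>x. f x - g x) = l2 M (\<lambda>x. g x - f x)"
  by (simp add: l2_def power2_commute)

lemma l2_cong_AE: "AE x in M. f x = g x \<Longrightarrow> f \<in> borel_measurable M \<Longrightarrow> g \<in> borel_measurable M \<Longrightarrow> l2 M f = l2 M g"
  unfolding l2_def by (intro arg_cong[of _ _ sqrt] integral_cong_AE) auto

lemma l2_diff_le:
  assumes "sq_integrable M f" "sq_integrable M g"
  shows "l2 M f \<le> l2 M g + l2 M (\<lambda>x. f x - g x)"
  using l2_triangle[OF assms(2) sq_integrable_diff[OF assms]] by simp

text \<open>Three modes of convergence of a family of functions along a filter.  Integrability is part of the
  first two because the integral of a nonintegrable function is 0, so that a small norm alone would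
  say nothing; boundedness of the limit is part of the third to make it stable under products.\<close>

definition L2lim :: "'a measure \<Rightarrow> ('t \<Rightarrow> 'a \<Rightarrow> real) \<Rightarrow> ('a \<Rightarrow> real) \<Rightarrow> 't filter \<Rightarrow> bool" where
  "L2lim M g G F \<longleftrightarrow> sq_integrable M G \<and> (\<forall>\<^sub>F t in F. sq_integrable M (g t)) \<and> ((\<lambda>t. l2 M (\<lambda>x. g t x - G x)) \<longlongrightarrow> 0) F"

definition L1lim :: "'a measure \<Rightarrow> ('t \<Rightarrow> 'a \<Rightarrow> real) \<Rightarrow> ('a \<Rightarrow> real) \<Rightarrow> 't filter \<Rightarrow> bool" where
  "L1lim M g G F \<longleftrightarrow> integrable M G \<and> (\<forall>\<^sub>F t in F. integrable M (g t)) \<and>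
     ((\<lambda>t. \<integral>x. \<bar>g t x - G x\<bar> \<partial>M) \<longlongrightarrow> 0) F"

definition Ulim :: "'a measure \<Rightarrow> ('t \<Rightarrow> 'a \<Rightarrow> real) \<Rightarrow> ('a \<Rightarrow> real) \<Rightarrow> 't filter \<Rightarrow> bool" where
  "Ulim M a A F \<longleftrightarrow> A \<in> borel_measurable M \<and> bounded (A ` space M) \<and>
     (\<forall>\<^sub>F t in F. a t \<in> borel_measurable M) \<and> uniform_limit (space M) a A F"

lemma Ulim_bound:
  assumes "Ulim M a A F"
  obtains C where "C > 0" "\<And>x. x \<in> space M \<Longrightarrow> \<bar>A x\<bar> \<le> C"
    "\<forall>\<^sub>F t in F. \<forall>x\<in>space M. \<bar>a t x\<bar> \<le> C"
proof -
  obtain B where B: "B > 0" "\<And>x. x \<in> space M \<Longrightarrow> \<bar>A x\<bar> \<le> B"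
    using assms unfolding Ulim_def bounded_pos by auto
  have "\<forall>\<^sub>F t in F. \<forall>x\<in>space M. dist (a t x) (A x) < 1"
    using assms by (auto simp: Ulim_def intro: uniform_limitD)
  then have "\<forall>\<^sub>F t in F. \<forall>x\<in>space M. \<bar>a t x\<bar> \<le> B + 1"
    by eventually_elim (use B in \<open>fastforce simp: dist_real_def\<close>)
  with B show ?thesis by (intro that[of "B + 1"]) fastforce+
qed

lemma Ulim_const:
  assumes "A \<in> borel_measurable M" "\<And>x. x \<in> space M \<Longrightarrow> \<bar>A x\<bar> \<le> C"
  shows "Ulim M (\<lambda>_. A) A F"
  using assms by (auto simp: Ulim_def bounded_iff intro!: uniform_limit_const exI[of _ C])

lemma Ulim_add:
  assumes "Ulim M a A F" "Ulim M b B F"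
  shows "Ulim M (\<lambda>t x. a t x + b t x) (\<lambda>x. A x + B x) F"
proof -
  have "\<forall>\<^sub>F t in F. a t \<in> borel_measurable M" "\<forall>\<^sub>F t in F. b t \<in> borel_measurable M"
    using assms by (auto simp: Ulim_def)
  then have "\<forall>\<^sub>F t in F. (\<lambda>x. a t x + b t x) \<in> borel_measurable M"
    by eventually_elim (rule borel_measurable_add)
  then show ?thesis
    using assms unfolding Ulim_def by (auto simp add: uniform_limit_add bounded_plus_comp)
qed

lemma Ulim_mult:
  assumes "Ulim M a A F" "Ulim M b B F"
  shows "Ulim M (\<lambda>t x. a t x * b t x) (\<lambda>x. A x * B x) F"
proof -
  obtain C where C: "C > 0" "\<And>x. x \<in> space M \<Longrightarrow> \<bar>A x\<bar> \<le> C"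
    using Ulim_bound[OF assms(1)] by blast
  obtain D where D: "\<And>x. x \<in> space M \<Longrightarrow> \<bar>B x\<bar> \<le> D"
    using Ulim_bound[OF assms(2)] by blast
  have "\<bar>A x * B x\<bar> \<le> C * D" if "x \<in> space M" for x
    unfolding abs_mult by (rule mult_mono) (use that C D in auto)
  then have "bounded ((\<lambda>x. A x * B x) ` space M)"
    by (auto simp: bounded_iff simp del: abs_mult intro!: exI[of _ "C * D"])
  moreover have "\<forall>\<^sub>F t in F. a t \<in> borel_measurable M" "\<forall>\<^sub>F t in F. b t \<in> borel_measurable M"
    using assms by (auto simp: Ulim_def)
  then have "\<forall>\<^sub>F t in F. (\<lambda>x. a t x * b t x) \<in> borel_measurable M"
    by eventually_elim (rule borel_measurable_times)
  ultimately show ?thesis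
    using assms unfolding Ulim_def by (auto simp add: uniform_lim_mult)
qed

lemma Ulim_scale:
  assumes "Ulim M a A F" shows "Ulim M (\<lambda>t x. c * a t x) (\<lambda>x. c * A x) F"
  by (rule Ulim_mult[OF Ulim_const[where C="\<bar>c\<bar>"] assms]) auto

lemma Ulim_diff:
  assumes "Ulim M a A F" "Ulim M b B F"
  shows "Ulim M (\<lambda>t x. a t x - b t x) (\<lambda>x. A x - B x) F"
  using Ulim_add[OF assms(1) Ulim_scale[OF assms(2), of "-1"]] by simp

text \<open>Eventually all values lie in one compact subset of \<open>{l<..}\<close>, where \<open>q\<close> is uniformly continuous.
  Functions such as \<open>r powr c\<close> make the restriction to a half-line necessary.\<close>

lemma Ulim_compose:
  fixes q :: "real \<Rightarrow> real"
  assumes a: "Ulim M a A F" and q: "continuous_on {l<..} q" and c: "l < c" "\<And>x. x \<in> space M \<Longrightarrow> c \<le> A x"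
  shows "Ulim M (\<lambda>t x. q (a t x)) (\<lambda>x. q (A x)) F"
proof -
  obtain C where C: "C > 0" "\<And>x. x \<in> space M \<Longrightarrow> \<bar>A x\<bar> \<le> C" "\<forall>\<^sub>F t in F. \<forall>x\<in>space M. \<bar>a t x\<bar> \<le> C"
    using Ulim_bound[OF a] by blast
  define d where "d = (c + l) / 2"
  have d: "l < d" "d < c" using c by (auto simp: d_def)
  let ?K = "{d..C}"
  have qK: "continuous_on ?K q" by (rule continuous_on_subset[OF q]) (use d in auto)
  have uc: "uniformly_continuous_on ?K q"
    by (rule compact_uniformly_continuous[OF qK]) simp
  have "\<forall>\<^sub>F t in F. \<forall>x\<in>space M. dist (a t x) (A x) < c - d"
    using a d by (auto simp: Ulim_def intro: uniform_limitD)
  then have "\<forall>\<^sub>F t in F. \<forall>x\<in>space M. d \<le> a t x"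
    by eventually_elim (use c(2) in \<open>fastforce simp: dist_real_def\<close>)
  with C(3) have evK: "\<forall>\<^sub>F t in F. \<forall>x\<in>space M. a t x \<in> ?K"
    by eventually_elim fastforce
  have AK: "A x \<in> ?K" if "x \<in> space M" for x
    using that C(2)[OF that] c(2)[OF that] d by auto
  define q' where "q' x = q (max d (min C x))" for x
  have dC: "space M \<noteq> {} \<Longrightarrow> d \<le> C" using AK by fastforce
  have q': "q' \<in> borel_measurable borel" if "d \<le> C"
    unfolding q'_def
    by (intro borel_measurable_continuous_onI continuous_on_compose2[OF qK])
       (use that in \<open>auto intro!: continuous_intros\<close>)
  have q'eq: "q' y = q y" if "y \<in> ?K" for y using that by (simp add: q'_def max_absorb2 min_absorb2)
  have meas: "(\<lambda>x. q (b x)) \<in> borel_measurable M"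
    if "b \<in> borel_measurable M" "\<forall>x\<in>space M. b x \<in> ?K" for b
  proof (cases "space M = {}")
    case False
    from dC[OF this] have "(\<lambda>x. q' (b x)) \<in> borel_measurable M"
      using measurable_compose[OF that(1) q'] by simp
    then show ?thesis by (rule measurable_cong[THEN iffD1, rotated]) (use that q'eq in auto)
  qed (auto simp: measurable_def)
  have "bounded (q ` ?K)" by (intro compact_imp_bounded compact_continuous_image[OF qK]) simp
  then have "bounded ((\<lambda>x. q (A x)) ` space M)" by (rule bounded_subset) (use AK in auto)
  moreover have "\<forall>\<^sub>F t in F. (\<lambda>x. q (a t x)) \<in> borel_measurable M"
  proof -
    have "\<forall>\<^sub>F t in F. a t \<in> borel_measurable M" using a by (simp add: Ulim_def)
    with evK show ?thesis by eventually_elim (rule meas)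
  qed
  moreover have "uniform_limit (space M) (\<lambda>t x. q (a t x)) (\<lambda>x. q (A x)) F"
    using uniform_limit_compose_uniformly_continuous_on[OF _ uc evK] a by (auto simp: Ulim_def)
  moreover have "(\<lambda>x. q (A x)) \<in> borel_measurable M"
    by (rule meas) (use a AK in \<open>auto simp: Ulim_def\<close>)
  ultimately show ?thesis by (simp add: Ulim_def)
qed

lemma tendsto_0_le_real:
  assumes "(b \<longlongrightarrow> (0::real)) F" "\<forall>\<^sub>F t in F. 0 \<le> a t" "\<forall>\<^sub>F t in F. a t \<le> b t"
  shows "(a \<longlongrightarrow> 0) F"
  by (rule tendsto_sandwich[OF assms(2,3) tendsto_const assms(1)])

lemma L2lim_add:
  assumes "L2lim M f F1 F" "L2lim M g G F"
  shows "L2lim M (\<lambda>t x. f t x + g t x) (\<lambda>x. F1 x + G x) F"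
  unfolding L2lim_def
proof (intro conjI)
  have ev: "\<forall>\<^sub>F t in F. sq_integrable M (f t) \<and> sq_integrable M (g t)"
    using assms by (auto simp: L2lim_def intro: eventually_conj)
  show "sq_integrable M (\<lambda>x. F1 x + G x)" using assms by (auto simp: L2lim_def intro: sq_integrable_add)
  show "\<forall>\<^sub>F t in F. sq_integrable M (\<lambda>x. f t x + g t x)" using ev by eventually_elim (auto intro: sq_integrable_add)
  have "((\<lambda>t. l2 M (\<lambda>x. f t x - F1 x) + l2 M (\<lambda>x. g t x - G x)) \<longlongrightarrow> 0 + 0) F"
    using assms by (intro tendsto_add) (auto simp: L2lim_def)
  then have lim: "((\<lambda>t. l2 M (\<lambda>x. f t x - F1 x) + l2 M (\<lambda>x. g t x - G x)) \<longlongrightarrow> 0) F" by simp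
  show "((\<lambda>t. l2 M (\<lambda>x. (f t x + g t x) - (F1 x + G x))) \<longlongrightarrow> 0) F"
  proof (rule tendsto_0_le_real[OF lim])
    show "\<forall>\<^sub>F t in F. l2 M (\<lambda>x. (f t x + g t x) - (F1 x + G x)) \<le> l2 M (\<lambda>x. f t x - F1 x) + l2 M (\<lambda>x. g t x - G x)"
      using ev
    proof eventually_elim
      case (elim t)
      have "sq_integrable M (\<lambda>x. f t x - F1 x)" "sq_integrable M (\<lambda>x. g t x - G x)"
        using elim assms by (auto simp: L2lim_def intro: sq_integrable_diff)
      from l2_triangle[OF this] show ?case by (simp add: algebra_simps)
    qed
  qed simp
qed

lemma L2lim_const: "sq_integrable M G \<Longrightarrow> L2lim M (\<lambda>_. G) G F"
  by (simp add: L2lim_def l2_def)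

text \<open>Products of the modes: the proofs split \<open>a g - A G = a (g - G) + (a - A) G\<close>.\<close>

lemma L2lim_Ulim_mult:
  assumes a: "Ulim M a A F" and g: "L2lim M g G F"
  shows "L2lim M (\<lambda>t x. a t x * g t x) (\<lambda>x. A x * G x) F"
  unfolding L2lim_def
proof (intro conjI)
  obtain C where C: "C > 0" "\<And>x. x \<in> space M \<Longrightarrow> \<bar>A x\<bar> \<le> C" "\<forall>\<^sub>F t in F. \<forall>x\<in>space M. \<bar>a t x\<bar> \<le> C"
    using Ulim_bound[OF a] by blast
  have A: "A \<in> borel_measurable M" and G: "sq_integrable M G" using a g by (auto simp: Ulim_def L2lim_def)
  show "sq_integrable M (\<lambda>x. A x * G x)" using sq_integrable_bounded_mult(1)[OF A C(2) G] by simp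
  have ev: "\<forall>\<^sub>F t in F. a t \<in> borel_measurable M \<and> (\<forall>x\<in>space M. \<bar>a t x\<bar> \<le> C) \<and> sq_integrable M (g t)"
    using a g C(3) by (auto simp: Ulim_def L2lim_def intro!: eventually_conj)
  then show "\<forall>\<^sub>F t in F. sq_integrable M (\<lambda>x. a t x * g t x)"
    by eventually_elim (auto intro: sq_integrable_bounded_mult)
  show "((\<lambda>t. l2 M (\<lambda>x. a t x * g t x - A x * G x)) \<longlongrightarrow> 0) F"
  proof (rule tendstoI)
    fix e :: real assume e: "e > 0"
    define d where "d = e / (2 * (l2 M G + 1))"
    have gp: "l2 M G + 1 > 0" using l2_nonneg[of M G] by linarith
    have d: "d > 0" using e gp by (simp add: d_def)
    have "d * l2 M G < e / 2"
    proof -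
      have "d * l2 M G < d * (l2 M G + 1)" using d by simp
      also have "\<dots> = e / 2" using gp by (simp only: d_def) (simp add: divide_simps)
      finally show ?thesis .
    qed
    note dG = this
    have "\<forall>\<^sub>F t in F. \<forall>x\<in>space M. dist (a t x) (A x) < d"
      using a d by (auto simp: Ulim_def intro: uniform_limitD)
    moreover have "\<forall>\<^sub>F t in F. l2 M (\<lambda>x. g t x - G x) < e / (2 * C)"
      by (rule order_tendstoD(2)[of _ 0]) (use g e C in \<open>auto simp: L2lim_def\<close>)
    ultimately show "\<forall>\<^sub>F t in F. dist (l2 M (\<lambda>x. a t x * g t x - A x * G x)) 0 < e"
      using ev
    proof eventually_elim
      case (elim t)
      have s1: "sq_integrable M (\<lambda>x. g t x - G x)" using elim G by (auto intro: sq_integrable_diff)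
      have m: "(\<lambda>x. a t x - A x) \<in> borel_measurable M" using elim A by auto
      have d': "\<bar>a t x - A x\<bar> \<le> d" if "x \<in> space M" for x
        using elim(1) that by (force simp: dist_real_def)
      have c': "\<bar>a t x\<bar> \<le> C" if "x \<in> space M" for x using elim that by auto
      have ma: "a t \<in> borel_measurable M" using elim by auto
      note p1 = sq_integrable_bounded_mult[OF ma c' s1]
      note p2 = sq_integrable_bounded_mult[OF m d' G]
      have "l2 M (\<lambda>x. a t x * g t x - A x * G x)
          = l2 M (\<lambda>x. a t x * (g t x - G x) + (a t x - A x) * G x)" by (simp add: algebra_simps)
      also have "\<dots> \<le> l2 M (\<lambda>x. a t x * (g t x - G x)) + l2 M (\<lambda>x. (a t x - A x) * G x)"
        by (rule l2_triangle[OF p1(1) p2(1)])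
      also have "\<dots> \<le> C * l2 M (\<lambda>x. g t x - G x) + d * l2 M G"
        using p1(2) p2(2) by simp
      also have "\<dots> < e / 2 + e / 2"
        using elim(2) dG C(1) by (intro add_strict_mono) (simp_all add: field_simps)
      finally show ?case by simp
    qed
  qed
qed

lemma L2lim_scale: "L2lim M f G F \<Longrightarrow> L2lim M (\<lambda>t x. c * f t x) (\<lambda>x. c * G x) F"
  by (rule L2lim_Ulim_mult[OF Ulim_const[where C="\<bar>c\<bar>"]]) auto

lemma L2lim_diff:
  assumes "L2lim M f F1 F" "L2lim M g G F"
  shows "L2lim M (\<lambda>t x. f t x - g t x) (\<lambda>x. F1 x - G x) F"
  using L2lim_add[OF assms(1) L2lim_scale[OF assms(2), of "-1"]] by simp

lemma (in finite_measure) Ulim_imp_L2lim: "Ulim M a A F \<Longrightarrow> L2lim M a A F"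
  using L2lim_Ulim_mult[of M a A F "\<lambda>_ _. 1" "\<lambda>_. 1"] L2lim_const[OF sq_integrable_const[of 1], of F] by simp

lemma L2lim_norm_bounded:
  assumes "L2lim M g G F"
  shows "\<forall>\<^sub>F t in F. l2 M (g t) \<le> l2 M G + 1"
proof -
  have "\<forall>\<^sub>F t in F. l2 M (\<lambda>x. g t x - G x) < 1" "\<forall>\<^sub>F t in F. sq_integrable M (g t)" "sq_integrable M G"
    using assms by (auto simp: L2lim_def intro: order_tendstoD)
  from this(1,2) show ?thesis
  proof eventually_elim
    case (elim t)
    then show ?case using l2_diff_le[OF elim(2) \<open>sq_integrable M G\<close>] by simp
  qed
qed

lemma L1lim_L2lim_mult:
  assumes f: "L2lim M f F1 F" and g: "L2lim M g G F"
  shows "L1lim M (\<lambda>t x. f t x * g t x) (\<lambda>x. F1 x * G x) F"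
  unfolding L1lim_def
proof (intro conjI)
  have F1: "sq_integrable M F1" and G: "sq_integrable M G" using f g by (auto simp: L2lim_def)
  show "integrable M (\<lambda>x. F1 x * G x)" by (rule sq_integrable_integrable_mult[OF F1 G])
  have ev: "\<forall>\<^sub>F t in F. sq_integrable M (f t) \<and> sq_integrable M (g t) \<and> l2 M (g t) \<le> l2 M G + 1"
    using f g L2lim_norm_bounded[OF g] by (auto simp: L2lim_def intro!: eventually_conj)
  then show "\<forall>\<^sub>F t in F. integrable M (\<lambda>x. f t x * g t x)"
    by eventually_elim (auto intro: sq_integrable_integrable_mult)
  have "((\<lambda>t. l2 M (\<lambda>x. f t x - F1 x) * (l2 M G + 1) + l2 M F1 * l2 M (\<lambda>x. g t x - G x)) \<longlongrightarrow> 0 * (l2 M G + 1) + l2 M F1 * 0) F"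
    using f g by (intro tendsto_intros) (auto simp: L2lim_def)
  then have lim: "((\<lambda>t. l2 M (\<lambda>x. f t x - F1 x) * (l2 M G + 1) + l2 M F1 * l2 M (\<lambda>x. g t x - G x)) \<longlongrightarrow> 0) F" by simp
  show "((\<lambda>t. \<integral>x. \<bar>f t x * g t x - F1 x * G x\<bar> \<partial>M) \<longlongrightarrow> 0) F"
  proof (rule tendsto_0_le_real[OF lim])
    show "\<forall>\<^sub>F t in F. (\<integral>x. \<bar>f t x * g t x - F1 x * G x\<bar> \<partial>M)
        \<le> l2 M (\<lambda>x. f t x - F1 x) * (l2 M G + 1) + l2 M F1 * l2 M (\<lambda>x. g t x - G x)"
      using ev
    proof eventually_elim
      case (elim t)
      have s1: "sq_integrable M (\<lambda>x. f t x - F1 x)" and s2: "sq_integrable M (\<lambda>x. g t x - G x)" and gt: "sq_integrable M (g t)"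
        using elim F1 G by (auto intro: sq_integrable_diff)
      have "(\<integral>x. \<bar>f t x * g t x - F1 x * G x\<bar> \<partial>M)
          \<le> (\<integral>x. \<bar>(f t x - F1 x) * g t x\<bar> + \<bar>F1 x * (g t x - G x)\<bar> \<partial>M)"
      proof (rule integral_mono)
        show "integrable M (\<lambda>x. \<bar>f t x * g t x - F1 x * G x\<bar>)"
          using elim F1 G by (auto intro!: sq_integrable_integrable_mult)
        show "integrable M (\<lambda>x. \<bar>(f t x - F1 x) * g t x\<bar> + \<bar>F1 x * (g t x - G x)\<bar>)"
          using sq_integrable_integrable_mult[OF s1 gt] sq_integrable_integrable_mult[OF F1 s2] by auto
        show "\<bar>f t x * g t x - F1 x * G x\<bar> \<le> \<bar>(f t x - F1 x) * g t x\<bar> + \<bar>F1 x * (g t x - G x)\<bar>" for x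
          using abs_triangle_ineq[of "(f t x - F1 x) * g t x" "F1 x * (g t x - G x)"]
          by (simp add: algebra_simps)
      qed
      also have "\<dots> = (\<integral>x. \<bar>(f t x - F1 x) * g t x\<bar> \<partial>M) + (\<integral>x. \<bar>F1 x * (g t x - G x)\<bar> \<partial>M)"
        using sq_integrable_integrable_mult[OF s1 gt] sq_integrable_integrable_mult[OF F1 s2]
        by (intro Bochner_Integration.integral_add) auto
      also have "\<dots> \<le> l2 M (\<lambda>x. f t x - F1 x) * l2 M (g t) + l2 M F1 * l2 M (\<lambda>x. g t x - G x)"
        by (intro add_mono l2_Cauchy_Schwarz_abs s1 s2 gt F1)
      also have "\<dots> \<le> l2 M (\<lambda>x. f t x - F1 x) * (l2 M G + 1) + l2 M F1 * l2 M (\<lambda>x. g t x - G x)"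
        using elim by (intro add_mono mult_left_mono) auto
      finally show ?case .
    qed
  qed simp
qed

lemma L1lim_Ulim_mult:
  assumes a: "Ulim M a A F" and g: "L1lim M g G F"
  shows "L1lim M (\<lambda>t x. a t x * g t x) (\<lambda>x. A x * G x) F"
  unfolding L1lim_def
proof (intro conjI)
  obtain C where C: "C > 0" "\<And>x. x \<in> space M \<Longrightarrow> \<bar>A x\<bar> \<le> C" "\<forall>\<^sub>F t in F. \<forall>x\<in>space M. \<bar>a t x\<bar> \<le> C"
    using Ulim_bound[OF a] by blast
  have bm: "integrable M (\<lambda>x. b x * h x)"
    if "b \<in> borel_measurable M" "\<forall>x\<in>space M. \<bar>b x\<bar> \<le> C'" "integrable M h" for b h :: "'a \<Rightarrow> real" and C'
  proof (rule Bochner_Integration.integrable_bound[where f="\<lambda>x. C' * h x"])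
    show "AE x in M. norm (b x * h x) \<le> norm (C' * h x)"
    proof (rule AE_I2)
      fix x assume "x \<in> space M"
      then have "\<bar>b x\<bar> \<le> \<bar>C'\<bar>" using that(2) by fastforce
      then show "norm (b x * h x) \<le> norm (C' * h x)" by (simp add: abs_mult mult_right_mono)
    qed
  qed (use that in auto)
  have A: "A \<in> borel_measurable M" and G: "integrable M G" using a g by (auto simp: Ulim_def L1lim_def)
  show iAG: "integrable M (\<lambda>x. A x * G x)" using bm[OF A _ G] C(2) by blast
  have ev: "\<forall>\<^sub>F t in F. a t \<in> borel_measurable M \<and> (\<forall>x\<in>space M. \<bar>a t x\<bar> \<le> C) \<and> integrable M (g t)"
    using a g C(3) by (auto simp: Ulim_def L1lim_def intro!: eventually_conj)
  then show "\<forall>\<^sub>F t in F. integrable M (\<lambda>x. a t x * g t x)"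
    by eventually_elim (auto intro: bm)
  show "((\<lambda>t. \<integral>x. \<bar>a t x * g t x - A x * G x\<bar> \<partial>M) \<longlongrightarrow> 0) F"
  proof (rule tendstoI)
    fix e :: real assume e: "e > 0"
    define I where "I = (\<integral>x. \<bar>G x\<bar> \<partial>M)"
    have I: "I \<ge> 0" by (simp add: I_def)
    define d where "d = e / (2 * (I + 1))"
    have d: "d > 0" using e I by (simp add: d_def)
    have dI: "d * I < e / 2"
    proof -
      have "d * I < d * (I + 1)" using d by simp
      also have "\<dots> = e / 2" using I by (simp only: d_def) (simp add: divide_simps)
      finally show ?thesis .
    qed
    have "\<forall>\<^sub>F t in F. \<forall>x\<in>space M. dist (a t x) (A x) < d"
      using a d by (auto simp: Ulim_def intro: uniform_limitD)
    moreover have "\<forall>\<^sub>F t in F. (\<integral>x. \<bar>g t x - G x\<bar> \<partial>M) < e / (2 * C)"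
      by (rule order_tendstoD(2)[of _ 0]) (use g e C in \<open>auto simp: L1lim_def\<close>)
    ultimately show "\<forall>\<^sub>F t in F. dist (\<integral>x. \<bar>a t x * g t x - A x * G x\<bar> \<partial>M) 0 < e"
      using ev
    proof eventually_elim
      case (elim t)
      have i1: "integrable M (\<lambda>x. a t x * g t x)" using elim bm by auto
      have i2: "integrable M (\<lambda>x. C * \<bar>g t x - G x\<bar> + d * \<bar>G x\<bar>)"
        using elim G by auto
      have "(\<integral>x. \<bar>a t x * g t x - A x * G x\<bar> \<partial>M) \<le> (\<integral>x. C * \<bar>g t x - G x\<bar> + d * \<bar>G x\<bar> \<partial>M)"
      proof (rule integral_mono[OF _ i2])
        show "integrable M (\<lambda>x. \<bar>a t x * g t x - A x * G x\<bar>)" using i1 iAG by auto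
        fix x assume x: "x \<in> space M"
        have "\<bar>a t x * g t x - A x * G x\<bar> \<le> \<bar>a t x * (g t x - G x)\<bar> + \<bar>(a t x - A x) * G x\<bar>"
          using abs_triangle_ineq[of "a t x * (g t x - G x)" "(a t x - A x) * G x"]
          by (simp add: algebra_simps)
        also have "\<dots> \<le> C * \<bar>g t x - G x\<bar> + d * \<bar>G x\<bar>"
          unfolding abs_mult using elim x
          by (intro add_mono mult_right_mono) (force simp: dist_real_def)+
        finally show "\<bar>a t x * g t x - A x * G x\<bar> \<le> C * \<bar>g t x - G x\<bar> + d * \<bar>G x\<bar>" .
      qed
      also have "\<dots> = C * (\<integral>x. \<bar>g t x - G x\<bar> \<partial>M) + d * I"
        using elim G by (simp add: I_def)
      also have "\<dots> < e / 2 + e / 2"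
        using elim(2) dI C(1) by (intro add_strict_mono) (simp_all add: field_simps)
      finally show ?case by simp
    qed
  qed
qed

lemma L1lim_integral:
  assumes "L1lim M g G F"
  shows "((\<lambda>t. \<integral>x. g t x \<partial>M) \<longlongrightarrow> (\<integral>x. G x \<partial>M)) F"
proof (rule LIM_zero_cancel, rule Lim_null_comparison)
  show "((\<lambda>t. \<integral>x. \<bar>g t x - G x\<bar> \<partial>M) \<longlongrightarrow> 0) F" using assms by (simp add: L1lim_def)
  have "\<forall>\<^sub>F t in F. integrable M (g t)" using assms by (simp add: L1lim_def)
  then show "\<forall>\<^sub>F t in F. norm ((\<integral>x. g t x \<partial>M) - (\<integral>x. G x \<partial>M)) \<le> (\<integral>x. \<bar>g t x - G x\<bar> \<partial>M)"
  proof eventually_elim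
    case (elim t)
    have "(\<integral>x. g t x \<partial>M) - (\<integral>x. G x \<partial>M) = (\<integral>x. g t x - G x \<partial>M)"
      using elim assms by (simp add: L1lim_def)
    then show ?case using integral_abs_bound[of M "\<lambda>x. g t x - G x"] by simp
  qed
qed

lemma (in finite_measure) L2lim_imp_L1lim: "L2lim M g G F \<Longrightarrow> L1lim M g G F"
  using L1lim_L2lim_mult[of M g G F "\<lambda>_ _. 1" "\<lambda>_. 1"] L2lim_const[OF sq_integrable_const[of 1], of F] by simp

lemma L1lim_const: "integrable M G \<Longrightarrow> L1lim M (\<lambda>_. G) G F"
  by (simp add: L1lim_def)

section \<open>Weakly differentiable functions on the torus\<close>

abbreviation T1 :: "real measure" where "T1 \<equiv> restrict_space lborel {0..1}"

lemma space_T1[simp]: "space T1 = {0..1}" by (simp add: space_restrict_space)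

interpretation T1: prob_space T1
  by (rule prob_spaceI) (simp add: emeasure_restrict_space)

lemma prob_T1[simp]: "measure T1 {0..1} = 1"
  using T1.prob_space by simp

lemma measurable_T1_continuous: "continuous_on {0..1} g \<Longrightarrow> (g :: real \<Rightarrow> real) \<in> borel_measurable T1"
  using borel_measurable_continuous_on_restrict[of "{0..1}" g]
  by (simp add: measurable_cong_sets[OF sets_restrict_space_cong[OF sets_lborel] refl])

lemma measurable_T1_borel: "g \<in> borel_measurable borel \<Longrightarrow> g \<in> borel_measurable T1"
  by (rule measurable_restrict_space1) simp

lemma integral_T1: "integral\<^sup>L T1 g = (LINT x:{0..1}|lborel. g x)" for g :: "real \<Rightarrow> real"
  by (simp add: integral_restrict_space set_lebesgue_integral_def)

lemma integrable_T1: "integrable T1 g \<longleftrightarrow> set_integrable lborel {0..1} g" for g :: "real \<Rightarrow> real"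
  by (simp add: integrable_restrict_space set_integrable_def)

lemma AE_T1: "(AE x in T1. P x) \<longleftrightarrow> (AE x in lborel. x \<in> {0..1} \<longrightarrow> P x)"
  by (rule AE_restrict_space_iff) simp

lemma continuous_bounded_T1:
  assumes "continuous_on {0..1} (g :: real \<Rightarrow> real)"
  obtains C where "\<And>x. x \<in> {0..1} \<Longrightarrow> \<bar>g x\<bar> \<le> C"
proof -
  have "bounded (g ` {0..1})" by (intro compact_imp_bounded compact_continuous_image assms compact_Icc)
  then obtain C where "\<forall>y\<in>g ` {0..1}. norm y \<le> C" unfolding bounded_iff by blast
  then show ?thesis by (intro that[of C]) auto
qed

lemma sq_integrable_T1_continuous: "continuous_on {0..1} g \<Longrightarrow> sq_integrable T1 (g :: real \<Rightarrow> real)"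
proof -
  assume g: "continuous_on {0..1} g"
  obtain C where "\<And>x. x \<in> {0..1} \<Longrightarrow> \<bar>g x\<bar> \<le> C" using continuous_bounded_T1[OF g] by blast
  then show ?thesis by (intro T1.sq_integrable_bounded[where C=C] measurable_T1_continuous[OF g]) auto
qed

lemma Ulim_T1_const:
  fixes g :: "real \<Rightarrow> real"
  assumes "continuous_on {0..1} g" shows "Ulim T1 (\<lambda>_. g) g F"
proof -
  obtain C where "\<And>x. x \<in> {0..1} \<Longrightarrow> \<bar>g x\<bar> \<le> C" using continuous_bounded_T1[OF assms] by blast
  then show ?thesis by (intro Ulim_const[where C=C] measurable_T1_continuous[OF assms]) auto
qed

lemma integral_T1_le_sup:
  fixes g :: "real \<Rightarrow> real"
  assumes "integrable T1 g" "\<And>x. x \<in> {0..1} \<Longrightarrow> g x \<le> C"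
  shows "integral\<^sup>L T1 g \<le> C"
  using integral_mono[of T1 g "\<lambda>_. C"] assms by (simp add: T1.prob_space)

lemma l2_T1_le_sup:
  assumes "g \<in> borel_measurable T1" "\<And>x. x \<in> {0..1} \<Longrightarrow> \<bar>g x\<bar> \<le> C" 
  shows "l2 T1 g \<le> C"
  using sq_integrable_bounded_mult(2)[of g T1 C "\<lambda>_. 1"] assms T1.sq_integrable_const by (simp add: l2_def T1.prob_space)

lemma integral_abs_T1_le_l2: "sq_integrable T1 g \<Longrightarrow> (\<integral>x. \<bar>g x\<bar> \<partial>T1) \<le> l2 T1 g"
  using l2_Cauchy_Schwarz_abs[of T1 g "\<lambda>_. 1"] T1.sq_integrable_const by (simp add: l2_def T1.prob_space)

lemma abs_integral_T1_le_l2: "sq_integrable T1 g \<Longrightarrow> \<bar>\<integral>x. g x \<partial>T1\<bar> \<le> l2 T1 g"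
  using integral_abs_T1_le_l2[of g] integral_abs_bound[of T1 g] by linarith

lemma test_xD:
  assumes "test_x \<phi>"
  shows "(\<phi> has_real_derivative deriv \<phi> x) (at x)" "continuous_on A \<phi>" "continuous_on A (deriv \<phi>)"
    "\<phi> (x + 1) = \<phi> x" "\<phi> \<in> borel_measurable T1" "deriv \<phi> \<in> borel_measurable T1" "sq_integrable T1 \<phi>" "sq_integrable T1 (deriv \<phi>)"
  using assms smoothD[of \<phi>] unfolding test_x_def periodic1_def
  by (auto intro: measurable_T1_continuous sq_integrable_T1_continuous)

lemma test_x_const: "test_x (\<lambda>_. c)" by (simp add: test_x_def smooth_const periodic1_def)
lemma test_x_add: "test_x f \<Longrightarrow> test_x g \<Longrightarrow> test_x (\<lambda>x. f x + g x)"
  by (simp add: test_x_def smooth_add periodic1_def)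
lemma test_x_cmult: "test_x f \<Longrightarrow> test_x (\<lambda>x. c * f x)"
  by (simp add: test_x_def smooth_mult smooth_const periodic1_def)
text \<open>For \<open>0 < a < 1\<close> the function \<open>sin (\<pi> x) * sin (\<pi> (a - x))\<close> has period 1, is positive on
  \<open>(0, a)\<close> and nonpositive on the rest of \<open>[0, 1]\<close>, so composing it with steeper and steeper smooth
  steps gives smooth periodic approximations of the indicator of \<open>(0, a)\<close>.\<close>

lemma test_x_tendsto_interval:
  obtains \<phi> :: "nat \<Rightarrow> real \<Rightarrow> real" where "\<And>n. test_x (\<phi> n)" "\<And>n x. 0 \<le> \<phi> n x" "\<And>n x. \<phi> n x \<le> 1"
    "\<And>x. x \<in> {0..1} \<Longrightarrow> x \<noteq> 0 \<Longrightarrow> x \<noteq> 1 \<Longrightarrow> (\<lambda>n. \<phi> n x) \<longlonglongrightarrow> indicator {..<a} x"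
proof (cases "0 < a \<and> a < 1")
  case True
  define s where "s x = sin (pi * x) * sin (pi * (a - x))" for x :: real
  define \<phi> where "\<phi> n x = sstep (real n * s x)" for n :: nat and x
  have "smooth (\<phi> n)" for n
    unfolding \<phi>_def s_def
    by (intro smooth_compose[OF sstep(1)] smooth_mult smooth_const smooth_compose[OF smooth_sin_cos(1)]
        smooth_diff smooth_ident)
  moreover have "periodic1 (\<phi> n)" for n
  proof -
    have "s (x + 1) = s x" for x
    proof -
      have "sin (pi * (x + 1)) = - sin (pi * x)" by (simp add: distrib_left)
      moreover have "sin (pi * (a - (x + 1))) = - sin (pi * (a - x))"
      proof -
        have "pi * (a - x) = pi * (a - (x + 1)) + pi" by (simp add: algebra_simps)
        then show ?thesis by (metis minus_minus sin_periodic_pi)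
      qed
      ultimately show ?thesis by (simp add: s_def)
    qed
    then show ?thesis by (simp add: periodic1_def \<phi>_def)
  qed
  moreover have "(\<lambda>n. \<phi> n x) \<longlonglongrightarrow> indicator {..<a} x" if x: "x \<in> {0..1}" "x \<noteq> 0" "x \<noteq> 1" for x
  proof (cases "x < a")
    case less: True
    have "s x > 0" unfolding s_def
      by (intro mult_pos_pos sin_gt_zero) (use less x True in auto)
    then obtain N :: nat where N: "1 / s x < real N" using reals_Archimedean2 by blast
    have "\<forall>\<^sub>F n in sequentially. \<phi> n x = 1"
    proof (rule eventually_sequentiallyI)
      fix n assume "N \<le> n"
      then have "1 / s x \<le> real n" using N by linarith
      then have "1 \<le> real n * s x" using \<open>s x > 0\<close> by (simp add: field_simps)
      then show "\<phi> n x = 1" by (simp add: \<phi>_def sstep)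
    qed
    then show ?thesis using less by (simp add: tendsto_eventually)
  next
    case False
    have "sin (pi * x) \<ge> 0" by (rule sin_ge_zero) (use x in auto)
    moreover have "sin (pi * (x - a)) \<ge> 0" by (rule sin_ge_zero) (use x False True in auto)
    moreover have "sin (pi * (a - x)) = - sin (pi * (x - a))"
      by (metis minus_diff_eq mult_minus_right sin_minus)
    ultimately have "s x \<le> 0" by (simp add: s_def mult_nonneg_nonpos)
    then have "\<phi> n x = 0" for n by (simp add: \<phi>_def sstep mult_nonneg_nonpos)
    then show ?thesis using False by simp
  qed
  ultimately show ?thesis
    by (intro that[of \<phi>]) (auto simp: test_x_def \<phi>_def sstep_bounds)
next
  case False
  then consider "a \<le> 0" | "a \<ge> 1" by linarith
  then show ?thesis
  proof cases
    case 1
    then show ?thesis by (intro that[of "\<lambda>_ _. 0"]) (auto simp: test_x_const)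
  next
    case 2
    then show ?thesis by (intro that[of "\<lambda>_ _. 1"]) (auto simp: test_x_const)
  qed
qed

lemma AE_T1_interior: "AE x in T1. x \<in> {0..1} \<and> x \<noteq> 0 \<and> x \<noteq> 1"
  unfolding AE_T1 using AE_lborel_singleton[of 0] AE_lborel_singleton[of 1] by eventually_elim auto

lemma indicator_T1_measurable: "A \<in> sets borel \<Longrightarrow> (indicator A :: real \<Rightarrow> real) \<in> borel_measurable T1"
  by (rule measurable_T1_borel) simp

text \<open>The half-lines generate the Borel sets and are closed under intersection.\<close>

lemma borel_set_induct_lessThan[consumes 1, case_names lessThan empty compl union]:
  fixes P :: "real set \<Rightarrow> bool"
  assumes A: "A \<in> sets borel"
    and basic: "\<And>a. P {..<a}" and empty: "P {}"
    and compl: "\<And>A. A \<in> sets borel \<Longrightarrow> P A \<Longrightarrow> P (- A)"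
    and union: "\<And>A :: nat \<Rightarrow> real set. disjoint_family A \<Longrightarrow> (\<And>i. A i \<in> sets borel) \<Longrightarrow> (\<And>i. P (A i)) \<Longrightarrow> P (\<Union>i. A i)"
  shows "P A"
proof -
  have s: "sets borel = sigma_sets UNIV (range (lessThan :: real \<Rightarrow> real set))"
    by (subst borel_Iio) simp
  have Is: "Int_stable (range (lessThan :: real \<Rightarrow> real set))"
    unfolding Int_stable_def
  proof (intro ballI)
    fix a b :: "real set" assume "a \<in> range lessThan" "b \<in> range lessThan"
    then obtain x y where "a = {..<x}" "b = {..<y}" by auto
    then have "a \<inter> b = {..<min x y}" by auto
    then show "a \<inter> b \<in> range lessThan" by simp
  qed
  have "range (lessThan :: real \<Rightarrow> real set) \<subseteq> Pow UNIV" by simp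
  from Is this A[unfolded s] show ?thesis
  proof (induction rule: sigma_sets_induct_disjoint)
    case (basic A) then show ?case using assms(2) by auto
  next
    case empty show ?case by fact
  next
    case (compl A) then show ?case using assms(4)[of A] unfolding s by (simp add: Compl_eq_Diff_UNIV)
  next
    case (union A) then show ?case using assms(5)[of A] unfolding s by auto
  qed
qed

text \<open>Orthogonality passes from smooth periodic functions to indicators of half-lines by dominated
  convergence, and from there to indicators of all Borel sets.\<close>

lemma T1_eq_0_if_orthogonal:
  assumes k: "integrable T1 k" and 0: "\<And>\<phi>. test_x \<phi> \<Longrightarrow> (\<integral>x. k x * \<phi> x \<partial>T1) = 0"
  shows "AE x in T1. k x = 0"
proof -
  have km: "k \<in> borel_measurable T1" using k by simp
  have iA: "integrable T1 (\<lambda>x. indicator A x * k x)" if "A \<in> sets borel" for A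
    by (rule Bochner_Integration.integrable_bound[OF k])
       (use borel_measurable_times[OF indicator_T1_measurable[OF that] km] in \<open>auto simp: abs_mult indicator_def\<close>)
  have ind: "(\<integral>x. indicator A x * k x \<partial>T1) = 0" if "A \<in> sets borel" for A
    using that
  proof (induction rule: borel_set_induct_lessThan)
    case (lessThan a)
    obtain \<phi> :: "nat \<Rightarrow> real \<Rightarrow> real" where \<phi>: "\<And>n. test_x (\<phi> n)" "\<And>n x. 0 \<le> \<phi> n x" "\<And>n x. \<phi> n x \<le> 1"
      "\<And>x. x \<in> {0..1} \<Longrightarrow> x \<noteq> 0 \<Longrightarrow> x \<noteq> 1 \<Longrightarrow> (\<lambda>n. \<phi> n x) \<longlonglongrightarrow> indicator {..<a} x"
      using test_x_tendsto_interval[of a] by blast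
    have "(\<lambda>n. \<integral>x. \<phi> n x * k x \<partial>T1) \<longlonglongrightarrow> (\<integral>x. indicator {..<a} x * k x \<partial>T1)"
    proof (rule integral_dominated_convergence[where w="\<lambda>x. \<bar>k x\<bar>"])
      show "AE x in T1. (\<lambda>n. \<phi> n x * k x) \<longlonglongrightarrow> indicator {..<a} x * k x"
        using AE_T1_interior by eventually_elim (auto intro!: tendsto_mult \<phi>(4))
      show "AE x in T1. norm (\<phi> n x * k x) \<le> \<bar>k x\<bar>" for n
        using \<phi>(2,3)[of n] by (auto simp: abs_mult intro!: mult_left_le_one_le)
      show "(\<lambda>x. indicator {..<a} x * k x) \<in> borel_measurable T1"
        by (intro borel_measurable_times km indicator_T1_measurable) simp
      show "(\<lambda>x. \<phi> n x * k x) \<in> borel_measurable T1" for n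
        by (intro borel_measurable_times km test_xD(5) \<phi>)
    qed (use k in auto)
    moreover have "(\<integral>x. \<phi> n x * k x \<partial>T1) = 0" for n
      using 0[OF \<phi>(1)[of n]] by (simp add: mult.commute)
    ultimately show ?case using LIMSEQ_unique[of "\<lambda>_. 0"] by auto
  next
    case empty then show ?case by simp
  next
    case (compl A)
    have "(\<integral>x. indicator (- A) x * k x \<partial>T1) = (\<integral>x. k x * 1 - indicator A x * k x \<partial>T1)"
      by (intro Bochner_Integration.integral_cong) (auto simp: indicator_def)
    also have "\<dots> = (\<integral>x. k x * 1 \<partial>T1) - (\<integral>x. indicator A x * k x \<partial>T1)"
      by (rule Bochner_Integration.integral_diff) (use k iA[OF compl(1)] in auto)
    also have "\<dots> = 0" using 0[OF test_x_const[of 1]] compl by simp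
    finally show ?case .
  next
    case (union A)
    have lim: "(\<lambda>n. \<integral>x. indicator (\<Union>i<n. A i) x * k x \<partial>T1) \<longlonglongrightarrow> (\<integral>x. indicator (\<Union>i. A i) x * k x \<partial>T1)"
    proof (rule integral_dominated_convergence[where w="\<lambda>x. \<bar>k x\<bar>"])
      show "AE x in T1. (\<lambda>n. indicator (\<Union>i<n. A i) x * k x) \<longlonglongrightarrow> indicator (\<Union>i. A i) x * k x"
        by (intro AE_I2 tendsto_mult LIMSEQ_indicator_UN tendsto_const)
      show "AE x in T1. norm (indicator (\<Union>i<n. A i) x * k x) \<le> \<bar>k x\<bar>" for n
        by (auto simp: indicator_def)
      show "(\<lambda>x. indicator (\<Union>i. A i) x * k x) \<in> borel_measurable T1"
        by (intro borel_measurable_times km indicator_T1_measurable) (use union in auto)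
      show "(\<lambda>x. indicator (\<Union>i<n. A i) x * k x) \<in> borel_measurable T1" for n
        by (intro borel_measurable_times km indicator_T1_measurable) (use union in auto)
    qed (use k in auto)
    have "(\<integral>x. indicator (\<Union>i<n. A i) x * k x \<partial>T1) = 0" for n :: nat
    proof -
      have "indicator (\<Union>i<n. A i) x = (\<Sum>i<n. indicator (A i) x :: real)" for x
        by (rule indicator_UN_disjoint) (use union(1) in \<open>auto simp: disjoint_family_on_def\<close>)
      then have "(\<integral>x. indicator (\<Union>i<n. A i) x * k x \<partial>T1) = (\<integral>x. (\<Sum>i<n. indicator (A i) x * k x) \<partial>T1)"
        by (simp add: sum_distrib_right)
      also have "\<dots> = (\<Sum>i<n. \<integral>x. indicator (A i) x * k x \<partial>T1)"
        by (rule Bochner_Integration.integral_sum) (use union iA in auto)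
      also have "\<dots> = 0" using union by simp
      finally show ?thesis .
    qed
    then show ?case using LIMSEQ_unique[OF lim, of 0] by simp
  qed
  show ?thesis
  proof (rule density_unique_real[OF k, of "\<lambda>_. 0"])
    fix A assume "A \<in> sets T1"
    then have A: "A \<in> sets borel" by (auto simp: sets_restrict_space)
    show "(LINT x:A|T1. k x) = (LINT x:A|T1. 0)"
      using ind[OF A] by (simp add: set_lebesgue_integral_def)
  qed simp
qed

text \<open>The functions that can be approximated in \<open>L\<^sup>2\<close> of the torus by smooth periodic ones.  They form
  a closed subspace that contains the indicators of half-lines, hence those of Borel sets, and by
  simple functions everything square-integrable.\<close>

definition L2_approx :: "(real \<Rightarrow> real) \<Rightarrow> bool" where
  "L2_approx h \<longleftrightarrow> sq_integrable T1 h \<and> (\<forall>e>0. \<exists>\<phi>. test_x \<phi> \<and> l2 T1 (\<lambda>x. \<phi> x - h x) < e)"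

lemma L2_approx_add: assumes "L2_approx f" "L2_approx g" shows "L2_approx (\<lambda>x. f x + g x)"
  unfolding L2_approx_def
proof (intro conjI allI impI)
  have s: "sq_integrable T1 f" "sq_integrable T1 g" using assms by (auto simp: L2_approx_def)
  then show "sq_integrable T1 (\<lambda>x. f x + g x)" by (rule sq_integrable_add)
  fix e :: real assume "e > 0"
  then have e2: "e / 2 > 0" by simp
  obtain \<phi> where \<phi>: "test_x \<phi>" "l2 T1 (\<lambda>x. \<phi> x - f x) < e / 2" using assms(1) e2 unfolding L2_approx_def by blast
  obtain \<psi> where \<psi>: "test_x \<psi>" "l2 T1 (\<lambda>x. \<psi> x - g x) < e / 2" using assms(2) e2 unfolding L2_approx_def by blast
  have "l2 T1 (\<lambda>x. (\<phi> x - f x) + (\<psi> x - g x)) \<le> l2 T1 (\<lambda>x. \<phi> x - f x) + l2 T1 (\<lambda>x. \<psi> x - g x)"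
    by (intro l2_triangle sq_integrable_diff s test_xD(7) \<phi> \<psi>)
  then have "l2 T1 (\<lambda>x. (\<phi> x + \<psi> x) - (f x + g x)) < e" using \<phi> \<psi> by (simp add: algebra_simps)
  then show "\<exists>\<phi>. test_x \<phi> \<and> l2 T1 (\<lambda>x. \<phi> x - (f x + g x)) < e"
    using test_x_add[OF \<phi>(1) \<psi>(1)] by blast
qed

lemma L2_approx_cmult: assumes "L2_approx f" shows "L2_approx (\<lambda>x. c * f x)"
  unfolding L2_approx_def
proof (intro conjI allI impI)
  have s: "sq_integrable T1 f" using assms by (auto simp: L2_approx_def)
  then show "sq_integrable T1 (\<lambda>x. c * f x)" by (rule sq_integrable_cmult)
  fix e :: real assume "e > 0"
  then have e2: "e / (\<bar>c\<bar> + 1) > 0" by simp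
  obtain \<phi> where \<phi>: "test_x \<phi>" "l2 T1 (\<lambda>x. \<phi> x - f x) < e / (\<bar>c\<bar> + 1)"
    using assms(1) e2 unfolding L2_approx_def by blast
  have "l2 T1 (\<lambda>x. c * (\<phi> x - f x)) = \<bar>c\<bar> * l2 T1 (\<lambda>x. \<phi> x - f x)" by (rule l2_cmult)
  also have "\<dots> \<le> (\<bar>c\<bar> + 1) * l2 T1 (\<lambda>x. \<phi> x - f x)" by (simp add: mult_right_mono)
  also have "\<dots> < (\<bar>c\<bar> + 1) * (e / (\<bar>c\<bar> + 1))" by (rule mult_strict_left_mono[OF \<phi>(2)]) simp
  also have "\<dots> = e" by (simp add: add_nonneg_eq_0_iff)
  finally have "l2 T1 (\<lambda>x. c * \<phi> x - c * f x) < e" by (simp add: algebra_simps)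
  then show "\<exists>\<phi>. test_x \<phi> \<and> l2 T1 (\<lambda>x. \<phi> x - c * f x) < e"
    using test_x_cmult[OF \<phi>(1)] by blast
qed

lemma L2_approx_const: "L2_approx (\<lambda>_. c)"
  unfolding L2_approx_def using test_x_const[of c] by (auto simp: T1.sq_integrable_const l2_def)

lemma L2_approx_sum: "(\<And>i. i \<in> I \<Longrightarrow> L2_approx (f i)) \<Longrightarrow> L2_approx (\<lambda>x. \<Sum>i\<in>I. f i x)"
  by (induction I rule: infinite_finite_induct) (auto intro: L2_approx_const L2_approx_add)

lemma L2_approx_limit:
  assumes s: "sq_integrable T1 h" and f: "\<And>n. L2_approx (f n)" and lim: "(\<lambda>n. l2 T1 (\<lambda>x. f n x - h x)) \<longlonglongrightarrow> 0"
  shows "L2_approx h"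
  unfolding L2_approx_def
proof (intro conjI allI impI s)
  fix e :: real assume "e > 0"
  then have e2: "e / 2 > 0" by simp
  have "\<forall>\<^sub>F n in sequentially. l2 T1 (\<lambda>x. f n x - h x) < e / 2" using lim e2 by (rule order_tendstoD)
  then obtain n where n: "l2 T1 (\<lambda>x. f n x - h x) < e / 2" by (auto simp: eventually_sequentially)
  obtain \<phi> where \<phi>: "test_x \<phi>" "l2 T1 (\<lambda>x. \<phi> x - f n x) < e / 2" using f[of n] e2 unfolding L2_approx_def by blast
  have sf: "sq_integrable T1 (f n)" using f by (simp add: L2_approx_def)
  have "l2 T1 (\<lambda>x. (\<phi> x - f n x) + (f n x - h x)) \<le> l2 T1 (\<lambda>x. \<phi> x - f n x) + l2 T1 (\<lambda>x. f n x - h x)"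
    by (intro l2_triangle sq_integrable_diff s sf test_xD(7) \<phi>)
  then have "l2 T1 (\<lambda>x. \<phi> x - h x) < e" using \<phi> n by simp
  then show "\<exists>\<phi>. test_x \<phi> \<and> l2 T1 (\<lambda>x. \<phi> x - h x) < e" using \<phi>(1) by blast
qed

lemma l2_T1_dominated:
  assumes "\<And>n. f n \<in> borel_measurable T1" "h \<in> borel_measurable T1" "sq_integrable T1 w"
    and "AE x in T1. (\<lambda>n. f n x) \<longlonglongrightarrow> h x" and "\<And>n. AE x in T1. \<bar>f n x - h x\<bar> \<le> \<bar>w x\<bar>"
  shows "(\<lambda>n. l2 T1 (\<lambda>x. f n x - h x)) \<longlonglongrightarrow> 0"
proof -
  have "(\<lambda>n. \<integral>x. (f n x - h x)\<^sup>2 \<partial>T1) \<longlonglongrightarrow> (\<integral>x. 0 \<partial>T1)"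
  proof (rule integral_dominated_convergence[where w="\<lambda>x. (w x)\<^sup>2"])
    show "AE x in T1. (\<lambda>n. (f n x - h x)\<^sup>2) \<longlonglongrightarrow> 0"
      using assms(4)
    proof eventually_elim
      case (elim x)
      then have "(\<lambda>n. (f n x - h x)\<^sup>2) \<longlonglongrightarrow> (h x - h x)\<^sup>2" by (intro tendsto_intros)
      then show ?case by simp
    qed
    show "AE x in T1. norm ((f n x - h x)\<^sup>2) \<le> (w x)\<^sup>2" for n
      using assms(5)[of n] by eventually_elim (auto simp: abs_le_square_iff)
  qed (use assms in \<open>auto simp: sq_integrable_def\<close>)
  then show ?thesis unfolding l2_def using tendsto_real_sqrt by fastforce
qed

lemma sq_integrable_indicator_T1: "A \<in> sets borel \<Longrightarrow> sq_integrable T1 (indicator A)"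
  by (rule T1.sq_integrable_bounded[where C=1]) (auto simp: indicator_T1_measurable indicator_def)

lemma L2_approx_indicator: "A \<in> sets borel \<Longrightarrow> L2_approx (indicator A)"
proof (induction rule: borel_set_induct_lessThan)
  case (lessThan a)
  obtain \<phi> :: "nat \<Rightarrow> real \<Rightarrow> real" where \<phi>: "\<And>n. test_x (\<phi> n)" "\<And>n x. 0 \<le> \<phi> n x" "\<And>n x. \<phi> n x \<le> 1"
    "\<And>x. x \<in> {0..1} \<Longrightarrow> x \<noteq> 0 \<Longrightarrow> x \<noteq> 1 \<Longrightarrow> (\<lambda>n. \<phi> n x) \<longlonglongrightarrow> indicator {..<a} x"
    using test_x_tendsto_interval[of a] by blast
  have ap: "L2_approx (\<phi> n)" for n unfolding L2_approx_def using \<phi>(1)[of n] test_xD(7)[OF \<phi>(1)[of n]]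
    by (auto intro!: exI[of _ "\<phi> n"] simp: l2_def)
  show ?case
  proof (rule L2_approx_limit[OF _ ap])
    show "(\<lambda>n. l2 T1 (\<lambda>x. \<phi> n x - indicator {..<a} x)) \<longlonglongrightarrow> 0"
    proof (rule l2_T1_dominated[where w="\<lambda>_. 1"])
      show "AE x in T1. (\<lambda>n. \<phi> n x) \<longlonglongrightarrow> indicator {..<a} x"
        using AE_T1_interior by eventually_elim (auto intro!: \<phi>(4))
      show "AE x in T1. \<bar>\<phi> n x - indicator {..<a} x\<bar> \<le> \<bar>1\<bar>" for n
        using \<phi>(2,3)[of n] by (intro AE_I2) (auto simp: indicator_def)
    qed (auto intro: test_xD \<phi> indicator_T1_measurable T1.sq_integrable_const)
  qed (simp add: sq_integrable_indicator_T1)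
next
  case empty then show ?case using L2_approx_const[of 0] by (simp add: indicator_def)
next
  case (compl A)
  have "(\<lambda>x. 1 + -1 * indicator A x) = (indicator (- A) :: real \<Rightarrow> real)"
    by (auto simp: indicator_def)
  then show ?case using L2_approx_add[OF L2_approx_const[of 1] L2_approx_cmult[OF compl(2), of "-1"]] by simp
next
  case (union A)
  have "L2_approx (indicator (\<Union>i<n. A i))" for n :: nat
  proof -
    have "indicator (\<Union>i<n. A i) = (\<lambda>x. \<Sum>i<n. indicator (A i) x :: real)"
      by (rule ext, rule indicator_UN_disjoint) (use union(1) in \<open>auto simp: disjoint_family_on_def\<close>)
    moreover have "L2_approx (\<lambda>x. \<Sum>i<n. indicator (A i) x)"
      by (induction n) (auto intro: L2_approx_const L2_approx_add union)
    ultimately show ?thesis by simp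
  qed
  then show ?case
  proof (rule L2_approx_limit[rotated])
    show "(\<lambda>n. l2 T1 (\<lambda>x. indicator (\<Union>i<n. A i) x - indicator (\<Union>i. A i) x)) \<longlonglongrightarrow> 0"
    proof (rule l2_T1_dominated[where w="\<lambda>_. 1"])
      show "AE x in T1. (\<lambda>n. indicator (\<Union>i<n. A i) x :: real) \<longlonglongrightarrow> indicator (\<Union>i. A i) x"
        by (intro AE_I2 LIMSEQ_indicator_UN)
      show "AE x in T1. \<bar>indicator (\<Union>i<n. A i) x - indicator (\<Union>i. A i) x\<bar> \<le> \<bar>1::real\<bar>" for n :: nat
        by (intro AE_I2) (auto simp: indicator_def)
    qed (use union in \<open>auto intro!: indicator_T1_measurable T1.sq_integrable_const\<close>)
  qed (use union in \<open>auto intro!: sq_integrable_indicator_T1\<close>)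
qed

lemma sq_integrable_imp_L2_approx:
  assumes h: "sq_integrable T1 h" shows "L2_approx h"
proof -
  have hm: "h \<in> borel_measurable T1" using h by (simp add: sq_integrable_def)
  obtain s where s: "\<And>i. simple_function T1 (s i)" "\<And>x. x \<in> space T1 \<Longrightarrow> (\<lambda>i. s i x) \<longlonglongrightarrow> h x"
    "\<And>i x. x \<in> space T1 \<Longrightarrow> dist (s i x) 0 \<le> 2 * dist (h x) 0"
    using borel_measurable_implies_sequence_metric[OF hm, of 0] by blast
  have sm: "s i \<in> borel_measurable T1" for i using s(1) by (rule borel_measurable_simple_function)
  define f where "f i x = (\<Sum>y\<in>s i ` space T1. y * indicator (s i -` {y} \<inter> space T1) x)" for i x
  have ap: "L2_approx (f i)" for i
    unfolding f_def
  proof (rule L2_approx_sum)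
    fix y assume "y \<in> s i ` space T1"
    then have "s i -` {y} \<inter> space T1 \<in> sets T1" using s(1)[of i] by (auto simp: simple_function_def)
    then obtain A where "A \<in> sets lborel" "s i -` {y} \<inter> space T1 = {0..1} \<inter> A"
      unfolding sets_restrict_space by blast
    then have "s i -` {y} \<inter> space T1 \<in> sets borel" by simp
    then show "L2_approx (\<lambda>x. y * indicator (s i -` {y} \<inter> space T1) x)" by (rule L2_approx_cmult[OF L2_approx_indicator])
  qed
  have fs: "f i x = s i x" if "x \<in> space T1" for i x
  proof -
    have fin: "finite (s i ` space T1)" using s(1)[of i] by (simp add: simple_function_def)
    have "f i x = (\<Sum>y\<in>s i ` space T1. if y = s i x then y else 0)"
      unfolding f_def by (intro sum.cong) (use that in \<open>auto simp: indicator_def\<close>)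
    also have "\<dots> = s i x" using that fin by simp
    finally show ?thesis .
  qed
  show ?thesis
  proof (rule L2_approx_limit[OF h ap])
    show "(\<lambda>n. l2 T1 (\<lambda>x. f n x - h x)) \<longlonglongrightarrow> 0"
    proof (rule l2_T1_dominated[where w="\<lambda>x. 3 * h x"])
      show "AE x in T1. (\<lambda>n. f n x) \<longlonglongrightarrow> h x" by (rule AE_I2) (use fs s(2) in simp)
      show "AE x in T1. \<bar>f n x - h x\<bar> \<le> \<bar>3 * h x\<bar>" for n
      proof (rule AE_I2)
        fix x assume x: "x \<in> space T1"
        show "\<bar>f n x - h x\<bar> \<le> \<bar>3 * h x\<bar>" using s(3)[OF x, of n] fs[OF x, of n] by simp
      qed
    next
      show "f n \<in> borel_measurable T1" for n using ap[of n] by (simp add: L2_approx_def sq_integrable_measurable)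
      show "h \<in> borel_measurable T1" by (rule hm)
      show "sq_integrable T1 (\<lambda>x. 3 * h x)" by (rule sq_integrable_cmult[OF h])
    qed
  qed
qed

lemma Ulim_T1_continuous:
  fixes A :: "real \<Rightarrow> real"
  assumes u: "uniform_limit {0..1} a A F" and A: "continuous_on {0..1} A"
    and a: "\<forall>\<^sub>F t in F. continuous_on {0..1} (a t)"
  shows "Ulim T1 a A F"
  unfolding Ulim_def
proof (intro conjI)
  show "bounded (A ` space T1)"
    unfolding space_T1 by (intro compact_imp_bounded compact_continuous_image A compact_Icc)
  show "\<forall>\<^sub>F t in F. a t \<in> borel_measurable T1"
    using a by eventually_elim (rule measurable_T1_continuous)
  show "A \<in> borel_measurable T1" by (rule measurable_T1_continuous[OF A])
  show "uniform_limit (space T1) a A F" using u by simp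
qed

definition prim :: "(real \<Rightarrow> real) \<Rightarrow> real \<Rightarrow> real" where
  "prim h x = (\<integral>y. indicator {0..x} y * h y \<partial>T1)"

text \<open>\<open>wd g h\<close> says that \<open>g\<close> is the continuous representative of a function in \<open>H\<^sup>1\<close> of the torus with
  derivative \<open>h\<close>.  The fundamental theorem of calculus serves as the definition because pointwise
  bounds and the rules of calculus follow from it directly; \<open>weak_deriv_imp_wd\<close> connects it
  with derivatives in the sense of distributions.\<close>

definition wd :: "(real \<Rightarrow> real) \<Rightarrow> (real \<Rightarrow> real) \<Rightarrow> bool" where
  "wd g h \<longleftrightarrow> continuous_on UNIV g \<and> periodic1 g \<and> sq_integrable T1 h \<and> (\<forall>x\<in>{0..1}. g x - g 0 = prim h x)"

lemma wdD:
  assumes "wd g h"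
  shows "continuous_on A g" "g (x + 1) = g x" "g 1 = g 0" "sq_integrable T1 h" "sq_integrable T1 g" "h \<in> borel_measurable T1"
    "g \<in> borel_measurable T1" "y \<in> {0..1} \<Longrightarrow> g y = g 0 + prim h y"
proof -
  have c: "continuous_on A g" for A using assms continuous_on_subset[of UNIV g A] by (simp add: wd_def)
  show "continuous_on A g" by (rule c)
  show "sq_integrable T1 g" by (rule sq_integrable_T1_continuous[OF c])
  show "g \<in> borel_measurable T1" by (rule measurable_T1_continuous[OF c])
  show p: "g (x + 1) = g x" for x using assms by (simp add: wd_def periodic1_def)
  show "g 1 = g 0" using p[of 0] by simp
  show "sq_integrable T1 h" "h \<in> borel_measurable T1" using assms by (simp_all add: wd_def sq_integrable_def)
  show "g y = g 0 + prim h y" if "y \<in> {0..1}"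
  proof -
    have "g y - g 0 = prim h y" using assms that unfolding wd_def by blast
    then show ?thesis by simp
  qed
qed

lemma integrable_T1_indicator_mult:
  fixes h :: "real \<Rightarrow> real"
  assumes "integrable T1 h" "A \<in> sets borel"
  shows "integrable T1 (\<lambda>y. indicator A y * h y)"
proof -
  have "(\<lambda>y. indicator A y * h y) \<in> borel_measurable T1"
    by (rule borel_measurable_times[OF indicator_T1_measurable[OF assms(2)]]) (use assms in simp)
  then show ?thesis
    by (intro Bochner_Integration.integrable_bound[OF assms(1)]) (auto simp: abs_mult indicator_def)
qed

lemma abs_integral_indicator_le:
  fixes h :: "real \<Rightarrow> real"
  assumes "integrable T1 h" "A \<in> sets borel"
  shows "\<bar>\<integral>y. indicator A y * h y \<partial>T1\<bar> \<le> (\<integral>y. \<bar>h y\<bar> \<partial>T1)"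
proof -
  have "\<bar>\<integral>y. indicator A y * h y \<partial>T1\<bar> \<le> (\<integral>y. \<bar>indicator A y * h y\<bar> \<partial>T1)" by (rule integral_abs_bound)
  also have "\<dots> \<le> (\<integral>y. \<bar>h y\<bar> \<partial>T1)"
    using integrable_abs[OF integrable_T1_indicator_mult[OF assms]] integrable_abs[OF assms(1)]
    by (rule integral_mono) (auto simp: abs_mult indicator_def)
  finally show ?thesis .
qed

lemma abs_prim_le: "integrable T1 h \<Longrightarrow> \<bar>prim h x\<bar> \<le> (\<integral>y. \<bar>h y\<bar> \<partial>T1)"
  unfolding prim_def by (rule abs_integral_indicator_le) auto

lemma prim_1: "prim h 1 = integral\<^sup>L T1 h"
  unfolding prim_def by (intro Bochner_Integration.integral_cong) auto

lemma prim_0: "integrable T1 h \<Longrightarrow> prim h 0 = 0"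
proof -
  assume h: "integrable T1 h"
  have "prim h 0 = (\<integral>y. 0 \<partial>T1)"
    unfolding prim_def
  proof (rule integral_cong_AE)
    show "AE y in T1. indicator {0..0} y * h y = 0"
      using AE_T1_interior by eventually_elim (auto simp: indicator_def)
    show "(\<lambda>y. indicator {0..0} y * h y) \<in> borel_measurable T1"
      using integrable_T1_indicator_mult[OF h, of "{0..0}"] by simp
  qed simp
  then show ?thesis by simp
qed

lemma prim_diff:
  assumes "integrable T1 h" "integrable T1 k"
  shows "prim (\<lambda>x. h x - k x) x = prim h x - prim k x"
  unfolding prim_def right_diff_distrib
  by (rule Bochner_Integration.integral_diff) (auto intro: integrable_T1_indicator_mult assms)

lemma prim_add:
  assumes "integrable T1 h" "integrable T1 k"
  shows "prim (\<lambda>x. h x + k x) x = prim h x + prim k x"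
  unfolding prim_def distrib_left
  by (rule Bochner_Integration.integral_add) (auto intro: integrable_T1_indicator_mult assms)

lemma prim_cmult: "prim (\<lambda>x. c * h x) x = c * prim h x"
  unfolding prim_def by (simp add: mult.left_commute)

lemma prim_limit:
  assumes "L1lim T1 h k F"
  shows "((\<lambda>t. prim (h t) x) \<longlongrightarrow> prim k x) F"
proof -
  have "Ulim T1 (\<lambda>_. indicator {0..x}) (indicator {0..x} :: real \<Rightarrow> real) F"
    by (rule Ulim_const[where C=1]) (auto intro: indicator_T1_measurable simp: indicator_def)
  from L1lim_integral[OF L1lim_Ulim_mult[OF this assms]] show ?thesis by (simp add: prim_def)
qed

lemma prim_FTC:
  assumes "\<And>x. x \<in> {0..1} \<Longrightarrow> (g has_real_derivative h x) (at x)" "continuous_on {0..1} h" and x: "x \<in> {0..1}"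
  shows "g x - g 0 = prim h x"
proof -
  have "has_bochner_integral lborel (\<lambda>y. indicator {0..x} y *\<^sub>R h y) (g x - g 0)"
  proof (rule has_bochner_integral_FTC_Icc)
    fix y assume y: "0 \<le> y" "y \<le> x"
    then show "(g has_vector_derivative h y) (at y within {0..x})"
      using assms(1)[of y] x by (auto simp: has_real_derivative_iff_has_vector_derivative intro: has_vector_derivative_at_within)
  next
    show "continuous_on {0..x} h" using continuous_on_subset[OF assms(2)] x by auto
  qed (use x in auto)
  then have "g x - g 0 = (\<integral>y. indicator {0..x} y * h y \<partial>lborel)"
    using has_bochner_integral_integral_eq by force
  also have "\<dots> = (\<integral>y. indicator {0..1} y * (indicator {0..x} y * h y) \<partial>lborel)"
    by (intro Bochner_Integration.integral_cong) (use x in \<open>auto simp: indicator_def\<close>)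
  also have "\<dots> = prim h x" by (simp add: prim_def integral_T1 set_lebesgue_integral_def)
  finally show ?thesis .
qed

lemma wd_C1:
  assumes "\<And>x. (g has_real_derivative h x) (at x)" "continuous_on UNIV h" "periodic1 g"
  shows "wd g h"
proof -
  have c: "continuous_on UNIV g"
    using assms(1) by (auto simp: continuous_on_eq_continuous_at intro: DERIV_isCont)
  have h: "continuous_on {0..1} h" by (rule continuous_on_subset[OF assms(2)]) simp
  show ?thesis unfolding wd_def
    using c assms(3) prim_FTC[OF assms(1) h] sq_integrable_T1_continuous[OF h] by auto
qed

lemma wd_test_x: "test_x \<phi> \<Longrightarrow> wd \<phi> (deriv \<phi>)"
  by (intro wd_C1 test_xD) (simp_all add: test_x_def)

lemma periodic_antiderivative:
  assumes k: "continuous_on UNIV k" and per: "\<And>x. k (x + 1) = k x" and 0: "integral\<^sup>L T1 k = 0"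
  obtains G where "\<And>x. (G has_real_derivative k x) (at x)" "periodic1 G" "G 0 = c"
proof -
  obtain H where H: "\<And>x. (H has_real_derivative k x) (at x)"
    using continuous_has_antiderivative[OF k] by blast
  define G where "G x = H x + (c - H 0)" for x
  have G: "(G has_real_derivative k x) (at x)" for x
    unfolding G_def using H by (auto intro!: derivative_eq_intros)
  have "((\<lambda>x. G (x + 1) - G x) has_real_derivative 0) (at x)" for x
    using DERIV_diff[OF DERIV_shift[THEN iffD1, OF G[of "x + 1"]] G[of x]] per by simp
  then have "G (x + 1) - G x = G (0 + 1) - G 0" for x
    using DERIV_isconst_all[of "\<lambda>x. G (x + 1) - G x" x 0] by simp
  moreover have "G 1 - G 0 = 0"
    using prim_FTC[OF G, of 1] continuous_on_subset[OF k] 0 by (simp add: prim_1)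
  ultimately have "periodic1 G" by (simp add: periodic1_def)
  with G show ?thesis by (rule that) (simp add: G_def)
qed

lemma wd_integral_0: "wd g h \<Longrightarrow> integral\<^sup>L T1 h = 0"
  using wdD(8)[of g h 1] wdD(3)[of g h] by (simp add: prim_1)

text \<open>Density in the energy norm: approximate the derivative in \<open>L\<^sup>2\<close>, correct its mean,
  and integrate.\<close>

lemma wd_approx:
  assumes g: "wd g h" and e: "e > 0"
  obtains \<phi> where "test_x \<phi>" "\<And>x. x \<in> {0..1} \<Longrightarrow> \<bar>\<phi> x - g x\<bar> \<le> e" "l2 T1 (\<lambda>x. deriv \<phi> x - h x) \<le> e"
proof -
  have h: "sq_integrable T1 h" using wdD(4)[OF g] .
  have ih: "integrable T1 h" using T1.sq_integrable_integrable[OF h] .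
  obtain \<psi> where \<psi>: "test_x \<psi>" "l2 T1 (\<lambda>x. \<psi> x - h x) < e / 2"
    using sq_integrable_imp_L2_approx[OF h] e unfolding L2_approx_def by (meson half_gt_zero)
  have s\<psi>: "sq_integrable T1 \<psi>" using test_xD(7)[OF \<psi>(1)] .
  have i\<psi>: "integrable T1 \<psi>" using T1.sq_integrable_integrable[OF s\<psi>] .
  define m where "m = integral\<^sup>L T1 \<psi>"
  have "m = (\<integral>x. \<psi> x - h x \<partial>T1)" unfolding m_def using wd_integral_0[OF g] i\<psi> ih by simp
  then have m: "\<bar>m\<bar> < e / 2" using abs_integral_T1_le_l2[OF sq_integrable_diff[OF s\<psi> h]] \<psi>(2) by simp
  define k where "k x = \<psi> x + - m" for x
  have k: "test_x k" unfolding k_def by (intro test_x_add \<psi> test_x_const)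
  have sk: "sq_integrable T1 k" using test_xD(7)[OF k] .
  have ik: "integrable T1 k" using T1.sq_integrable_integrable[OF sk] .
  have "integral\<^sup>L T1 k = 0" unfolding k_def using i\<psi> by (simp add: m_def T1.prob_space)
  then obtain G where G: "\<And>x. (G has_real_derivative k x) (at x)" "periodic1 G" "G 0 = g 0"
    using periodic_antiderivative[OF test_xD(2)[OF k] test_xD(4)[OF k]] by blast
  have "l2 T1 (\<lambda>x. k x - h x) = l2 T1 (\<lambda>x. (\<psi> x - h x) + - m)" by (simp add: k_def algebra_simps)
  also have "\<dots> \<le> l2 T1 (\<lambda>x. \<psi> x - h x) + l2 T1 (\<lambda>_. - m)"
    by (intro l2_triangle sq_integrable_diff s\<psi> h T1.sq_integrable_const)
  also have "\<dots> < e" using m \<psi>(2) by (simp add: l2_def T1.prob_space)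
  finally have kh: "l2 T1 (\<lambda>x. k x - h x) < e" .
  have G': "deriv G = k" using G(1) by (auto intro: DERIV_imp_deriv)
  show ?thesis
  proof (rule that[of G])
    have "smooth k" using k by (simp add: test_x_def)
    from smooth_real_derivI[OF G(1) this] G(2) show "test_x G" by (simp add: test_x_def)
    show "l2 T1 (\<lambda>x. deriv G x - h x) \<le> e" using kh G' by simp
    fix x :: real assume x: "x \<in> {0..1}"
    have "G x - G 0 = prim k x"
      by (rule prim_FTC[OF G(1)]) (use x test_xD(2)[OF k] in auto)
    then have "G x - g x = prim (\<lambda>x. k x - h x) x"
      using wdD(8)[OF g x] G(3) prim_diff[OF ik ih] by simp
    then have "\<bar>G x - g x\<bar> \<le> (\<integral>y. \<bar>k y - h y\<bar> \<partial>T1)" using abs_prim_le[of "\<lambda>x. k x - h x"] ik ih by simp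
    also have "\<dots> \<le> l2 T1 (\<lambda>x. k x - h x)" by (rule integral_abs_T1_le_l2[OF sq_integrable_diff[OF sk h]])
    finally show "\<bar>G x - g x\<bar> \<le> e" using kh by simp
  qed
qed

lemma wd_approx_seq:
  assumes g: "wd g h"
  obtains \<phi> :: "nat \<Rightarrow> real \<Rightarrow> real" where "\<And>n. test_x (\<phi> n)" "Ulim T1 \<phi> g sequentially"
    "L2lim T1 (\<lambda>n. deriv (\<phi> n)) h sequentially"
proof -
  have "\<exists>\<phi>. test_x \<phi> \<and> (\<forall>x\<in>{0..1}. \<bar>\<phi> x - g x\<bar> \<le> inverse (real (Suc n))) \<and>
      l2 T1 (\<lambda>x. deriv \<phi> x - h x) \<le> inverse (real (Suc n))" for n
  proof -
    have "inverse (real (Suc n)) > 0" by simp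
    from wd_approx[OF g this] obtain \<phi> where "test_x \<phi>"
        "\<And>x. x \<in> {0..1} \<Longrightarrow> \<bar>\<phi> x - g x\<bar> \<le> inverse (real (Suc n))"
        "l2 T1 (\<lambda>x. deriv \<phi> x - h x) \<le> inverse (real (Suc n))" by blast
    then show ?thesis by (intro exI[of _ \<phi>]) simp
  qed
  then obtain \<phi> where \<phi>: "\<And>n. test_x (\<phi> n)" "\<And>n x. x \<in> {0..1} \<Longrightarrow> \<bar>\<phi> n x - g x\<bar> \<le> inverse (real (Suc n))"
    "\<And>n. l2 T1 (\<lambda>x. deriv (\<phi> n) x - h x) \<le> inverse (real (Suc n))" by metis
  show ?thesis
  proof (rule that[OF \<phi>(1)])
    have "uniform_limit {0..1} \<phi> g sequentially"
    proof (rule uniform_limitI)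
      fix e :: real assume "e > 0"
      then have "\<forall>\<^sub>F n in sequentially. inverse (real (Suc n)) < e"
        using LIMSEQ_inverse_real_of_nat by (intro order_tendstoD(2)) auto
      then show "\<forall>\<^sub>F n in sequentially. \<forall>x\<in>{0..1}. dist (\<phi> n x) (g x) < e"
      proof eventually_elim
        case (elim n)
        show ?case
        proof
          fix x :: real assume "x \<in> {0..1}"
          from \<phi>(2)[OF this, of n] elim show "dist (\<phi> n x) (g x) < e" by (simp add: dist_real_def)
        qed
      qed
    qed
    then show "Ulim T1 \<phi> g sequentially"
      by (rule Ulim_T1_continuous[OF _ wdD(1)[OF g]]) (simp add: test_xD(2)[OF \<phi>(1)])
    show "L2lim T1 (\<lambda>n. deriv (\<phi> n)) h sequentially"
      unfolding L2lim_def
    proof (intro conjI)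
      show "(\<lambda>t. l2 T1 (\<lambda>x. deriv (\<phi> t) x - h x)) \<longlonglongrightarrow> 0"
        by (rule tendsto_0_le_real[OF LIMSEQ_inverse_real_of_nat]) (use \<phi>(3) in auto)
    qed (use wdD(4)[OF g] test_xD(8)[OF \<phi>(1)] in auto)
  qed
qed

lemma wd_const: "wd (\<lambda>_. c) (\<lambda>_. 0)"
  using wd_test_x[OF test_x_const[of c]] by (simp add: deriv_const[unfolded fun_eq_iff])

lemma wd_add: "wd f f' \<Longrightarrow> wd g g' \<Longrightarrow> wd (\<lambda>x. f x + g x) (\<lambda>x. f' x + g' x)"
proof -
  assume f: "wd f f'" and g: "wd g g'"
  have "f x + g x - (f 0 + g 0) = prim (\<lambda>x. f' x + g' x) x" if "x \<in> {0..1}" for x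
    using wdD(8)[OF f that] wdD(8)[OF g that]
      prim_add[OF T1.sq_integrable_integrable[OF wdD(4)[OF f]] T1.sq_integrable_integrable[OF wdD(4)[OF g]]] by simp
  then show ?thesis
    unfolding wd_def using sq_integrable_add[OF wdD(4)[OF f] wdD(4)[OF g]] wdD(2)[OF f] wdD(2)[OF g]
    by (auto simp: periodic1_def intro!: continuous_intros wdD(1)[OF f] wdD(1)[OF g])
qed

lemma wd_cmult: "wd f f' \<Longrightarrow> wd (\<lambda>x. c * f x) (\<lambda>x. c * f' x)"
proof -
  assume f: "wd f f'"
  have "c * f x - c * f 0 = prim (\<lambda>x. c * f' x) x" if "x \<in> {0..1}" for x
    using wdD(8)[OF f that] by (simp add: prim_cmult algebra_simps)
  then show ?thesis
    unfolding wd_def using sq_integrable_cmult[OF wdD(4)[OF f]] wdD(2)[OF f]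
    by (auto simp: periodic1_def intro!: continuous_intros wdD(1)[OF f])
qed

lemma wd_diff: "wd f f' \<Longrightarrow> wd g g' \<Longrightarrow> wd (\<lambda>x. f x - g x) (\<lambda>x. f' x - g' x)"
  using wd_add[of f f' "\<lambda>x. -1 * g x" "\<lambda>x. -1 * g' x"] wd_cmult[of g g' "-1"] by simp

text \<open>Chain rule, by passing to the limit in the fundamental theorem of calculus for smooth
  approximations.\<close>

lemma wd_compose:
  assumes g: "wd g h" and c: "l < c" "\<And>x. x \<in> {0..1} \<Longrightarrow> c \<le> g x"
    and q: "\<And>y. l < y \<Longrightarrow> (q has_real_derivative q' y) (at y)" and q': "continuous_on {l<..} q'"
  shows "wd (\<lambda>x. q (g x)) (\<lambda>x. q' (g x) * h x)"
proof -
  have qc: "continuous_on {l<..} q" using q by (intro continuous_at_imp_continuous_on) (auto intro: DERIV_isCont)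
  obtain \<phi> where \<phi>: "\<And>n :: nat. test_x (\<phi> n)" "Ulim T1 \<phi> g sequentially"
      "L2lim T1 (\<lambda>n. deriv (\<phi> n)) h sequentially"
    using wd_approx_seq[OF g] by blast
  have c': "\<And>x. x \<in> space T1 \<Longrightarrow> c \<le> g x" using c(2) by simp
  have U: "Ulim T1 (\<lambda>n x. q (\<phi> n x)) (\<lambda>x. q (g x)) sequentially"
    by (rule Ulim_compose[OF \<phi>(2) qc c(1) c'])
  have U': "Ulim T1 (\<lambda>n x. q' (\<phi> n x)) (\<lambda>x. q' (g x)) sequentially"
    by (rule Ulim_compose[OF \<phi>(2) q' c(1) c'])
  have L: "L2lim T1 (\<lambda>n x. q' (\<phi> n x) * deriv (\<phi> n) x) (\<lambda>x. q' (g x) * h x) sequentially"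
    by (rule L2lim_Ulim_mult[OF U' \<phi>(3)])
  have gl: "l < g x" for x
  proof -
    define y where "y = x - of_int \<lfloor>x\<rfloor>"
    have p: "g (y + real n) = g y" for n
      by (induction n) (use wdD(2)[OF g] in \<open>auto simp: add.assoc[symmetric] add.commute[of 1]\<close>)
    have p2: "g (y - real n) = g y" for n
    proof (induction n)
      case (Suc n)
      have "g (y - real (Suc n) + 1) = g (y - real (Suc n))" by (rule wdD(2)[OF g])
      then show ?case using Suc by (simp add: algebra_simps)
    qed simp
    have "g x = g y"
    proof (cases "\<lfloor>x\<rfloor> \<ge> 0")
      case True then show ?thesis using p[of "nat \<lfloor>x\<rfloor>"] by (simp add: y_def)
    next
      case False then show ?thesis using p2[of "nat (- \<lfloor>x\<rfloor>)"] by (simp add: y_def)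
    qed
    moreover have "y \<in> {0..1}" unfolding y_def by (simp add: le_less floor_correct) linarith
    ultimately show ?thesis using c(1) c(2)[of y] by simp
  qed
  show ?thesis unfolding wd_def
  proof (intro conjI ballI)
    show "continuous_on UNIV (\<lambda>x. q (g x))"
      by (rule continuous_on_compose2[OF qc wdD(1)[OF g]]) (use gl in auto)
    show "periodic1 (\<lambda>x. q (g x))" using wdD(2)[OF g] by (simp add: periodic1_def)
    show "sq_integrable T1 (\<lambda>x. q' (g x) * h x)" using L by (simp add: L2lim_def)
    fix x :: real assume x: "x \<in> {0..1}"
    have "\<forall>\<^sub>F n in sequentially. \<forall>x\<in>space T1. dist (\<phi> n x) (g x) < c - l"
      using \<phi>(2) c(1) by (auto simp: Ulim_def intro: uniform_limitD)
    then have ev: "\<forall>\<^sub>F n in sequentially. q (\<phi> n x) - q (\<phi> n 0) = prim (\<lambda>x. q' (\<phi> n x) * deriv (\<phi> n) x) x"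
    proof eventually_elim
      case (elim n)
      have gt: "l < \<phi> n y" if "y \<in> {0..1}" for y
        using elim c(2)[OF that] that by (force simp: dist_real_def)
      show ?case
      proof (rule prim_FTC[OF _ _ x])
        show "((\<lambda>x. q (\<phi> n x)) has_real_derivative q' (\<phi> n y) * deriv (\<phi> n) y) (at y)" if "y \<in> {0..1}" for y
          by (rule DERIV_chain2[OF q[OF gt[OF that]] test_xD(1)[OF \<phi>(1)]])
        show "continuous_on {0..1} (\<lambda>x. q' (\<phi> n x) * deriv (\<phi> n) x)"
          by (intro continuous_on_mult continuous_on_compose2[OF q' test_xD(2)[OF \<phi>(1)]] test_xD(3)[OF \<phi>(1)])
             (use gt in auto)
      qed
    qed
    have pt: "(\<lambda>n. q (\<phi> n y)) \<longlonglongrightarrow> q (g y)" if "y \<in> {0..1}" for y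
      using U that by (auto simp: Ulim_def intro: tendsto_uniform_limitI)
    have "(\<lambda>n. q (\<phi> n x) - q (\<phi> n 0)) \<longlonglongrightarrow> q (g x) - q (g 0)"
      by (intro tendsto_diff pt x) simp
    moreover have "(\<lambda>n. prim (\<lambda>x. q' (\<phi> n x) * deriv (\<phi> n) x) x) \<longlonglongrightarrow> prim (\<lambda>x. q' (g x) * h x) x"
      by (rule prim_limit[OF T1.L2lim_imp_L1lim[OF L]])
    ultimately show "q (g x) - q (g 0) = prim (\<lambda>x. q' (g x) * h x) x"
      using LIMSEQ_unique Lim_transform_eventually[OF _ ev] by blast
  qed
qed

lemma wd_power2: assumes "wd g h" shows "wd (\<lambda>x. (g x)\<^sup>2) (\<lambda>x. 2 * g x * h x)"
proof -
  obtain C where C: "\<And>x. x \<in> {0..1} \<Longrightarrow> \<bar>g x\<bar> \<le> C" using continuous_bounded_T1[OF wdD(1)[OF assms]] by blast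
  show ?thesis
  proof (rule wd_compose[OF assms, of "- C - 1" "- C"])
    show "- C \<le> g x" if "x \<in> {0..1}" for x using C[OF that] by linarith
  qed (auto intro!: derivative_eq_intros continuous_intros)
qed

text \<open>Polarisation reduces the product rule to the chain rule for squares.\<close>

lemma wd_mult:
  assumes f: "wd f f'" and g: "wd g g'"
  shows "wd (\<lambda>x. f x * g x) (\<lambda>x. f' x * g x + f x * g' x)"
proof -
  have "wd (\<lambda>x. (1/4) * ((f x + g x)\<^sup>2 - (f x - g x)\<^sup>2))
     (\<lambda>x. (1/4) * (2 * (f x + g x) * (f' x + g' x) - 2 * (f x - g x) * (f' x - g' x)))"
    by (rule wd_cmult[OF wd_diff[OF wd_power2[OF wd_add[OF f g]] wd_power2[OF wd_diff[OF f g]]]])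
  moreover have "(\<lambda>x. (1/4) * ((f x + g x)\<^sup>2 - (f x - g x)\<^sup>2)) = (\<lambda>x. f x * g x)"
    by (simp add: power2_eq_square algebra_simps)
  moreover have "(\<lambda>x. (1/4) * (2 * (f x + g x) * (f' x + g' x) - 2 * (f x - g x) * (f' x - g' x)))
      = (\<lambda>x. f' x * g x + f x * g' x)"
    by (rule ext) (simp add: field_simps)
  ultimately show ?thesis by (simp only:)
qed

lemma wd_by_parts:
  assumes f: "wd f f'" and g: "wd g g'"
  shows "(\<integral>x. f' x * g x \<partial>T1) = - (\<integral>x. f x * g' x \<partial>T1)"
proof -
  have "(\<integral>x. f' x * g x + f x * g' x \<partial>T1) = 0" by (rule wd_integral_0[OF wd_mult[OF f g]])
  moreover have "(\<integral>x. f' x * g x + f x * g' x \<partial>T1) = (\<integral>x. f' x * g x \<partial>T1) + (\<integral>x. f x * g' x \<partial>T1)"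
    by (intro Bochner_Integration.integral_add sq_integrable_integrable_mult
        wdD(4)[OF f] wdD(4)[OF g] wdD(5)[OF f] wdD(5)[OF g])
  ultimately show ?thesis by simp
qed

text \<open>Poincare inequality: the oscillation of \<open>g\<close> is bounded by its total variation.\<close>

lemma wd_deviation_le:
  assumes g: "wd g h" and x: "x \<in> {0..1}"
  shows "\<bar>g x - (\<integral>y. g y \<partial>T1)\<bar> \<le> (\<integral>y. \<bar>h y\<bar> \<partial>T1)"
proof -
  have h: "integrable T1 h" using T1.sq_integrable_integrable[OF wdD(4)[OF g]] .
  have ig: "integrable T1 g" using T1.sq_integrable_integrable[OF wdD(5)[OF g]] .
  have *: "\<bar>g x - g y\<bar> \<le> (\<integral>y. \<bar>h y\<bar> \<partial>T1)" if "x \<in> {0..1}" "y \<in> {0..1}" "y \<le> x" for x y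
  proof -
    have "g x - g y = (\<integral>z. indicator {0..x} z * h z - indicator {0..y} z * h z \<partial>T1)"
      using wdD(8)[OF g that(1)] wdD(8)[OF g that(2)]
      by (simp add: prim_def integrable_T1_indicator_mult[OF h])
    also have "\<dots> = (\<integral>z. indicator {y<..x} z * h z \<partial>T1)"
      by (intro Bochner_Integration.integral_cong) (use that in \<open>auto simp: indicator_def\<close>)
    finally show ?thesis using abs_integral_indicator_le[OF h, of "{y<..x}"] by simp
  qed
  have **: "\<bar>g x - g y\<bar> \<le> (\<integral>y. \<bar>h y\<bar> \<partial>T1)" if "y \<in> {0..1}" for y
    using *[OF x that] *[OF that x] by (cases "y \<le> x") (auto simp: abs_minus_commute)
  have "g x - (\<integral>y. g y \<partial>T1) = (\<integral>y. g x - g y \<partial>T1)" using ig by (simp add: T1.prob_space)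
  also have "\<bar>\<dots>\<bar> \<le> (\<integral>y. \<bar>g x - g y\<bar> \<partial>T1)" by (rule integral_abs_bound)
  also have "\<dots> \<le> (\<integral>y. \<bar>h y\<bar> \<partial>T1)" by (rule integral_T1_le_sup) (use ** ig in auto)
  finally show ?thesis .
qed

lemma wd_deviation_le_l2:
  assumes "wd g h" "x \<in> {0..1}" shows "\<bar>g x - (\<integral>y. g y \<partial>T1)\<bar> \<le> l2 T1 h"
  using wd_deviation_le[OF assms] integral_abs_T1_le_l2[OF wdD(4)[OF assms(1)]] by simp

lemma wd_sup_le:
  assumes "wd g h" "x \<in> {0..1}" shows "\<bar>g x\<bar> \<le> l2 T1 g + l2 T1 h"
  using wd_deviation_le_l2[OF assms] abs_integral_T1_le_l2[OF wdD(5)[OF assms(1)]] by linarith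

section \<open>Weak derivatives\<close>

lemma weak_deriv_AE_unique:
  assumes "weak_deriv g h" "weak_deriv g k"
  shows "AE x in T1. h x = k x"
proof -
  have i: "integrable T1 h" "integrable T1 k" using assms by (auto simp: weak_deriv_def integrable_T1)
  have *: "integrable T1 (\<lambda>x. a x * \<phi> x)" if "integrable T1 a" "test_x \<phi>" for a \<phi>
    using L1lim_Ulim_mult[OF Ulim_T1_const[OF test_xD(2)[OF that(2)]] L1lim_const[OF that(1)], of sequentially]
    by (simp add: L1lim_def mult.commute)
  have "AE x in T1. h x - k x = 0"
  proof (rule T1_eq_0_if_orthogonal)
    fix \<phi> assume \<phi>: "test_x \<phi>"
    have "(\<integral>x. h x * \<phi> x \<partial>T1) = (\<integral>x. k x * \<phi> x \<partial>T1)"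
      using assms \<phi> by (simp add: weak_deriv_def integral_T1)
    then show "(\<integral>x. (h x - k x) * \<phi> x \<partial>T1) = 0"
      using *[OF i(1) \<phi>] *[OF i(2) \<phi>] by (simp add: left_diff_distrib)
  qed (use i in simp)
  then show ?thesis by simp
qed

text \<open>The identity is clear for smooth \<open>h\<close>, and both sides are continuous in \<open>h\<close> with respect to the
  \<open>L\<^sup>2\<close> norm.\<close>

lemma prim_by_parts:
  assumes h: "sq_integrable T1 h" "integral\<^sup>L T1 h = 0" and \<phi>: "test_x \<phi>"
  shows "(\<integral>x. prim h x * deriv \<phi> x \<partial>T1) = - (\<integral>x. h x * \<phi> x \<partial>T1)" "continuous_on {0..1} (prim h)"
proof -
  have ih: "integrable T1 h" using T1.sq_integrable_integrable[OF h(1)] .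
  have "\<exists>\<psi>. test_x \<psi> \<and> l2 T1 (\<lambda>x. \<psi> x - h x) < inverse (real (Suc n))" for n
    using sq_integrable_imp_L2_approx[OF h(1)] by (simp add: L2_approx_def)
  then obtain \<psi> where \<psi>: "\<And>n. test_x (\<psi> n)" "\<And>n. l2 T1 (\<lambda>x. \<psi> n x - h x) < inverse (real (Suc n))" by metis
  have L0: "L2lim T1 \<psi> h sequentially"
    unfolding L2lim_def
  proof (intro conjI)
    show "(\<lambda>t. l2 T1 (\<lambda>x. \<psi> t x - h x)) \<longlonglongrightarrow> 0"
      by (rule tendsto_0_le_real[OF LIMSEQ_inverse_real_of_nat]) (use \<psi>(2) in \<open>auto simp: less_imp_le\<close>)
  qed (use h test_xD(7)[OF \<psi>(1)] in auto)
  define m where "m n = integral\<^sup>L T1 (\<psi> n)" for n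
  have "m \<longlonglongrightarrow> 0"
    using L1lim_integral[OF T1.L2lim_imp_L1lim[OF L0]] h(2) by (simp add: m_def[abs_def])
  have Um: "Ulim T1 (\<lambda>n _. m n) (\<lambda>_. 0) sequentially"
    unfolding Ulim_def
  proof (intro conjI)
    show "uniform_limit (space T1) (\<lambda>n _. m n) (\<lambda>_. 0) sequentially"
      using \<open>m \<longlonglongrightarrow> 0\<close> by (auto simp: uniform_limit_iff tendsto_iff)
    show "bounded ((\<lambda>_. 0 :: real) ` space T1)" by (auto simp: bounded_iff)
  qed auto
  have L: "L2lim T1 (\<lambda>n x. \<psi> n x - m n) h sequentially"
    using L2lim_diff[OF L0 T1.Ulim_imp_L2lim[OF Um]] by simp
  have "\<exists>G. (\<forall>x. (G has_real_derivative \<psi> n x - m n) (at x)) \<and> periodic1 G \<and> G 0 = 0" for n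
  proof -
    have c: "continuous_on UNIV (\<lambda>x. \<psi> n x - m n)" by (intro continuous_intros test_xD(2)[OF \<psi>(1)])
    have p: "\<psi> n (x + 1) - m n = \<psi> n x - m n" for x by (simp add: test_xD(4)[OF \<psi>(1)])
    have "(\<integral>x. \<psi> n x - m n \<partial>T1) = 0"
      using T1.sq_integrable_integrable[OF test_xD(7)[OF \<psi>(1)]] by (simp add: m_def)
    from periodic_antiderivative[OF c p this, of 0] show ?thesis by metis
  qed
  then obtain G where G: "\<And>n x. (G n has_real_derivative \<psi> n x - m n) (at x)" "\<And>n. periodic1 (G n)" "\<And>n. G n 0 = 0"
    by metis
  have w: "wd (G n) (\<lambda>x. \<psi> n x - m n)" for n
    by (rule wd_C1[OF G(1) _ G(2)]) (intro continuous_intros test_xD(2)[OF \<psi>(1)])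
  have close: "\<bar>G n x - prim h x\<bar> \<le> l2 T1 (\<lambda>x. (\<psi> n x - m n) - h x)" if "x \<in> {0..1}" for n x
  proof -
    note s = wdD(4)[OF w[of n]]
    have "G n x - prim h x = prim (\<lambda>x. (\<psi> n x - m n) - h x) x"
      using wdD(8)[OF w that] G(3) prim_diff[OF T1.sq_integrable_integrable[OF s] ih] by simp
    then show ?thesis
      using abs_prim_le[OF T1.sq_integrable_integrable[OF sq_integrable_diff[OF s h(1)]], of x]
        integral_abs_T1_le_l2[OF sq_integrable_diff[OF s h(1)]] by linarith
  qed
  have UG: "uniform_limit {0..1} G (prim h) sequentially"
  proof (rule uniform_limitI)
    fix e :: real assume "e > 0"
    then have "\<forall>\<^sub>F n in sequentially. l2 T1 (\<lambda>x. (\<psi> n x - m n) - h x) < e"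
      using L by (intro order_tendstoD(2)[of _ 0]) (auto simp: L2lim_def)
    then show "\<forall>\<^sub>F n in sequentially. \<forall>x\<in>{0..1}. dist (G n x) (prim h x) < e"
    proof eventually_elim
      case (elim n)
      show ?case
      proof
        fix x :: real assume "x \<in> {0..1}"
        from close[OF this, of n] elim show "dist (G n x) (prim h x) < e" by (simp add: dist_real_def)
      qed
    qed
  qed
  show cont: "continuous_on {0..1} (prim h)"
    by (rule uniform_limit_theorem[OF _ UG]) (simp_all add: wdD(1)[OF w])
  have U: "Ulim T1 G (prim h) sequentially"
    by (rule Ulim_T1_continuous[OF UG cont]) (simp add: wdD(1)[OF w])
  have "(\<lambda>n. \<integral>x. G n x * deriv \<phi> x \<partial>T1) \<longlonglongrightarrow> (\<integral>x. prim h x * deriv \<phi> x \<partial>T1)"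
    by (intro L1lim_integral T1.L2lim_imp_L1lim L2lim_Ulim_mult[OF U] L2lim_const test_xD(8) \<phi>)
  moreover have "(\<lambda>n. - (\<integral>x. (\<psi> n x - m n) * \<phi> x \<partial>T1)) \<longlonglongrightarrow> - (\<integral>x. h x * \<phi> x \<partial>T1)"
    by (intro tendsto_minus L1lim_integral L1lim_L2lim_mult[OF L] L2lim_const test_xD(7) \<phi>)
  moreover have "(\<integral>x. G n x * deriv \<phi> x \<partial>T1) = - (\<integral>x. (\<psi> n x - m n) * \<phi> x \<partial>T1)" for n
    using wd_by_parts[OF w wd_test_x[OF \<phi>], of n] by simp
  ultimately show "(\<integral>x. prim h x * deriv \<phi> x \<partial>T1) = - (\<integral>x. h x * \<phi> x \<partial>T1)"
    using LIMSEQ_unique by simp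
qed

text \<open>The difference of \<open>g\<close> and the primitive of \<open>h\<close> is orthogonal to the derivatives of all test
  functions, that is, to all test functions of mean zero.  Hence it is constant almost everywhere
  and, being continuous, everywhere.\<close>

lemma weak_deriv_imp_wd:
  assumes w: "weak_deriv g h" and g: "continuous_on UNIV g" and h: "sq_integrable T1 h"
  shows "wd g h"
proof -
  have ih: "integrable T1 h" using T1.sq_integrable_integrable[OF h] .
  have W: "(\<integral>x. g x * deriv \<phi> x \<partial>T1) = - (\<integral>x. h x * \<phi> x \<partial>T1)" if "test_x \<phi>" for \<phi>
    using w that by (simp add: weak_deriv_def integral_T1)
  have h0: "integral\<^sup>L T1 h = 0"
    using W[OF test_x_const[of 1]] by (simp add: deriv_const[unfolded fun_eq_iff])
  note P = prim_by_parts[OF h h0]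
  have gc: "continuous_on {0..1} g" by (rule continuous_on_subset[OF g]) simp
  have pc: "continuous_on {0..1} (prim h)" using P(2)[OF test_x_const] .
  define k where "k x = g x - prim h x" for x
  have kc: "continuous_on {0..1} k" unfolding k_def by (intro continuous_intros gc pc)
  define m where "m = integral\<^sup>L T1 k"
  have sk: "sq_integrable T1 k" by (rule sq_integrable_T1_continuous[OF kc])
  have k\<phi>: "(\<integral>x. k x * deriv \<phi> x \<partial>T1) = 0" if \<phi>: "test_x \<phi>" for \<phi>
  proof -
    have "(\<integral>x. k x * deriv \<phi> x \<partial>T1) = (\<integral>x. g x * deriv \<phi> x - prim h x * deriv \<phi> x \<partial>T1)"
      by (simp add: k_def left_diff_distrib)
    also have "\<dots> = (\<integral>x. g x * deriv \<phi> x \<partial>T1) - (\<integral>x. prim h x * deriv \<phi> x \<partial>T1)"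
      by (intro Bochner_Integration.integral_diff sq_integrable_integrable_mult sq_integrable_T1_continuous gc pc test_xD(3) \<phi>)
    finally show ?thesis using W[OF \<phi>] P(1)[OF \<phi>] by simp
  qed
  have "AE x in T1. k x - m = 0"
  proof (rule T1_eq_0_if_orthogonal)
    fix \<psi> assume \<psi>: "test_x \<psi>"
    define n where "n = integral\<^sup>L T1 \<psi>"
    have t: "test_x (\<lambda>x. \<psi> x + - n)" by (intro test_x_add \<psi> test_x_const)
    have i\<psi>: "integrable T1 \<psi>" using T1.sq_integrable_integrable[OF test_xD(7)[OF \<psi>]] .
    have "(\<integral>x. \<psi> x + - n \<partial>T1) = 0" using i\<psi> by (simp add: n_def)
    then obtain G where G: "\<And>x. (G has_real_derivative \<psi> x + - n) (at x)" "periodic1 G"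
      using periodic_antiderivative[OF test_xD(2)[OF t] test_xD(4)[OF t], of 0] by metis
    have "smooth (\<lambda>x. \<psi> x + - n)" using t by (simp add: test_x_def)
    then have "test_x G" using G(2) smooth_real_derivI[OF G(1)] by (simp add: test_x_def)
    moreover have "deriv G = (\<lambda>x. \<psi> x + - n)" using G(1) by (auto intro: DERIV_imp_deriv)
    ultimately have 0: "(\<integral>x. k x * (\<psi> x + - n) \<partial>T1) = 0" using k\<phi>[of G] by simp
    have i1: "integrable T1 (\<lambda>x. k x * \<psi> x)" by (rule sq_integrable_integrable_mult[OF sk test_xD(7)[OF \<psi>]])
    have ik: "integrable T1 k" using T1.sq_integrable_integrable[OF sk] .
    have "(\<integral>x. k x * (\<psi> x + - n) \<partial>T1) = (\<integral>x. k x * \<psi> x \<partial>T1) - m * n"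
      using i1 ik by (simp add: distrib_left right_diff_distrib m_def)
    moreover have "(\<integral>x. (k x - m) * \<psi> x \<partial>T1) = (\<integral>x. k x * \<psi> x \<partial>T1) - m * n"
      using i1 i\<psi> by (simp add: left_diff_distrib n_def)
    ultimately show "(\<integral>x. (k x - m) * \<psi> x \<partial>T1) = 0" using 0 by simp
  qed (use T1.sq_integrable_integrable[OF sk] in simp)
  then have ae: "AE x in lborel. x \<in> {0..1} \<longrightarrow> k x = m" by (simp add: AE_T1)
  have km: "k x = m" if x: "x \<in> {0..1}" for x
  proof (rule ccontr)
    assume ne: "k x \<noteq> m"
    have op: "open (- {m})" by (intro open_Compl closed_singleton)
    obtain U where U: "open U" "U \<inter> {0..1} = k -` (- {m}) \<inter> {0..1}"
    proof -
      from continuous_on_open_invariant[THEN iffD1, OF kc]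
      have "open (- {m}) \<longrightarrow> (\<exists>A. open A \<and> A \<inter> {0..1} = k -` (- {m}) \<inter> {0..1})" by (rule spec)
      then have "\<exists>A. open A \<and> A \<inter> {0..1} = k -` (- {m}) \<inter> {0..1}" using op by (rule mp)
      then show thesis
      proof (elim exE conjE)
        fix A assume "open A" "A \<inter> {0..1} = k -` (- {m}) \<inter> {0..1}"
        then show thesis by (rule that)
      qed
    qed
    have inU: "y \<in> U \<longleftrightarrow> k y \<noteq> m" if "y \<in> {0..1}" for y
    proof -
      have "y \<in> U \<inter> {0..1} \<longleftrightarrow> y \<in> k -` (- {m}) \<inter> {0..1}" by (simp only: U(2))
      then show ?thesis using that by simp
    qed
    have "x \<in> U" using inU[OF x] ne by simp
    then have "\<exists>e>0. ball x e \<subseteq> U" using U(1) unfolding open_contains_ball by (rule bspec[rotated])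
    then obtain e where e: "e > 0" "ball x e \<subseteq> U" by (elim exE conjE)
    have "\<exists>c d. c < d \<and> {c<..<d} \<subseteq> U \<inter> {0..1}"
    proof (cases "x < 1")
      case True
      have "{x<..<min 1 (x + e)} \<subseteq> U \<inter> {0..1}" using e(2) x by (auto simp: subset_eq dist_real_def)
      then show ?thesis using True e(1) by (intro exI[of _ x] exI[of _ "min 1 (x + e)"]) auto
    next
      case False
      have "{max 0 (x - e)<..<x} \<subseteq> U \<inter> {0..1}" using e(2) x by (auto simp: subset_eq dist_real_def)
      then show ?thesis using False e(1) x by (intro exI[of _ x] exI[of _ "max 0 (x - e)"]) auto
    qed
    then obtain c d where cd: "c < d" "{c<..<d} \<subseteq> U \<inter> {0..1}" by blast
    have "AE y in lborel. y \<notin> {c<..<d}"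
      using ae
    proof eventually_elim
      case (elim y)
      then show ?case using inU[of y] cd(2) by (meson IntD1 IntD2 subsetD)
    qed
    then have "{c<..<d} \<in> null_sets lborel" by (subst AE_iff_null_sets) auto
    then have "emeasure lborel {c<..<d} = 0" by (rule null_setsD1)
    then show False using cd(1) by simp
  qed
  have fin: "g x - g 0 = prim h x" if x: "x \<in> {0..1}" for x
  proof -
    have "k x = m" "k 0 = m" using km x by auto
    then show ?thesis unfolding k_def using prim_0[OF ih] by linarith
  qed
  have "periodic1 g" using w by (simp add: weak_deriv_def)
  show ?thesis unfolding wd_def
  proof (intro conjI ballI)
    show "continuous_on UNIV g" by (rule g)
    show "periodic1 g" by fact
    show "sq_integrable T1 h" by (rule h)
    show "g x - g 0 = prim h x" if "x \<in> {0..1}" for x by (rule fin[OF that])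
  qed
qed

section \<open>Time derivatives of integral identities\<close>

text \<open>The function \<open>ramp c e\<close> rises smoothly from 0 to 1 on \<open>[c, c + e]\<close>; its derivative is a
  smooth approximation of the Dirac mass at \<open>c\<close>.\<close>

definition ramp :: "real \<Rightarrow> real \<Rightarrow> real \<Rightarrow> real" where
  "ramp c e \<tau> = sstep ((\<tau> - c) / e)"

lemma smooth_ramp: "smooth (ramp c e)"
proof -
  have "smooth (\<lambda>\<tau>. sstep (inverse e * (\<tau> - c)))"
    by (rule smooth_compose[OF sstep(1) smooth_mult[OF smooth_const smooth_diff[OF smooth_ident smooth_const]]])
  moreover have "ramp c e = (\<lambda>\<tau>. sstep (inverse e * (\<tau> - c)))"
    by (rule ext) (simp add: ramp_def field_simps)
  ultimately show ?thesis by simp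
qed

lemma ramp_eq:
  assumes "e > 0"
  shows "\<tau> \<le> c \<Longrightarrow> ramp c e \<tau> = 0" "c + e \<le> \<tau> \<Longrightarrow> ramp c e \<tau> = 1"
  using assms by (auto simp: ramp_def divide_nonpos_pos intro!: sstep(3,4))

lemma deriv_ramp_nonneg:
  assumes "e > 0" shows "0 \<le> deriv (ramp c e) \<tau>"
proof (rule mono_on_imp_deriv_nonneg[of UNIV])
  show "mono (ramp c e)"
    unfolding ramp_def using assms by (intro monoI monoD[OF sstep(2)] divide_right_mono) auto
  show "(ramp c e has_real_derivative deriv (ramp c e) \<tau>) (at \<tau>)" by (rule smoothD(1)[OF smooth_ramp])
qed simp

lemma deriv_eq_0_if_locally_const:
  fixes f :: "real \<Rightarrow> real"
  assumes "open U" "x \<in> U" "\<And>y. y \<in> U \<Longrightarrow> f y = c"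
  shows "deriv f x = 0"
proof -
  have "eventually (\<lambda>y. f y = c) (nhds x)"
    using eventually_nhds_in_open[OF assms(1,2)] by eventually_elim (rule assms(3))
  then have "(f has_real_derivative 0) (at x)" by (subst DERIV_cong_ev[OF refl _ refl]) auto
  then show ?thesis by (rule DERIV_imp_deriv)
qed

lemma deriv_ramp_eq_0:
  assumes "e > 0" "\<tau> < c \<or> c + e < \<tau>" shows "deriv (ramp c e) \<tau> = 0"
  using assms(2)
proof
  assume "\<tau> < c" then show ?thesis
    by (intro deriv_eq_0_if_locally_const[where U="{..<c}" and c=0]) (auto simp: ramp_eq[OF assms(1)])
next
  assume "c + e < \<tau>" then show ?thesis
    by (intro deriv_eq_0_if_locally_const[where U="{c + e<..}" and c=1]) (auto simp: ramp_eq[OF assms(1)])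
qed

text \<open>The weight \<open>deriv (ramp c e)\<close> is nonnegative, has integral 1 and vanishes outside \<open>[c, c + e]\<close>.\<close>

lemma integral_mult_deriv_ramp:
  assumes K: "continuous_on {0..b} K" and e: "e > 0" and c: "0 < c" "c + e \<le> b"
    and d: "\<And>\<tau>. c \<le> \<tau> \<Longrightarrow> \<tau> \<le> c + e \<Longrightarrow> \<bar>K \<tau> - K c\<bar> \<le> d"
  shows "\<bar>integral {0..b} (\<lambda>\<tau>. K \<tau> * deriv (ramp c e) \<tau>) - K c\<bar> \<le> d"
proof -
  let ?r = "deriv (ramp c e)"
  have rc: "continuous_on {0..b} ?r" by (rule smoothD(4)[OF smooth_ramp])
  have r: "(?r has_integral (ramp c e b - ramp c e 0)) {0..b}"
    by (rule fundamental_theorem_of_calculus)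
       (use c e smoothD(1)[OF smooth_ramp] in \<open>auto simp: has_real_derivative_iff_has_vector_derivative[symmetric] intro: has_field_derivative_at_within\<close>)
  then have r1: "(?r has_integral 1) {0..b}" using ramp_eq[OF e, of 0 c] ramp_eq[OF e, of c b] c by simp
  have i1: "(\<lambda>\<tau>. K \<tau> * ?r \<tau>) integrable_on {0..b}" by (intro integrable_continuous_real continuous_intros K rc)
  have i2: "(\<lambda>\<tau>. (K \<tau> - K c) * ?r \<tau>) integrable_on {0..b}" by (intro integrable_continuous_real continuous_intros K rc)
  have "integral {0..b} (\<lambda>\<tau>. (K \<tau> - K c) * ?r \<tau>) = integral {0..b} (\<lambda>\<tau>. K \<tau> * ?r \<tau> - K c * ?r \<tau>)"
    by (simp add: left_diff_distrib)
  also have "\<dots> = integral {0..b} (\<lambda>\<tau>. K \<tau> * ?r \<tau>) - integral {0..b} (\<lambda>\<tau>. K c * ?r \<tau>)"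
    by (rule integral_diff[OF i1]) (intro integrable_continuous_real continuous_intros rc)
  also have "integral {0..b} (\<lambda>\<tau>. K c * ?r \<tau>) = K c" using integral_unique[OF has_integral_mult_right[OF r1, of "K c"]] by simp
  finally have eq: "integral {0..b} (\<lambda>\<tau>. K \<tau> * ?r \<tau>) - K c = integral {0..b} (\<lambda>\<tau>. (K \<tau> - K c) * ?r \<tau>)" by simp
  have "norm (integral {0..b} (\<lambda>\<tau>. (K \<tau> - K c) * ?r \<tau>)) \<le> integral {0..b} (\<lambda>\<tau>. d * ?r \<tau>)"
  proof (rule integral_norm_bound_integral[OF i2])
    show "(\<lambda>\<tau>. d * ?r \<tau>) integrable_on {0..b}" by (intro integrable_continuous_real continuous_intros rc)
    fix \<tau> assume "\<tau> \<in> {0..b}"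
    show "norm ((K \<tau> - K c) * ?r \<tau>) \<le> d * ?r \<tau>"
    proof (cases "c \<le> \<tau> \<and> \<tau> \<le> c + e")
      case True
      then show ?thesis using d[of \<tau>] deriv_ramp_nonneg[OF e, of c \<tau>] by (simp add: abs_mult mult_right_mono)
    next
      case False
      then have "?r \<tau> = 0" by (intro deriv_ramp_eq_0[OF e]) auto
      then show ?thesis by simp
    qed
  qed
  also have "\<dots> = d" using integral_unique[OF has_integral_mult_right[OF r1, of d]] by simp
  finally show ?thesis by (simp add: eq)
qed

text \<open>Du Bois-Reymond's lemma in time: testing with differences of two ramps shows that
  \<open>g\<close> minus a primitive of \<open>h\<close> takes the same value at any two positive times.\<close>

lemma du_Bois_Reymond:
  fixes g h :: "real \<Rightarrow> real"
  assumes g: "continuous_on {0..} g" and h: "continuous_on {0..} h"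
    and eq: "\<And>\<theta> a b. smooth \<theta> \<Longrightarrow> 0 < a \<Longrightarrow> (\<And>t. t \<notin> {a..b} \<Longrightarrow> \<theta> t = 0) \<Longrightarrow>
        (LINT t:{0..}|lborel. g t * deriv \<theta> t + h t * \<theta> t) = 0"
    and t: "t \<ge> 0"
  shows "(g has_real_derivative h t) (at t within {0..})"
proof -
  \<comment> \<open>constant extension to negative times, so that a primitive exists on the whole line\<close>
  define h' where "h' t = h (max 0 t)" for t
  have "continuous_on UNIV h'" unfolding h'_def
    by (rule continuous_on_compose2[OF h]) (auto intro!: continuous_intros)
  then obtain H where H: "\<And>t. (H has_real_derivative h' t) (at t)" using continuous_has_antiderivative by blast
  have Hc: "continuous_on A H" for A by (intro continuous_at_imp_continuous_on) (use H DERIV_isCont in blast)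
  define K where "K t = g t - H t" for t
  have Kc: "continuous_on {0..} K" unfolding K_def by (intro continuous_intros g Hc)
  have const: "K s = K t" if st: "0 < s" "s < t" for s t
  proof (rule ccontr)
    assume "K s \<noteq> K t"
    define d where "d = \<bar>K s - K t\<bar> / 3"
    have d: "d > 0" using \<open>K s \<noteq> K t\<close> by (simp add: d_def)
    have near: "\<exists>e>0. \<forall>\<tau>. c \<le> \<tau> \<and> \<tau> \<le> c + e \<longrightarrow> \<bar>K \<tau> - K c\<bar> \<le> d" if c: "0 < c" for c
    proof -
      have "continuous (at c within {0..}) K" using Kc c by (simp add: continuous_on_eq_continuous_within)
      then obtain e where e: "e > 0" "\<And>\<tau>. \<tau> \<in> {0..} \<Longrightarrow> dist \<tau> c < e \<Longrightarrow> dist (K \<tau>) (K c) < d"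
        using d unfolding continuous_within_eps_delta by blast
      show ?thesis
      proof (intro exI[of _ "e / 2"] conjI allI impI)
        fix \<tau> assume "c \<le> \<tau> \<and> \<tau> \<le> c + e / 2"
        then have "dist (K \<tau>) (K c) < d" using e c by (intro e(2)) (auto simp: dist_real_def)
        then show "\<bar>K \<tau> - K c\<bar> \<le> d" by (simp add: dist_real_def)
      qed (use e in simp)
    qed
    obtain e1 where e1: "e1 > 0" "\<And>\<tau>. s \<le> \<tau> \<Longrightarrow> \<tau> \<le> s + e1 \<Longrightarrow> \<bar>K \<tau> - K s\<bar> \<le> d" using near[OF st(1)] by blast
    obtain e2 where e2: "e2 > 0" "\<And>\<tau>. t \<le> \<tau> \<Longrightarrow> \<tau> \<le> t + e2 \<Longrightarrow> \<bar>K \<tau> - K t\<bar> \<le> d" using near[of t] st by auto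
    define e where "e = min e1 e2"
    have e: "e > 0" "e \<le> e1" "e \<le> e2" using e1 e2 by (auto simp: e_def)
    define b where "b = t + e"
    define \<theta> where "\<theta> \<tau> = ramp s e \<tau> - ramp t e \<tau>" for \<tau>
    have s\<theta>: "smooth \<theta>" unfolding \<theta>_def by (intro smooth_diff smooth_ramp)
    have D\<theta>: "(\<theta> has_real_derivative deriv (ramp s e) \<tau> - deriv (ramp t e) \<tau>) (at \<tau>)" for \<tau>
      unfolding \<theta>_def by (intro DERIV_diff smoothD(1)[OF smooth_ramp])
    then have d\<theta>: "deriv \<theta> \<tau> = deriv (ramp s e) \<tau> - deriv (ramp t e) \<tau>" for \<tau> by (rule DERIV_imp_deriv)
    have supp: "\<theta> \<tau> = 0" if "\<tau> \<notin> {s..b}" for \<tau>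
    proof (cases "\<tau> < s")
      case True then show ?thesis using st by (simp add: \<theta>_def ramp_eq[OF e(1)])
    next
      case False then have "\<tau> > t + e" using that by (simp add: b_def)
      then show ?thesis using st by (simp add: \<theta>_def ramp_eq[OF e(1)])
    qed
    have dsupp: "deriv \<theta> \<tau> = 0" if "\<tau> > b" for \<tau>
      by (rule deriv_eq_0_if_locally_const[where U="{b<..}" and c=0]) (use that supp in auto)
    let ?F = "\<lambda>t. g t * deriv \<theta> t + h t * \<theta> t"
    have Fc: "continuous_on {0..b} ?F"
      by (intro continuous_intros continuous_on_subset[OF g] continuous_on_subset[OF h] smoothD(3,4)[OF s\<theta>]) auto
    have "(LINT t:{0..}|lborel. ?F t) = (LINT t:{0..b}|lborel. ?F t)"
      unfolding set_lebesgue_integral_def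
      by (intro Bochner_Integration.integral_cong) (auto simp: indicator_def supp dsupp)
    also have "\<dots> = integral {0..b} ?F"
      by (rule set_borel_integral_eq_integral(2), unfold set_integrable_def)
         (rule borel_integrable_compact[OF compact_Icc Fc])
    finally have F0: "integral {0..b} ?F = 0" using eq[OF s\<theta> st(1) supp] by simp
    have "((\<lambda>\<tau>. H \<tau> * \<theta> \<tau>) has_real_derivative h' \<tau> * \<theta> \<tau> + deriv \<theta> \<tau> * H \<tau>) (at \<tau>)" for \<tau>
      by (rule DERIV_mult[OF H]) (simp add: D\<theta> d\<theta>)
    then have "((\<lambda>\<tau>. h' \<tau> * \<theta> \<tau> + deriv \<theta> \<tau> * H \<tau>) has_integral (H b * \<theta> b - H 0 * \<theta> 0)) {0..b}"
      using st e by (intro fundamental_theorem_of_calculus)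
        (auto simp: b_def has_real_derivative_iff_has_vector_derivative[symmetric] intro: has_field_derivative_at_within)
    moreover have "\<theta> b = 0" "\<theta> 0 = 0" using st e by (auto simp: \<theta>_def b_def ramp_eq)
    ultimately have "((\<lambda>\<tau>. h' \<tau> * \<theta> \<tau> + deriv \<theta> \<tau> * H \<tau>) has_integral 0) {0..b}" by simp
    then have H0: "integral {0..b} (\<lambda>\<tau>. h' \<tau> * \<theta> \<tau> + deriv \<theta> \<tau> * H \<tau>) = 0"
      "(\<lambda>\<tau>. h' \<tau> * \<theta> \<tau> + deriv \<theta> \<tau> * H \<tau>) integrable_on {0..b}"
      by (auto dest: integral_unique)
    have "integral {0..b} (\<lambda>\<tau>. ?F \<tau> - (h' \<tau> * \<theta> \<tau> + deriv \<theta> \<tau> * H \<tau>)) = 0"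
      using F0 H0 integrable_continuous_real[OF Fc] by (simp add: integral_diff)
    moreover have "integral {0..b} (\<lambda>\<tau>. ?F \<tau> - (h' \<tau> * \<theta> \<tau> + deriv \<theta> \<tau> * H \<tau>))
        = integral {0..b} (\<lambda>\<tau>. K \<tau> * deriv (ramp s e) \<tau> - K \<tau> * deriv (ramp t e) \<tau>)"
      by (rule integral_cong) (simp add: K_def h'_def d\<theta> algebra_simps)
    moreover have Kb: "continuous_on {0..b} K" by (rule continuous_on_subset[OF Kc]) auto
    moreover have "integral {0..b} (\<lambda>\<tau>. K \<tau> * deriv (ramp s e) \<tau> - K \<tau> * deriv (ramp t e) \<tau>)
       = integral {0..b} (\<lambda>\<tau>. K \<tau> * deriv (ramp s e) \<tau>) - integral {0..b} (\<lambda>\<tau>. K \<tau> * deriv (ramp t e) \<tau>)"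
      by (intro integral_diff integrable_continuous_real continuous_intros Kb smoothD(4)[OF smooth_ramp])
    ultimately have "integral {0..b} (\<lambda>\<tau>. K \<tau> * deriv (ramp s e) \<tau>) = integral {0..b} (\<lambda>\<tau>. K \<tau> * deriv (ramp t e) \<tau>)"
      by simp
    moreover have "\<bar>integral {0..b} (\<lambda>\<tau>. K \<tau> * deriv (ramp s e) \<tau>) - K s\<bar> \<le> d"
      by (rule integral_mult_deriv_ramp[OF Kb e(1) st(1)]) (use st e e1(2) in \<open>auto simp: b_def\<close>)
    moreover have "\<bar>integral {0..b} (\<lambda>\<tau>. K \<tau> * deriv (ramp t e) \<tau>) - K t\<bar> \<le> d"
      by (rule integral_mult_deriv_ramp[OF Kb e(1)]) (use st e e2(2) in \<open>auto simp: b_def\<close>)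
    ultimately have "\<bar>K s - K t\<bar> \<le> 2 * d" by linarith
    then show False using d by (simp add: d_def)
  qed
  have K1: "K t = K 1" if "t > 0" for t
  proof (cases t "1::real" rule: linorder_cases)
    case less then show ?thesis using const[OF that less] by simp
  next
    case greater then show ?thesis using const[OF zero_less_one greater] by simp
  qed simp
  have K0: "K 0 = K 1"
  proof -
    have "continuous (at 0 within {0..}) K" using Kc by (simp add: continuous_on_eq_continuous_within)
    then have lim: "(K \<longlongrightarrow> K 0) (at 0 within {0..})" by (simp only: continuous_within)
    have le: "at_right (0::real) \<le> at 0 within {0..}" by (rule at_le, rule subsetI, simp)
    note l1 = tendsto_mono[OF le lim]
    have ev: "\<forall>\<^sub>F t in at_right (0::real). K t = K 1"
      unfolding eventually_at_filter
      by (rule always_eventually, intro allI impI K1) simp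
    note l2 = tendsto_eventually[OF ev]
    show ?thesis by (rule tendsto_unique[OF trivial_limit_at_right_real l1 l2])
  qed
  have gH: "g \<tau> = H \<tau> + K 1" if "\<tau> \<in> {0..}" for \<tau>
  proof -
    have "K \<tau> = K 1" using K1[of \<tau>] K0 that by (cases "\<tau> = 0") auto
    then show ?thesis unfolding K_def[of \<tau>] by linarith
  qed
  have "((\<lambda>\<tau>. H \<tau> + K 1) has_real_derivative h' t + 0) (at t within {0..})"
    by (rule DERIV_add[OF has_field_derivative_at_within[OF H] DERIV_const])
  then have D: "((\<lambda>\<tau>. H \<tau> + K 1) has_real_derivative h' t) (at t within {0..})" by simp
  have "h' t = h t" using t by (simp add: h'_def)
  moreover have "(g has_real_derivative h' t) (at t within {0..})"
  proof (rule has_field_derivative_transform_within[OF D zero_less_one])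
    show "t \<in> {0..}" using t by simp
    fix \<tau> :: real assume "\<tau> \<in> {0..}"
    from gH[OF this] show "H \<tau> + K 1 = g \<tau>" by (rule sym)
  qed
  ultimately show ?thesis by simp
qed

text \<open>The velocities of the particles stay in a bounded set, so the kinetic variable ranges over a box of
  finite measure.\<close>

abbreviation QB :: "real \<Rightarrow> (real \<times> real) measure" where
  "QB B \<equiv> restrict_space lborel ({0..1} \<times> {-B..B})"

lemma space_QB[simp]: "space (QB B) = {0..1} \<times> {-B..B}" by (simp add: space_restrict_space)

lemma finite_measure_QB: "finite_measure (QB B)"
proof
  have c: "compact ({0..1::real} \<times> {-B..B})" by (intro compact_Times) auto
  have "({0..1::real} \<times> {-B..B}) \<in> sets borel" using c by (intro borel_closed compact_imp_closed)
  then have "emeasure (QB B) (space (QB B)) = emeasure lborel ({0..1::real} \<times> {-B..B})"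
    by (simp add: emeasure_restrict_space)
  also have "\<dots> < \<infinity>" by (rule emeasure_bounded_finite[OF compact_imp_bounded[OF c]])
  finally show "emeasure (QB B) (space (QB B)) \<noteq> \<infinity>" by simp
qed

interpretation QB: finite_measure "QB B" for B by (rule finite_measure_QB)

lemma measurable_QB_continuous:
  assumes "continuous_on ({0..1} \<times> {-B..B}) g" shows "(g :: real \<times> real \<Rightarrow> real) \<in> borel_measurable (QB B)"
  using borel_measurable_continuous_on_restrict[OF assms]
  by (simp add: measurable_cong_sets[OF sets_restrict_space_cong[OF sets_lborel] refl])

lemma continuous_bounded_QB:
  assumes "continuous_on ({0..1} \<times> {-B..B}) (g :: real \<times> real \<Rightarrow> real)"
  obtains C where "C \<ge> 0" "\<And>z. z \<in> {0..1} \<times> {-B..B} \<Longrightarrow> \<bar>g z\<bar> \<le> C"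
proof -
  have "bounded (g ` ({0..1} \<times> {-B..B}))"
    by (intro compact_imp_bounded compact_continuous_image assms compact_Times compact_Icc)
  then obtain C where "\<forall>y\<in>g ` ({0..1} \<times> {-B..B}). norm y \<le> C" unfolding bounded_iff by blast
  then have "\<bar>g z\<bar> \<le> max 0 C" if "z \<in> {0..1} \<times> {-B..B}" for z using that by force
  then show ?thesis by (intro that[of "max 0 C"]) auto
qed

lemma Ulim_QB_continuous:
  fixes A :: "real \<times> real \<Rightarrow> real"
  assumes u: "uniform_limit ({0..1} \<times> {-B..B}) a A F" and A: "continuous_on ({0..1} \<times> {-B..B}) A"
    and a: "\<forall>\<^sub>F t in F. continuous_on ({0..1} \<times> {-B..B}) (a t)"
  shows "Ulim (QB B) a A F"
  unfolding Ulim_def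
proof (intro conjI)
  obtain C where "\<And>z. z \<in> {0..1} \<times> {-B..B} \<Longrightarrow> \<bar>A z\<bar> \<le> C" using continuous_bounded_QB[OF A] by blast
  then show "bounded (A ` space (QB B))" unfolding space_QB bounded_iff by (intro exI[of _ C]) auto
  show "\<forall>\<^sub>F t in F. a t \<in> borel_measurable (QB B)"
    using a by eventually_elim (rule measurable_QB_continuous)
  show "A \<in> borel_measurable (QB B)" by (rule measurable_QB_continuous[OF A])
  show "uniform_limit (space (QB B)) a A F" using u by simp
qed

lemma Ulim_QB_const:
  "continuous_on ({0..1} \<times> {-B..B}) A \<Longrightarrow> Ulim (QB B) (\<lambda>_. A) A F"
  by (rule Ulim_QB_continuous) (auto intro: uniform_limit_const)

lemma continuous_on_fst_QB: "continuous_on {0..1} g \<Longrightarrow> continuous_on ({0..1} \<times> {-B..B}) (\<lambda>z. g (fst z))"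
  by (rule continuous_on_compose2) (auto intro!: continuous_intros)

lemma Ulim_QB_fst:
  fixes a :: "'t \<Rightarrow> real \<Rightarrow> real"
  assumes u: "Ulim T1 a A F" and A: "continuous_on {0..1} A" and a: "\<forall>\<^sub>F t in F. continuous_on {0..1} (a t)"
  shows "Ulim (QB B) (\<lambda>t z. a t (fst z)) (\<lambda>z. A (fst z)) F"
proof (rule Ulim_QB_continuous)
  have "uniform_limit {0..1} a A F" using u by (simp add: Ulim_def)
  then show "uniform_limit ({0..1} \<times> {-B..B}) (\<lambda>t z. a t (fst z)) (\<lambda>z. A (fst z)) F"
    by (rule uniform_limit_compose') auto
  show "continuous_on ({0..1} \<times> {-B..B}) (\<lambda>z. A (fst z))" by (rule continuous_on_fst_QB[OF A])
  show "\<forall>\<^sub>F t in F. continuous_on ({0..1} \<times> {-B..B}) (\<lambda>z. a t (fst z))"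
    using a by eventually_elim (rule continuous_on_fst_QB)
qed

lemma integrable_mult_bounded:
  fixes b h :: "'a \<Rightarrow> real"
  assumes "b \<in> borel_measurable M" "\<And>x. x \<in> space M \<Longrightarrow> \<bar>b x\<bar> \<le> C" "integrable M h"
  shows "integrable M (\<lambda>x. b x * h x)" "(\<integral>x. \<bar>b x * h x\<bar> \<partial>M) \<le> C * (\<integral>x. \<bar>h x\<bar> \<partial>M)"
proof -
  have "Ulim M (\<lambda>_::nat. b) b sequentially" by (rule Ulim_const[OF assms(1,2)])
  from L1lim_Ulim_mult[OF this L1lim_const[OF assms(3)]]
  show i: "integrable M (\<lambda>x. b x * h x)" by (simp add: L1lim_def)
  have "(\<integral>x. \<bar>b x * h x\<bar> \<partial>M) \<le> (\<integral>x. C * \<bar>h x\<bar> \<partial>M)"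
    using integrable_abs[OF i] integrable_mult_right[OF integrable_abs[OF assms(3)], of C]
    by (rule integral_mono) (auto simp: abs_mult intro: mult_right_mono[OF assms(2)])
  then show "(\<integral>x. \<bar>b x * h x\<bar> \<partial>M) \<le> C * (\<integral>x. \<bar>h x\<bar> \<partial>M)" by simp
qed

lemma integrable_QB_mult_continuous:
  fixes b h :: "real \<times> real \<Rightarrow> real"
  assumes "continuous_on ({0..1} \<times> {-B..B}) b" "integrable (QB B) h"
  shows "integrable (QB B) (\<lambda>z. b z * h z)"
proof -
  obtain C where "\<And>z. z \<in> {0..1} \<times> {-B..B} \<Longrightarrow> \<bar>b z\<bar> \<le> C" using continuous_bounded_QB[OF assms(1)] by blast
  then show ?thesis
    by (intro integrable_mult_bounded(1)[OF measurable_QB_continuous[OF assms(1)] _ assms(2)]) auto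
qed

text \<open>The right-hand side of a balance law, as a functional of the test function \<open>\<phi>\<close> and its
  weak derivative \<open>h\<close>: a flux \<open>a\<close> and a source given by integration in the kinetic variable.\<close>

definition flux :: "real \<Rightarrow> (real \<Rightarrow> real) \<Rightarrow> (real \<times> real \<Rightarrow> real) \<Rightarrow> (real \<Rightarrow> real) \<Rightarrow> (real \<Rightarrow> real) \<Rightarrow> real" where
  "flux B a b \<phi> h = (\<integral>x. a x * h x \<partial>T1) - (\<integral>z. \<phi> (fst z) * b z \<partial>QB B)"

lemma integrable_QB_fst_mult:
  assumes "wd \<phi> h" "integrable (QB B) b" shows "integrable (QB B) (\<lambda>z. \<phi> (fst z) * b z)"
  by (rule integrable_QB_mult_continuous[OF continuous_on_fst_QB[OF wdD(1)[OF assms(1)]] assms(2)])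

lemma flux_diff_test:
  assumes "wd \<phi> h" "wd \<psi> k" "sq_integrable T1 a" "integrable (QB B) b"
  shows "flux B a b (\<lambda>x. \<phi> x - \<psi> x) (\<lambda>x. h x - k x) = flux B a b \<phi> h - flux B a b \<psi> k"
  using integrable_QB_fst_mult[OF assms(1,4)] integrable_QB_fst_mult[OF assms(2,4)]
    sq_integrable_integrable_mult[OF assms(3) wdD(4)[OF assms(1)]] sq_integrable_integrable_mult[OF assms(3) wdD(4)[OF assms(2)]]
  by (simp add: flux_def right_diff_distrib left_diff_distrib)

lemma flux_diff_data:
  assumes "wd \<phi> h" "sq_integrable T1 a" "integrable (QB B) b" "sq_integrable T1 a'" "integrable (QB B) b'"
  shows "flux B (\<lambda>x. a x - a' x) (\<lambda>z. b z - b' z) \<phi> h = flux B a b \<phi> h - flux B a' b' \<phi> h"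
  using integrable_QB_fst_mult[OF assms(1,3)] integrable_QB_fst_mult[OF assms(1,5)]
    sq_integrable_integrable_mult[OF assms(2) wdD(4)[OF assms(1)]] sq_integrable_integrable_mult[OF assms(4) wdD(4)[OF assms(1)]]
  by (simp add: flux_def right_diff_distrib left_diff_distrib)

lemma abs_flux_le:
  assumes \<phi>: "wd \<phi> h" and a: "sq_integrable T1 a" and b: "integrable (QB B) b"
  shows "\<bar>flux B a b \<phi> h\<bar> \<le> (l2 T1 a + (\<integral>z. \<bar>b z\<bar> \<partial>QB B)) * (l2 T1 \<phi> + l2 T1 h)"
proof -
  have "\<bar>\<integral>x. a x * h x \<partial>T1\<bar> \<le> l2 T1 a * l2 T1 h" by (rule l2_Cauchy_Schwarz[OF a wdD(4)[OF \<phi>]])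
  also have "\<dots> \<le> l2 T1 a * (l2 T1 \<phi> + l2 T1 h)" by (simp add: mult_left_mono)
  finally have 1: "\<bar>\<integral>x. a x * h x \<partial>T1\<bar> \<le> l2 T1 a * (l2 T1 \<phi> + l2 T1 h)" .
  have "\<bar>\<integral>z. \<phi> (fst z) * b z \<partial>QB B\<bar> \<le> (\<integral>z. \<bar>\<phi> (fst z) * b z\<bar> \<partial>QB B)" by (rule integral_abs_bound)
  also have "\<dots> \<le> (l2 T1 \<phi> + l2 T1 h) * (\<integral>z. \<bar>b z\<bar> \<partial>QB B)"
    by (rule integrable_mult_bounded(2)[OF measurable_QB_continuous[OF continuous_on_fst_QB[OF wdD(1)[OF \<phi>]]] _ b])
       (auto intro: wd_sup_le[OF \<phi>])
  finally show ?thesis using 1 unfolding flux_def by (simp add: algebra_simps)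
qed

lemma L2lim_l2_tendsto:
  assumes "L2lim M g G F" shows "((\<lambda>t. l2 M (g t)) \<longlongrightarrow> l2 M G) F"
proof (rule LIM_zero_cancel, rule Lim_null_comparison)
  show "((\<lambda>t. l2 M (\<lambda>x. g t x - G x)) \<longlongrightarrow> 0) F" using assms by (simp add: L2lim_def)
  have G: "sq_integrable M G" and ev: "\<forall>\<^sub>F t in F. sq_integrable M (g t)" using assms by (auto simp: L2lim_def)
  show "\<forall>\<^sub>F t in F. norm (l2 M (g t) - l2 M G) \<le> l2 M (\<lambda>x. g t x - G x)"
    using ev
  proof eventually_elim
    case (elim t)
    show ?case using l2_diff_le[OF elim G] l2_diff_le[OF G elim] l2_commute[of M G "g t"] by simp
  qed
qed

lemma flux_tendsto:
  assumes \<phi>: "\<And>t. wd (\<phi> t) (h t)" "wd \<psi> k" and L: "L2lim T1 \<phi> \<psi> F" "L2lim T1 h k F"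
    and a: "sq_integrable T1 a" and b: "integrable (QB B) b"
  shows "((\<lambda>t. flux B a b (\<phi> t) (h t)) \<longlongrightarrow> flux B a b \<psi> k) F"
proof (rule LIM_zero_cancel, rule Lim_null_comparison)
  let ?C = "l2 T1 a + (\<integral>z. \<bar>b z\<bar> \<partial>QB B)"
  have "((\<lambda>t. ?C * (l2 T1 (\<lambda>x. \<phi> t x - \<psi> x) + l2 T1 (\<lambda>x. h t x - k x))) \<longlongrightarrow> ?C * (0 + 0)) F"
    using L by (intro tendsto_intros) (auto simp: L2lim_def)
  then show "((\<lambda>t. ?C * (l2 T1 (\<lambda>x. \<phi> t x - \<psi> x) + l2 T1 (\<lambda>x. h t x - k x))) \<longlongrightarrow> 0) F" by simp
  show "\<forall>\<^sub>F t in F. norm (flux B a b (\<phi> t) (h t) - flux B a b \<psi> k)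
      \<le> ?C * (l2 T1 (\<lambda>x. \<phi> t x - \<psi> x) + l2 T1 (\<lambda>x. h t x - k x))"
    using abs_flux_le[OF wd_diff[OF \<phi>(1) \<phi>(2)] a b] flux_diff_test[OF \<phi>(1) \<phi>(2) a b] by simp
qed

text \<open>For a fixed smooth test function the mean value theorem in time bounds the error of the difference
  quotient, and because flux and source are strongly continuous in time the bound depends only on
  the \<open>H\<^sup>1\<close> norm of the test function.  Hence \<open>m\<close> is differentiable in time as a functional on \<open>H\<^sup>1\<close>,
  and its difference quotients may be paired with test functions that vary with time.\<close>

lemma balance_law_difference_quotient:
  fixes m a :: "real \<Rightarrow> real \<Rightarrow> real"
  assumes m: "\<And>t. t \<ge> 0 \<Longrightarrow> continuous_on {0..1} (m t)"
    and der: "\<And>\<phi> t. test_x \<phi> \<Longrightarrow> t \<ge> 0 \<Longrightarrow>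
       ((\<lambda>t. \<integral>x. m t x * \<phi> x \<partial>T1) has_real_derivative flux B (a t) (b t) \<phi> (deriv \<phi>)) (at t within {0..})"
    and a: "L2lim T1 a (a s) (at s within {0..})" and b: "L1lim (QB B) b (b s) (at s within {0..})"
    and ab: "\<And>t. t \<ge> 0 \<Longrightarrow> sq_integrable T1 (a t)" "\<And>t. t \<ge> 0 \<Longrightarrow> integrable (QB B) (b t)"
    and s: "s \<ge> 0" and \<phi>: "\<And>t. t \<ge> 0 \<Longrightarrow> wd (\<phi> t) (h t)"
    and L: "L2lim T1 \<phi> (\<phi> s) (at s within {0..})" "L2lim T1 h (h s) (at s within {0..})"
  shows "((\<lambda>t. (\<integral>x. (m t x - m s x) * \<phi> t x \<partial>T1) / (t - s)) \<longlongrightarrow> flux B (a s) (b s) (\<phi> s) (h s)) (at s within {0..})"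
proof -
  let ?F = "at s within {0..}"
  have sm: "sq_integrable T1 (m t)" if "t \<ge> 0" for t by (rule sq_integrable_T1_continuous[OF m[OF that]])
  \<comment> \<open>the mean value theorem, uniformly in the test function; density extends it from smooth to weakly differentiable ones\<close>
  have local: "\<exists>\<delta>>0. \<forall>t\<ge>0. \<bar>t - s\<bar> < \<delta> \<longrightarrow> (\<forall>\<psi> k. wd \<psi> k \<longrightarrow>
      \<bar>(\<integral>x. (m t x - m s x) * \<psi> x \<partial>T1) - (t - s) * flux B (a s) (b s) \<psi> k\<bar> \<le> e * (l2 T1 \<psi> + l2 T1 k) * \<bar>t - s\<bar>)"
    if e: "e > 0" for e
  proof -
    have "((\<lambda>t. l2 T1 (\<lambda>x. a t x - a s x) + (\<integral>z. \<bar>b t z - b s z\<bar> \<partial>QB B)) \<longlongrightarrow> 0 + 0) ?F"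
      using a b by (intro tendsto_add) (auto simp: L2lim_def L1lim_def)
    then have "\<forall>\<^sub>F t in ?F. l2 T1 (\<lambda>x. a t x - a s x) + (\<integral>z. \<bar>b t z - b s z\<bar> \<partial>QB B) < e"
      using e by (intro order_tendstoD) auto
    then obtain \<delta> where \<delta>: "\<delta> > 0" "\<And>t. t \<in> {0..} \<Longrightarrow> t \<noteq> s \<Longrightarrow> dist t s < \<delta> \<Longrightarrow>
        l2 T1 (\<lambda>x. a t x - a s x) + (\<integral>z. \<bar>b t z - b s z\<bar> \<partial>QB B) < e"
      unfolding eventually_at by blast
    have clo: "\<bar>flux B (a t) (b t) \<psi> k - flux B (a s) (b s) \<psi> k\<bar> \<le> e * (l2 T1 \<psi> + l2 T1 k)"
      if t: "t \<ge> 0" "\<bar>t - s\<bar> < \<delta>" and w: "wd \<psi> k" for t \<psi> k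
    proof (cases "t = s")
      case False
      have "\<bar>flux B (a t) (b t) \<psi> k - flux B (a s) (b s) \<psi> k\<bar>
          = \<bar>flux B (\<lambda>x. a t x - a s x) (\<lambda>z. b t z - b s z) \<psi> k\<bar>"
        using flux_diff_data[OF w ab(1)[OF t(1)] ab(2)[OF t(1)] ab(1)[OF s] ab(2)[OF s]] by simp
      also have "\<dots> \<le> (l2 T1 (\<lambda>x. a t x - a s x) + (\<integral>z. \<bar>b t z - b s z\<bar> \<partial>QB B)) * (l2 T1 \<psi> + l2 T1 k)"
        by (rule abs_flux_le[OF w sq_integrable_diff[OF ab(1)[OF t(1)] ab(1)[OF s]]]) (use ab(2) t s in simp)
      also have "\<dots> \<le> e * (l2 T1 \<psi> + l2 T1 k)"
        using \<delta>(2)[of t] t False by (intro mult_right_mono) (auto simp: dist_real_def)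
      finally show ?thesis .
    qed (use e in simp)
    show ?thesis
    proof (intro exI[of _ \<delta>] conjI allI impI \<delta>(1))
      fix t :: real and \<psi> k :: "real \<Rightarrow> real" assume t: "t \<ge> 0" "\<bar>t - s\<bar> < \<delta>" and w: "wd \<psi> k"
      have smooth_case: "\<bar>(\<integral>x. (m t x - m s x) * \<psi> x \<partial>T1) - (t - s) * flux B (a s) (b s) \<psi> (deriv \<psi>)\<bar>
          \<le> e * (l2 T1 \<psi> + l2 T1 (deriv \<psi>)) * \<bar>t - s\<bar>" if \<psi>: "test_x \<psi>" for \<psi>
      proof -
        define S where "S = {0..} \<inter> ball s \<delta>"
        define I where "I t = (\<integral>x. m t x * \<psi> x \<partial>T1) - t * flux B (a s) (b s) \<psi> (deriv \<psi>)" for t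
        have "norm (I t - I s) \<le> e * (l2 T1 \<psi> + l2 T1 (deriv \<psi>)) * norm (t - s)"
        proof (rule field_differentiable_bound)
          show "convex S" unfolding S_def by (intro convex_Int convex_ball) auto
          fix z assume z: "z \<in> S"
          then have z0: "z \<ge> 0" "\<bar>z - s\<bar> < \<delta>" by (auto simp: S_def dist_real_def abs_minus_commute)
          have "(I has_real_derivative flux B (a z) (b z) \<psi> (deriv \<psi>) - flux B (a s) (b s) \<psi> (deriv \<psi>)) (at z within {0..})"
            unfolding I_def by (rule derivative_eq_intros der[OF \<psi> z0(1)] refl)+ simp
          then show "(I has_real_derivative flux B (a z) (b z) \<psi> (deriv \<psi>) - flux B (a s) (b s) \<psi> (deriv \<psi>)) (at z within S)"
            by (rule DERIV_subset) (simp add: S_def)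
          show "norm (flux B (a z) (b z) \<psi> (deriv \<psi>) - flux B (a s) (b s) \<psi> (deriv \<psi>)) \<le> e * (l2 T1 \<psi> + l2 T1 (deriv \<psi>))"
            using clo[OF z0 wd_test_x[OF \<psi>]] by simp
        next
          show "t \<in> S" "s \<in> S" using t s \<delta>(1) by (auto simp: S_def dist_real_def abs_minus_commute)
        qed
        moreover have "(\<integral>x. (m t x - m s x) * \<psi> x \<partial>T1) = (\<integral>x. m t x * \<psi> x \<partial>T1) - (\<integral>x. m s x * \<psi> x \<partial>T1)"
          using sq_integrable_integrable_mult[OF sm[OF t(1)] test_xD(7)[OF \<psi>]] sq_integrable_integrable_mult[OF sm[OF s] test_xD(7)[OF \<psi>]]
          by (simp add: left_diff_distrib)
        ultimately show ?thesis by (simp add: I_def algebra_simps)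
      qed
      obtain \<psi>' :: "nat \<Rightarrow> real \<Rightarrow> real" where \<psi>': "\<And>n. test_x (\<psi>' n)" "Ulim T1 \<psi>' \<psi> sequentially"
        "L2lim T1 (\<lambda>n. deriv (\<psi>' n)) k sequentially" using wd_approx_seq[OF w] by blast
      have L2: "L2lim T1 \<psi>' \<psi> sequentially" by (rule T1.Ulim_imp_L2lim[OF \<psi>'(2)])
      have "(\<lambda>n. \<integral>x. (m t x - m s x) * \<psi>' n x \<partial>T1) \<longlonglongrightarrow> (\<integral>x. (m t x - m s x) * \<psi> x \<partial>T1)"
        by (rule L1lim_integral[OF L1lim_L2lim_mult[OF L2lim_const[OF sq_integrable_diff[OF sm[OF t(1)] sm[OF s]]] L2]])
      moreover have "(\<lambda>n. flux B (a s) (b s) (\<psi>' n) (deriv (\<psi>' n))) \<longlonglongrightarrow> flux B (a s) (b s) \<psi> k"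
        by (rule flux_tendsto[OF wd_test_x[OF \<psi>'(1)] w L2 \<psi>'(3) ab(1)[OF s] ab(2)[OF s]])
      ultimately show "\<bar>(\<integral>x. (m t x - m s x) * \<psi> x \<partial>T1) - (t - s) * flux B (a s) (b s) \<psi> k\<bar> \<le> e * (l2 T1 \<psi> + l2 T1 k) * \<bar>t - s\<bar>"
        using smooth_case[OF \<psi>'(1)]
        by (intro tendsto_le[OF _ _ _ always_eventually[of "\<lambda>n. \<bar>(\<integral>x. (m t x - m s x) * \<psi>' n x \<partial>T1)
            - (t - s) * flux B (a s) (b s) (\<psi>' n) (deriv (\<psi>' n))\<bar> \<le> e * (l2 T1 (\<psi>' n) + l2 T1 (deriv (\<psi>' n))) * \<bar>t - s\<bar>"]])
           (auto intro!: tendsto_intros L2lim_l2_tendsto[OF L2] L2lim_l2_tendsto[OF \<psi>'(3)])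
    qed
  qed
  \<comment> \<open>\<open>max 0 t\<close> replaces the negative times, at which \<open>\<phi>\<close> and \<open>h\<close> are arbitrary\<close>
  have fl: "((\<lambda>t. flux B (a s) (b s) (\<phi> (max 0 t)) (h (max 0 t))) \<longlongrightarrow> flux B (a s) (b s) (\<phi> s) (h s)) ?F"
  proof (rule flux_tendsto[OF _ \<phi>[OF s] _ _ ab(1)[OF s] ab(2)[OF s]])
    show "wd (\<phi> (max 0 t)) (h (max 0 t))" for t by (rule \<phi>) simp
    have ev: "\<forall>\<^sub>F t in ?F. max 0 t = t" by (auto simp: eventually_at_filter)
    have cong: "L2lim T1 (\<lambda>t. g (max 0 t)) G ?F" if "L2lim T1 g G ?F" for g G
      unfolding L2lim_def
    proof (intro conjI)
      show "sq_integrable T1 G" using that by (simp add: L2lim_def)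
      have "\<forall>\<^sub>F t in ?F. sq_integrable T1 (g t)" using that by (simp add: L2lim_def)
      then show "\<forall>\<^sub>F t in ?F. sq_integrable T1 (g (max 0 t))" using ev by eventually_elim simp
      have "((\<lambda>t. l2 T1 (\<lambda>x. g t x - G x)) \<longlongrightarrow> 0) ?F" using that by (simp add: L2lim_def)
      then show "((\<lambda>t. l2 T1 (\<lambda>x. g (max 0 t) x - G x)) \<longlongrightarrow> 0) ?F"
        by (rule Lim_transform_eventually) (use ev in eventually_elim, simp)
    qed
    show "L2lim T1 (\<lambda>t. \<phi> (max 0 t)) (\<phi> s) ?F" "L2lim T1 (\<lambda>t. h (max 0 t)) (h s) ?F"
      by (rule cong[OF L(1)], rule cong[OF L(2)])
  qed
  define Z where "Z = l2 T1 (\<phi> s) + 1 + (l2 T1 (h s) + 1)"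
  have Z: "Z > 0" using l2_nonneg[of T1 "\<phi> s"] l2_nonneg[of T1 "h s"] unfolding Z_def by linarith
  show ?thesis
  proof (rule tendstoI)
    fix e :: real assume e: "e > 0"
    define d where "d = e / (2 * Z)"
    have d: "d > 0" using e Z by (simp add: d_def)
    obtain \<delta> where \<delta>: "\<delta> > 0" "\<And>t \<psi> k. t \<ge> 0 \<Longrightarrow> \<bar>t - s\<bar> < \<delta> \<Longrightarrow> wd \<psi> k \<Longrightarrow>
      \<bar>(\<integral>x. (m t x - m s x) * \<psi> x \<partial>T1) - (t - s) * flux B (a s) (b s) \<psi> k\<bar> \<le> d * (l2 T1 \<psi> + l2 T1 k) * \<bar>t - s\<bar>"
      using local[OF d] by blast
    have "\<forall>\<^sub>F t in ?F. t \<in> {0..} \<and> t \<noteq> s \<and> \<bar>t - s\<bar> < \<delta>"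
      using \<delta>(1) by (auto simp: eventually_at dist_real_def)
    moreover have "\<forall>\<^sub>F t in ?F. dist (flux B (a s) (b s) (\<phi> (max 0 t)) (h (max 0 t))) (flux B (a s) (b s) (\<phi> s) (h s)) < e / 2"
      by (rule tendstoD[OF fl]) (use e in simp)
    moreover note L2lim_norm_bounded[OF L(1)] L2lim_norm_bounded[OF L(2)]
    ultimately show "\<forall>\<^sub>F t in ?F. dist ((\<integral>x. (m t x - m s x) * \<phi> t x \<partial>T1) / (t - s)) (flux B (a s) (b s) (\<phi> s) (h s)) < e"
    proof eventually_elim
      case (elim t)
      then have t: "t \<ge> 0" "t \<noteq> s" "\<bar>t - s\<bar> < \<delta>" by auto
      let ?I = "\<integral>x. (m t x - m s x) * \<phi> t x \<partial>T1" and ?A = "flux B (a s) (b s) (\<phi> t) (h t)"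
      have "\<bar>?I / (t - s) - ?A\<bar> = \<bar>?I - (t - s) * ?A\<bar> / \<bar>t - s\<bar>"
        using t by (simp add: abs_divide[symmetric] diff_divide_distrib)
      also have "\<dots> \<le> d * (l2 T1 (\<phi> t) + l2 T1 (h t))"
        using \<delta>(2)[OF t(1,3) \<phi>[OF t(1)]] t(2) by (simp add: divide_le_eq)
      also have "\<dots> \<le> d * Z" using elim d unfolding Z_def by (intro mult_left_mono add_mono) auto
      also have "\<dots> = e / 2" using Z by (simp add: d_def)
      finally have "\<bar>?I / (t - s) - ?A\<bar> \<le> e / 2" .
      moreover have "\<bar>?A - flux B (a s) (b s) (\<phi> s) (h s)\<bar> < e / 2"
        using elim(2) t(1) by (simp add: dist_real_def max_absorb2)
      ultimately show ?case unfolding dist_real_def by linarith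
    qed
  qed
qed

section \<open>Lyapunov functional of the coupled flow\<close>

text \<open>Sobolev embedding: convergence in \<open>H\<^sup>1\<close> of the torus implies uniform convergence.\<close>

lemma L2lim_wd_imp_Ulim:
  assumes w: "\<And>t. t \<ge> 0 \<Longrightarrow> wd (g t) (h t)" and s: "s \<ge> 0"
    and L: "L2lim T1 g (g s) (at s within {0..})" "L2lim T1 h (h s) (at s within {0..})"
  shows "Ulim T1 g (g s) (at s within {0..})"
proof (rule Ulim_T1_continuous)
  show "continuous_on {0..1} (g s)" by (rule wdD(1)[OF w[OF s]])
  have ev: "\<forall>\<^sub>F t in at s within {0..}. t \<in> {0..}" unfolding eventually_at_filter by (rule always_eventually) simp
  then show "\<forall>\<^sub>F t in at s within {0..}. continuous_on {0..1} (g t)"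
    by eventually_elim (rule wdD(1)[OF w], simp)
  have "((\<lambda>t. l2 T1 (\<lambda>x. g t x - g s x) + l2 T1 (\<lambda>x. h t x - h s x)) \<longlongrightarrow> 0 + 0) (at s within {0..})"
    using L by (intro tendsto_add) (auto simp: L2lim_def)
  then have lim: "((\<lambda>t. l2 T1 (\<lambda>x. g t x - g s x) + l2 T1 (\<lambda>x. h t x - h s x)) \<longlongrightarrow> 0) (at s within {0..})" by simp
  show "uniform_limit {0..1} g (g s) (at s within {0..})"
  proof (rule uniform_limitI)
    fix e :: real assume "e > 0"
    then have "\<forall>\<^sub>F t in at s within {0..}. l2 T1 (\<lambda>x. g t x - g s x) + l2 T1 (\<lambda>x. h t x - h s x) < e"
      using lim by (intro order_tendstoD(2))
    with ev show "\<forall>\<^sub>F t in at s within {0..}. \<forall>x\<in>{0..1}. dist (g t x) (g s x) < e"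
    proof eventually_elim
      case (elim t)
      show ?case
      proof
        fix x :: real assume x: "x \<in> {0..1}"
        have t: "t \<ge> 0" using elim(1) by simp
        show "dist (g t x) (g s x) < e"
          using wd_sup_le[OF wd_diff[OF w[OF t] w[OF s]] x] elim(2) by (simp add: dist_real_def)
      qed
    qed
  qed
qed

lemma weighted_Cauchy_Schwarz:
  fixes g f :: "'a \<Rightarrow> real"
  assumes f: "integrable M f" "AE x in M. 0 \<le> f x" and gf: "integrable M (\<lambda>x. (g x)\<^sup>2 * f x)" "integrable M (\<lambda>x. g x * f x)"
  shows "(\<integral>x. \<bar>g x * f x\<bar> \<partial>M) \<le> sqrt (\<integral>x. (g x)\<^sup>2 * f x \<partial>M) * sqrt (\<integral>x. f x \<partial>M)"
proof (rule le_sqrt_mult_sqrt)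
  show "0 \<le> (\<integral>x. f x \<partial>M)" using f(2) by (rule integral_nonneg_AE)
  show "0 \<le> (\<integral>x. (g x)\<^sup>2 * f x \<partial>M)" by (rule integral_nonneg_AE) (use f(2) in eventually_elim, simp)
  fix s :: real assume s: "s > 0"
  have "2 * (\<integral>x. \<bar>g x * f x\<bar> \<partial>M) = (\<integral>x. 2 * \<bar>g x * f x\<bar> \<partial>M)" by simp
  also have "\<dots> \<le> (\<integral>x. s * ((g x)\<^sup>2 * f x) + f x / s \<partial>M)"
  proof (rule integral_mono_AE)
    show "integrable M (\<lambda>x. 2 * \<bar>g x * f x\<bar>)" by (rule integrable_mult_right[OF integrable_abs[OF gf(2)]])
    show "integrable M (\<lambda>x. s * ((g x)\<^sup>2 * f x) + f x / s)" using gf f by simp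
    show "AE x in M. 2 * \<bar>g x * f x\<bar> \<le> s * ((g x)\<^sup>2 * f x) + f x / s"
      using f(2)
    proof eventually_elim
      case (elim x)
      have "0 \<le> (s * \<bar>g x\<bar> - 1)\<^sup>2 / s" using s by simp
      also have "\<dots> = s * (g x)\<^sup>2 + 1 / s - 2 * \<bar>g x\<bar>"
        using s by (simp add: power2_diff power_mult_distrib field_simps power2_eq_square[of s])
      finally have "2 * \<bar>g x\<bar> \<le> s * (g x)\<^sup>2 + 1 / s" by simp
      from mult_right_mono[OF this elim] show ?case using elim
        by (simp add: abs_mult distrib_right mult.assoc)
    qed
  qed
  also have "\<dots> = s * (\<integral>x. (g x)\<^sup>2 * f x \<partial>M) + (\<integral>x. f x \<partial>M) / s" using gf f by simp
  finally show "2 * (\<integral>x. \<bar>g x * f x\<bar> \<partial>M) \<le> s * (\<integral>x. (g x)\<^sup>2 * f x \<partial>M) + (\<integral>x. f x \<partial>M) / s" .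
qed

text \<open>Taylor's formula for the pressure potential \<open>r powr \<gamma> / (\<gamma> - 1)\<close>: on a compact subinterval of
  \<open>(0, \<infinity>)\<close> its second derivative is bounded above and below by positive constants.\<close>

lemma powr_Bregman_bounds:
  fixes \<gamma> a b :: real
  assumes \<gamma>: "\<gamma> > 1" and ab: "0 < a" "a \<le> b"
  obtains c C where "0 < c" "0 < C"
    "\<And>r s. r \<in> {a..b} \<Longrightarrow> s \<in> {a..b} \<Longrightarrow>
      c * (r - s)\<^sup>2 \<le> r powr \<gamma> / (\<gamma> - 1) - s powr \<gamma> / (\<gamma> - 1) - \<gamma> / (\<gamma> - 1) * s powr (\<gamma> - 1) * (r - s)"
    "\<And>r s. r \<in> {a..b} \<Longrightarrow> s \<in> {a..b} \<Longrightarrow>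
      r powr \<gamma> / (\<gamma> - 1) - s powr \<gamma> / (\<gamma> - 1) - \<gamma> / (\<gamma> - 1) * s powr (\<gamma> - 1) * (r - s) \<le> C * (r - s)\<^sup>2"
proof -
  define P where "P r = r powr \<gamma> / (\<gamma> - 1)" for r
  define P' where "P' r = \<gamma> / (\<gamma> - 1) * r powr (\<gamma> - 1)" for r
  define P'' where "P'' r = \<gamma> * r powr (\<gamma> - 2)" for r
  have D1: "(P has_real_derivative P' r) (at r)" if "r > 0" for r
    unfolding P_def P'_def using that \<gamma> by (auto intro!: derivative_eq_intros)
  have D2: "(P' has_real_derivative P'' r) (at r)" if "r > 0" for r
    unfolding P'_def P''_def using that \<gamma> by (auto intro!: derivative_eq_intros)
  define m where "m = min (a powr (\<gamma> - 2)) (b powr (\<gamma> - 2))"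
  define M where "M = max (a powr (\<gamma> - 2)) (b powr (\<gamma> - 2))"
  have m: "0 < m" "m \<le> M" using ab by (auto simp: m_def M_def)
  have bd: "m \<le> r powr (\<gamma> - 2)" "r powr (\<gamma> - 2) \<le> M" if "r \<in> {a..b}" for r
  proof -
    have r: "0 < r" "a \<le> r" "r \<le> b" using that ab by auto
    show "m \<le> r powr (\<gamma> - 2)"
    proof (cases "\<gamma> \<ge> 2")
      case True
      then have "a powr (\<gamma> - 2) \<le> r powr (\<gamma> - 2)" using r ab by (intro powr_mono2) auto
      then show ?thesis by (simp add: m_def)
    next
      case False
      then have "b powr (\<gamma> - 2) \<le> r powr (\<gamma> - 2)" using r ab by (intro powr_mono2') auto
      then show ?thesis by (simp add: m_def)
    qed
    show "r powr (\<gamma> - 2) \<le> M"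
    proof (cases "\<gamma> \<ge> 2")
      case True
      then have "r powr (\<gamma> - 2) \<le> b powr (\<gamma> - 2)" using r ab by (intro powr_mono2) auto
      then show ?thesis by (simp add: M_def)
    next
      case False
      then have "r powr (\<gamma> - 2) \<le> a powr (\<gamma> - 2)" using r ab by (intro powr_mono2') auto
      then show ?thesis by (simp add: M_def)
    qed
  qed
  have T: "\<exists>z\<in>{a..b}. P r - P s - P' s * (r - s) = P'' z / 2 * (r - s)\<^sup>2" if rs: "r \<in> {a..b}" "s \<in> {a..b}" for r s
  proof (cases "r = s")
    case False
    define diff where "diff k = (if k = 0 then P else if k = 1 then P' else P'')" for k :: nat
    have "\<exists>t. (if r < s then r < t \<and> t < s else s < t \<and> t < r) \<and>
       P r = (\<Sum>m<2. (diff m s / fact m) * (r - s)^m) + (diff 2 t / fact 2) * (r - s)^2"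
    proof (rule Taylor[where a=a and b=b])
      show "\<forall>m t. m < 2 \<and> a \<le> t \<and> t \<le> b \<longrightarrow> DERIV (diff m) t :> diff (Suc m) t"
        using D1 D2 ab by (auto simp: diff_def less_2_cases_iff)
    qed (use rs False in \<open>auto simp: diff_def\<close>)
    then obtain t where t: "if r < s then r < t \<and> t < s else s < t \<and> t < r"
      "P r = (\<Sum>m<2. (diff m s / fact m) * (r - s)^m) + (diff 2 t / fact 2) * (r - s)^2" by blast
    then have "t \<in> {a..b}" using rs by (auto split: if_splits)
    moreover have "P r - P s - P' s * (r - s) = P'' t / 2 * (r - s)\<^sup>2"
      using t(2) by (simp add: diff_def numeral_2_eq_2)
    ultimately show ?thesis by blast
  qed (use rs in auto)
  show ?thesis
  proof (rule that[of "\<gamma> * m / 2" "\<gamma> * M / 2"])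
    fix r s assume rs: "r \<in> {a..b}" "s \<in> {a..b}"
    obtain z where z: "z \<in> {a..b}" "P r - P s - P' s * (r - s) = P'' z / 2 * (r - s)\<^sup>2" using T[OF rs] by blast
    have "\<gamma> * m / 2 \<le> P'' z / 2" "P'' z / 2 \<le> \<gamma> * M / 2" using bd[OF z(1)] \<gamma> by (auto simp: P''_def)
    then have "\<gamma> * m / 2 * (r - s)\<^sup>2 \<le> P r - P s - P' s * (r - s)" "P r - P s - P' s * (r - s) \<le> \<gamma> * M / 2 * (r - s)\<^sup>2"
      unfolding z(2) by (intro mult_right_mono; simp)+
    then show "\<gamma> * m / 2 * (r - s)\<^sup>2 \<le> r powr \<gamma> / (\<gamma> - 1) - s powr \<gamma> / (\<gamma> - 1) - \<gamma> / (\<gamma> - 1) * s powr (\<gamma> - 1) * (r - s)"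
      "r powr \<gamma> / (\<gamma> - 1) - s powr \<gamma> / (\<gamma> - 1) - \<gamma> / (\<gamma> - 1) * s powr (\<gamma> - 1) * (r - s) \<le> \<gamma> * M / 2 * (r - s)\<^sup>2"
      by (simp_all add: P_def P'_def)
  qed (use m \<gamma> in auto)
qed

lemma flux_double:
  shows "flux B a b (\<lambda>x. \<phi> x + \<phi> x) (\<lambda>x. h x + h x) = 2 * flux B a b \<phi> h"
proof -
  have 1: "(\<integral>x. a x * (h x + h x) \<partial>T1) = 2 * (\<integral>x. a x * h x \<partial>T1)"
    unfolding integral_mult_right_zero[symmetric] by (rule Bochner_Integration.integral_cong) simp_all
  have 2: "(\<integral>z. (\<phi> (fst z) + \<phi> (fst z)) * b z \<partial>QB B) = 2 * (\<integral>z. \<phi> (fst z) * b z \<partial>QB B)"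
    unfolding integral_mult_right_zero[symmetric] by (rule Bochner_Integration.integral_cong) simp_all
  show ?thesis unfolding flux_def 1 2 by simp
qed

text \<open>The properties of a global weak solution on which the decay rests, in a form that is already
  integrated against test functions of space: \<open>R t\<close> and \<open>U t\<close> are density and velocity of the fluid
  with derivatives \<open>Rx t\<close> and \<open>Ux t\<close>, and \<open>f t\<close> is the particle distribution on the box.  The
  Vlasov equation enters only through the moments \<open>\<integral> (v - us)\<^sup>k f\<close>, and \<open>us\<close> is characterised by
  the balance of momentum at time 0.\<close>

locale nsv_flow =
  fixes \<gamma> \<beta> B rm rp us C0 :: real and R U Rx Ux :: "real \<Rightarrow> real \<Rightarrow> real" and f :: "real \<Rightarrow> real \<times> real \<Rightarrow> real"
  assumes \<gamma>: "\<gamma> > 1" and \<beta>: "\<beta> \<ge> 0" and rm: "0 < rm"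
    and wdR: "t \<ge> 0 \<Longrightarrow> wd (R t) (Rx t)" and wdU: "t \<ge> 0 \<Longrightarrow> wd (U t) (Ux t)"
    and R_bounds: "t \<ge> 0 \<Longrightarrow> x \<in> {0..1} \<Longrightarrow> rm \<le> R t x \<and> R t x \<le> rp"
    and Rx_bound: "t \<ge> 0 \<Longrightarrow> l2 T1 (Rx t) \<le> C0"
    and LR: "s \<ge> 0 \<Longrightarrow> L2lim T1 R (R s) (at s within {0..})" and LRx: "s \<ge> 0 \<Longrightarrow> L2lim T1 Rx (Rx s) (at s within {0..})"
    and LU: "s \<ge> 0 \<Longrightarrow> L2lim T1 U (U s) (at s within {0..})" and LUx: "s \<ge> 0 \<Longrightarrow> L2lim T1 Ux (Ux s) (at s within {0..})"
    and f_int: "t \<ge> 0 \<Longrightarrow> integrable (QB B) (f t)" and f_nonneg: "t \<ge> 0 \<Longrightarrow> AE z in QB B. 0 \<le> f t z"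
    and Lf: "s \<ge> 0 \<Longrightarrow> L1lim (QB B) f (f s) (at s within {0..})"
    and mass_law: "test_x \<phi> \<Longrightarrow> t \<ge> 0 \<Longrightarrow>
      ((\<lambda>t. \<integral>x. R t x * \<phi> x \<partial>T1) has_real_derivative (\<integral>x. (R t x * U t x) * deriv \<phi> x \<partial>T1)) (at t within {0..})"
    and momentum_law: "test_x \<phi> \<Longrightarrow> t \<ge> 0 \<Longrightarrow>
      ((\<lambda>t. \<integral>x. (R t x * U t x) * \<phi> x \<partial>T1) has_real_derivative
        flux B (\<lambda>x. R t x * (U t x)\<^sup>2 + R t x powr \<gamma> - (1 + R t x powr \<beta>) * Ux t x)
               (\<lambda>z. R t (fst z) * (U t (fst z) - snd z) * f t z) \<phi> (deriv \<phi>)) (at t within {0..})"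
    and moment_law: "t \<ge> 0 \<Longrightarrow>
      ((\<lambda>t. \<integral>z. (snd z - us) ^ k * f t z \<partial>QB B) has_real_derivative
        (\<integral>z. (R t (fst z) * (U t (fst z) - snd z) * (real k * (snd z - us) ^ (k - 1))) * f t z \<partial>QB B)) (at t within {0..})"
    and us: "us * ((\<integral>x. R 0 x \<partial>T1) + (\<integral>z. f 0 z \<partial>QB B)) = (\<integral>x. R 0 x * U 0 x \<partial>T1) + (\<integral>z. snd z * f 0 z \<partial>QB B)"
begin

abbreviation Fl :: "real \<Rightarrow> real filter" where "Fl s \<equiv> at s within {0..}"

lemma ev_nonneg: "\<forall>\<^sub>F t in Fl s. t \<ge> 0 \<and> t \<noteq> s"
  unfolding eventually_at_filter by (rule always_eventually) simp

lemma R_pos: "t \<ge> 0 \<Longrightarrow> x \<in> {0..1} \<Longrightarrow> 0 < R t x" using R_bounds[of t x] rm by auto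

lemma rp_pos: "0 < rp" "rm \<le> rp" using R_bounds[of 0 0] rm by auto

definition w :: "real \<Rightarrow> real \<Rightarrow> real" where "w t x = U t x - us"
definition m :: "real \<Rightarrow> real \<Rightarrow> real" where "m t x = R t x * w t x"
definition rb :: real where "rb = (\<integral>x. R 0 x \<partial>T1)"
definition Mf :: real where "Mf = (\<integral>z. f 0 z \<partial>QB B)"

text \<open>Momentum flux and drag in the frame that moves with \<open>us\<close>.\<close>

definition fa :: "real \<Rightarrow> real \<Rightarrow> real" where
  "fa t x = R t x * U t x * w t x + R t x powr \<gamma> - (1 + R t x powr \<beta>) * Ux t x"
definition fb :: "real \<Rightarrow> real \<times> real \<Rightarrow> real" where
  "fb t z = R t (fst z) * (U t (fst z) - snd z) * f t z"

lemma cR: "t \<ge> 0 \<Longrightarrow> continuous_on A (R t)" by (rule wdD(1)[OF wdR])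
lemma cU: "t \<ge> 0 \<Longrightarrow> continuous_on A (U t)" by (rule wdD(1)[OF wdU])
lemma cw: "t \<ge> 0 \<Longrightarrow> continuous_on A (w t)" unfolding w_def by (intro continuous_intros cU)
lemma cm: "t \<ge> 0 \<Longrightarrow> continuous_on A (m t)" unfolding m_def by (intro continuous_intros cR cw)
lemma cRpowr: "t \<ge> 0 \<Longrightarrow> continuous_on {0..1} (\<lambda>x. R t x powr c)"
  using R_pos[of t] by (intro continuous_intros cR) force+

lemma sUx: "t \<ge> 0 \<Longrightarrow> sq_integrable T1 (Ux t)" by (rule wdD(4)[OF wdU])
lemma sRx: "t \<ge> 0 \<Longrightarrow> sq_integrable T1 (Rx t)" by (rule wdD(4)[OF wdR])

lemma wdw: assumes "t \<ge> 0" shows "wd (w t) (Ux t)"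
  using wd_diff[OF wdU[OF assms] wd_const[of us]] by (simp add: w_def[abs_def])

lemma UR: "s \<ge> 0 \<Longrightarrow> Ulim T1 R (R s) (Fl s)" by (rule L2lim_wd_imp_Ulim[OF wdR _ LR LRx])
lemma UU: "s \<ge> 0 \<Longrightarrow> Ulim T1 U (U s) (Fl s)" by (rule L2lim_wd_imp_Ulim[OF wdU _ LU LUx])

lemma Uw: assumes "s \<ge> 0" shows "Ulim T1 w (w s) (Fl s)"
  using Ulim_diff[OF UU[OF assms] Ulim_T1_const[of "\<lambda>_. us"]] by (simp add: w_def[abs_def])

lemma URpowr: assumes "s \<ge> 0" shows "Ulim T1 (\<lambda>t x. R t x powr c) (\<lambda>x. R s x powr c) (Fl s)"
  by (rule Ulim_compose[OF UR[OF assms], where l=0 and c=rm])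
     (use rm R_bounds[OF assms] in \<open>auto intro!: continuous_intros\<close>)

lemma ev_cont: "(\<And>t. t \<ge> 0 \<Longrightarrow> continuous_on {0..1} (g t)) \<Longrightarrow> \<forall>\<^sub>F t in Fl s. continuous_on {0..1} (g t)"
  using ev_nonneg by (rule eventually_mono) auto

lemma URQ: "s \<ge> 0 \<Longrightarrow> Ulim (QB B) (\<lambda>t z. R t (fst z)) (\<lambda>z. R s (fst z)) (Fl s)"
  by (rule Ulim_QB_fst[OF UR cR ev_cont[OF cR]])
lemma UUQ: "s \<ge> 0 \<Longrightarrow> Ulim (QB B) (\<lambda>t z. U t (fst z)) (\<lambda>z. U s (fst z)) (Fl s)"
  by (rule Ulim_QB_fst[OF UU cU ev_cont[OF cU]])

lemma cQ: "t \<ge> 0 \<Longrightarrow> continuous_on ({0..1} \<times> {-B..B}) (\<lambda>z. R t (fst z))"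
  "t \<ge> 0 \<Longrightarrow> continuous_on ({0..1} \<times> {-B..B}) (\<lambda>z. U t (fst z))"
  "t \<ge> 0 \<Longrightarrow> continuous_on ({0..1} \<times> {-B..B}) (\<lambda>z. w t (fst z))"
  by (intro continuous_on_fst_QB cR cU cw; assumption)+

lemma sfa: assumes t: "t \<ge> 0" shows "sq_integrable T1 (fa t)"
proof -
  have "sq_integrable T1 (\<lambda>x. (R t x * U t x * w t x + R t x powr \<gamma>) - (1 + R t x powr \<beta>) * Ux t x)"
  proof (rule sq_integrable_diff)
    show "sq_integrable T1 (\<lambda>x. R t x * U t x * w t x + R t x powr \<gamma>)"
      by (intro sq_integrable_T1_continuous continuous_intros cR[OF t] cU[OF t] cw[OF t] cRpowr[OF t])
    have c: "continuous_on {0..1} (\<lambda>x. 1 + R t x powr \<beta>)" by (intro continuous_intros cRpowr[OF t])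
    obtain C where "\<And>x. x \<in> {0..1} \<Longrightarrow> \<bar>1 + R t x powr \<beta>\<bar> \<le> C" using continuous_bounded_T1[OF c] by blast
    then show "sq_integrable T1 (\<lambda>x. (1 + R t x powr \<beta>) * Ux t x)"
      by (intro sq_integrable_bounded_mult(1)[OF measurable_T1_continuous[OF c] _ sUx[OF t]]) auto
  qed
  then show ?thesis by (simp add: fa_def[abs_def])
qed

lemma ifb: assumes t: "t \<ge> 0" shows "integrable (QB B) (fb t)"
  unfolding fb_def by (intro integrable_QB_mult_continuous[OF _ f_int[OF t]] continuous_intros cQ[OF t])

lemma Lfa: assumes s: "s \<ge> 0" shows "L2lim T1 fa (fa s) (Fl s)"
proof -
  have "L2lim T1 (\<lambda>t x. (R t x * U t x * w t x + R t x powr \<gamma>) - (1 + R t x powr \<beta>) * Ux t x)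
     (\<lambda>x. (R s x * U s x * w s x + R s x powr \<gamma>) - (1 + R s x powr \<beta>) * Ux s x) (Fl s)"
    by (rule L2lim_diff[OF T1.Ulim_imp_L2lim[OF Ulim_add[OF Ulim_mult[OF Ulim_mult[OF UR[OF s] UU[OF s]] Uw[OF s]] URpowr[OF s]]]
        L2lim_Ulim_mult[OF Ulim_add[OF Ulim_T1_const[of "\<lambda>_. 1"] URpowr[OF s]] LUx[OF s]]]) simp
  then show ?thesis by (simp add: fa_def[abs_def])
qed

lemma Lfb: assumes s: "s \<ge> 0" shows "L1lim (QB B) fb (fb s) (Fl s)"
proof -
  have "continuous_on ({0..1} \<times> {-B..B}) (snd :: real \<times> real \<Rightarrow> real)" by (intro continuous_intros)
  from L1lim_Ulim_mult[OF Ulim_mult[OF URQ[OF s] Ulim_diff[OF UUQ[OF s] Ulim_QB_const[OF this]]] Lf[OF s]]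
  show ?thesis by (simp add: fb_def[abs_def])
qed

lemma sRU: "t \<ge> 0 \<Longrightarrow> sq_integrable T1 (\<lambda>x. R t x * U t x)"
  by (intro sq_integrable_T1_continuous continuous_intros cR cU)

text \<open>Subtract \<open>us\<close> times the mass balance from the momentum balance.\<close>

lemma m_law:
  assumes \<phi>: "test_x \<phi>" and t: "t \<ge> 0"
  shows "((\<lambda>t. \<integral>x. m t x * \<phi> x \<partial>T1) has_real_derivative flux B (fa t) (fb t) \<phi> (deriv \<phi>)) (at t within {0..})"
proof -
  let ?g = "\<lambda>x. R t x * (U t x)\<^sup>2 + R t x powr \<gamma> - (1 + R t x powr \<beta>) * Ux t x"
  have D: "((\<lambda>t. (\<integral>x. (R t x * U t x) * \<phi> x \<partial>T1) - us * (\<integral>x. R t x * \<phi> x \<partial>T1)) has_real_derivative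
     flux B ?g (fb t) \<phi> (deriv \<phi>) - us * (\<integral>x. (R t x * U t x) * deriv \<phi> x \<partial>T1)) (at t within {0..})"
    using momentum_law[OF \<phi> t] mass_law[OF \<phi> t] by (auto intro!: derivative_eq_intros simp: fb_def[abs_def])
  have g: "?g = (\<lambda>x. fa t x + us * (R t x * U t x))"
    by (rule ext) (simp add: fa_def w_def power2_eq_square algebra_simps)
  have "(\<integral>x. ?g x * deriv \<phi> x \<partial>T1) = (\<integral>x. fa t x * deriv \<phi> x + us * ((R t x * U t x) * deriv \<phi> x) \<partial>T1)"
    by (rule Bochner_Integration.integral_cong[OF refl], subst fun_cong[OF g]) (simp add: algebra_simps)
  also have "\<dots> = (\<integral>x. fa t x * deriv \<phi> x \<partial>T1) + us * (\<integral>x. (R t x * U t x) * deriv \<phi> x \<partial>T1)"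
    using sq_integrable_integrable_mult[OF sfa[OF t] test_xD(8)[OF \<phi>]] sq_integrable_integrable_mult[OF sRU[OF t] test_xD(8)[OF \<phi>]] by simp
  finally have "flux B ?g (fb t) \<phi> (deriv \<phi>) - us * (\<integral>x. (R t x * U t x) * deriv \<phi> x \<partial>T1) = flux B (fa t) (fb t) \<phi> (deriv \<phi>)"
    by (simp add: flux_def)
  with D have D': "((\<lambda>t. (\<integral>x. (R t x * U t x) * \<phi> x \<partial>T1) - us * (\<integral>x. R t x * \<phi> x \<partial>T1)) has_real_derivative
     flux B (fa t) (fb t) \<phi> (deriv \<phi>)) (at t within {0..})" by simp
  show ?thesis
  proof (rule has_field_derivative_transform_within[OF D' zero_less_one])
    show "t \<in> {0..}" using t by simp
    fix r :: real assume "r \<in> {0..}"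
    then have r: "r \<ge> 0" by simp
    have i: "integrable T1 (\<lambda>x. (R r x * U r x) * \<phi> x)" "integrable T1 (\<lambda>x. R r x * \<phi> x)"
      by (rule sq_integrable_integrable_mult[OF sRU[OF r] test_xD(7)[OF \<phi>]],
          rule sq_integrable_integrable_mult[OF wdD(5)[OF wdR[OF r]] test_xD(7)[OF \<phi>]])
    have "(\<integral>x. m r x * \<phi> x \<partial>T1) = (\<integral>x. (R r x * U r x) * \<phi> x - us * (R r x * \<phi> x) \<partial>T1)"
      by (simp add: m_def w_def algebra_simps)
    also have "\<dots> = (\<integral>x. (R r x * U r x) * \<phi> x \<partial>T1) - us * (\<integral>x. R r x * \<phi> x \<partial>T1)" using i by simp
    finally show "(\<integral>x. (R r x * U r x) * \<phi> x \<partial>T1) - us * (\<integral>x. R r x * \<phi> x \<partial>T1) = (\<integral>x. m r x * \<phi> x \<partial>T1)" ..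
  qed
qed

lemma mass_quotient:
  assumes s: "s \<ge> 0" and \<phi>: "\<And>t. t \<ge> 0 \<Longrightarrow> wd (\<phi> t) (h t)"
    and L: "L2lim T1 \<phi> (\<phi> s) (Fl s)" "L2lim T1 h (h s) (Fl s)"
  shows "((\<lambda>t. (\<integral>x. (R t x - R s x) * \<phi> t x \<partial>T1) / (t - s)) \<longlongrightarrow> (\<integral>x. (R s x * U s x) * h s x \<partial>T1)) (Fl s)"
proof -
  have "((\<lambda>t. (\<integral>x. (R t x - R s x) * \<phi> t x \<partial>T1) / (t - s)) \<longlongrightarrow> flux B (\<lambda>x. R s x * U s x) (\<lambda>_. 0) (\<phi> s) (h s)) (Fl s)"
  proof (rule balance_law_difference_quotient[where m=R and a="\<lambda>t x. R t x * U t x" and b="\<lambda>_ _. 0"])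
    show "((\<lambda>t. \<integral>x. R t x * \<phi> x \<partial>T1) has_real_derivative flux B (\<lambda>x. R t x * U t x) (\<lambda>_. 0) \<phi> (deriv \<phi>)) (at t within {0..})"
      if "test_x \<phi>" "t \<ge> 0" for \<phi> t using mass_law[OF that] by (simp add: flux_def)
    show "L2lim T1 (\<lambda>t x. R t x * U t x) (\<lambda>x. R s x * U s x) (Fl s)"
      by (rule T1.Ulim_imp_L2lim[OF Ulim_mult[OF UR[OF s] UU[OF s]]])
    show "L1lim (QB B) (\<lambda>_ _. 0) (\<lambda>_. 0) (Fl s)" by (rule L1lim_const) simp
  qed (simp_all add: cR sRU s \<phi> L)
  then show ?thesis by (simp add: flux_def)
qed

lemma momentum_quotient:
  assumes s: "s \<ge> 0" and \<phi>: "\<And>t. t \<ge> 0 \<Longrightarrow> wd (\<phi> t) (h t)"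
    and L: "L2lim T1 \<phi> (\<phi> s) (Fl s)" "L2lim T1 h (h s) (Fl s)"
  shows "((\<lambda>t. (\<integral>x. (m t x - m s x) * \<phi> t x \<partial>T1) / (t - s)) \<longlongrightarrow> flux B (fa s) (fb s) (\<phi> s) (h s)) (Fl s)"
  by (rule balance_law_difference_quotient[OF cm m_law Lfa[OF s] Lfb[OF s] sfa ifb s \<phi> L])

lemma const_if_derivative_0:
  fixes g :: "real \<Rightarrow> real"
  assumes "\<And>t. t \<ge> 0 \<Longrightarrow> (g has_real_derivative 0) (at t within {0..})" "t \<ge> 0"
  shows "g t = g 0"
proof -
  have "\<exists>c. \<forall>x\<in>{0..}. g x = c"
    by (rule has_field_derivative_zero_constant) (use assms(1) in auto)
  then show ?thesis using assms(2) by fastforce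
qed

lemma mass_const: "t \<ge> 0 \<Longrightarrow> (\<integral>x. R t x \<partial>T1) = rb"
  unfolding rb_def
  by (rule const_if_derivative_0[of "\<lambda>t. \<integral>x. R t x \<partial>T1"])
     (use mass_law[OF test_x_const[of 1]] in \<open>auto simp: deriv_const[unfolded fun_eq_iff]\<close>)

lemma fmass_const: "t \<ge> 0 \<Longrightarrow> (\<integral>z. f t z \<partial>QB B) = Mf"
  unfolding Mf_def
  by (rule const_if_derivative_0[of "\<lambda>t. \<integral>z. f t z \<partial>QB B"]) (use moment_law[of _ 0] in auto)

lemma f_mult_int: "t \<ge> 0 \<Longrightarrow> continuous_on ({0..1} \<times> {-B..B}) g \<Longrightarrow> integrable (QB B) (\<lambda>z. g z * f t z)"
  by (rule integrable_QB_mult_continuous[OF _ f_int])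

text \<open>Testing the momentum balance with 1 leaves only the drag, which cancels against the drag in the
  first moment of \<open>f\<close>; by the choice of \<open>us\<close> the conserved value is 0.\<close>

lemma total_momentum:
  assumes t: "t \<ge> 0" shows "(\<integral>x. m t x \<partial>T1) + (\<integral>z. (snd z - us) * f t z \<partial>QB B) = 0"
proof -
  have "(\<integral>x. m t x \<partial>T1) + (\<integral>z. (snd z - us) * f t z \<partial>QB B)
      = (\<integral>x. m 0 x \<partial>T1) + (\<integral>z. (snd z - us) * f 0 z \<partial>QB B)"
  proof (rule const_if_derivative_0[OF _ t])
    fix s :: real assume s: "s \<ge> 0"
    have 1: "((\<lambda>t. \<integral>x. m t x \<partial>T1) has_real_derivative - (\<integral>z. fb s z \<partial>QB B)) (at s within {0..})"
      using m_law[OF test_x_const[of 1] s] by (simp add: flux_def deriv_const[unfolded fun_eq_iff])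
    have 2: "((\<lambda>t. \<integral>z. (snd z - us) * f t z \<partial>QB B) has_real_derivative (\<integral>z. fb s z \<partial>QB B)) (at s within {0..})"
      using moment_law[OF s, of 1] by (simp add: fb_def)
    show "((\<lambda>t. (\<integral>x. m t x \<partial>T1) + (\<integral>z. (snd z - us) * f t z \<partial>QB B)) has_real_derivative 0) (at s within {0..})"
      using DERIV_add[OF 1 2] by simp
  qed
  also have "(\<integral>x. m 0 x \<partial>T1) = (\<integral>x. R 0 x * U 0 x - us * R 0 x \<partial>T1)"
    by (simp add: m_def w_def algebra_simps)
  also have "\<dots> = (\<integral>x. R 0 x * U 0 x \<partial>T1) - us * (\<integral>x. R 0 x \<partial>T1)"
    using T1.sq_integrable_integrable[OF sRU] T1.sq_integrable_integrable[OF wdD(5)[OF wdR]] by simp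
  also have "(\<integral>z. (snd z - us) * f 0 z \<partial>QB B) = (\<integral>z. snd z * f 0 z \<partial>QB B) - us * (\<integral>z. f 0 z \<partial>QB B)"
    using f_mult_int[of 0 snd] f_int[of 0] by (simp add: left_diff_distrib continuous_on_snd[OF continuous_on_id])
  finally show ?thesis using us by (simp add: algebra_simps)
qed

subsection \<open>Energy\<close>

text \<open>The kinetic energy of the fluid, the pressure potential relative to the mean density, the
  kinetic energy of the particles, and their common dissipation.\<close>

definition E1 :: "real \<Rightarrow> real" where "E1 t = (\<integral>x. m t x * w t x \<partial>T1) / 2"
definition E2 :: "real \<Rightarrow> real" where "E2 t = (\<integral>x. R t x powr \<gamma> / (\<gamma> - 1) \<partial>T1) - rb powr \<gamma> / (\<gamma> - 1)"
definition E3 :: "real \<Rightarrow> real" where "E3 t = (\<integral>z. (snd z - us)\<^sup>2 * f t z \<partial>QB B) / 2"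
definition Ds :: "real \<Rightarrow> real" where
  "Ds t = (\<integral>x. (1 + R t x powr \<beta>) * (Ux t x)\<^sup>2 \<partial>T1) + (\<integral>z. (R t (fst z) * (U t (fst z) - snd z)\<^sup>2) * f t z \<partial>QB B)"

lemma has_derivative_quotientI:
  assumes "((\<lambda>t. q t) \<longlongrightarrow> D) (Fl s)" "\<And>t. t \<ge> 0 \<Longrightarrow> t \<noteq> s \<Longrightarrow> q t = (g t - g s) / (t - s)"
  shows "(g has_real_derivative D) (Fl s)"
  unfolding has_field_derivative_iff
  by (rule Lim_transform_eventually[OF assms(1)]) (use ev_nonneg in eventually_elim, auto simp: assms(2))

text \<open>The increment of \<open>m w\<close> is expressed by increments of \<open>m\<close> and \<open>R\<close> alone, for which there are balance
  laws:  \<open>m\<^sub>t w\<^sub>t - m\<^sub>s w\<^sub>s = (m\<^sub>t - m\<^sub>s) (w\<^sub>t + w\<^sub>s) - (R\<^sub>t - R\<^sub>s) w\<^sub>t w\<^sub>s\<close>.\<close>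

lemma E1_derivative:
  assumes s: "s \<ge> 0"
  shows "(E1 has_real_derivative flux B (fa s) (fb s) (w s) (Ux s) - (\<integral>x. (R s x * U s x) * (w s x * Ux s x) \<partial>T1)) (Fl s)"
proof -
  have Lw: "L2lim T1 w (w s) (Fl s)" by (rule T1.Ulim_imp_L2lim[OF Uw[OF s]])
  have sw: "sq_integrable T1 (w s)" by (rule wdD(5)[OF wdw[OF s]])
  have q1: "((\<lambda>t. (\<integral>x. (m t x - m s x) * (w t x + w s x) \<partial>T1) / (t - s)) \<longlongrightarrow>
      flux B (fa s) (fb s) (\<lambda>x. w s x + w s x) (\<lambda>x. Ux s x + Ux s x)) (Fl s)"
    by (rule momentum_quotient[OF s wd_add[OF wdw wdw[OF s]] L2lim_add[OF Lw L2lim_const[OF sw]]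
        L2lim_add[OF LUx[OF s] L2lim_const[OF sUx[OF s]]]])
  have L2: "L2lim T1 (\<lambda>t x. Ux t x * w s x + w t x * Ux s x) (\<lambda>x. Ux s x * w s x + w s x * Ux s x) (Fl s)"
  proof (rule L2lim_add)
    show "L2lim T1 (\<lambda>t x. Ux t x * w s x) (\<lambda>x. Ux s x * w s x) (Fl s)"
      using L2lim_Ulim_mult[OF Ulim_T1_const[OF cw[OF s]] LUx[OF s]] by (simp add: mult.commute)
    show "L2lim T1 (\<lambda>t x. w t x * Ux s x) (\<lambda>x. w s x * Ux s x) (Fl s)"
      by (rule L2lim_Ulim_mult[OF Uw[OF s] L2lim_const[OF sUx[OF s]]])
  qed
  have L1: "L2lim T1 (\<lambda>t x. w t x * w s x) (\<lambda>x. w s x * w s x) (Fl s)"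
    by (rule T1.Ulim_imp_L2lim[OF Ulim_mult[OF Uw[OF s] Ulim_T1_const[OF cw[OF s]]]])
  have q2: "((\<lambda>t. (\<integral>x. (R t x - R s x) * (w t x * w s x) \<partial>T1) / (t - s)) \<longlongrightarrow>
      (\<integral>x. (R s x * U s x) * (Ux s x * w s x + w s x * Ux s x) \<partial>T1)) (Fl s)"
    by (rule mass_quotient[OF s wd_mult[OF wdw wdw[OF s]] L1 L2])
  have eq1: "flux B (fa s) (fb s) (\<lambda>x. w s x + w s x) (\<lambda>x. Ux s x + Ux s x) = 2 * flux B (fa s) (fb s) (w s) (Ux s)"
    by (rule flux_double)
  have eq2: "(\<integral>x. (R s x * U s x) * (Ux s x * w s x + w s x * Ux s x) \<partial>T1) = 2 * (\<integral>x. (R s x * U s x) * (w s x * Ux s x) \<partial>T1)"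
    unfolding integral_mult_right_zero[symmetric] by (rule Bochner_Integration.integral_cong) (simp_all add: algebra_simps)
  have lim: "((\<lambda>t. ((\<integral>x. (m t x - m s x) * (w t x + w s x) \<partial>T1) / (t - s)
        - (\<integral>x. (R t x - R s x) * (w t x * w s x) \<partial>T1) / (t - s)) / 2) \<longlongrightarrow>
      (2 * flux B (fa s) (fb s) (w s) (Ux s) - 2 * (\<integral>x. (R s x * U s x) * (w s x * Ux s x) \<partial>T1)) / 2) (Fl s)"
    by (rule tendsto_divide[OF tendsto_diff[OF q1[unfolded eq1] q2[unfolded eq2]] tendsto_const]) simp
  have "(E1 has_real_derivative (2 * flux B (fa s) (fb s) (w s) (Ux s) - 2 * (\<integral>x. (R s x * U s x) * (w s x * Ux s x) \<partial>T1)) / 2) (Fl s)"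
  proof (rule has_derivative_quotientI[OF lim])
    fix t assume t: "t \<ge> 0" "t \<noteq> s"
    have i: "integrable T1 (\<lambda>x. (m t x - m s x) * (w t x + w s x))" "integrable T1 (\<lambda>x. (R t x - R s x) * (w t x * w s x))"
      "integrable T1 (\<lambda>x. m t x * w t x)" "integrable T1 (\<lambda>x. m s x * w s x)"
      by (intro T1.sq_integrable_integrable sq_integrable_T1_continuous continuous_intros cm cw cR t s)+
    have "(\<integral>x. (m t x - m s x) * (w t x + w s x) \<partial>T1) - (\<integral>x. (R t x - R s x) * (w t x * w s x) \<partial>T1)
        = (\<integral>x. (m t x - m s x) * (w t x + w s x) - (R t x - R s x) * (w t x * w s x) \<partial>T1)"
      using i by simp
    also have "\<dots> = (\<integral>x. m t x * w t x - m s x * w s x \<partial>T1)"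
      by (rule Bochner_Integration.integral_cong) (simp_all add: m_def algebra_simps)
    also have "\<dots> = 2 * (E1 t - E1 s)" using i by (simp add: E1_def)
    finally have e: "(\<integral>x. (m t x - m s x) * (w t x + w s x) \<partial>T1)
        - (\<integral>x. (R t x - R s x) * (w t x * w s x) \<partial>T1) = 2 * (E1 t - E1 s)" .
    have "(a / d - b / d) / 2 = c / d" if "a - b = 2 * c" for a b c d :: real
      using that by (simp add: diff_divide_distrib[symmetric])
    from this[OF e] show "((\<integral>x. (m t x - m s x) * (w t x + w s x) \<partial>T1) / (t - s)
        - (\<integral>x. (R t x - R s x) * (w t x * w s x) \<partial>T1) / (t - s)) / 2 = (E1 t - E1 s) / (t - s)" .
  qed
  then show ?thesis by (simp add: diff_divide_distrib)
qed

lemma wd_Rpowr: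
  assumes s: "s \<ge> 0" shows "wd (\<lambda>x. R s x powr c) (\<lambda>x. c * R s x powr (c - 1) * Rx s x)"
proof -
  have "wd (\<lambda>x. R s x powr c) (\<lambda>x. (c * (R s x powr (c - 1))) * Rx s x)"
    by (rule wd_compose[OF wdR[OF s], where l=0 and c=rm and q="\<lambda>y. y powr c" and q'="\<lambda>y. c * y powr (c - 1)"])
       (use rm R_bounds[OF s] in \<open>auto intro!: continuous_intros derivative_eq_intros\<close>)
  then show ?thesis by simp
qed

text \<open>The potential is linearised at time \<open>s\<close>.  The remainder is of order \<open>(R t - R s)\<^sup>2\<close>, and the mass
  balance tested with \<open>R t - R s\<close> itself shows that its difference quotient tends to 0.\<close>

lemma E2_derivative:
  assumes s: "s \<ge> 0"
  shows "(E2 has_real_derivative - (\<integral>x. R s x powr \<gamma> * Ux s x \<partial>T1)) (Fl s)"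
proof -
  obtain c C where C: "0 < c" "0 < C"
    "\<And>r r'. r \<in> {rm..rp} \<Longrightarrow> r' \<in> {rm..rp} \<Longrightarrow>
      c * (r - r')\<^sup>2 \<le> r powr \<gamma> / (\<gamma> - 1) - r' powr \<gamma> / (\<gamma> - 1) - \<gamma> / (\<gamma> - 1) * r' powr (\<gamma> - 1) * (r - r')"
    "\<And>r r'. r \<in> {rm..rp} \<Longrightarrow> r' \<in> {rm..rp} \<Longrightarrow>
      r powr \<gamma> / (\<gamma> - 1) - r' powr \<gamma> / (\<gamma> - 1) - \<gamma> / (\<gamma> - 1) * r' powr (\<gamma> - 1) * (r - r') \<le> C * (r - r')\<^sup>2"
    using powr_Bregman_bounds[OF \<gamma> rm rp_pos(2)] by metis
  let ?p = "\<lambda>t x. R t x powr \<gamma> / (\<gamma> - 1)"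
  let ?q = "\<lambda>x. \<gamma> / (\<gamma> - 1) * R s x powr (\<gamma> - 1)"
  let ?q' = "\<lambda>x. \<gamma> / (\<gamma> - 1) * ((\<gamma> - 1) * R s x powr (\<gamma> - 1 - 1) * Rx s x)"
  have wq: "wd ?q ?q'" by (rule wd_cmult[OF wd_Rpowr[OF s]])
  have q1: "((\<lambda>t. (\<integral>x. (R t x - R s x) * ?q x \<partial>T1) / (t - s)) \<longlongrightarrow> (\<integral>x. (R s x * U s x) * ?q' x \<partial>T1)) (Fl s)"
    by (rule mass_quotient[OF s wq L2lim_const[OF wdD(5)[OF wq]] L2lim_const[OF wdD(4)[OF wq]]])
  have q2: "((\<lambda>t. (\<integral>x. (R t x - R s x) * (R t x - R s x) \<partial>T1) / (t - s)) \<longlongrightarrow> (\<integral>x. (R s x * U s x) * (Rx s x - Rx s x) \<partial>T1)) (Fl s)"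
    by (rule mass_quotient[OF s wd_diff[OF wdR wdR[OF s]]
        L2lim_diff[OF LR[OF s] L2lim_const[OF wdD(5)[OF wdR[OF s]]]]
        L2lim_diff[OF LRx[OF s] L2lim_const[OF wdD(4)[OF wdR[OF s]]]]])
  then have q2': "((\<lambda>t. C * \<bar>(\<integral>x. (R t x - R s x) * (R t x - R s x) \<partial>T1) / (t - s)\<bar>) \<longlongrightarrow> C * \<bar>0\<bar>) (Fl s)"
    by (intro tendsto_intros) simp
  then have q2'': "((\<lambda>t. C * \<bar>(\<integral>x. (R t x - R s x) * (R t x - R s x) \<partial>T1) / (t - s)\<bar>) \<longlongrightarrow> 0) (Fl s)"
    by (simp only: abs_zero mult_zero_right)
  have rem: "((\<lambda>t. (E2 t - E2 s) / (t - s) - (\<integral>x. (R t x - R s x) * ?q x \<partial>T1) / (t - s)) \<longlongrightarrow> 0) (Fl s)"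
  proof (rule Lim_null_comparison[OF _ q2''])
    show "\<forall>\<^sub>F t in Fl s. norm ((E2 t - E2 s) / (t - s) - (\<integral>x. (R t x - R s x) * ?q x \<partial>T1) / (t - s))
        \<le> C * \<bar>(\<integral>x. (R t x - R s x) * (R t x - R s x) \<partial>T1) / (t - s)\<bar>"
      using ev_nonneg
    proof eventually_elim
      case (elim t)
      then have t: "t \<ge> 0" "t \<noteq> s" by auto
      have i: "integrable T1 (?p t)" "integrable T1 (?p s)" "integrable T1 (\<lambda>x. (R t x - R s x) * ?q x)"
        "integrable T1 (\<lambda>x. (R t x - R s x) * (R t x - R s x))"
        by (intro T1.sq_integrable_integrable sq_integrable_T1_continuous continuous_intros cR cRpowr t s; use \<gamma> in simp)+
      let ?J = "\<lambda>x. ?p t x - ?p s x - (R t x - R s x) * ?q x"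
      have "E2 t - E2 s - (\<integral>x. (R t x - R s x) * ?q x \<partial>T1) = (\<integral>x. ?J x \<partial>T1)"
        using i by (simp add: E2_def del: Bochner_Integration.integral_divide_zero)
      moreover have "0 \<le> ?J x \<and> ?J x \<le> C * ((R t x - R s x) * (R t x - R s x))" if x: "x \<in> {0..1}" for x
      proof -
        have r: "R t x \<in> {rm..rp}" "R s x \<in> {rm..rp}" using R_bounds[OF t(1) x] R_bounds[OF s x] by auto
        have "0 \<le> c * (R t x - R s x)\<^sup>2" using C(1) by simp
        then show ?thesis using C(3)[OF r] C(4)[OF r] by (simp add: power2_eq_square mult.commute mult.left_commute)
      qed
      then have "0 \<le> (\<integral>x. ?J x \<partial>T1)" "(\<integral>x. ?J x \<partial>T1) \<le> (\<integral>x. C * ((R t x - R s x) * (R t x - R s x)) \<partial>T1)"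
        using i by (intro Bochner_Integration.integral_nonneg integral_mono; simp)+
      ultimately have "\<bar>E2 t - E2 s - (\<integral>x. (R t x - R s x) * ?q x \<partial>T1)\<bar> \<le> C * \<bar>\<integral>x. (R t x - R s x) * (R t x - R s x) \<partial>T1\<bar>"
        by simp
      then have "\<bar>E2 t - E2 s - (\<integral>x. (R t x - R s x) * ?q x \<partial>T1)\<bar> / \<bar>t - s\<bar>
          \<le> C * \<bar>\<integral>x. (R t x - R s x) * (R t x - R s x) \<partial>T1\<bar> / \<bar>t - s\<bar>" by (rule divide_right_mono) simp
      then show ?case by (simp only: diff_divide_distrib[symmetric] abs_divide real_norm_def times_divide_eq_right)
    qed
  qed
  have lim: "((\<lambda>t. (E2 t - E2 s) / (t - s)) \<longlongrightarrow> (\<integral>x. (R s x * U s x) * ?q' x \<partial>T1)) (Fl s)"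
    using tendsto_add[OF rem q1] by simp
  have D: "(E2 has_real_derivative (\<integral>x. (R s x * U s x) * ?q' x \<partial>T1)) (Fl s)"
    by (rule has_derivative_quotientI[OF lim]) simp
  have wU: "wd (U s) (Ux s)" by (rule wdU[OF s])
  have "(\<integral>x. (R s x * U s x) * ?q' x \<partial>T1) = (\<integral>x. U s x * (\<gamma> * R s x powr (\<gamma> - 1) * Rx s x) \<partial>T1)"
  proof (rule Bochner_Integration.integral_cong[OF refl])
    fix x assume "x \<in> space T1"
    then have "R s x > 0" using R_pos[OF s] by simp
    then have "R s x * R s x powr (\<gamma> - 1 - 1) = R s x powr (\<gamma> - 1)" by (simp add: powr_mult_base)
    moreover have "(R s x * U s x) * ?q' x = U s x * (\<gamma> * (R s x * R s x powr (\<gamma> - 1 - 1)) * Rx s x)"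
      using \<gamma> by simp
    ultimately show "(R s x * U s x) * ?q' x = U s x * (\<gamma> * R s x powr (\<gamma> - 1) * Rx s x)" by simp
  qed
  also have "\<dots> = - (\<integral>x. R s x powr \<gamma> * Ux s x \<partial>T1)"
    using wd_by_parts[OF wU wd_Rpowr[OF s, of \<gamma>]] by (simp add: mult.commute)
  finally show ?thesis using D by simp
qed

lemma E3_derivative:
  assumes s: "s \<ge> 0"
  shows "(E3 has_real_derivative (\<integral>z. (snd z - us) * fb s z \<partial>QB B)) (Fl s)"
proof -
  have "((\<lambda>t. (\<integral>z. (snd z - us)\<^sup>2 * f t z \<partial>QB B) / 2) has_real_derivative
     (\<integral>z. (R s (fst z) * (U s (fst z) - snd z) * (real 2 * (snd z - us) ^ (2 - 1))) * f s z \<partial>QB B) / 2) (Fl s)"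
    using DERIV_cdivide[OF moment_law[OF s, of 2]] by simp
  moreover have "(\<integral>z. (R s (fst z) * (U s (fst z) - snd z) * (real 2 * (snd z - us) ^ (2 - 1))) * f s z \<partial>QB B)
      = (\<integral>z. 2 * ((snd z - us) * fb s z) \<partial>QB B)"
    by (rule Bochner_Integration.integral_cong) (simp_all add: fb_def algebra_simps)
  ultimately show ?thesis by (simp add: E3_def[abs_def])
qed

lemma iUxUx: assumes s: "s \<ge> 0" shows "integrable T1 (\<lambda>x. (1 + R s x powr \<beta>) * (Ux s x)\<^sup>2)"
proof -
  have c: "continuous_on {0..1} (\<lambda>x. 1 + R s x powr \<beta>)" by (intro continuous_intros cRpowr[OF s])
  obtain C where "\<And>x. x \<in> {0..1} \<Longrightarrow> \<bar>1 + R s x powr \<beta>\<bar> \<le> C" using continuous_bounded_T1[OF c] by blast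
  then show ?thesis
    using sUx[OF s] by (intro integrable_mult_bounded(1)[OF measurable_T1_continuous[OF c]]) (auto simp: sq_integrable_def)
qed

text \<open>Convection and pressure work cancel, and the work of the drag on the fluid and on the particles adds
  up to minus the weighted square of the relative velocity.\<close>

lemma energy_derivative:
  assumes s: "s \<ge> 0"
  shows "((\<lambda>t. E1 t + E2 t + E3 t) has_real_derivative - Ds s) (Fl s)"
proof -
  have sR\<gamma>: "sq_integrable T1 (\<lambda>x. R s x powr \<gamma>)" by (intro sq_integrable_T1_continuous cRpowr s)
  have i: "integrable T1 (\<lambda>x. (R s x * U s x * w s x) * Ux s x)" "integrable T1 (\<lambda>x. R s x powr \<gamma> * Ux s x)"
    by (intro sq_integrable_integrable_mult sUx s sq_integrable_T1_continuous continuous_intros cR cU cw cRpowr)+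
  have "(\<integral>x. fa s x * Ux s x \<partial>T1) = (\<integral>x. (R s x * U s x * w s x) * Ux s x + R s x powr \<gamma> * Ux s x
      - (1 + R s x powr \<beta>) * (Ux s x)\<^sup>2 \<partial>T1)"
    by (rule Bochner_Integration.integral_cong) (simp_all add: fa_def power2_eq_square algebra_simps)
  also have "\<dots> = (\<integral>x. (R s x * U s x * w s x) * Ux s x \<partial>T1) + (\<integral>x. R s x powr \<gamma> * Ux s x \<partial>T1)
      - (\<integral>x. (1 + R s x powr \<beta>) * (Ux s x)\<^sup>2 \<partial>T1)" using i iUxUx[OF s] by simp
  finally have 1: "(\<integral>x. fa s x * Ux s x \<partial>T1) = \<dots>" .
  have j: "integrable (QB B) (\<lambda>z. w s (fst z) * fb s z)" "integrable (QB B) (\<lambda>z. (snd z - us) * fb s z)"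
    by (intro integrable_QB_mult_continuous[OF _ ifb[OF s]] cQ s continuous_intros)+
  have "(\<integral>z. (snd z - us) * fb s z \<partial>QB B) - (\<integral>z. w s (fst z) * fb s z \<partial>QB B)
      = (\<integral>z. - ((R s (fst z) * (U s (fst z) - snd z)\<^sup>2) * f s z) \<partial>QB B)"
    unfolding Bochner_Integration.integral_diff[OF j(2,1), symmetric]
    by (rule Bochner_Integration.integral_cong) (simp_all add: fb_def w_def power2_eq_square algebra_simps)
  then have 2: "(\<integral>z. (snd z - us) * fb s z \<partial>QB B) - (\<integral>z. w s (fst z) * fb s z \<partial>QB B)
      = - (\<integral>z. (R s (fst z) * (U s (fst z) - snd z)\<^sup>2) * f s z \<partial>QB B)" by simp
  have 3: "(\<integral>x. (R s x * U s x) * (w s x * Ux s x) \<partial>T1) = (\<integral>x. (R s x * U s x * w s x) * Ux s x \<partial>T1)"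
    by (simp add: mult.assoc)
  have "(flux B (fa s) (fb s) (w s) (Ux s) - (\<integral>x. (R s x * U s x) * (w s x * Ux s x) \<partial>T1))
      + - (\<integral>x. R s x powr \<gamma> * Ux s x \<partial>T1) + (\<integral>z. (snd z - us) * fb s z \<partial>QB B) = - Ds s"
    unfolding flux_def Ds_def using 1 2 3 by linarith
  then show ?thesis
    using DERIV_add[OF DERIV_add[OF E1_derivative[OF s] E2_derivative[OF s]] E3_derivative[OF s]] by simp
qed

end

lemma zero_mean_primitive:
  assumes k: "continuous_on UNIV k" "\<And>x. k (x + 1) = k x" "integral\<^sup>L T1 k = 0"
  obtains p where "wd p k" "integral\<^sup>L T1 p = 0"
proof -
  obtain G where G: "\<And>x. (G has_real_derivative k x) (at x)" "periodic1 G" "G 0 = 0"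
    using periodic_antiderivative[OF k] by blast
  have w: "wd G k" by (rule wd_C1[OF G(1) k(1) G(2)])
  have "wd (\<lambda>x. G x - integral\<^sup>L T1 G) k" using wd_diff[OF w wd_const] by simp
  moreover have "(\<integral>x. G x - integral\<^sup>L T1 G \<partial>T1) = 0" using T1.sq_integrable_integrable[OF wdD(5)[OF w]] by simp
  ultimately show ?thesis by (rule that)
qed

lemma nonincreasing_within:
  fixes g :: "real \<Rightarrow> real"
  assumes "\<And>t. t \<ge> 0 \<Longrightarrow> (g has_real_derivative g' t) (at t within {0..})" "\<And>t. a < t \<Longrightarrow> t < b \<Longrightarrow> g' t \<le> 0" "0 \<le> a" "a \<le> b"
  shows "g b \<le> g a"
proof (rule DERIV_nonpos_imp_decreasing_open[OF assms(4)])
  show "\<exists>y. (g has_real_derivative y) (at x) \<and> y \<le> 0" if "a < x" "x < b" for x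
  proof -
    have "at x within {0..} = at x" by (rule at_within_interior) (use that assms(3) in simp)
    then show ?thesis using assms(1)[of x] assms(2)[OF that] that assms(3) by auto
  qed
  show "continuous_on {a..b} g"
  proof (rule continuous_on_subset[of "{0..}"])
    show "continuous_on {0..} g"
      unfolding continuous_on_eq_continuous_within using assms(1) by (auto intro: DERIV_continuous)
  qed (use assms in auto)
qed

text \<open>After the last time at which \<open>g \<le> 0\<close>, the function would be positive and nonincreasing.\<close>

lemma nonpos_if_derivative_nonpos_where_pos:
  fixes g :: "real \<Rightarrow> real"
  assumes D: "\<And>t. t \<ge> 0 \<Longrightarrow> (g has_real_derivative g' t) (at t within {0..})"
    and 0: "g 0 \<le> 0" and le: "\<And>t. t \<ge> 0 \<Longrightarrow> g t > 0 \<Longrightarrow> g' t \<le> 0" and t: "t \<ge> 0"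
  shows "g t \<le> 0"
proof (rule ccontr)
  assume "\<not> g t \<le> 0"
  have c: "continuous_on {0..} g"
    unfolding continuous_on_eq_continuous_within using D by (auto intro: DERIV_continuous)
  define S where "S = {0..t} \<inter> g -` {..0}"
  have "closed S" unfolding S_def
    by (rule continuous_closed_preimage) (auto intro: continuous_on_subset[OF c])
  moreover have S0: "0 \<in> S" using 0 t by (simp add: S_def)
  moreover have bd: "bdd_above S" by (auto simp: S_def)
  ultimately have "Sup S \<in> S" by (intro closed_contains_Sup) auto
  then have s: "0 \<le> Sup S" "Sup S \<le> t" "g (Sup S) \<le> 0" by (auto simp: S_def)
  have pos: "g \<tau> > 0" if "Sup S < \<tau>" "\<tau> < t" for \<tau>
  proof (rule ccontr)
    assume "\<not> g \<tau> > 0"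
    then have "\<tau> \<in> S" using that s by (simp add: S_def)
    from cSup_upper[OF this bd] that show False by simp
  qed
  have "g t \<le> g (Sup S)"
    by (rule nonincreasing_within[OF D _ s(1,2)]) (use pos le s in auto)
  then show False using s(3) \<open>\<not> g t \<le> 0\<close> by simp
qed

text \<open>Bernoulli's inequality for \<open>(r / y)\<^sup>n\<close>.\<close>

lemma Young_power:
  fixes y r :: real
  assumes "n \<ge> 2" "y \<ge> 0" "r > 0"
  shows "real n * r * y ^ (n - 1) \<le> (real n - 1) * y ^ n + r ^ n"
proof (cases "y = 0")
  case True
  then show ?thesis using assms by (simp add: power_0_left)
next
  case False
  then have y: "y > 0" using assms by simp
  have "1 + real n * (r / y - 1) \<le> (1 + (r / y - 1)) ^ n"
    by (rule Bernoulli_inequality) (use assms y in simp)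
  then have "(1 + real n * (r / y - 1)) * y ^ n \<le> (r / y) ^ n * y ^ n" using y by (intro mult_right_mono) auto
  also have "\<dots> = r ^ n" using y by (simp add: power_divide)
  finally have 1: "(1 + real n * (r / y - 1)) * y ^ n \<le> r ^ n" .
  have yn: "y ^ n = y * y ^ (n - 1)" by (subst power_eq_if) (use assms in simp)
  have "(1 + real n * (r / y - 1)) * (y * p) = y * p - real n * (y * p) + real n * r * p" for p
    using y by (simp add: field_simps)
  from this[of "y ^ (n - 1)"]
  have "(1 + real n * (r / y - 1)) * y ^ n = y ^ n - real n * y ^ n + real n * r * y ^ (n - 1)"
    unfolding yn[symmetric] .
  with 1 show ?thesis by (simp add: algebra_simps)
qed

context nsv_flow
begin

subsection \<open>The cross term\<close>

lemma periodic_R: "t \<ge> 0 \<Longrightarrow> R t (x + 1) = R t x" by (rule wdD(2)[OF wdR])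
lemma periodic_m: "t \<ge> 0 \<Longrightarrow> m t (x + 1) = m t x" by (simp add: m_def w_def periodic_R wdD(2)[OF wdU])

lemma iR: "t \<ge> 0 \<Longrightarrow> integrable T1 (R t)" by (rule T1.sq_integrable_integrable[OF wdD(5)[OF wdR]])
lemma im: "t \<ge> 0 \<Longrightarrow> integrable T1 (m t)" by (intro T1.sq_integrable_integrable sq_integrable_T1_continuous cm)

definition \<psi> :: "real \<Rightarrow> real \<Rightarrow> real" where
  "\<psi> t = (SOME p. wd p (\<lambda>x. R t x - rb) \<and> integral\<^sup>L T1 p = 0)"

lemma \<psi>: assumes t: "t \<ge> 0" shows "wd (\<psi> t) (\<lambda>x. R t x - rb)" "integral\<^sup>L T1 (\<psi> t) = 0"
proof -
  have c: "continuous_on UNIV (\<lambda>x. R t x - rb)" by (intro continuous_intros cR t)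
  have p: "R t (x + 1) - rb = R t x - rb" for x by (simp add: periodic_R t)
  have z: "(\<integral>x. R t x - rb \<partial>T1) = 0" using iR[OF t] mass_const[OF t] by simp
  obtain p where "wd p (\<lambda>x. R t x - rb)" "integral\<^sup>L T1 p = 0" by (rule zero_mean_primitive[OF c p z])
  then have "wd p (\<lambda>x. R t x - rb) \<and> integral\<^sup>L T1 p = 0" by (rule conjI)
  then have ex: "\<exists>p. wd p (\<lambda>x. R t x - rb) \<and> integral\<^sup>L T1 p = 0" by (rule exI[of _ p])
  have *: "wd (\<psi> t) (\<lambda>x. R t x - rb) \<and> integral\<^sup>L T1 (\<psi> t) = 0" unfolding \<psi>_def by (rule someI_ex[OF ex])
  show "wd (\<psi> t) (\<lambda>x. R t x - rb)" by (rule conjunct1[OF *])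
  show "integral\<^sup>L T1 (\<psi> t) = 0" by (rule conjunct2[OF *])
qed

text \<open>The size of the density fluctuation; it also bounds \<open>\<psi>\<close> uniformly.\<close>

definition A :: "real \<Rightarrow> real" where "A t = l2 T1 (\<lambda>x. R t x - rb)"

lemma \<psi>_sup: "t \<ge> 0 \<Longrightarrow> x \<in> {0..1} \<Longrightarrow> \<bar>\<psi> t x\<bar> \<le> A t"
  using wd_deviation_le_l2[OF \<psi>(1), of t x] \<psi>(2)[of t] by (simp add: A_def)

lemma wd_\<psi>_diff:
  assumes "t \<ge> 0" "s \<ge> 0" shows "wd (\<lambda>x. \<psi> t x - \<psi> s x) (\<lambda>x. R t x - R s x)"
  using wd_diff[OF \<psi>(1)[OF assms(1)] \<psi>(1)[OF assms(2)]] by simp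

lemma \<psi>_diff_sup:
  assumes "t \<ge> 0" "s \<ge> 0" "x \<in> {0..1}"
  shows "\<bar>\<psi> t x - \<psi> s x\<bar> \<le> l2 T1 (\<lambda>x. R t x - R s x)"
proof -
  have "(\<integral>x. \<psi> t x - \<psi> s x \<partial>T1) = 0"
    using T1.sq_integrable_integrable[OF wdD(5)[OF \<psi>(1)]] \<psi>(2) assms by simp
  then show ?thesis using wd_deviation_le_l2[OF wd_\<psi>_diff[OF assms(1,2)] assms(3)] by simp
qed

lemma L\<psi>: assumes s: "s \<ge> 0" shows "L2lim T1 \<psi> (\<psi> s) (Fl s)"
  unfolding L2lim_def
proof (intro conjI)
  show "sq_integrable T1 (\<psi> s)" by (rule wdD(5)[OF \<psi>(1)[OF s]])
  show "\<forall>\<^sub>F t in Fl s. sq_integrable T1 (\<psi> t)" using ev_nonneg by eventually_elim (rule wdD(5)[OF \<psi>(1)], simp)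
  have lim: "((\<lambda>t. l2 T1 (\<lambda>x. R t x - R s x)) \<longlongrightarrow> 0) (Fl s)" using LR[OF s] by (simp add: L2lim_def)
  show "((\<lambda>t. l2 T1 (\<lambda>x. \<psi> t x - \<psi> s x)) \<longlongrightarrow> 0) (Fl s)"
  proof (rule tendsto_0_le_real[OF lim])
    show "\<forall>\<^sub>F t in Fl s. l2 T1 (\<lambda>x. \<psi> t x - \<psi> s x) \<le> l2 T1 (\<lambda>x. R t x - R s x)"
      using ev_nonneg
    proof eventually_elim
      case (elim t)
      then have t: "t \<ge> 0" by simp
      show ?case by (rule l2_T1_le_sup[OF wdD(7)[OF wd_\<psi>_diff[OF t s]] \<psi>_diff_sup[OF t s]])
    qed
  qed simp
qed

text \<open>The cross term makes the density fluctuation visible to the Lyapunov functional.\<close>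

definition X :: "real \<Rightarrow> real" where "X t = (\<integral>x. m t x * \<psi> t x \<partial>T1)"
definition mb :: "real \<Rightarrow> real" where "mb t = (\<integral>x. m t x \<partial>T1)"

text \<open>In the increment of \<open>m \<psi>\<close> the part with \<open>\<psi> t - \<psi> s\<close> is integrated by parts against a primitive of
  \<open>m s - mb s\<close>; this leaves the increment of the density, to which the mass balance applies.\<close>

lemma X_derivative:
  assumes s: "s \<ge> 0"
  shows "(X has_real_derivative flux B (fa s) (fb s) (\<psi> s) (\<lambda>x. R s x - rb)
            - (\<integral>x. (R s x * U s x) * (m s x - mb s) \<partial>T1)) (Fl s)"
proof -
  have c: "continuous_on UNIV (\<lambda>x. m s x - mb s)" by (intro continuous_intros cm s)
  have p: "m s (x + 1) - mb s = m s x - mb s" for x by (simp add: periodic_m s)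
  have z: "(\<integral>x. m s x - mb s \<partial>T1) = 0" using im[OF s] by (simp add: mb_def)
  obtain k where k: "wd k (\<lambda>x. m s x - mb s)" by (rule zero_mean_primitive[OF c p z])
  have LRb: "L2lim T1 (\<lambda>t x. R t x - rb) (\<lambda>x. R s x - rb) (Fl s)"
    by (rule L2lim_diff[OF LR[OF s] L2lim_const[OF T1.sq_integrable_const]])
  have q1: "((\<lambda>t. (\<integral>x. (m t x - m s x) * \<psi> t x \<partial>T1) / (t - s)) \<longlongrightarrow> flux B (fa s) (fb s) (\<psi> s) (\<lambda>x. R s x - rb)) (Fl s)"
    by (rule momentum_quotient[OF s \<psi>(1) L\<psi>[OF s] LRb])
  have q2: "((\<lambda>t. (\<integral>x. (R t x - R s x) * k x \<partial>T1) / (t - s)) \<longlongrightarrow> (\<integral>x. (R s x * U s x) * (m s x - mb s) \<partial>T1)) (Fl s)"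
    by (rule mass_quotient[OF s k L2lim_const[OF wdD(5)[OF k]] L2lim_const[OF wdD(4)[OF k]]])
  show ?thesis
  proof (rule has_derivative_quotientI[OF tendsto_diff[OF q1 q2]])
    fix t assume t: "t \<ge> 0" "t \<noteq> s"
    have c\<psi>: "continuous_on {0..1} (\<psi> t)" "continuous_on {0..1} (\<psi> s)"
      by (rule wdD(1)[OF \<psi>(1)[OF t(1)]], rule wdD(1)[OF \<psi>(1)[OF s]])
    have i: "integrable T1 (\<lambda>x. (m t x - m s x) * \<psi> t x)" "integrable T1 (\<lambda>x. m t x * \<psi> t x)" "integrable T1 (\<lambda>x. m s x * \<psi> s x)"
      "integrable T1 (\<lambda>x. (m s x - mb s) * (\<psi> t x - \<psi> s x))" "integrable T1 (\<psi> t)" "integrable T1 (\<psi> s)"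
      by (intro T1.sq_integrable_integrable sq_integrable_T1_continuous continuous_intros cm t s c\<psi>)+
    have "(\<integral>x. (m s x - mb s) * (\<psi> t x - \<psi> s x) \<partial>T1) = - (\<integral>x. k x * (R t x - R s x) \<partial>T1)"
      by (rule wd_by_parts[OF k wd_\<psi>_diff[OF t(1) s]])
    then have 1: "(\<integral>x. (R t x - R s x) * k x \<partial>T1) = - (\<integral>x. (m s x - mb s) * (\<psi> t x - \<psi> s x) \<partial>T1)"
      by (simp add: mult.commute)
    have "X t - X s = (\<integral>x. (m t x - m s x) * \<psi> t x + ((m s x - mb s) * (\<psi> t x - \<psi> s x) + mb s * (\<psi> t x - \<psi> s x)) \<partial>T1)"
      unfolding X_def Bochner_Integration.integral_diff[OF i(2,3), symmetric]
      by (rule Bochner_Integration.integral_cong) (simp_all add: algebra_simps)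
    also have "\<dots> = (\<integral>x. (m t x - m s x) * \<psi> t x \<partial>T1) + (\<integral>x. (m s x - mb s) * (\<psi> t x - \<psi> s x) \<partial>T1)"
      using i \<psi>(2)[OF t(1)] \<psi>(2)[OF s] by simp
    finally have e: "(\<integral>x. (m t x - m s x) * \<psi> t x \<partial>T1) - (\<integral>x. (R t x - R s x) * k x \<partial>T1) = X t - X s" using 1 by simp
    show "(\<integral>x. (m t x - m s x) * \<psi> t x \<partial>T1) / (t - s) - (\<integral>x. (R t x - R s x) * k x \<partial>T1) / (t - s) = (X t - X s) / (t - s)"
      by (simp only: diff_divide_distrib[symmetric] e)
  qed
qed

subsection \<open>Estimates by the dissipation\<close>

lemma f_int_nonneg: assumes "t \<ge> 0" "\<And>z. z \<in> {0..1} \<times> {-B..B} \<Longrightarrow> 0 \<le> g z" shows "0 \<le> (\<integral>z. g z * f t z \<partial>QB B)"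
proof (rule integral_nonneg_AE)
  have "AE z in QB B. z \<in> space (QB B)" by (rule AE_space)
  with f_nonneg[OF assms(1)] show "AE z in QB B. 0 \<le> g z * f t z"
    by eventually_elim (use assms(2) in simp)
qed

lemma f_int_mono:
  assumes t: "t \<ge> 0" and c: "continuous_on ({0..1} \<times> {-B..B}) g" "continuous_on ({0..1} \<times> {-B..B}) h"
    and le: "\<And>z. z \<in> {0..1} \<times> {-B..B} \<Longrightarrow> g z \<le> h z"
  shows "(\<integral>z. g z * f t z \<partial>QB B) \<le> (\<integral>z. h z * f t z \<partial>QB B)"
proof (rule integral_mono_AE[OF f_mult_int[OF t c(1)] f_mult_int[OF t c(2)]])
  have "AE z in QB B. z \<in> space (QB B)" by (rule AE_space)
  with f_nonneg[OF t] show "AE z in QB B. g z * f t z \<le> h z * f t z"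
    by eventually_elim (use le in \<open>simp add: mult_right_mono\<close>)
qed

lemma Mf_nonneg: "0 \<le> Mf"
  unfolding Mf_def by (rule integral_nonneg_AE[OF f_nonneg]) simp

lemma rb_bounds: "rm \<le> rb" "rb \<le> rp"
proof -
  have "(\<integral>x. rm \<partial>T1) \<le> (\<integral>x. R 0 x \<partial>T1)" using iR[of 0] R_bounds[of 0] by (intro integral_mono) auto
  then show "rm \<le> rb" by (simp add: rb_def)
  show "rb \<le> rp" unfolding rb_def using iR[of 0] R_bounds[of 0] by (intro integral_T1_le_sup) auto
qed

lemma Ds1: assumes t: "t \<ge> 0" shows "0 \<le> (\<integral>z. (R t (fst z) * (U t (fst z) - snd z)\<^sup>2) * f t z \<partial>QB B)"
proof (rule f_int_nonneg[OF t])
  fix z :: "real \<times> real" assume "z \<in> {0..1} \<times> {-B..B}"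
  then have "0 < R t (fst z)" by (intro R_pos[OF t]) auto
  then show "0 \<le> R t (fst z) * (U t (fst z) - snd z)\<^sup>2" by simp
qed

lemma Ux2: assumes t: "t \<ge> 0" shows "(l2 T1 (Ux t))\<^sup>2 \<le> (\<integral>x. (1 + R t x powr \<beta>) * (Ux t x)\<^sup>2 \<partial>T1)"
  unfolding l2_power2
proof (rule integral_mono[OF _ iUxUx[OF t]])
  show "integrable T1 (\<lambda>x. (Ux t x)\<^sup>2)" using sUx[OF t] by (simp add: sq_integrable_def)
  fix x
  have "1 * (Ux t x)\<^sup>2 \<le> (1 + R t x powr \<beta>) * (Ux t x)\<^sup>2" by (intro mult_right_mono) auto
  then show "(Ux t x)\<^sup>2 \<le> (1 + R t x powr \<beta>) * (Ux t x)\<^sup>2" by simp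
qed

lemma Ds_nonneg: assumes t: "t \<ge> 0" shows "0 \<le> Ds t"
proof -
  have "0 \<le> (l2 T1 (Ux t))\<^sup>2" by simp
  then show ?thesis using Ux2[OF t] Ds1[OF t] unfolding Ds_def by linarith
qed

lemma l2_Ux_le: assumes t: "t \<ge> 0" shows "l2 T1 (Ux t) \<le> sqrt (Ds t)"
  by (rule real_le_rsqrt) (use Ux2[OF t] Ds1[OF t] in \<open>simp add: Ds_def\<close>)

lemma rel2: assumes t: "t \<ge> 0" shows "(\<integral>z. (U t (fst z) - snd z)\<^sup>2 * f t z \<partial>QB B) \<le> Ds t / rm"
proof -
  have c: "continuous_on ({0..1} \<times> {-B..B}) (\<lambda>z. (U t (fst z) - snd z)\<^sup>2)"
    by (intro continuous_intros cQ t)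
  have c2: "continuous_on ({0..1} \<times> {-B..B}) (\<lambda>z. rm * (U t (fst z) - snd z)\<^sup>2)"
    "continuous_on ({0..1} \<times> {-B..B}) (\<lambda>z. R t (fst z) * (U t (fst z) - snd z)\<^sup>2)"
    by (intro continuous_intros cQ t)+
  have "rm * (\<integral>z. (U t (fst z) - snd z)\<^sup>2 * f t z \<partial>QB B) = (\<integral>z. (rm * (U t (fst z) - snd z)\<^sup>2) * f t z \<partial>QB B)"
    by (simp add: mult.assoc)
  also have "\<dots> \<le> (\<integral>z. (R t (fst z) * (U t (fst z) - snd z)\<^sup>2) * f t z \<partial>QB B)"
    by (rule f_int_mono[OF t c2]) (use R_bounds[OF t] in \<open>auto intro: mult_right_mono\<close>)
  also have "\<dots> \<le> Ds t" using Ux2[OF t] zero_le_power2[of "l2 T1 (Ux t)"] unfolding Ds_def by linarith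
  finally show ?thesis using rm by (simp add: pos_le_divide_eq mult.commute)
qed

lemma rel1: assumes t: "t \<ge> 0"
  shows "(\<integral>z. \<bar>(U t (fst z) - snd z) * f t z\<bar> \<partial>QB B) \<le> sqrt (Mf / rm) * sqrt (Ds t)"
proof -
  have "(\<integral>z. \<bar>(U t (fst z) - snd z) * f t z\<bar> \<partial>QB B)
      \<le> sqrt (\<integral>z. (U t (fst z) - snd z)\<^sup>2 * f t z \<partial>QB B) * sqrt (\<integral>z. f t z \<partial>QB B)"
    by (rule weighted_Cauchy_Schwarz[OF f_int[OF t] f_nonneg[OF t]])
       (rule f_mult_int[OF t], intro continuous_intros cQ t)+
  also have "\<dots> \<le> sqrt (Ds t / rm) * sqrt Mf"
    unfolding fmass_const[OF t] using rel2[OF t] Mf_nonneg by (intro mult_right_mono) auto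
  also have "\<dots> = sqrt (Mf / rm) * sqrt (Ds t)" by (simp add: real_sqrt_divide)
  finally show ?thesis .
qed

definition CW :: real where "CW = 2 + sqrt (Mf / rm) / (rb + Mf)"

lemma CW_pos: "CW > 0"
  unfolding CW_def using rb_bounds rm Mf_nonneg by (intro add_pos_nonneg divide_nonneg_nonneg) auto

text \<open>The Poincare inequality bounds the deviation of \<open>w\<close> from its mean by the viscous part of the
  dissipation.  Since the total momentum vanishes, the mean is a combination of averages of this
  deviation over fluid and particles and of the slip velocity \<open>u - v\<close>, which the drag part
  of the dissipation controls.\<close>

lemma w_le:
  assumes t: "t \<ge> 0" and x: "x \<in> {0..1}"
  shows "\<bar>w t x\<bar> \<le> CW * sqrt (Ds t)"
proof -
  define d where "d = sqrt (Ds t)"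
  define wb where "wb = (\<integral>x. w t x \<partial>T1)"
  have d: "d \<ge> 0" by (simp add: d_def Ds_nonneg[OF t])
  have dev: "\<bar>w t x - wb\<bar> \<le> d" if "x \<in> {0..1}" for x
    using wd_deviation_le_l2[OF wdw[OF t] that] l2_Ux_le[OF t] by (simp add: wb_def d_def)
  have pos: "rb + Mf > 0" using rb_bounds rm Mf_nonneg by linarith
  have cwb: "continuous_on {0..1} (\<lambda>x. w t x - wb)" by (intro continuous_intros cw t)
  have i: "integrable T1 (\<lambda>x. R t x * (w t x - wb))"
    by (intro T1.sq_integrable_integrable sq_integrable_T1_continuous continuous_intros cR cw t)
  have "(\<integral>x. m t x \<partial>T1) = (\<integral>x. R t x * (w t x - wb) + wb * R t x \<partial>T1)"
    by (rule Bochner_Integration.integral_cong) (simp_all add: m_def algebra_simps)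
  also have "\<dots> = (\<integral>x. R t x * (w t x - wb) \<partial>T1) + wb * rb" using i iR[OF t] mass_const[OF t] by simp
  finally have 1: "(\<integral>x. m t x \<partial>T1) = (\<integral>x. R t x * (w t x - wb) \<partial>T1) + wb * rb" .
  have a1: "\<bar>\<integral>x. R t x * (w t x - wb) \<partial>T1\<bar> \<le> d * rb"
  proof -
    have "\<bar>\<integral>x. R t x * (w t x - wb) \<partial>T1\<bar> \<le> (\<integral>x. \<bar>R t x * (w t x - wb)\<bar> \<partial>T1)" by (rule integral_abs_bound)
    also have "\<dots> \<le> (\<integral>x. d * R t x \<partial>T1)"
    proof (rule integral_mono[OF integrable_abs[OF i] integrable_mult_right[OF iR[OF t]]])
      fix x assume "x \<in> space T1"
      then have "x \<in> {0..1}" by simp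
      then show "\<bar>R t x * (w t x - wb)\<bar> \<le> d * R t x"
        using mult_left_mono[OF dev less_imp_le[OF R_pos[OF t]], of x x] R_pos[OF t, of x] by (simp add: abs_mult mult.commute)
    qed
    also have "\<dots> = d * rb" by (simp add: mass_const[OF t])
    finally show ?thesis .
  qed
  have j: "integrable (QB B) (\<lambda>z. (w t (fst z) - wb) * f t z)" "integrable (QB B) (\<lambda>z. (U t (fst z) - snd z) * f t z)"
    by (rule f_mult_int[OF t], intro continuous_intros cQ t)+
  have "(\<integral>z. (snd z - us) * f t z \<partial>QB B) = (\<integral>z. (w t (fst z) - wb) * f t z + wb * f t z - (U t (fst z) - snd z) * f t z \<partial>QB B)"
    by (rule Bochner_Integration.integral_cong) (simp_all add: w_def algebra_simps)
  also have "\<dots> = (\<integral>z. (w t (fst z) - wb) * f t z \<partial>QB B) + wb * Mf - (\<integral>z. (U t (fst z) - snd z) * f t z \<partial>QB B)"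
    using j f_int[OF t] fmass_const[OF t] by simp
  finally have 2: "(\<integral>z. (snd z - us) * f t z \<partial>QB B) = \<dots>" .
  have a2: "\<bar>\<integral>z. (w t (fst z) - wb) * f t z \<partial>QB B\<bar> \<le> d * Mf"
  proof -
    have "\<bar>\<integral>z. (w t (fst z) - wb) * f t z \<partial>QB B\<bar> \<le> (\<integral>z. \<bar>(w t (fst z) - wb) * f t z\<bar> \<partial>QB B)" by (rule integral_abs_bound)
    also have "\<dots> \<le> d * (\<integral>z. \<bar>f t z\<bar> \<partial>QB B)"
      by (rule integrable_mult_bounded(2)[OF measurable_QB_continuous[OF continuous_on_fst_QB[OF cwb]] _ f_int[OF t]]) (auto intro: dev)
    also have "(\<integral>z. \<bar>f t z\<bar> \<partial>QB B) = Mf"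
      unfolding fmass_const[OF t, symmetric] 
    proof (rule integral_cong_AE)
      show "AE z in QB B. \<bar>f t z\<bar> = f t z" using f_nonneg[OF t] by eventually_elim simp
    qed (use f_int[OF t] in auto)
    finally show ?thesis .
  qed
  have a3: "\<bar>\<integral>z. (U t (fst z) - snd z) * f t z \<partial>QB B\<bar> \<le> sqrt (Mf / rm) * d"
    unfolding d_def by (rule order_trans[OF integral_abs_bound rel1[OF t]])
  have "wb * (rb + Mf) = (\<integral>z. (U t (fst z) - snd z) * f t z \<partial>QB B) - (\<integral>z. (w t (fst z) - wb) * f t z \<partial>QB B)
       - (\<integral>x. R t x * (w t x - wb) \<partial>T1)"
    using total_momentum[OF t] 1 2 by (simp add: distrib_left)
  then have "\<bar>wb * (rb + Mf)\<bar> \<le> sqrt (Mf / rm) * d + d * Mf + d * rb" using a1 a2 a3 by linarith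
  then have "\<bar>wb\<bar> * (rb + Mf) \<le> d * (rb + Mf) + sqrt (Mf / rm) * d" using pos by (simp add: abs_mult distrib_left)
  then have "\<bar>wb\<bar> \<le> (d * (rb + Mf) + sqrt (Mf / rm) * d) / (rb + Mf)" using pos by (simp add: pos_le_divide_eq)
  also have "\<dots> = d + sqrt (Mf / rm) / (rb + Mf) * d" using pos by (simp add: add_divide_distrib)
  finally have "\<bar>w t x\<bar> \<le> d + (d + sqrt (Mf / rm) / (rb + Mf) * d)" using dev[OF x] by linarith
  also have "\<dots> = CW * d" by (simp add: CW_def distrib_right)
  finally show ?thesis by (simp add: d_def)
qed

definition W :: "real \<Rightarrow> real" where "W t = l2 T1 (w t)"

lemma sw: "t \<ge> 0 \<Longrightarrow> sq_integrable T1 (w t)" by (rule wdD(5)[OF wdw])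
lemma sRb: "t \<ge> 0 \<Longrightarrow> sq_integrable T1 (\<lambda>x. R t x - rb)" by (rule wdD(4)[OF \<psi>(1)])

lemma W_le: "t \<ge> 0 \<Longrightarrow> W t \<le> CW * sqrt (Ds t)"
  unfolding W_def by (rule l2_T1_le_sup[OF wdD(7)[OF wdw] w_le])

lemma E1_bounds:
  assumes t: "t \<ge> 0"
  shows "rm / 2 * (W t)\<^sup>2 \<le> E1 t" "E1 t \<le> rp / 2 * CW\<^sup>2 * Ds t"
proof -
  have i: "integrable T1 (\<lambda>x. m t x * w t x)" "integrable T1 (\<lambda>x. (w t x)\<^sup>2)"
    by (intro T1.sq_integrable_integrable sq_integrable_T1_continuous continuous_intros cm cw t)+
  have mw: "m t x * w t x = R t x * (w t x)\<^sup>2" for x by (simp add: m_def power2_eq_square)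
  have "rm * (W t)\<^sup>2 = (\<integral>x. rm * (w t x)\<^sup>2 \<partial>T1)" by (simp add: W_def l2_power2)
  also have "\<dots> \<le> (\<integral>x. m t x * w t x \<partial>T1)"
    unfolding mw by (rule integral_mono) (use i R_bounds[OF t] in \<open>auto simp: mw intro: mult_right_mono\<close>)
  finally show "rm / 2 * (W t)\<^sup>2 \<le> E1 t" by (simp add: E1_def)
  have "(\<integral>x. m t x * w t x \<partial>T1) \<le> (\<integral>x. rp * (w t x)\<^sup>2 \<partial>T1)"
    unfolding mw by (rule integral_mono) (use i R_bounds[OF t] in \<open>auto simp: mw intro: mult_right_mono\<close>)
  also have "\<dots> = rp * (W t)\<^sup>2" by (simp add: W_def l2_power2)
  also have "\<dots> \<le> rp * (CW * sqrt (Ds t))\<^sup>2"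
    using W_le[OF t] rp_pos by (intro mult_left_mono power_mono) (auto simp: W_def)
  also have "\<dots> = rp * CW\<^sup>2 * Ds t" using Ds_nonneg[OF t] by (simp add: power_mult_distrib)
  finally show "E1 t \<le> rp / 2 * CW\<^sup>2 * Ds t" by (simp add: E1_def)
qed

lemma E2_bounds:
  obtains c C where "0 < c" "0 < C" "\<And>t. t \<ge> 0 \<Longrightarrow> c * (A t)\<^sup>2 \<le> E2 t" "\<And>t. t \<ge> 0 \<Longrightarrow> E2 t \<le> C * (A t)\<^sup>2"
proof -
  obtain c C where C: "0 < c" "0 < C"
    "\<And>r r'. r \<in> {rm..rp} \<Longrightarrow> r' \<in> {rm..rp} \<Longrightarrow>
      c * (r - r')\<^sup>2 \<le> r powr \<gamma> / (\<gamma> - 1) - r' powr \<gamma> / (\<gamma> - 1) - \<gamma> / (\<gamma> - 1) * r' powr (\<gamma> - 1) * (r - r')"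
    "\<And>r r'. r \<in> {rm..rp} \<Longrightarrow> r' \<in> {rm..rp} \<Longrightarrow>
      r powr \<gamma> / (\<gamma> - 1) - r' powr \<gamma> / (\<gamma> - 1) - \<gamma> / (\<gamma> - 1) * r' powr (\<gamma> - 1) * (r - r') \<le> C * (r - r')\<^sup>2"
    using powr_Bregman_bounds[OF \<gamma> rm rp_pos(2)] by metis
  define q where "q = \<gamma> / (\<gamma> - 1) * rb powr (\<gamma> - 1)"
  define p where "p t x = R t x powr \<gamma> / (\<gamma> - 1)" for t x
  define J where "J t x = p t x - rb powr \<gamma> / (\<gamma> - 1) - q * (R t x - rb)" for t x
  have rb: "rb \<in> {rm..rp}" using rb_bounds by simp
  have J: "c * (R t x - rb)\<^sup>2 \<le> J t x" "J t x \<le> C * (R t x - rb)\<^sup>2" if "t \<ge> 0" "x \<in> {0..1}" for t x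
    using C(3,4)[of "R t x" rb] R_bounds[OF that] rb by (auto simp: J_def p_def q_def)
  have ip: "integrable T1 (p t)" if t: "t \<ge> 0" for t
    unfolding p_def by (intro T1.sq_integrable_integrable sq_integrable_T1_continuous continuous_intros cRpowr t) (use \<gamma> in auto)
  have iJ: "integrable T1 (J t)" if t: "t \<ge> 0" for t
    unfolding J_def using ip[OF t] iR[OF t] by simp
  have EJ: "E2 t = (\<integral>x. J t x \<partial>T1)" if t: "t \<ge> 0" for t
    using ip[OF t] iR[OF t] mass_const[OF t] by (simp add: J_def E2_def p_def[symmetric] del: Bochner_Integration.integral_divide_zero)
  have iA: "integrable T1 (\<lambda>x. a * (R t x - rb)\<^sup>2)" if "t \<ge> 0" for a t
    using sRb[OF that] by (simp add: sq_integrable_def)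
  have A2: "a * (A t)\<^sup>2 = (\<integral>x. a * (R t x - rb)\<^sup>2 \<partial>T1)" for a t by (simp add: A_def l2_power2)
  show ?thesis
  proof (rule that[OF C(1,2)])
    fix t :: real assume t: "t \<ge> 0"
    show "c * (A t)\<^sup>2 \<le> E2 t" unfolding EJ[OF t] A2 by (rule integral_mono[OF iA[OF t] iJ[OF t]]) (use J(1)[OF t] in simp)
    show "E2 t \<le> C * (A t)\<^sup>2" unfolding EJ[OF t] A2 by (rule integral_mono[OF iJ[OF t] iA[OF t]]) (use J(2)[OF t] in simp)
  qed
qed

text \<open>\<open>v - us\<close> is the difference of \<open>w\<close> and the slip velocity \<open>u - v\<close>.\<close>

lemma E3_bounds:
  assumes t: "t \<ge> 0" shows "0 \<le> E3 t" "E3 t \<le> (CW\<^sup>2 * Mf + 1 / rm) * Ds t"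
proof -
  show "0 \<le> E3 t" unfolding E3_def using f_int_nonneg[OF t, of "\<lambda>z. (snd z - us)\<^sup>2"] by simp
  define K where "K = 2 * (CW\<^sup>2 * Ds t)"
  have c: "continuous_on ({0..1} \<times> {-B..B}) (\<lambda>z. (snd z - us)\<^sup>2)"
    "continuous_on ({0..1} \<times> {-B..B}) (\<lambda>z. K + 2 * (U t (fst z) - snd z)\<^sup>2)"
    "continuous_on ({0..1} \<times> {-B..B}) (\<lambda>z. (U t (fst z) - snd z)\<^sup>2)"
    by (intro continuous_intros cQ t)+
  have "(\<integral>z. (snd z - us)\<^sup>2 * f t z \<partial>QB B) \<le> (\<integral>z. (K + 2 * (U t (fst z) - snd z)\<^sup>2) * f t z \<partial>QB B)"
  proof (rule f_int_mono[OF t c(1,2)])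
    fix z :: "real \<times> real" assume z: "z \<in> {0..1} \<times> {-B..B}"
    then have x: "fst z \<in> {0..1}" by auto
    have "(w t (fst z))\<^sup>2 = \<bar>w t (fst z)\<bar>\<^sup>2" by simp
    also have "\<dots> \<le> (CW * sqrt (Ds t))\<^sup>2" by (rule power_mono[OF w_le[OF t x]]) simp
    also have "\<dots> = CW\<^sup>2 * Ds t" using Ds_nonneg[OF t] by (simp add: power_mult_distrib)
    finally have "(w t (fst z))\<^sup>2 \<le> CW\<^sup>2 * Ds t" .
    moreover have "(a - b)\<^sup>2 \<le> 2 * a\<^sup>2 + 2 * b\<^sup>2" for a b :: real
      using zero_le_power2[of "a + b"] by (simp add: power2_eq_square algebra_simps)
    from this[of "w t (fst z)" "U t (fst z) - snd z"]
    have "(snd z - us)\<^sup>2 \<le> 2 * (w t (fst z))\<^sup>2 + 2 * (U t (fst z) - snd z)\<^sup>2" by (simp add: w_def)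
    ultimately show "(snd z - us)\<^sup>2 \<le> K + 2 * (U t (fst z) - snd z)\<^sup>2" by (simp add: K_def)
  qed
  also have "\<dots> = (\<integral>z. K * f t z + 2 * ((U t (fst z) - snd z)\<^sup>2 * f t z) \<partial>QB B)"
    by (rule Bochner_Integration.integral_cong) (simp_all add: algebra_simps)
  also have "\<dots> = K * Mf + 2 * (\<integral>z. (U t (fst z) - snd z)\<^sup>2 * f t z \<partial>QB B)"
    using f_mult_int[OF t c(3)] f_int[OF t] fmass_const[OF t] by simp
  also have "\<dots> \<le> K * Mf + 2 * (Ds t / rm)" using rel2[OF t] by simp
  finally have "2 * E3 t \<le> K * Mf + 2 * (Ds t / rm)" by (simp add: E3_def)
  also have "\<dots> = 2 * ((CW\<^sup>2 * Mf + 1 / rm) * Ds t)" by (simp add: K_def field_simps)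
  finally show "E3 t \<le> (CW\<^sup>2 * Mf + 1 / rm) * Ds t" by simp
qed

lemma abs_X_le: assumes t: "t \<ge> 0" shows "\<bar>X t\<bar> \<le> rp / 2 * ((W t)\<^sup>2 + (A t)\<^sup>2)"
proof -
  have m: "sq_integrable T1 (m t)" by (intro sq_integrable_T1_continuous cm t)
  have "\<bar>X t\<bar> \<le> l2 T1 (m t) * l2 T1 (\<psi> t)" unfolding X_def by (rule l2_Cauchy_Schwarz[OF m wdD(5)[OF \<psi>(1)[OF t]]])
  also have "\<dots> \<le> (rp * W t) * A t"
  proof (rule mult_mono)
    show "l2 T1 (m t) \<le> rp * W t" unfolding m_def W_def
      by (rule sq_integrable_bounded_mult(2)[OF measurable_T1_continuous[OF cR[OF t]] _ sw[OF t]])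
         (use R_bounds[OF t] R_pos[OF t] in force)
    show "l2 T1 (\<psi> t) \<le> A t" by (rule l2_T1_le_sup[OF wdD(7)[OF \<psi>(1)[OF t]] \<psi>_sup[OF t]])
  qed (use rp_pos in \<open>auto simp: W_def\<close>)
  also have "\<dots> = rp * (W t * A t)" by simp
  also have "\<dots> \<le> rp * (((W t)\<^sup>2 + (A t)\<^sup>2) / 2)"
    using rp_pos sum_squares_bound[of "W t" "A t"] by (intro mult_left_mono) auto
  finally show ?thesis by simp
qed


text \<open>In the convective part \<open>R U w (R - rb) - R U (m - mb)\<close> the products \<open>R U m\<close> cancel, since \<open>m = R w\<close>.\<close>

lemma X_derivative_eq:
  assumes t: "t \<ge> 0"
  shows "flux B (fa t) (fb t) (\<psi> t) (\<lambda>x. R t x - rb) - (\<integral>x. (R t x * U t x) * (m t x - mb t) \<partial>T1)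
    = - (2 * rb * E1 t) + (mb t)\<^sup>2 + (\<integral>x. R t x powr \<gamma> * (R t x - rb) \<partial>T1)
      - (\<integral>x. ((1 + R t x powr \<beta>) * Ux t x) * (R t x - rb) \<partial>T1) - (\<integral>z. \<psi> t (fst z) * fb t z \<partial>QB B)"
proof -
  have c\<beta>: "continuous_on {0..1} (\<lambda>x. 1 + R t x powr \<beta>)" by (intro continuous_intros cRpowr t)
  obtain C where "\<And>x. x \<in> {0..1} \<Longrightarrow> \<bar>1 + R t x powr \<beta>\<bar> \<le> C" using continuous_bounded_T1[OF c\<beta>] by blast
  then have s\<mu>: "sq_integrable T1 (\<lambda>x. (1 + R t x powr \<beta>) * Ux t x)"
    by (intro sq_integrable_bounded_mult(1)[OF measurable_T1_continuous[OF c\<beta>] _ sUx[OF t]]) auto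
  have i: "integrable T1 (\<lambda>x. m t x * w t x)" "integrable T1 (\<lambda>x. m t x)" "integrable T1 (R t)"
    "integrable T1 (\<lambda>x. R t x powr \<gamma> * (R t x - rb))" "integrable T1 (\<lambda>x. (R t x * U t x) * (m t x - mb t))"
    by (intro T1.sq_integrable_integrable sq_integrable_T1_continuous continuous_intros cm cw cR cU cRpowr t)+
  have j: "integrable T1 (\<lambda>x. ((1 + R t x powr \<beta>) * Ux t x) * (R t x - rb))"
    by (rule sq_integrable_integrable_mult[OF s\<mu> sRb[OF t]])
  have k: "integrable T1 (\<lambda>x. fa t x * (R t x - rb))" by (rule sq_integrable_integrable_mult[OF sfa[OF t] sRb[OF t]])
  have "(\<integral>x. fa t x * (R t x - rb) \<partial>T1) - (\<integral>x. (R t x * U t x) * (m t x - mb t) \<partial>T1)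
     = (\<integral>x. R t x powr \<gamma> * (R t x - rb) - ((1 + R t x powr \<beta>) * Ux t x) * (R t x - rb)
          + (mb t * m t x + mb t * us * R t x - rb * (m t x * w t x) - rb * us * m t x) \<partial>T1)"
    unfolding Bochner_Integration.integral_diff[OF k i(5), symmetric]
    by (rule Bochner_Integration.integral_cong) (simp_all add: fa_def m_def w_def algebra_simps)
  also have "\<dots> = (\<integral>x. R t x powr \<gamma> * (R t x - rb) \<partial>T1) - (\<integral>x. ((1 + R t x powr \<beta>) * Ux t x) * (R t x - rb) \<partial>T1)
      + (mb t * mb t + mb t * us * rb - rb * (\<integral>x. m t x * w t x \<partial>T1) - rb * us * mb t)"
    using i j by (simp add: mass_const[OF t] mb_def[symmetric])
  finally show ?thesis by (simp add: flux_def E1_def power2_eq_square algebra_simps)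
qed

text \<open>Since \<open>R t - rb\<close> has mean zero, \<open>rb powr \<gamma>\<close> may be subtracted from the pressure, which is a strictly
  increasing function of the density.\<close>

lemma pressure_coercive:
  obtains \<kappa> where "\<kappa> > 0" "\<And>t. t \<ge> 0 \<Longrightarrow> \<kappa> * (A t)\<^sup>2 \<le> (\<integral>x. R t x powr \<gamma> * (R t x - rb) \<partial>T1)"
proof -
  define \<kappa> where "\<kappa> = \<gamma> * rm powr (\<gamma> - 1)"
  have mono: "\<kappa> * (r - s)\<^sup>2 \<le> (r powr \<gamma> - s powr \<gamma>) * (r - s)" if "rm \<le> r" "rm \<le> s" for r s
  proof -
    have *: "\<kappa> * (r - s)\<^sup>2 \<le> (r powr \<gamma> - s powr \<gamma>) * (r - s)" if rs: "rm \<le> s" "s < r" for r s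
    proof -
      have "\<exists>z. s < z \<and> z < r \<and> r powr \<gamma> - s powr \<gamma> = (r - s) * (\<gamma> * z powr (\<gamma> - 1))"
        by (rule MVT2[OF rs(2)]) (use rm rs in \<open>auto intro!: derivative_eq_intros\<close>)
      then obtain z where z: "s < z" "r powr \<gamma> - s powr \<gamma> = (r - s) * (\<gamma> * z powr (\<gamma> - 1))" by blast
      have "rm powr (\<gamma> - 1) \<le> z powr (\<gamma> - 1)" using rm z(1) rs \<gamma> by (intro powr_mono2) auto
      then have "\<kappa> \<le> \<gamma> * z powr (\<gamma> - 1)" using \<gamma> by (simp add: \<kappa>_def)
      then have "\<kappa> * (r - s)\<^sup>2 \<le> (\<gamma> * z powr (\<gamma> - 1)) * (r - s)\<^sup>2" by (rule mult_right_mono) simp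
      also have "\<dots> = (r powr \<gamma> - s powr \<gamma>) * (r - s)" by (simp add: z(2) power2_eq_square mult_ac)
      finally show ?thesis .
    qed
    show ?thesis
    proof (cases r s rule: linorder_cases)
      case less
      from *[OF that(1) less] show ?thesis by (simp add: power2_commute algebra_simps)
    next
      case greater
      from *[OF that(2) greater] show ?thesis .
    qed simp
  qed
  show ?thesis
  proof (rule that[of \<kappa>])
    show "\<kappa> > 0" using \<gamma> rm by (simp add: \<kappa>_def)
    fix t :: real assume t: "t \<ge> 0"
    have i: "integrable T1 (\<lambda>x. R t x powr \<gamma> * (R t x - rb))"
      by (intro T1.sq_integrable_integrable sq_integrable_T1_continuous continuous_intros cR cRpowr t)
    have "\<kappa> * (A t)\<^sup>2 = (\<integral>x. \<kappa> * (R t x - rb)\<^sup>2 \<partial>T1)" by (simp add: A_def l2_power2)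
    also have "\<dots> \<le> (\<integral>x. R t x powr \<gamma> * (R t x - rb) - rb powr \<gamma> * (R t x - rb) \<partial>T1)"
    proof (rule integral_mono)
      show "integrable T1 (\<lambda>x. \<kappa> * (R t x - rb)\<^sup>2)" using sRb[OF t] by (simp add: sq_integrable_def)
      show "integrable T1 (\<lambda>x. R t x powr \<gamma> * (R t x - rb) - rb powr \<gamma> * (R t x - rb))" using i iR[OF t] by simp
      fix x assume "x \<in> space T1"
      then have "rm \<le> R t x" using R_bounds[OF t] by simp
      from mono[OF this rb_bounds(1)]
      show "\<kappa> * (R t x - rb)\<^sup>2 \<le> R t x powr \<gamma> * (R t x - rb) - rb powr \<gamma> * (R t x - rb)" by (simp add: left_diff_distrib)
    qed
    also have "\<dots> = (\<integral>x. R t x powr \<gamma> * (R t x - rb) \<partial>T1)" using i iR[OF t] mass_const[OF t] by simp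
    finally show "\<kappa> * (A t)\<^sup>2 \<le> (\<integral>x. R t x powr \<gamma> * (R t x - rb) \<partial>T1)" .
  qed
qed

definition X' :: "real \<Rightarrow> real" where
  "X' t = flux B (fa t) (fb t) (\<psi> t) (\<lambda>x. R t x - rb) - (\<integral>x. (R t x * U t x) * (m t x - mb t) \<partial>T1)"

lemma A_nonneg: "0 \<le> A t" by (simp add: A_def)

text \<open>The pressure dominates \<open>(A t)\<^sup>2\<close>; the viscous and the drag term are at most \<open>K * sqrt (Ds t) * A t\<close> and
  are absorbed by Young's inequality, and the kinetic term is bounded by the dissipation.\<close>

lemma X'_lower:
  obtains k4 k5 where "k4 > 0" "k5 > 0" "\<And>t. t \<ge> 0 \<Longrightarrow> - X' t \<le> k4 * Ds t - k5 * (A t)\<^sup>2"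
proof -
  obtain \<kappa> where \<kappa>: "\<kappa> > 0" "\<And>t. t \<ge> 0 \<Longrightarrow> \<kappa> * (A t)\<^sup>2 \<le> (\<integral>x. R t x powr \<gamma> * (R t x - rb) \<partial>T1)"
    using pressure_coercive by metis
  define K where "K = (1 + rp powr \<beta>) + rp * sqrt (Mf / rm)"
  have K: "K > 0" unfolding K_def using rp_pos Mf_nonneg rm by (intro add_pos_nonneg mult_nonneg_nonneg) (auto intro: add_pos_nonneg)
  define k4 where "k4 = rp * rp * CW\<^sup>2 + K\<^sup>2 / (2 * \<kappa>)"
  show ?thesis
  proof (rule that[of k4 "\<kappa> / 2"])
    show "k4 > 0" unfolding k4_def using K \<kappa>(1) by (intro add_nonneg_pos) auto
    show "\<kappa> / 2 > 0" using \<kappa>(1) by simp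
    fix t :: real assume t: "t \<ge> 0"
    define d where "d = sqrt (Ds t)"
    have d: "d \<ge> 0" "d\<^sup>2 = Ds t" using Ds_nonneg[OF t] by (auto simp: d_def)
    have c\<beta>: "continuous_on {0..1} (\<lambda>x. 1 + R t x powr \<beta>)" by (intro continuous_intros cRpowr t)
    have \<mu>: "\<bar>1 + R t x powr \<beta>\<bar> \<le> 1 + rp powr \<beta>" if "x \<in> space T1" for x
      using R_bounds[OF t, of x] R_pos[OF t, of x] that \<beta> by (simp add: powr_mono2)
    note s\<mu> = sq_integrable_bounded_mult[OF measurable_T1_continuous[OF c\<beta>] \<mu> sUx[OF t]]
    have "\<bar>\<integral>x. ((1 + R t x powr \<beta>) * Ux t x) * (R t x - rb) \<partial>T1\<bar> \<le> l2 T1 (\<lambda>x. (1 + R t x powr \<beta>) * Ux t x) * A t"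
      unfolding A_def by (rule l2_Cauchy_Schwarz[OF s\<mu>(1) sRb[OF t]])
    also have "\<dots> \<le> ((1 + rp powr \<beta>) * d) * A t"
    proof (rule mult_right_mono[OF _ A_nonneg])
      have "(1 + rp powr \<beta>) * l2 T1 (Ux t) \<le> (1 + rp powr \<beta>) * d"
        using l2_Ux_le[OF t] by (intro mult_left_mono) (auto simp: d_def add_nonneg_nonneg)
      with s\<mu>(2) show "l2 T1 (\<lambda>x. (1 + R t x powr \<beta>) * Ux t x) \<le> (1 + rp powr \<beta>) * d" by linarith
    qed
    finally have 1: "\<bar>\<integral>x. ((1 + R t x powr \<beta>) * Ux t x) * (R t x - rb) \<partial>T1\<bar> \<le> ((1 + rp powr \<beta>) * d) * A t" .
    have irel: "integrable (QB B) (\<lambda>z. (U t (fst z) - snd z) * f t z)"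
      by (rule f_mult_int[OF t], intro continuous_intros cQ t)
    have "\<bar>\<integral>z. \<psi> t (fst z) * fb t z \<partial>QB B\<bar> \<le> (\<integral>z. \<bar>\<psi> t (fst z) * fb t z\<bar> \<partial>QB B)" by (rule integral_abs_bound)
    also have "\<dots> \<le> A t * (\<integral>z. \<bar>fb t z\<bar> \<partial>QB B)"
      by (rule integrable_mult_bounded(2)[OF measurable_QB_continuous[OF continuous_on_fst_QB[OF wdD(1)[OF \<psi>(1)[OF t]]]] _ ifb[OF t]])
         (auto intro: \<psi>_sup[OF t])
    also have "(\<integral>z. \<bar>fb t z\<bar> \<partial>QB B) = (\<integral>z. \<bar>R t (fst z) * ((U t (fst z) - snd z) * f t z)\<bar> \<partial>QB B)"
      by (simp add: fb_def mult.assoc)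
    also have "A t * \<dots> \<le> A t * (rp * (\<integral>z. \<bar>(U t (fst z) - snd z) * f t z\<bar> \<partial>QB B))"
    proof (rule mult_left_mono[OF _ A_nonneg])
      show "(\<integral>z. \<bar>R t (fst z) * ((U t (fst z) - snd z) * f t z)\<bar> \<partial>QB B) \<le> rp * (\<integral>z. \<bar>(U t (fst z) - snd z) * f t z\<bar> \<partial>QB B)"
        by (rule integrable_mult_bounded(2)[OF measurable_QB_continuous[OF cQ(1)[OF t]] _ irel])
           (use R_bounds[OF t] R_pos[OF t] in force)
    qed
    also have "\<dots> \<le> A t * (rp * (sqrt (Mf / rm) * d))"
      using rel1[OF t] rp_pos by (intro mult_left_mono A_nonneg) (auto simp: d_def)
    finally have 2: "\<bar>\<integral>z. \<psi> t (fst z) * fb t z \<partial>QB B\<bar> \<le> A t * (rp * (sqrt (Mf / rm) * d))" .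
    have 3: "2 * rb * E1 t \<le> rp * rp * CW\<^sup>2 * Ds t"
    proof -
      have "2 * rb * E1 t \<le> 2 * rb * (rp / 2 * CW\<^sup>2 * Ds t)"
        using E1_bounds(2)[OF t] rb_bounds rm by (intro mult_left_mono) auto
      also have "\<dots> = rb * (rp * CW\<^sup>2 * Ds t)" by simp
      also have "\<dots> \<le> rp * (rp * CW\<^sup>2 * Ds t)"
        using rb_bounds rp_pos Ds_nonneg[OF t] by (intro mult_right_mono) auto
      finally show ?thesis by (simp add: mult.assoc)
    qed
    have 4: "K * d * A t \<le> \<kappa> / 2 * (A t)\<^sup>2 + K\<^sup>2 / (2 * \<kappa>) * Ds t"
    proof -
      have "0 \<le> (\<kappa> * A t - K * d)\<^sup>2 / (2 * \<kappa>)" using \<kappa>(1) by simp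
      also have "\<dots> = \<kappa> / 2 * (A t)\<^sup>2 + K\<^sup>2 / (2 * \<kappa>) * d\<^sup>2 - K * d * A t"
        using \<kappa>(1) by (simp add: power2_eq_square field_simps)
      finally show ?thesis by (simp add: d(2))
    qed
    have Kd: "K * d * A t = ((1 + rp powr \<beta>) * d) * A t + A t * (rp * (sqrt (Mf / rm) * d))"
      by (simp add: K_def algebra_simps)
    have "- X' t = 2 * rb * E1 t - (mb t)\<^sup>2 - (\<integral>x. R t x powr \<gamma> * (R t x - rb) \<partial>T1)
      + (\<integral>x. ((1 + R t x powr \<beta>) * Ux t x) * (R t x - rb) \<partial>T1) + (\<integral>z. \<psi> t (fst z) * fb t z \<partial>QB B)"
      unfolding X'_def X_derivative_eq[OF t] by simp
    also have "\<dots> \<le> rp * rp * CW\<^sup>2 * Ds t - \<kappa> * (A t)\<^sup>2 + K * d * A t"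
      using 1 2 3 \<kappa>(2)[OF t] zero_le_power2[of "mb t"] unfolding Kd by linarith
    also have "\<dots> \<le> rp * rp * CW\<^sup>2 * Ds t - \<kappa> * (A t)\<^sup>2 + (\<kappa> / 2 * (A t)\<^sup>2 + K\<^sup>2 / (2 * \<kappa>) * Ds t)" using 4 by linarith
    also have "\<dots> = k4 * Ds t - \<kappa> / 2 * (A t)\<^sup>2" by (simp add: k4_def distrib_right)
    finally show "- X' t \<le> k4 * Ds t - \<kappa> / 2 * (A t)\<^sup>2" .
  qed
qed

subsection \<open>The Lyapunov functional\<close>

text \<open>The cross term enters with a factor \<open>\<epsilon>\<close> so small that it changes the energy by at most one half and
  consumes at most one half of the dissipation.  Of the other half, one part produces the exponential
  rate and the part \<open>Ds t / 4\<close> is kept to control the forcing of the particles.\<close>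

lemma lyapunov:
  obtains L L' :: "real \<Rightarrow> real" and lam c :: real where "0 < lam" "lam < rm" "0 < c"
    "\<And>t. t \<ge> 0 \<Longrightarrow> (L has_real_derivative L' t) (at t within {0..})"
    "\<And>t. t \<ge> 0 \<Longrightarrow> L' t \<le> - lam * L t - Ds t / 4"
    "\<And>t. t \<ge> 0 \<Longrightarrow> c * ((W t)\<^sup>2 + (A t)\<^sup>2) \<le> L t"
proof -
  obtain c2 C2 where E2: "0 < c2" "0 < C2" "\<And>t. t \<ge> 0 \<Longrightarrow> c2 * (A t)\<^sup>2 \<le> E2 t" "\<And>t. t \<ge> 0 \<Longrightarrow> E2 t \<le> C2 * (A t)\<^sup>2"
    using E2_bounds by metis
  obtain k4 k5 where k: "k4 > 0" "k5 > 0" "\<And>t. t \<ge> 0 \<Longrightarrow> - X' t \<le> k4 * Ds t - k5 * (A t)\<^sup>2"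
    using X'_lower by metis
  define k1 where "k1 = min (rm / 2) c2"
  define k3 where "k3 = rp / 2"
  define kD where "kD = rp / 2 * CW\<^sup>2 + (CW\<^sup>2 * Mf + 1 / rm)"
  define k2 where "k2 = max kD C2"
  define \<epsilon> where "\<epsilon> = min (k1 / (2 * k3)) (1 / (2 * k4))"
  have pos: "k1 > 0" "k3 > 0" "k2 > 0" using rm E2 rp_pos by (auto simp: k1_def k3_def k2_def)
  have \<epsilon>: "\<epsilon> > 0" "\<epsilon> * k3 \<le> k1 / 2" "\<epsilon> * k4 \<le> 1 / 2"
  proof -
    show "\<epsilon> > 0" using pos k(1) by (auto simp: \<epsilon>_def)
    have "\<epsilon> \<le> k1 / (2 * k3)" "\<epsilon> \<le> 1 / (2 * k4)" by (auto simp: \<epsilon>_def)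
    then show "\<epsilon> * k3 \<le> k1 / 2" "\<epsilon> * k4 \<le> 1 / 2" using pos k(1) by (auto simp: field_simps)
  qed
  define \<mu> where "\<mu> = min (1 / 4) (\<epsilon> * k5)"
  have \<mu>: "\<mu> > 0" using \<epsilon> k by (simp add: \<mu>_def)
  define lam where "lam = min (rm / 2) (\<mu> / (3 / 2 * k2))"
  define E where "E t = E1 t + E2 t + E3 t" for t
  define L where "L t = E t - \<epsilon> * X t" for t
  have El: "k1 * ((W t)\<^sup>2 + (A t)\<^sup>2) \<le> E t" if t: "t \<ge> 0" for t
  proof -
    have "k1 * (W t)\<^sup>2 \<le> rm / 2 * (W t)\<^sup>2" "k1 * (A t)\<^sup>2 \<le> c2 * (A t)\<^sup>2"
      by (rule mult_right_mono; simp add: k1_def)+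
    then show ?thesis using E1_bounds(1)[OF t] E2(3)[OF t] E3_bounds(1)[OF t] unfolding E_def distrib_left by linarith
  qed
  have Eu: "E t \<le> k2 * (Ds t + (A t)\<^sup>2)" if t: "t \<ge> 0" for t
  proof -
    have "kD * Ds t \<le> k2 * Ds t" "C2 * (A t)\<^sup>2 \<le> k2 * (A t)\<^sup>2"
      using Ds_nonneg[OF t] by (auto simp: k2_def intro!: mult_right_mono)
    moreover have "kD * Ds t = rp / 2 * CW\<^sup>2 * Ds t + (CW\<^sup>2 * Mf + 1 / rm) * Ds t" by (simp add: kD_def distrib_right)
    ultimately show ?thesis
      using E1_bounds(2)[OF t] E2(4)[OF t] E3_bounds(2)[OF t] unfolding E_def distrib_left by linarith
  qed
  have eX: "\<bar>\<epsilon> * X t\<bar> \<le> E t / 2" if t: "t \<ge> 0" for t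
  proof -
    have "\<bar>\<epsilon> * X t\<bar> = \<epsilon> * \<bar>X t\<bar>" using \<epsilon>(1) by (simp add: abs_mult)
    also have "\<dots> \<le> \<epsilon> * (k3 * ((W t)\<^sup>2 + (A t)\<^sup>2))" using abs_X_le[OF t] \<epsilon>(1) by (intro mult_left_mono) (auto simp: k3_def)
    also have "\<dots> = (\<epsilon> * k3) * ((W t)\<^sup>2 + (A t)\<^sup>2)" by simp
    also have "\<dots> \<le> k1 / 2 * ((W t)\<^sup>2 + (A t)\<^sup>2)" using \<epsilon>(2) by (intro mult_right_mono) auto
    also have "\<dots> \<le> E t / 2" using El[OF t] by simp
    finally show ?thesis .
  qed
  show ?thesis
  proof (rule that[of lam "k1 / 2" L "\<lambda>t. - Ds t - \<epsilon> * X' t"])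
    show "0 < lam" using rm \<mu> pos by (simp add: lam_def)
    show "lam < rm" using rm by (simp add: lam_def min_less_iff_disj)
    show "0 < k1 / 2" using pos by simp
    fix t :: real assume t: "t \<ge> 0"
    have DX: "(X has_real_derivative X' t) (at t within {0..})" unfolding X'_def by (rule X_derivative[OF t])
    show "(L has_real_derivative - Ds t - \<epsilon> * X' t) (at t within {0..})"
      unfolding L_def E_def by (rule DERIV_diff[OF energy_derivative[OF t] DERIV_cmult[OF DX]])
    have Lu: "L t \<le> 3 / 2 * (k2 * (Ds t + (A t)\<^sup>2))" using eX[OF t] Eu[OF t] unfolding L_def by linarith
    show "k1 / 2 * ((W t)\<^sup>2 + (A t)\<^sup>2) \<le> L t" using eX[OF t] El[OF t] unfolding L_def by linarith
    have "lam * L t \<le> lam * (3 / 2 * (k2 * (Ds t + (A t)\<^sup>2)))"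
      using Lu \<open>0 < lam\<close> by (intro mult_left_mono) auto
    also have "\<dots> \<le> \<mu> / (3 / 2 * k2) * (3 / 2 * (k2 * (Ds t + (A t)\<^sup>2)))"
      using pos Ds_nonneg[OF t] by (intro mult_right_mono) (auto simp: lam_def)
    also have "\<dots> = \<mu> * (Ds t + (A t)\<^sup>2)" using pos by simp
    also have "\<dots> \<le> Ds t / 4 + \<epsilon> * k5 * (A t)\<^sup>2"
    proof -
      have "\<mu> * Ds t \<le> 1 / 4 * Ds t" "\<mu> * (A t)\<^sup>2 \<le> \<epsilon> * k5 * (A t)\<^sup>2"
        using Ds_nonneg[OF t] by (intro mult_right_mono; simp add: \<mu>_def)+
      then show ?thesis by (simp add: distrib_left)
    qed
    finally have lL: "lam * L t \<le> Ds t / 4 + \<epsilon> * k5 * (A t)\<^sup>2" .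
    have "\<epsilon> * (- X' t) \<le> \<epsilon> * (k4 * Ds t - k5 * (A t)\<^sup>2)" using k(3)[OF t] \<epsilon>(1) by (intro mult_left_mono) auto
    also have "\<dots> = (\<epsilon> * k4) * Ds t - \<epsilon> * k5 * (A t)\<^sup>2" by (simp add: right_diff_distrib)
    also have "\<dots> \<le> 1 / 2 * Ds t - \<epsilon> * k5 * (A t)\<^sup>2" using mult_right_mono[OF \<epsilon>(3) Ds_nonneg[OF t]] by linarith
    finally show "- Ds t - \<epsilon> * X' t \<le> - lam * L t - Ds t / 4" using lL by simp
  qed
qed

subsection \<open>Decay of the velocity support\<close>

text \<open>All even moments around the limit velocity are compared with powers of one and the same radius \<open>r\<close>:
  the quotient of \<open>\<integral> \<bar>v - us\<bar>\<^sup>n f\<close> and \<open>r\<^sup>n\<close> cannot exceed the mass of \<open>f\<close>, because by Young's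
  inequality it decreases wherever it is larger.  Letting \<open>n\<close> tend to infinity excludes mass outside
  the radius, as in the convergence of \<open>L\<^sup>p\<close> norms to the \<open>L\<^sup>\<infinity>\<close> norm.\<close>

lemma support_le_radius:
  fixes r r' What :: "real \<Rightarrow> real"
  assumes r: "\<And>t. t \<ge> 0 \<Longrightarrow> r t > 0" "\<And>t. t \<ge> 0 \<Longrightarrow> (r has_real_derivative r' t) (at t within {0..})"
    and r': "\<And>t. t \<ge> 0 \<Longrightarrow> - rm * r t + rp * What t \<le> r' t"
    and What: "\<And>t x. t \<ge> 0 \<Longrightarrow> x \<in> {0..1} \<Longrightarrow> \<bar>w t x\<bar> \<le> What t"
    and r0: "\<And>v. v \<in> {-B..B} \<Longrightarrow> \<bar>v - us\<bar> \<le> r 0" and t: "t \<ge> 0"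
  shows "AE z in QB B. f t z \<noteq> 0 \<longrightarrow> \<bar>snd z - us\<bar> \<le> r t"
proof -
  define M where "M n t = (\<integral>z. (snd z - us) ^ n * f t z \<partial>QB B)" for n t
  define M' where "M' n t = (\<integral>z. (R t (fst z) * (U t (fst z) - snd z) * (real n * (snd z - us) ^ (n - 1))) * f t z \<partial>QB B)" for n t
  have c: "continuous_on ({0..1} \<times> {-B..B}) (\<lambda>z. (snd z - us) ^ n)"
    "continuous_on ({0..1} \<times> {-B..B}) (\<lambda>z. \<bar>snd z - us\<bar> ^ n)" for n
    by (intro continuous_intros)+
  have W0: "What t \<ge> 0" if "t \<ge> 0" for t using What[OF that, of 0] by (meson abs_ge_zero atLeastAtMost_iff order_refl order_trans zero_le_one)
  have moment: "M n t \<le> Mf * r t ^ n" if n: "even n" "n \<ge> 2" and t: "t \<ge> 0" for n t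
  proof -
    have n1: "n - 1 + 1 = n" using n by simp
    have xi: "x ^ n = \<bar>x\<bar> ^ n" "x ^ n = x * x ^ (n - 1)" "0 \<le> x ^ n" for x :: real
    proof -
      show "x ^ n = \<bar>x\<bar> ^ n" using n by (simp add: power_even_abs)
      show "x ^ n = x * x ^ (n - 1)" by (subst power_eq_if) (use n in simp)
      show "0 \<le> x ^ n" by (rule zero_le_even_power[OF n(1)])
    qed
    define G where "G t = M n t * inverse (r t) ^ n - Mf" for t
    define G' where "G' t = M' n t * inverse (r t) ^ n + real n * inverse (r t) ^ (n - 1) * (- (inverse (r t) * r' t * inverse (r t))) * M n t" for t
    have DG: "(G has_real_derivative G' t) (at t within {0..})" if t: "t \<ge> 0" for t
    proof -
      have dM: "(M n has_real_derivative M' n t) (at t within {0..})"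
        unfolding M_def M'_def by (rule moment_law[OF t])
      have di: "((\<lambda>t. inverse (r t)) has_real_derivative - (inverse (r t) * r' t * inverse (r t))) (at t within {0..})"
        by (rule DERIV_inverse'[OF r(2)[OF t]]) (use r(1)[OF t] in simp)
      have dp: "((\<lambda>t. inverse (r t) ^ n) has_real_derivative
          real n * inverse (r t) ^ (n - 1) * (- (inverse (r t) * r' t * inverse (r t)))) (at t within {0..})"
        using DERIV_power[OF di, of n] by (simp add: mult_ac)
      show ?thesis unfolding G_def G'_def
        using DERIV_diff[OF DERIV_mult[OF dM dp] DERIV_const[of Mf]] by simp
    qed
    have "G t \<le> 0"
    proof (rule nonpos_if_derivative_nonpos_where_pos[OF DG _ _ t])
      have "M n 0 \<le> (\<integral>z. r 0 ^ n * f 0 z \<partial>QB B)"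
        unfolding M_def
      proof (rule f_int_mono[OF order_refl c(1) continuous_on_const])
        fix z :: "real \<times> real" assume "z \<in> {0..1} \<times> {-B..B}"
        then have "\<bar>snd z - us\<bar> \<le> r 0" by (intro r0) auto
        then have "\<bar>snd z - us\<bar> ^ n \<le> r 0 ^ n" by (intro power_mono) auto
        then show "(snd z - us) ^ n \<le> r 0 ^ n" by (simp only: xi(1)[of "snd z - us", symmetric])
      qed
      also have "\<dots> = Mf * r 0 ^ n" using fmass_const[of 0] by simp
      finally have "M n 0 * inverse (r 0) ^ n \<le> Mf * r 0 ^ n * inverse (r 0) ^ n"
        using r(1)[of 0] by (intro mult_right_mono) auto
      also have "\<dots> = Mf" using r(1)[of 0] by (simp add: power_inverse)
      finally show "G 0 \<le> 0" by (simp add: G_def)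
    next
      fix t :: real assume t: "t \<ge> 0" and Gpos: "G t > 0"
      have rt: "r t > 0" by (rule r(1)[OF t])
      let ?y = "\<lambda>z::real \<times> real. \<bar>snd z - us\<bar>"
      define M1 where "M1 = (\<integral>z. ?y z ^ (n - 1) * f t z \<partial>QB B)"
      have M'le: "M' n t \<le> real n * (rp * What t * M1 - rm * M n t)"
      proof -
        have "M' n t \<le> (\<integral>z. (real n * (rp * What t * ?y z ^ (n - 1) - rm * (snd z - us) ^ n)) * f t z \<partial>QB B)"
          unfolding M'_def
        proof (rule f_int_mono[OF t])
          show "continuous_on ({0..1} \<times> {- B..B}) (\<lambda>z. R t (fst z) * (U t (fst z) - snd z) * (real n * (snd z - us) ^ (n - 1)))"
            "continuous_on ({0..1} \<times> {- B..B}) (\<lambda>z. real n * (rp * What t * ?y z ^ (n - 1) - rm * (snd z - us) ^ n))"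
            by (intro continuous_intros cQ t)+
          fix z :: "real \<times> real" assume z: "z \<in> {0..1} \<times> {-B..B}"
          then have x: "fst z \<in> {0..1}" by auto
          define \<xi> where "\<xi> = snd z - us"
          define a where "a = R t (fst z)"
          have a: "0 \<le> a" "rm \<le> a" "a \<le> rp" using R_bounds[OF t x] rm by (auto simp: a_def)
          have "a * w t (fst z) * \<xi> ^ (n - 1) \<le> \<bar>a * w t (fst z) * \<xi> ^ (n - 1)\<bar>" by simp
          also have "\<dots> = a * \<bar>w t (fst z)\<bar> * \<bar>\<xi>\<bar> ^ (n - 1)" using a by (simp add: abs_mult power_abs)
          also have "\<dots> \<le> rp * What t * \<bar>\<xi>\<bar> ^ (n - 1)"
            using a What[OF t x] by (intro mult_right_mono mult_mono) auto
          finally have 1: "a * w t (fst z) * \<xi> ^ (n - 1) \<le> rp * What t * \<bar>\<xi>\<bar> ^ (n - 1)" .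
          have 2: "rm * \<xi> ^ n \<le> a * \<xi> ^ n" using a xi(3) by (intro mult_right_mono) auto
          have rel: "U t (fst z) - snd z = w t (fst z) - \<xi>" by (simp add: w_def \<xi>_def)
          have "R t (fst z) * (U t (fst z) - snd z) * (real n * (snd z - us) ^ (n - 1))
              = real n * (a * w t (fst z) * \<xi> ^ (n - 1) - a * (\<xi> * \<xi> ^ (n - 1)))"
            unfolding rel a_def[symmetric] \<xi>_def[symmetric] by (simp add: algebra_simps)
          also have "\<dots> = real n * (a * w t (fst z) * \<xi> ^ (n - 1) - a * \<xi> ^ n)" by (simp only: xi(2)[symmetric])
          also have "\<dots> \<le> real n * (rp * What t * \<bar>\<xi>\<bar> ^ (n - 1) - rm * \<xi> ^ n)"
            using 1 2 by (intro mult_left_mono) auto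
          finally show "R t (fst z) * (U t (fst z) - snd z) * (real n * (snd z - us) ^ (n - 1))
              \<le> real n * (rp * What t * ?y z ^ (n - 1) - rm * (snd z - us) ^ n)" by (simp only: \<xi>_def)
        qed
        also have "\<dots> = (\<integral>z. real n * (rp * What t * (?y z ^ (n - 1) * f t z) - rm * ((snd z - us) ^ n * f t z)) \<partial>QB B)"
          by (rule Bochner_Integration.integral_cong) (simp_all add: algebra_simps)
        also have "\<dots> = real n * (rp * What t * M1 - rm * M n t)"
          using f_mult_int[OF t c(1)[of n]] f_mult_int[OF t c(2)[of "n - 1"]] by (simp add: M1_def M_def)
        finally show ?thesis .
      qed
      have Y: "real n * r t * M1 \<le> (real n - 1) * M n t + r t ^ n * Mf"
      proof -
        have "real n * r t * M1 = (\<integral>z. (real n * r t * ?y z ^ (n - 1)) * f t z \<partial>QB B)" by (simp add: M1_def mult.assoc)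
        also have "\<dots> \<le> (\<integral>z. ((real n - 1) * (snd z - us) ^ n + r t ^ n) * f t z \<partial>QB B)"
        proof (rule f_int_mono[OF t])
          show "continuous_on ({0..1} \<times> {- B..B}) (\<lambda>z. real n * r t * ?y z ^ (n - 1))"
            "continuous_on ({0..1} \<times> {- B..B}) (\<lambda>z. (real n - 1) * (snd z - us) ^ n + r t ^ n)"
            by (intro continuous_intros)+
          fix z :: "real \<times> real"
          have "real n * r t * ?y z ^ (n - 1) \<le> (real n - 1) * ?y z ^ n + r t ^ n"
            by (rule Young_power) (use n rt in auto)
          then show "real n * r t * ?y z ^ (n - 1) \<le> (real n - 1) * (snd z - us) ^ n + r t ^ n"
            by (simp only: xi(1)[of "snd z - us", symmetric])
        qed
        also have "\<dots> = (\<integral>z. (real n - 1) * ((snd z - us) ^ n * f t z) + r t ^ n * f t z \<partial>QB B)"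
          by (rule Bochner_Integration.integral_cong) (simp_all add: algebra_simps)
        also have "\<dots> = (real n - 1) * M n t + r t ^ n * Mf"
          using f_mult_int[OF t c(1)[of n]] f_int[OF t] fmass_const[OF t] by (simp add: M_def)
        finally show ?thesis .
      qed
      define q where "q = rp * What t / r t"
      have q: "q \<ge> 0" using rp_pos W0[OF t] rt by (simp add: q_def)
      have M0: "M n t \<ge> 0" unfolding M_def by (rule f_int_nonneg[OF t]) (rule xi(3))
      have "real n * (rp * What t * M1) = q * (real n * r t * M1)" using rt by (simp add: q_def)
      also have "\<dots> \<le> q * ((real n - 1) * M n t + r t ^ n * Mf)" using Y q by (rule mult_left_mono)
      finally have s1: "M' n t \<le> q * ((real n - 1) * M n t + r t ^ n * Mf) - real n * rm * M n t"
        using M'le by (simp add: right_diff_distrib mult.assoc)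
      have "- rm + q \<le> r' t / r t"
      proof -
        have "q * r t = rp * What t" using rt by (simp add: q_def)
        then have "(- rm + q) * r t \<le> r' t" using r'[OF t] unfolding distrib_right by linarith
        then show ?thesis using rt by (simp add: pos_le_divide_eq)
      qed
      then have s2: "real n * M n t * (- rm + q) \<le> real n * M n t * (r' t / r t)" using M0 by (intro mult_left_mono) auto
      have "M' n t - real n * M n t * (r' t / r t)
          \<le> (q * ((real n - 1) * M n t + r t ^ n * Mf) - real n * rm * M n t) - real n * M n t * (- rm + q)"
        using s1 s2 by linarith
      also have "\<dots> = q * (r t ^ n * Mf - M n t)" by (simp add: algebra_simps)
      also have "\<dots> \<le> 0"
      proof -
        have "Mf < M n t * inverse (r t) ^ n" using Gpos by (simp add: G_def)
        then have "Mf * r t ^ n < M n t * inverse (r t) ^ n * r t ^ n" using rt by (intro mult_strict_right_mono) auto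
        also have "\<dots> = M n t" using rt by (simp add: power_inverse)
        finally show ?thesis using q by (intro mult_nonneg_nonpos) (auto simp: mult.commute)
      qed
      finally have le0: "M' n t - real n * M n t * (r' t / r t) \<le> 0" .
      have pw: "inverse (r t) ^ n = inverse (r t) * inverse (r t) ^ (n - 1)" by (rule xi(2))
      have "G' t = inverse (r t) ^ n * (M' n t - real n * M n t * (r' t / r t))"
        unfolding G'_def pw by (simp add: divide_inverse algebra_simps)
      also have "\<dots> \<le> 0" using rt le0 by (intro mult_nonneg_nonpos) auto
      finally show "G' t \<le> 0" .
    qed
    then have "M n t * inverse (r t) ^ n \<le> Mf" by (simp add: G_def)
    then have le: "M n t * inverse (r t) ^ n * r t ^ n \<le> Mf * r t ^ n" using r(1)[OF t] by (intro mult_right_mono) auto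
    have eq: "M n t * inverse (r t) ^ n * r t ^ n = M n t" using r(1)[OF t] by (simp add: power_inverse)
    from le show ?thesis unfolding eq .
  qed
  \<comment> \<open>Chebyshev's inequality with the moment of order \<open>2 (k + 1)\<close>, for every \<open>k\<close>\<close>
  have far: "AE z in QB B. (1 + \<delta>) * r t \<le> \<bar>snd z - us\<bar> \<longrightarrow> f t z = 0" if \<delta>: "\<delta> > 0" for \<delta>
  proof -
    define S where "S = {z :: real \<times> real. (1 + \<delta>) * r t \<le> \<bar>snd z - us\<bar>}"
    define \<rho> where "\<rho> = (1 + \<delta>) * r t"
    have \<rho>: "\<rho> > 0" using \<delta> r(1)[OF t] by (simp add: \<rho>_def)
    have "closed S" unfolding S_def by (intro closed_Collect_le continuous_intros)
    then have Sm: "indicator S \<in> borel_measurable (QB B)" by (intro measurable_restrict_space1) auto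
    have iS: "integrable (QB B) (\<lambda>z. indicator S z * f t z)"
      by (rule integrable_mult_bounded(1)[OF Sm _ f_int[OF t], of 1]) (auto simp: indicator_def)
    have pos: "AE z in QB B. 0 \<le> indicator S z * f t z" using f_nonneg[OF t] by eventually_elim simp
    have bound: "(\<integral>z. indicator S z * f t z \<partial>QB B) \<le> Mf * inverse ((1 + \<delta>)\<^sup>2) ^ Suc k" for k
    proof -
      define n where "n = 2 * Suc k"
      have n: "even n" "n \<ge> 2" by (auto simp: n_def)
      have "(\<integral>z. indicator S z * f t z \<partial>QB B) \<le> (\<integral>z. inverse \<rho> ^ n * ((snd z - us) ^ n * f t z) \<partial>QB B)"
      proof (rule integral_mono_AE[OF iS integrable_mult_right[OF f_mult_int[OF t c(1)]]])
        show "AE z in QB B. indicator S z * f t z \<le> inverse \<rho> ^ n * ((snd z - us) ^ n * f t z)"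
          using f_nonneg[OF t]
        proof eventually_elim
          case (elim z)
          have "indicator S z \<le> inverse \<rho> ^ n * (snd z - us) ^ n"
          proof (cases "z \<in> S")
            case True
            then have "\<rho> ^ n \<le> \<bar>snd z - us\<bar> ^ n" using \<rho> by (intro power_mono) (auto simp: S_def \<rho>_def)
            then have "\<rho> ^ n \<le> (snd z - us) ^ n" using n by (simp add: power_even_abs)
            then have "inverse \<rho> ^ n * \<rho> ^ n \<le> inverse \<rho> ^ n * (snd z - us) ^ n" using \<rho> by (intro mult_left_mono) auto
            then show ?thesis using True \<rho> by (simp add: power_inverse)
          next
            case False
            then show ?thesis using \<rho> n by (simp add: zero_le_even_power)
          qed
          from mult_right_mono[OF this elim] show ?case by (simp add: mult.assoc)
        qed
      qed
      also have "\<dots> = inverse \<rho> ^ n * M n t" by (simp add: M_def)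
      also have "\<dots> \<le> inverse \<rho> ^ n * (Mf * r t ^ n)" using \<rho> by (intro mult_left_mono moment n t) auto
      also have "\<dots> = Mf * inverse (1 + \<delta>) ^ n" using r(1)[OF t] by (simp add: \<rho>_def power_mult_distrib power_inverse)
      also have "\<dots> = Mf * inverse ((1 + \<delta>)\<^sup>2) ^ Suc k" unfolding n_def power_mult by (simp only: power_inverse)
      finally show ?thesis .
    qed
    have "(\<lambda>k. Mf * inverse ((1 + \<delta>)\<^sup>2) ^ Suc k) \<longlonglongrightarrow> Mf * 0"
    proof (intro tendsto_mult tendsto_const LIMSEQ_Suc LIMSEQ_realpow_zero)
      have "1 < (1 + \<delta>)\<^sup>2" using \<delta> by (simp add: one_less_power)
      then show "inverse ((1 + \<delta>)\<^sup>2) < 1" by (rule inverse_less_1_iff[THEN iffD2, OF disjI2])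
    qed simp
    then have "(\<integral>z. indicator S z * f t z \<partial>QB B) \<le> Mf * 0"
      by (rule LIMSEQ_le_const) (use bound in auto)
    moreover have "0 \<le> (\<integral>z. indicator S z * f t z \<partial>QB B)" by (rule integral_nonneg_AE[OF pos])
    ultimately have "(\<integral>z. indicator S z * f t z \<partial>QB B) = 0" by simp
    then have "AE z in QB B. indicator S z * f t z = 0" using integral_nonneg_eq_0_iff_AE[OF iS pos] by simp
    then show ?thesis by eventually_elim (auto simp: S_def indicator_def)
  qed
  have "AE z in QB B. \<forall>k::nat. (1 + inverse (real (Suc k))) * r t \<le> \<bar>snd z - us\<bar> \<longrightarrow> f t z = 0"
    unfolding AE_all_countable by (intro allI far) simp
  then show ?thesis
  proof eventually_elim
    case (elim z)
    show ?case
    proof (rule impI, rule ccontr)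
      assume nz: "f t z \<noteq> 0" and "\<not> \<bar>snd z - us\<bar> \<le> r t"
      then have gt: "r t < \<bar>snd z - us\<bar>" by simp
      have "(\<lambda>k. (1 + inverse (real (Suc k))) * r t) \<longlonglongrightarrow> (1 + 0) * r t"
        by (intro tendsto_intros LIMSEQ_inverse_real_of_nat)
      then have "\<forall>\<^sub>F k in sequentially. (1 + inverse (real (Suc k))) * r t < \<bar>snd z - us\<bar>"
        using gt by (intro order_tendstoD(2)) auto
      then obtain k where "(1 + inverse (real (Suc k))) * r t < \<bar>snd z - us\<bar>" by (auto simp: eventually_sequentially)
      then show False using elim nz by (meson less_imp_le)
    qed
  qed
qed

text \<open>The product \<open>y t = exp (lam * t) * L t\<close> is nonincreasing, which gives the decay in \<open>L\<^sup>2\<close>.  The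
  density follows in the uniform norm by interpolation with its \<open>H\<^sup>1\<close> bound, at half the rate.  For the
  velocity support the radius \<open>r t = exp (- h * t) * (A0 - B0 * y t)\<close> is used: the derivative of
  \<open>- B0 * y t\<close> is at least a multiple of \<open>exp (lam * t) * Ds t\<close>, which pays for the forcing
  \<open>CW * sqrt (Ds t)\<close> by Young's inequality with weight \<open>exp (h * t)\<close>, where \<open>h = lam / 2\<close>.\<close>

theorem exponential_decay:
  obtains C lam :: real where "C > 0" "lam > 0"
    "\<And>t x. t \<ge> 0 \<Longrightarrow> x \<in> {0..1} \<Longrightarrow> \<bar>R t x - rb\<bar> \<le> C * exp (- lam * t)"
    "\<And>t. t \<ge> 0 \<Longrightarrow> l2 T1 (\<lambda>x. U t x - us) \<le> C * exp (- lam * t)"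
    "\<And>t. t \<ge> 0 \<Longrightarrow> AE z in QB B. f t z \<noteq> 0 \<longrightarrow> \<bar>snd z - us\<bar> \<le> C * exp (- lam * t)"
proof -
  obtain L L' :: "real \<Rightarrow> real" and lam c :: real where L: "0 < lam" "lam < rm" "0 < c"
    "\<And>t. t \<ge> 0 \<Longrightarrow> (L has_real_derivative L' t) (at t within {0..})"
    "\<And>t. t \<ge> 0 \<Longrightarrow> L' t \<le> - lam * L t - Ds t / 4"
    "\<And>t. t \<ge> 0 \<Longrightarrow> c * ((W t)\<^sup>2 + (A t)\<^sup>2) \<le> L t" using lyapunov by metis
  define y where "y t = exp (lam * t) * L t" for t
  define y' where "y' t = exp (lam * t) * (lam * L t + L' t)" for t
  have Dy: "(y has_real_derivative y' t) (at t within {0..})" if "t \<ge> 0" for t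
  proof -
    have e: "((\<lambda>t. exp (lam * t)) has_real_derivative exp (lam * t) * lam) (at t within {0..})"
      by (auto intro!: derivative_eq_intros)
    show ?thesis unfolding y_def y'_def using DERIV_mult[OF e L(4)[OF that]] by (simp add: algebra_simps)
  qed
  have y'le: "y' t \<le> - (exp (lam * t) * Ds t / 4)" if "t \<ge> 0" for t
  proof -
    have "lam * L t + L' t \<le> - (Ds t / 4)" using L(5)[OF that] by simp
    from mult_left_mono[OF this, of "exp (lam * t)"] show ?thesis by (simp add: y'_def)
  qed
  have y'0: "y' t \<le> 0" if "t \<ge> 0" for t
  proof -
    have "0 \<le> exp (lam * t) * Ds t / 4" using Ds_nonneg[OF that] by simp
    then show ?thesis using y'le[OF that] by linarith
  qed
  have ymono: "y t \<le> y 0" if "t \<ge> 0" for t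
    by (rule nonincreasing_within[OF Dy _ order_refl that]) (use y'0 in auto)
  have y0: "0 \<le> y t" if "t \<ge> 0" for t
  proof -
    have "0 \<le> c * ((W t)\<^sup>2 + (A t)\<^sup>2)" using L(3) by simp
    then show ?thesis using L(6)[OF that] by (simp add: y_def)
  qed
  have Ldec: "L t \<le> y 0 * exp (- lam * t)" if "t \<ge> 0" for t
  proof -
    have "L t = y t * exp (- lam * t)" by (simp add: y_def exp_minus field_simps)
    then show ?thesis using ymono[OF that] by (simp add: mult_right_mono)
  qed
  define h where "h = lam / 2"
  have h: "0 < h" "h < rm" "lam = 2 * h" using L(1,2) by (auto simp: h_def)
  define K where "K = sqrt (y 0 / c)"
  have K: "K \<ge> 0" using y0[of 0] L(3) by (simp add: K_def)
  have e2: "exp (- lam * t) = (exp (- h * t))\<^sup>2" for t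
    unfolding h(3) power2_eq_square by (simp add: mult_exp_exp[symmetric] exp_add[symmetric])
  have WA: "(W t)\<^sup>2 \<le> (K * exp (- h * t))\<^sup>2" "(A t)\<^sup>2 \<le> (K * exp (- h * t))\<^sup>2" if t: "t \<ge> 0" for t
  proof -
    have K2: "(K * exp (- h * t))\<^sup>2 = y 0 * exp (- lam * t) / c"
      unfolding power_mult_distrib e2[symmetric] using y0[of 0] L(3) by (simp add: K_def)
    have "c * ((W t)\<^sup>2 + (A t)\<^sup>2) \<le> y 0 * exp (- lam * t)" using L(6)[OF t] Ldec[OF t] by linarith
    then have "(W t)\<^sup>2 + (A t)\<^sup>2 \<le> y 0 * exp (- lam * t) / c" using L(3) by (simp add: pos_le_divide_eq mult.commute)
    then show "(W t)\<^sup>2 \<le> (K * exp (- h * t))\<^sup>2" "(A t)\<^sup>2 \<le> (K * exp (- h * t))\<^sup>2"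
      unfolding K2 using zero_le_power2[of "W t"] zero_le_power2[of "A t"] by linarith+
  qed
  have Wd: "W t \<le> K * exp (- h * t)" and Ad: "A t \<le> K * exp (- h * t)" if t: "t \<ge> 0" for t
    using power2_le_imp_le[OF WA(1)[OF t]] power2_le_imp_le[OF WA(2)[OF t]] K by auto
  define Ks where "Ks = sqrt (K\<^sup>2 + 2 * (K * max 0 C0))"
  have Rd: "\<bar>R t x - rb\<bar> \<le> Ks * exp (- (h / 2) * t)" if t: "t \<ge> 0" and x: "x \<in> {0..1}" for t x
  proof -
    define e where "e = exp (- h * t)"
    have e: "0 < e" "e \<le> 1" using h t by (auto simp: e_def)
    have wg: "wd (\<lambda>x. R t x - rb) (Rx t)" using wd_diff[OF wdR[OF t] wd_const[of rb]] by simp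
    note wg2 = wd_power2[OF wg]
    have "(R t x - rb)\<^sup>2 \<le> (A t)\<^sup>2 + (\<integral>x. \<bar>2 * (R t x - rb) * Rx t x\<bar> \<partial>T1)"
      using wd_deviation_le[OF wg2 x] unfolding A_def l2_power2 by linarith
    also have "(\<integral>x. \<bar>2 * (R t x - rb) * Rx t x\<bar> \<partial>T1) = (\<integral>x. 2 * \<bar>(R t x - rb) * Rx t x\<bar> \<partial>T1)"
      by (simp only: abs_mult mult.assoc abs_numeral)
    also have "\<dots> = 2 * (\<integral>x. \<bar>(R t x - rb) * Rx t x\<bar> \<partial>T1)" by simp
    also have "\<dots> \<le> 2 * (A t * max 0 C0)"
      using l2_Cauchy_Schwarz_abs[OF sRb[OF t] sRx[OF t]] mult_left_mono[OF Rx_bound[OF t] A_nonneg[of t]]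
        mult_left_mono[of C0 "max 0 C0" "A t"] A_nonneg[of t] unfolding A_def[symmetric] by auto
    also have "\<dots> \<le> 2 * ((K * e) * max 0 C0)" using Ad[OF t] by (intro mult_left_mono mult_right_mono) (auto simp: e_def)
    also have "(A t)\<^sup>2 \<le> K\<^sup>2 * e"
    proof -
      have "(A t)\<^sup>2 \<le> K\<^sup>2 * (e * e)"
        using WA(2)[OF t] unfolding e_def[symmetric] power_mult_distrib power2_eq_square[of e] .
      also have "\<dots> \<le> K\<^sup>2 * e" using e by (intro mult_left_mono mult_left_le) auto
      finally show ?thesis .
    qed
    finally have "(R t x - rb)\<^sup>2 \<le> (K\<^sup>2 + 2 * (K * max 0 C0)) * e" by (simp add: algebra_simps)
    also have "\<dots> = (Ks * exp (- (h / 2) * t))\<^sup>2"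
    proof -
      have "e = (exp (- (h / 2) * t))\<^sup>2" unfolding e_def power2_eq_square by (simp add: exp_add[symmetric])
      moreover have "K\<^sup>2 + 2 * (K * max 0 C0) = Ks\<^sup>2" using K by (simp add: Ks_def)
      ultimately show ?thesis by (simp add: power_mult_distrib)
    qed
    finally have "\<bar>R t x - rb\<bar>\<^sup>2 \<le> (Ks * exp (- (h / 2) * t))\<^sup>2" by (simp only: power2_abs)
    moreover have "0 \<le> Ks * exp (- (h / 2) * t)" using K by (simp add: Ks_def)
    ultimately show ?thesis by (rule power2_le_imp_le)
  qed
  \<comment> \<open>\<open>D0\<close> covers the initial support, and \<open>(rm - h) * D0\<close> pays for the term of Young's inequality without dissipation\<close>
  define B0 where "B0 = 2 * (rp * CW)"
  define D0 where "D0 = rp * CW / (2 * (rm - h)) + (B + \<bar>us\<bar>) * (if B \<ge> 0 then 1 else 0) + 1"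
  define A0 where "A0 = B0 * y 0 + D0"
  have rc: "rp * CW > 0" using rp_pos CW_pos by simp
  have B0: "B0 > 0" using rc by (simp add: B0_def)
  have D0: "D0 > 0" "rp * CW / (2 * (rm - h)) \<le> D0" using rc h by (auto simp: D0_def intro: add_nonneg_pos)
  define r where "r t = exp (- h * t) * (A0 - B0 * y t)" for t
  define r' where "r' t = exp (- h * t) * (- h) * (A0 - B0 * y t) + - (B0 * y' t) * exp (- h * t)" for t
  have bracket: "D0 \<le> A0 - B0 * y t" if "t \<ge> 0" for t
    using mult_left_mono[OF ymono[OF that], of B0] B0 by (simp add: A0_def)
  have supp: "AE z in QB B. f t z \<noteq> 0 \<longrightarrow> \<bar>snd z - us\<bar> \<le> r t" if t: "t \<ge> 0" for t
  proof (rule support_le_radius[where r=r and r'=r' and What="\<lambda>t. CW * sqrt (Ds t)", OF _ _ _ w_le _ t])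
    fix t :: real assume t: "t \<ge> 0"
    have br: "A0 - B0 * y t > 0" using bracket[OF t] D0 by simp
    then show "0 < r t" by (simp add: r_def)
    have e: "((\<lambda>t. exp (- h * t)) has_real_derivative exp (- h * t) * (- h)) (at t within {0..})"
      by (auto intro!: derivative_eq_intros)
    have b: "((\<lambda>t. A0 - B0 * y t) has_real_derivative - (B0 * y' t)) (at t within {0..})"
      using DERIV_diff[OF DERIV_const[of A0] DERIV_cmult[OF Dy[OF t], of B0]] by simp
    show "(r has_real_derivative r' t) (at t within {0..})"
      unfolding r_def r'_def by (rule DERIV_mult[OF e b])
    define p where "p = exp (h * t)"
    have p: "p > 0" "exp (- h * t) = 1 / p" "exp (lam * t) = p * p"
      by (auto simp: p_def exp_minus divide_inverse h(3) exp_add[symmetric])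
    define d where "d = sqrt (Ds t)"
    have d: "d * d = Ds t" using Ds_nonneg[OF t] by (simp add: d_def)
    \<comment> \<open>the second term is paid by the decrease of \<open>y\<close>, the first by the surplus \<open>rm - h\<close> of the contraction rate\<close>
    have am: "2 * d \<le> 1 / p + p * (d * d)"
    proof -
      have "0 \<le> (1 - p * d)\<^sup>2 / p" using p by simp
      also have "\<dots> = 1 / p + p * (d * d) - 2 * d" using p(1) by (simp add: power2_eq_square field_simps)
      finally show ?thesis by simp
    qed
    have "B0 * (p * p * (d * d) / 4) / p \<le> - (B0 * y' t) * exp (- h * t)"
    proof -
      have "B0 * (p * p * (d * d) / 4) \<le> B0 * (- y' t)"
        using y'le[OF t] B0 by (intro mult_left_mono) (auto simp: p(3) d)
      then have "B0 * (p * p * (d * d) / 4) / p \<le> B0 * (- y' t) / p" using p(1) by (intro divide_right_mono) auto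
      also have "B0 * (- y' t) / p = - (B0 * y' t) * (1 / p)" by simp
      finally show ?thesis unfolding p(2) .
    qed
    moreover have "B0 * (p * p * (d * d) / 4) / p = rp * CW / 2 * (p * (d * d))" using p(1) by (simp add: B0_def field_simps)
    ultimately have g1: "rp * CW / 2 * (p * (d * d)) \<le> - (B0 * y' t) * exp (- h * t)" by simp
    have g2: "rp * CW / 2 * (1 / p) \<le> (rm - h) * r t"
    proof -
      have "rp * CW / (2 * (rm - h)) \<le> A0 - B0 * y t" using bracket[OF t] D0 by linarith
      then have "rp * CW / (2 * (rm - h)) * (rm - h) \<le> (A0 - B0 * y t) * (rm - h)"
        using h by (intro mult_right_mono) auto
      moreover have "a / (2 * k) * k = a / 2" if "k > 0" for a k :: real using that by simp
      from this[of "rm - h" "rp * CW"] h have "rp * CW / (2 * (rm - h)) * (rm - h) = rp * CW / 2" by simp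
      ultimately have "rp * CW / 2 \<le> (rm - h) * (A0 - B0 * y t)" by (simp only: mult.commute)
      from mult_right_mono[OF this, of "1 / p"] p(1)
      have "rp * CW / 2 * (1 / p) \<le> (rm - h) * (A0 - B0 * y t) * (1 / p)" by simp
      also have "\<dots> = (rm - h) * (1 / p * (A0 - B0 * y t))" by simp
      finally show ?thesis unfolding r_def p(2) .
    qed
    have "rp * (CW * d) = rp * CW / 2 * (2 * d)" by simp
    also have "\<dots> \<le> rp * CW / 2 * (1 / p + p * (d * d))" using am rc by (intro mult_left_mono) auto
    also have "\<dots> \<le> (rm - h) * r t + - (B0 * y' t) * exp (- h * t)" using g1 g2 unfolding distrib_left by linarith
    finally have "rp * (CW * d) \<le> rm * r t + (- h * r t + - (B0 * y' t) * exp (- h * t))" by (simp add: left_diff_distrib)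
    moreover have "r' t = - h * r t + - (B0 * y' t) * exp (- h * t)" by (simp add: r'_def r_def)
    ultimately show "- rm * r t + rp * (CW * sqrt (Ds t)) \<le> r' t" by (simp add: d_def)
  next
    fix v assume v: "v \<in> {-B..B}"
    then have "B \<ge> 0" by simp
    then have "B + \<bar>us\<bar> \<le> D0" using rc h by (simp add: D0_def)
    also have "D0 = r 0" by (simp add: r_def A0_def)
    finally show "\<bar>v - us\<bar> \<le> r 0" using v by auto
  qed
  have A0: "A0 > 0" using bracket[of 0] mult_nonneg_nonneg[OF less_imp_le[OF B0] y0[of 0]] D0 by simp
  have rle: "r t \<le> A0 * exp (- h * t)" if "t \<ge> 0" for t
  proof -
    have "0 \<le> B0 * y t" using B0 y0[OF that] by simp
    then have "exp (- h * t) * (A0 - B0 * y t) \<le> exp (- h * t) * A0" by (intro mult_left_mono) auto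
    then show ?thesis by (simp add: r_def mult.commute)
  qed
  define C where "C = max A0 (max K Ks)"
  have C: "C > 0" "A0 \<le> C" "K \<le> C" "Ks \<le> C" using A0 by (auto simp: C_def)
  have mono: "a * exp (- h * t) \<le> C * exp (- (h / 2) * t)" if "a \<le> C" "t \<ge> 0" for a t
  proof -
    have "a * exp (- h * t) \<le> C * exp (- h * t)" using that by (intro mult_right_mono) auto
    also have "\<dots> \<le> C * exp (- (h / 2) * t)" using C h that by (intro mult_left_mono) auto
    finally show ?thesis .
  qed
  show ?thesis
  proof (rule that[of C "h / 2"])
    show "C > 0" "h / 2 > 0" using C h by auto
    show "\<bar>R t x - rb\<bar> \<le> C * exp (- (h / 2) * t)" if "t \<ge> 0" "x \<in> {0..1}" for t x
      by (rule order_trans[OF Rd[OF that] mult_right_mono[OF C(4)]]) simp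
    show "l2 T1 (\<lambda>x. U t x - us) \<le> C * exp (- (h / 2) * t)" if "t \<ge> 0" for t
      using Wd[OF that] mono[OF C(3) that] unfolding W_def w_def by linarith
    show "AE z in QB B. f t z \<noteq> 0 \<longrightarrow> \<bar>snd z - us\<bar> \<le> C * exp (- (h / 2) * t)" if "t \<ge> 0" for t
      using supp[OF that] by eventually_elim (use rle[OF that] mono[OF C(2) that] in linarith)
  qed
qed

end

section \<open>Essential supports and the Wasserstein distance\<close>

text \<open>By the Lindelof property countably many of the open null sets cover the complement of the essential
  support.\<close>

lemma ess_supp_AE:
  assumes "ess_supp g \<subseteq> K" "closed K"
  shows "AE v in lborel. v \<notin> K \<longrightarrow> g v = 0"
proof -
  define F where "F = {U :: real set. open U \<and> (AE v in lborel. v \<in> U \<longrightarrow> g v = 0)}"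
  have sub: "- K \<subseteq> \<Union>F" using assms(1) unfolding ess_supp_def F_def by blast
  have "\<And>S. S \<in> F \<Longrightarrow> open S" by (simp add: F_def)
  then obtain F' where F': "F' \<subseteq> F" "countable F'" "\<Union>F' = \<Union>F" by (rule Lindelof)
  have "AE v in lborel. \<forall>U\<in>F'. v \<in> U \<longrightarrow> g v = 0"
    unfolding AE_ball_countable[OF F'(2)] using F'(1) by (auto simp: F_def)
  then show ?thesis
  proof eventually_elim
    case (elim v)
    show ?case
    proof
      assume "v \<notin> K"
      then have "v \<in> \<Union>F'" using sub F'(3) by blast
      then show "g v = 0" using elim by blast
    qed
  qed
qed

lemma ess_supp_subsetI:
  assumes "AE v in lborel. v \<notin> K \<longrightarrow> g v = 0" "closed K"
  shows "ess_supp g \<subseteq> K"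
proof -
  have "open (- K)" "AE v in lborel. v \<in> - K \<longrightarrow> g v = 0" using assms by auto
  then show ?thesis unfolding ess_supp_def by blast
qed

lemma AE_lborel_prodD:
  fixes P :: "real \<times> real \<Rightarrow> bool"
  assumes "AE z in lborel. P z" shows "AE x in lborel. AE v in lborel. P (x, v)"
  using assms unfolding lborel_prod[symmetric] by (rule lborel_pair.AE_pair)

lemma AE_lborel_prodI:
  fixes P :: "real \<times> real \<Rightarrow> bool"
  assumes "AE x in lborel. AE v in lborel. P (x, v)" "{z. P z} \<in> sets borel"
  shows "AE z in lborel. P z"
proof -
  have "{z \<in> space (lborel \<Otimes>\<^sub>M lborel). P z} \<in> sets (lborel \<Otimes>\<^sub>M lborel)"
    using assms(2) unfolding lborel_prod by simp
  from lborel_pair.AE_pair_measure[OF this assms(1)] show ?thesis unfolding lborel_prod .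
qed

lemma AE_periodic:
  fixes P :: "real \<Rightarrow> bool"
  assumes AE: "AE x in lborel. x \<in> {0..1} \<longrightarrow> P x" and per: "\<And>x. P (x + 1) = P x"
  shows "AE x in lborel. P x"
proof -
  have pern: "P (x + real n) = P x" for x n
    by (induction n) (use per in \<open>auto simp: add.assoc[symmetric] add.commute[of 1]\<close>)
  have peri: "P (x - of_int k) = P x" for x k
  proof (cases "k \<ge> 0")
    case True then show ?thesis using pern[of "x - of_int k" "nat k"] by simp
  next
    case False then show ?thesis using pern[of x "nat (- k)"] by simp
  qed
  obtain N where N: "N \<in> null_sets lborel" "{x. \<not> (x \<in> {0..1} \<longrightarrow> P x)} \<subseteq> N"
    using AE[unfolded eventually_ae_filter] by auto
  have "{x. x - of_int k \<in> N} \<in> null_sets lborel" for k by (rule null_sets_translation[OF N(1)])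
  then have "(\<Union>k::int. {x. x - of_int k \<in> N}) \<in> null_sets lborel" by (intro null_sets_UN')  auto
  moreover have "{x \<in> space lborel. \<not> P x} \<subseteq> (\<Union>k::int. {x. x - of_int k \<in> N})"
  proof
    fix x assume "x \<in> {x \<in> space lborel. \<not> P x}"
    then have "\<not> P (x - of_int \<lfloor>x\<rfloor>)" using peri by simp
    moreover have "x - of_int \<lfloor>x\<rfloor> \<in> {0..1}"
      using of_int_floor_le[of x] real_of_int_floor_add_one_gt[of x] unfolding atLeastAtMost_iff by linarith
    ultimately have "x - of_int \<lfloor>x\<rfloor> \<in> N" using N(2) by blast
    then show "x \<in> (\<Union>k::int. {x. x - of_int k \<in> N})" by blast
  qed
  ultimately show ?thesis unfolding eventually_ae_filter by blast
qed

text \<open>The integrals of the difference quotients over \<open>[a, b]\<close> converge to \<open>g b - g a\<close>, while by dominated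
  convergence the part in which they exceed 1 disappears in the limit.\<close>

lemma lipschitz_increment_le:
  fixes g :: "real \<Rightarrow> real"
  assumes lip: "\<And>x y. \<bar>g x - g y\<bar> \<le> L * \<bar>x - y\<bar>"
    and d: "AE v in lborel. \<exists>d. (g has_real_derivative d) (at v) \<and> \<bar>d\<bar> \<le> 1" and ab: "a \<le> b"
  shows "g b - g a \<le> b - a"
proof -
  have L: "L \<ge> 0" using lip[of 1 0] by (simp add: order_trans[OF abs_ge_zero])
  have cg: "continuous_on UNIV g"
  proof (rule continuous_onI)
    fix x e :: real assume e: "e > 0"
    show "\<exists>d>0. \<forall>x'\<in>UNIV. dist x' x < d \<longrightarrow> dist (g x') (g x) \<le> e"
    proof (intro exI[of _ "e / (L + 1)"] conjI ballI impI)
      show "0 < e / (L + 1)" using e L by simp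
      fix x' assume "dist x' x < e / (L + 1)"
      then have "(L + 1) * \<bar>x' - x\<bar> < e" using L by (simp add: dist_real_def pos_less_divide_eq mult.commute)
      moreover have "L * \<bar>x' - x\<bar> \<le> (L + 1) * \<bar>x' - x\<bar>" by (simp add: mult_right_mono)
      ultimately show "dist (g x') (g x) \<le> e" using lip[of x' x] by (simp add: dist_real_def)
    qed
  qed
  define h where "h n = inverse (real (Suc n))" for n
  have h: "h n > 0" "h \<longlonglongrightarrow> 0" for n using LIMSEQ_inverse_real_of_nat by (auto simp: h_def[abs_def])
  obtain G where G: "\<And>x. (G has_real_derivative g x) (at x)" using continuous_has_antiderivative[OF cg] by blast
  define q where "q n v = (g (v + h n) - g v) / h n" for n v
  define p where "p n v = max (\<bar>q n v\<bar> - 1) 0" for n v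
  have cq: "continuous_on A (q n)" for n A
    unfolding q_def by (intro continuous_intros continuous_on_compose2[OF cg]) (use h(1)[of n] in auto)
  have cp: "continuous_on A (p n)" for n A unfolding p_def by (intro continuous_intros cq)
  have ql: "\<bar>q n v\<bar> \<le> L" for n v
    using lip[of "v + h n" v] h(1)[of n] by (simp add: q_def abs_divide pos_divide_le_eq)
  have Dq: "(\<lambda>n. (H (v + h n) - H v) / h n) \<longlonglongrightarrow> H'" if "(H has_real_derivative H') (at v)" for H H' v
  proof -
    have "filterlim h (at 0) sequentially"
      using h(2) h(1) by (intro filterlim_atI) (auto intro: always_eventually simp: less_imp_neq[symmetric])
    from filterlim_compose[OF that[unfolded DERIV_def] this] show ?thesis .
  qed
  have pl: "AE v in lborel. (\<lambda>n. indicator {a..b} v * p n v) \<longlonglongrightarrow> indicator {a..b} v * 0"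
    using d
  proof eventually_elim
    case (elim v)
    then obtain d where d: "(g has_real_derivative d) (at v)" "\<bar>d\<bar> \<le> 1" by blast
    have "(\<lambda>n. p n v) \<longlonglongrightarrow> max (\<bar>d\<bar> - 1) 0"
      unfolding p_def q_def by (intro tendsto_intros Dq d(1))
    then have "(\<lambda>n. p n v) \<longlonglongrightarrow> 0" using d(2) by simp
    then show ?case by (intro tendsto_intros)
  qed
  have ip: "set_integrable lborel {a..b} (p n)" "set_integrable lborel {a..b} (q n)" for n
    unfolding set_integrable_def by (rule borel_integrable_compact[OF compact_Icc], rule cp cq)+
  have "(\<lambda>n. \<integral>v. indicator {a..b} v * p n v \<partial>lborel) \<longlonglongrightarrow> (\<integral>v. indicator {a..b} v * 0 \<partial>lborel)"
  proof (rule integral_dominated_convergence[where w="\<lambda>v. indicator {a..b} v * L"])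
    show "AE v in lborel. norm (indicator {a..b} v * p n v) \<le> indicator {a..b} v * L" for n
    proof (rule AE_I2)
      fix v show "norm (indicator {a..b} v * p n v) \<le> indicator {a..b} v * L"
        using ql[of n v] L by (auto simp: p_def indicator_def)
    qed
    have "p n \<in> borel_measurable borel" for n by (rule borel_measurable_continuous_onI[OF cp])
    then show "(\<lambda>v. indicator {a..b} v * p n v) \<in> borel_measurable lborel" for n by simp
    show "integrable lborel (\<lambda>v. indicator {a..b} v * L)"
      using borel_integrable_compact[OF compact_Icc continuous_on_const[of "{a..b}" L]] by simp
  qed (use pl in simp_all)
  then have limp: "(\<lambda>n. LINT v:{a..b}|lborel. p n v) \<longlonglongrightarrow> 0" by (simp add: set_lebesgue_integral_def)
  have ub: "(LINT v:{a..b}|lborel. q n v) \<le> (b - a) + (LINT v:{a..b}|lborel. p n v)" for n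
  proof -
    have i1: "set_integrable lborel {a..b} (\<lambda>_. 1 :: real)"
      unfolding set_integrable_def by (rule borel_integrable_compact[OF compact_Icc continuous_on_const])
    have "(LINT v:{a..b}|lborel. q n v) \<le> (LINT v:{a..b}|lborel. 1 + p n v)"
      by (rule set_integral_mono[OF ip(2) set_integral_add(1)[OF i1 ip(1)]]) (simp add: p_def)
    also have "\<dots> = (LINT v:{a..b}|lborel. 1) + (LINT v:{a..b}|lborel. p n v)" by (rule set_integral_add(2)[OF i1 ip(1)])
    also have "(LINT v:{a..b}|lborel. (1::real)) = b - a" using ab by (simp add: set_lebesgue_integral_def)
    finally show ?thesis .
  qed
  have eqq: "(LINT v:{a..b}|lborel. q n v) = (G (b + h n) - G b) / h n - (G (a + h n) - G a) / h n" for n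
  proof -
    define Q where "Q v = (G (v + h n) - G v) / h n" for v
    have DQ: "(Q has_real_derivative q n v) (at v)" for v
    proof -
      have "((\<lambda>v. G (v + h n)) has_real_derivative g (v + h n)) (at v)"
        using G[of "v + h n"] by (simp add: DERIV_shift)
      from DERIV_cdivide[OF DERIV_diff[OF this G[of v]], of "h n"] show ?thesis by (simp add: Q_def[abs_def] q_def)
    qed
    have "has_bochner_integral lborel (\<lambda>v. indicator {a..b} v *\<^sub>R q n v) (Q b - Q a)"
      by (rule has_bochner_integral_FTC_Icc[OF ab _ cq])
         (use DQ in \<open>auto simp: has_real_derivative_iff_has_vector_derivative intro: has_vector_derivative_at_within\<close>)
    then show ?thesis by (simp add: set_lebesgue_integral_def has_bochner_integral_iff Q_def diff_divide_distrib)
  qed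
  have l1: "(\<lambda>n. LINT v:{a..b}|lborel. q n v) \<longlonglongrightarrow> g b - g a"
    unfolding eqq by (intro tendsto_diff Dq G)
  have l2: "(\<lambda>n. (b - a) + (LINT v:{a..b}|lborel. p n v)) \<longlonglongrightarrow> (b - a) + 0"
    by (intro tendsto_intros limp)
  from LIMSEQ_le[OF l1 l2] ub show ?thesis by auto
qed

text \<open>By Fubini the bound on the gradient holds almost everywhere on almost every vertical line; on such a
  line \<open>lipschitz_increment_le\<close> applies, and continuity of \<open>\<phi>\<close> extends the estimate to all lines.\<close>

lemma W1_test_vertical:
  assumes \<phi>: "\<phi> \<in> W1_test"
  shows "\<bar>\<phi> (x, v) - \<phi> (x, w)\<bar> \<le> \<bar>v - w\<bar>" "continuous_on UNIV \<phi>"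
proof -
  obtain L where L: "L-lipschitz_on UNIV \<phi>" using \<phi> by (auto simp: W1_test_def)
  show c: "continuous_on UNIV \<phi>" using L by (rule lipschitz_on_continuous_on)
  have "AE z in lborel. \<exists>D. (\<phi> has_derivative D) (at z) \<and> onorm D \<le> 1" using \<phi> by (simp add: W1_test_def)
  from AE_lborel_prodD[OF this]
  have AEx: "AE x in lborel. AE v in lborel. \<exists>D. (\<phi> has_derivative D) (at (x, v)) \<and> onorm D \<le> 1" by simp
  have good: "\<bar>\<phi> (x, v) - \<phi> (x, w)\<bar> \<le> \<bar>v - w\<bar>"
    if x: "AE v in lborel. \<exists>D. (\<phi> has_derivative D) (at (x, v)) \<and> onorm D \<le> 1" for x v w
  proof -
    define g where "g v = \<phi> (x, v)" for v
    have lip: "\<bar>g v - g w\<bar> \<le> L * \<bar>v - w\<bar>" for v w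
      using lipschitz_onD[OF L, of "(x, v)" "(x, w)"] by (simp add: g_def dist_prod_def dist_real_def)
    have D: "AE v in lborel. \<exists>d. (g has_real_derivative d) (at v) \<and> \<bar>d\<bar> \<le> 1"
      using x
    proof eventually_elim
      case (elim v)
      then obtain D where D: "(\<phi> has_derivative D) (at (x, v))" "onorm D \<le> 1" by blast
      have bl: "bounded_linear D" by (rule has_derivative_bounded_linear[OF D(1)])
      have "((\<lambda>v. (x, v)) has_derivative (\<lambda>h. (0, h))) (at v)"
        by (rule has_derivative_Pair[OF has_derivative_const has_derivative_ident])
      from has_derivative_compose[OF this D(1)]
      have "(g has_derivative (\<lambda>h. D (0, h))) (at v)" by (simp add: g_def[abs_def])
      moreover have "(\<lambda>h. D (0, h)) = (*) (D (0, 1))"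
      proof
        fix h show "D (0, h) = D (0, 1) * h"
          using linear_cmul[OF bounded_linear.linear[OF bl], of h "(0, 1)"] by (simp add: mult.commute)
      qed
      ultimately have "(g has_real_derivative D (0, 1)) (at v)" by (simp only: has_field_derivative_def)
      moreover have "\<bar>D (0, 1)\<bar> \<le> 1"
      proof -
        have "norm (D (0, 1)) \<le> onorm D * norm (0::real, 1::real)" by (rule onorm[OF bl])
        then show ?thesis using D(2) by (simp add: norm_prod_def)
      qed
      ultimately show ?case by blast
    qed
    have D': "AE v in lborel. \<exists>d. ((\<lambda>v. - g v) has_real_derivative d) (at v) \<and> \<bar>d\<bar> \<le> 1"
      using D
    proof eventually_elim
      case (elim v)
      then obtain d where "(g has_real_derivative d) (at v)" "\<bar>d\<bar> \<le> 1" by blast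
      then show ?case by (intro exI[of _ "- d"]) (auto intro: DERIV_minus)
    qed
    have lip': "\<bar>- g v - - g w\<bar> \<le> L * \<bar>v - w\<bar>" for v w using lip[of w v] by (simp add: abs_minus_commute)
    have *: "\<bar>g v - g w\<bar> \<le> \<bar>v - w\<bar>" if "w \<le> v" for v w
      using lipschitz_increment_le[OF lip D that] lipschitz_increment_le[OF lip' D' that] that by simp
    show ?thesis
    proof (cases "w \<le> v")
      case True then show ?thesis using * by (simp add: g_def)
    next
      case False then show ?thesis using *[of v w] by (simp add: g_def abs_minus_commute)
    qed
  qed
  show "\<bar>\<phi> (x, v) - \<phi> (x, w)\<bar> \<le> \<bar>v - w\<bar>"
  proof (rule field_le_epsilon)
    fix e :: real assume e: "e > 0"
    have L0: "L \<ge> 0" using lipschitz_on_nonneg[OF L] .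
    define \<delta> where "\<delta> = e / (2 * (L + 1))"
    have \<delta>: "\<delta> > 0" using e L0 by (simp add: \<delta>_def)
    have "\<exists>x'\<in>{x<..<x+\<delta>}. AE v in lborel. \<exists>D. (\<phi> has_derivative D) (at (x', v)) \<and> onorm D \<le> 1"
    proof (rule ccontr)
      assume no: "\<not> ?thesis"
      have "AE y in lborel. y \<notin> {x<..<x+\<delta>}" using AEx by eventually_elim (use no in blast)
      then have "{x<..<x+\<delta>} \<in> null_sets lborel" by (subst AE_iff_null_sets) auto
      then have "emeasure lborel {x<..<x+\<delta>} = 0" by (rule null_setsD1)
      then show False using \<delta> by simp
    qed
    then obtain x' where x': "x < x'" "x' < x + \<delta>"
      "AE v in lborel. \<exists>D. (\<phi> has_derivative D) (at (x', v)) \<and> onorm D \<le> 1" by auto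
    have near: "\<bar>\<phi> (x, y) - \<phi> (x', y)\<bar> \<le> e / 2" for y
    proof -
      have "\<bar>\<phi> (x, y) - \<phi> (x', y)\<bar> \<le> L * \<bar>x - x'\<bar>"
        using lipschitz_onD[OF L, of "(x, y)" "(x', y)"] by (simp add: dist_prod_def dist_real_def)
      also have "\<dots> \<le> (L + 1) * \<delta>" using x' L0 by (intro mult_mono) auto
      also have "\<dots> = e / 2" using L0 by (simp only: \<delta>_def) (simp add: divide_simps)
      finally show ?thesis .
    qed
    show "\<bar>\<phi> (x, v) - \<phi> (x, w)\<bar> \<le> \<bar>v - w\<bar> + e"
      using near[of v] near[of w] good[OF x'(3), of v w] by linarith
  qed
qed

lemma pair_return_eq_distr:
  assumes "finite_measure M" "sets M = sets borel"
  shows "M \<Otimes>\<^sub>M return borel (w :: real) = distr M borel (\<lambda>x :: real. (x, w))"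
proof (rule pair_measure_eqI)
  show "sigma_finite_measure M" using assms(1) by (simp add: finite_measure.axioms(1))
  have "prob_space (return borel w)" by (rule prob_space_return) simp
  then show "sigma_finite_measure (return borel w)" by (simp add: prob_space_imp_sigma_finite)
  show "sets (M \<Otimes>\<^sub>M return borel w) = sets (distr M borel (\<lambda>x. (x, w)))"
    unfolding sets_distr using sets_pair_measure_cong[OF assms(2) sets_return[of borel w]] by (metis borel_prod)
  fix A B assume A: "A \<in> sets M" and B: "B \<in> sets (return borel w)"
  have AB: "A \<in> sets borel" "B \<in> sets borel" using A B assms(2) by auto
  have m: "(\<lambda>x. (x, w)) \<in> measurable M borel"
    unfolding measurable_cong_sets[OF assms(2) refl] by (intro borel_measurable_continuous_onI continuous_intros)
  have "A \<times> B \<in> sets borel" using AB by (metis borel_prod pair_measureI)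
  then have "emeasure (distr M borel (\<lambda>x. (x, w))) (A \<times> B) = emeasure M ((\<lambda>x. (x, w)) -` (A \<times> B) \<inter> space M)"
    by (rule emeasure_distr[OF m])
  also have "(\<lambda>x. (x, w)) -` (A \<times> B) \<inter> space M = (if w \<in> B then A else {})"
    using sets.sets_into_space[OF A] by auto
  also have "emeasure M \<dots> = emeasure M A * emeasure (return borel w) B"
    using AB(2) by (simp add: indicator_def)
  finally show "emeasure M A * emeasure (return borel w) B = emeasure (distr M borel (\<lambda>x. (x, w))) (A \<times> B)" ..
qed

text \<open>Moving all mass on a vertical line to the height \<open>w\<close> costs the first moment of \<open>v - w\<close>.\<close>

lemma W1_monokinetic_le:
  fixes g :: "real \<Rightarrow> real \<Rightarrow> real"
  assumes gm: "(\<lambda>(x, v). g x v) \<in> borel_measurable borel"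
    and gi: "set_integrable lborel TxR (\<lambda>(x, v). g x v)" and g0: "AE z in lborel. 0 \<le> g (fst z) (snd z)"
    and supp: "AE z in lborel. z \<in> TxR \<longrightarrow> \<bar>snd z\<bar> > B \<longrightarrow> g (fst z) (snd z) = 0"
  shows "W1 (kinetic_measure g) (monokinetic_measure (\<lambda>x. LINT v|lborel. g x v) w)
    \<le> ereal (LINT z:TxR|lborel. \<bar>snd z - w\<bar> * g (fst z) (snd z))"
  unfolding W1_def
proof (rule SUP_least)
  fix \<phi> assume \<phi>: "\<phi> \<in> W1_test"
  define G where "G z = g (fst z) (snd z)" for z :: "real \<times> real"
  have Gm: "G \<in> borel_measurable borel" using gm by (simp add: G_def[abs_def] case_prod_beta')
  define I where "I z = (indicator {0..<1} (fst z) :: real)" for z :: "real \<times> real"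
  have Im: "I \<in> borel_measurable borel" unfolding I_def
    by (rule measurable_compose[OF borel_measurable_continuous_onI[OF continuous_on_fst[OF continuous_on_id]]
        borel_measurable_indicator]) simp
  have cont: "continuous_on UNIV \<phi>" by (rule W1_test_vertical(2)[OF \<phi>])
  have \<phi>m: "\<phi> \<in> borel_measurable borel" by (rule borel_measurable_continuous_onI[OF cont])
  have cw: "continuous_on UNIV (\<lambda>x. \<phi> (x, w))"
    by (rule continuous_on_compose2[OF cont]) (auto intro!: continuous_intros)
  have \<phi>wm: "(\<lambda>x. \<phi> (x, w)) \<in> borel_measurable borel" by (rule borel_measurable_continuous_onI[OF cw])
  have TG: "integrable lborel (\<lambda>z. indicator TxR z * G z)"
    using gi by (simp add: set_integrable_def G_def case_prod_beta')
  have ITx: "I z = I z * indicator TxR z" for z by (simp add: I_def indicator_def mem_Times_iff)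
  have IG: "integrable lborel (\<lambda>z. I z * G z)"
  proof (rule Bochner_Integration.integrable_bound[OF TG])
    show "(\<lambda>z. I z * G z) \<in> borel_measurable lborel" using borel_measurable_times[OF Im Gm] by simp
    show "AE z in lborel. norm (I z * G z) \<le> norm (indicator TxR z * G z)"
      by (rule AE_I2) (simp add: I_def indicator_def mem_Times_iff)
  qed
  have bounded_mult: "integrable lborel (\<lambda>z. I z * G z * k z)"
    if k: "k \<in> borel_measurable borel" "\<And>z. z \<in> {0..1} \<times> {-B..B} \<Longrightarrow> \<bar>k z\<bar> \<le> C" for k C
  proof (rule Bochner_Integration.integrable_bound[where f="\<lambda>z. C * (I z * G z)"])
    show "integrable lborel (\<lambda>z. C * (I z * G z))" using IG by simp
    show "(\<lambda>z. I z * G z * k z) \<in> borel_measurable lborel" using Im Gm k(1) by simp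
    show "AE z in lborel. norm (I z * G z * k z) \<le> norm (C * (I z * G z))"
      using supp
    proof eventually_elim
      case (elim z)
      show ?case
      proof (cases "I z = 0 \<or> G z = 0")
        case False
        then have "z \<in> {0..1} \<times> {-B..B}" using elim by (cases z) (auto simp: I_def indicator_def G_def split: if_splits)
        from k(2)[OF this] have "\<bar>k z\<bar> \<le> \<bar>C\<bar>" by simp
        then have "\<bar>I z * G z\<bar> * \<bar>k z\<bar> \<le> \<bar>I z * G z\<bar> * \<bar>C\<bar>" by (rule mult_left_mono) simp
        then show ?thesis by (simp only: real_norm_def abs_mult mult_ac)
      qed auto
    qed
  qed
  have cB: "\<exists>C. \<forall>z\<in>{0..1} \<times> {-B..B}. \<bar>k z\<bar> \<le> C" if "continuous_on UNIV k" for k :: "real \<times> real \<Rightarrow> real"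
  proof -
    have "continuous_on ({0..1} \<times> {-B..B}) k" using continuous_on_subset[OF that] by simp
    from continuous_bounded_QB[OF this] show ?thesis by metis
  qed
  have mult_cont: "integrable lborel (\<lambda>z. I z * G z * k z)" if k: "continuous_on UNIV k" for k
  proof -
    obtain C where "\<forall>z\<in>{0..1} \<times> {-B..B}. \<bar>k z\<bar> \<le> C" using cB[OF k] by blast
    then show ?thesis by (intro bounded_mult[of k C] borel_measurable_continuous_onI[OF k]) auto
  qed
  have kin: "(LINT z|kinetic_measure g. \<phi> z) = (\<integral>z. I z * G z * \<phi> z \<partial>lborel)"
  proof -
    have "kinetic_measure g = density lborel (\<lambda>z. ennreal (I z * G z))"
      unfolding kinetic_measure_def
      by (rule arg_cong[of _ _ "density lborel"]) (auto simp: fun_eq_iff I_def G_def indicator_def)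
    moreover have "(LINT z|density lborel (\<lambda>z. ennreal (I z * G z)). \<phi> z) = (\<integral>z. (I z * G z) *\<^sub>R \<phi> z \<partial>lborel)"
    proof (rule integral_density)
      show "AE z in lborel. 0 \<le> I z * G z" using g0 by eventually_elim (simp add: I_def G_def)
    qed (use \<phi>m Im Gm in auto)
    ultimately show ?thesis by simp
  qed
  define n where "n x = (LINT v|lborel. g x v)" for x
  have IG': "integrable (lborel \<Otimes>\<^sub>M lborel) (\<lambda>z. I z * G z)" using IG by (simp add: lborel_prod)
  have in_int: "integrable lborel (\<lambda>x. indicator {0..<1} x * n x)"
    using lborel_pair.integrable_fst'[OF IG'] by (simp add: I_def G_def n_def)
  have n0: "AE x in lborel. 0 \<le> indicator {0..<1} x * n x"
    using AE_lborel_prodD[OF g0] by eventually_elim (simp add: n_def integral_nonneg_AE)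
  have mono: "(LINT z|monokinetic_measure n w. \<phi> z) = (\<integral>x. indicator {0..<1} x * n x * \<phi> (x, w) \<partial>lborel)"
  proof -
    define D where "D = density lborel (\<lambda>x. ennreal (indicator {0..<1} x * n x))"
    have D: "density lborel (\<lambda>x. indicator {0..<1} x * ennreal (n x)) = D"
      unfolding D_def by (rule arg_cong[of _ _ "density lborel"]) (auto simp: fun_eq_iff indicator_def)
    have nm: "(\<lambda>x. indicator {0..<1} x * n x) \<in> borel_measurable lborel" using in_int by (rule borel_measurable_integrable)
    have "emeasure D (space D) = (\<integral>\<^sup>+x. ennreal (indicator {0..<1} x * n x) \<partial>lborel)"
      using nm by (simp add: D_def emeasure_density)
    also have "\<dots> = ennreal (\<integral>x. indicator {0..<1} x * n x \<partial>lborel)" by (rule nn_integral_eq_integral[OF in_int n0])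
    finally have "finite_measure D" by (intro finite_measureI) simp
    then have "monokinetic_measure n w = distr D borel (\<lambda>x. (x, w))"
      unfolding monokinetic_measure_def D by (rule pair_return_eq_distr) (simp add: D_def)
    moreover have "(LINT z|distr D borel (\<lambda>x. (x, w)). \<phi> z) = (LINT x|D. \<phi> (x, w))"
    proof (rule integral_distr[OF _ \<phi>m])
      have "(\<lambda>x. (x, w)) \<in> borel_measurable borel" by (intro borel_measurable_continuous_onI continuous_intros)
      then show "(\<lambda>x. (x, w)) \<in> measurable D borel" by (simp add: D_def)
    qed
    moreover have "(LINT x|D. \<phi> (x, w)) = (\<integral>x. (indicator {0..<1} x * n x) *\<^sub>R \<phi> (x, w) \<partial>lborel)"
      unfolding D_def by (rule integral_density[OF _ nm n0]) (use \<phi>wm in simp)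
    ultimately show ?thesis by simp
  qed
  have c2: "continuous_on UNIV (\<lambda>z :: real \<times> real. \<phi> (fst z, w))"
    by (rule continuous_on_compose2[OF cont]) (auto intro!: continuous_intros)
  have "(\<integral>z. I z * G z * \<phi> (fst z, w) \<partial>lborel) = (\<integral>z. I z * G z * \<phi> (fst z, w) \<partial>(lborel \<Otimes>\<^sub>M lborel))"
    by (simp add: lborel_prod)
  also have "\<dots> = (\<integral>x. (\<integral>v. I (x, v) * G (x, v) * \<phi> (fst (x, v), w) \<partial>lborel) \<partial>lborel)"
    by (rule lborel_pair.integral_fst'[symmetric]) (use mult_cont[OF c2] in \<open>simp add: lborel_prod\<close>)
  also have "\<dots> = (\<integral>x. indicator {0..<1} x * n x * \<phi> (x, w) \<partial>lborel)" by (simp add: I_def G_def n_def)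
  finally have mono2: "(LINT z|monokinetic_measure n w. \<phi> z) = (\<integral>z. I z * G z * \<phi> (fst z, w) \<partial>lborel)" using mono by simp
  have c3: "continuous_on UNIV (\<lambda>z :: real \<times> real. \<bar>snd z - w\<bar>)" by (intro continuous_intros)
  have "(LINT z|kinetic_measure g. \<phi> z) - (LINT z|monokinetic_measure n w. \<phi> z)
      = (\<integral>z. I z * G z * \<phi> z - I z * G z * \<phi> (fst z, w) \<partial>lborel)"
    unfolding kin mono2 by (rule Bochner_Integration.integral_diff[symmetric, OF mult_cont[OF cont] mult_cont[OF c2]])
  also have "\<dots> \<le> (\<integral>z. I z * G z * \<bar>snd z - w\<bar> \<partial>lborel)"
  proof (rule integral_mono_AE[OF Bochner_Integration.integrable_diff[OF mult_cont[OF cont] mult_cont[OF c2]] mult_cont[OF c3]])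
    show "AE z in lborel. I z * G z * \<phi> z - I z * G z * \<phi> (fst z, w) \<le> I z * G z * \<bar>snd z - w\<bar>"
      using g0
    proof eventually_elim
      case (elim z)
      have "\<phi> z - \<phi> (fst z, w) \<le> \<bar>snd z - w\<bar>" using W1_test_vertical(1)[OF \<phi>, of "fst z" "snd z" w] by simp
      moreover have "0 \<le> I z * G z" using elim by (simp add: I_def G_def)
      ultimately have "I z * G z * (\<phi> z - \<phi> (fst z, w)) \<le> I z * G z * \<bar>snd z - w\<bar>" by (rule mult_left_mono)
      then show ?case by (simp add: right_diff_distrib)
    qed
  qed
  also have "\<dots> = (LINT z:TxR|lborel. \<bar>snd z - w\<bar> * g (fst z) (snd z))"
    unfolding set_lebesgue_integral_def
  proof (rule integral_cong_AE)
    have 1: "AE x in lborel. AE v :: real in lborel. fst (x, v) \<noteq> (1::real)"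
      using AE_lborel_singleton[of "1::real"] by eventually_elim simp
    have "{z :: real \<times> real. fst z \<noteq> 1} \<in> sets borel"
      by (intro borel_open open_Collect_neq continuous_intros)
    from AE_lborel_prodI[OF 1 this] have "AE z :: real \<times> real in lborel. fst z \<noteq> 1" .
    then show "AE z in lborel. I z * G z * \<bar>snd z - w\<bar> = indicator TxR z *\<^sub>R (\<bar>snd z - w\<bar> * g (fst z) (snd z))"
      by eventually_elim (auto simp: I_def G_def indicator_def)
    have m3: "(\<lambda>z :: real \<times> real. \<bar>snd z - w\<bar>) \<in> borel_measurable borel" by (rule borel_measurable_continuous_onI[OF c3])
    show "(\<lambda>z. I z * G z * \<bar>snd z - w\<bar>) \<in> borel_measurable lborel" using Im Gm m3 by simp
    have "TxR \<in> sets (borel :: (real \<times> real) measure)" by (intro borel_closed closed_Times) auto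
    then show "(\<lambda>z. indicator TxR z *\<^sub>R (\<bar>snd z - w\<bar> * g (fst z) (snd z))) \<in> borel_measurable lborel"
      using Gm m3 by (simp add: G_def[abs_def])
  qed
  finally show "ereal ((LINT z|kinetic_measure g. \<phi> z) - (LINT z|monokinetic_measure (\<lambda>x. LINT v|lborel. g x v) w. \<phi> z))
      \<le> ereal (LINT z:TxR|lborel. \<bar>snd z - w\<bar> * g (fst z) (snd z))" by (simp add: n_def[abs_def])
qed

section \<open>From the weak formulation to balance laws\<close>

lemma L2_norm_T1: "L2_norm {0..1} g = l2 T1 g" for g :: "real \<Rightarrow> real"
  by (simp add: L2_norm_def l2_def integral_T1)

lemma wd_imp_weak_deriv:
  assumes w: "wd g h" and h: "periodic1 h"
  shows "weak_deriv g h"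
  unfolding weak_deriv_def
proof (intro conjI allI impI)
  show "periodic1 g" using w by (simp add: wd_def)
  show "set_integrable lborel {0..1} g" "set_integrable lborel {0..1} h"
    using T1.sq_integrable_integrable[OF wdD(5)[OF w]] T1.sq_integrable_integrable[OF wdD(4)[OF w]] by (simp_all add: integrable_T1)
  fix \<phi> assume "test_x \<phi>"
  from wd_by_parts[OF w wd_test_x[OF this]]
  show "(LINT x:{0..1}|lborel. g x * deriv \<phi> x) = - (LINT x:{0..1}|lborel. h x * \<phi> x)"
    unfolding integral_T1[symmetric] by linarith
qed (rule h)

lemma weak_deriv_wderiv: "weak_deriv g h \<Longrightarrow> weak_deriv g (wderiv g)"
  unfolding wderiv_def by (rule someI[where P="weak_deriv g" and x=h])

lemma weak_deriv_measurable: "weak_deriv g h \<Longrightarrow> h \<in> borel_measurable T1"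
  unfolding weak_deriv_def integrable_T1[symmetric] by (elim conjE borel_measurable_integrable)

lemma H1_T_wd:
  assumes g: "H1_T g" "continuous_on UNIV g"
  shows "wd g (wderiv g)" "periodic1 (wderiv g)"
proof -
  obtain h where h: "weak_deriv g h" "L2_T h" using g(1) by (auto simp: H1_T_def)
  note w = weak_deriv_wderiv[OF h(1)]
  show "periodic1 (wderiv g)" using w by (simp add: weak_deriv_def)
  have ae: "AE x in T1. h x = wderiv g x" by (rule weak_deriv_AE_unique[OF h(1) w])
  have hm: "h \<in> borel_measurable T1" and wm: "wderiv g \<in> borel_measurable T1"
    by (rule weak_deriv_measurable[OF h(1)], rule weak_deriv_measurable[OF w])
  have "integrable T1 (\<lambda>x. (h x)\<^sup>2)" using h(2) by (simp add: L2_T_def integrable_T1)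
  moreover have "AE x in T1. (h x)\<^sup>2 = (wderiv g x)\<^sup>2" using ae by eventually_elim simp
  ultimately have "integrable T1 (\<lambda>x. (wderiv g x)\<^sup>2)"
    using integrable_cong_AE[of "\<lambda>x. (h x)\<^sup>2" T1 "\<lambda>x. (wderiv g x)\<^sup>2"] hm wm by simp
  then have "sq_integrable T1 (wderiv g)" using wm by (simp add: sq_integrable_def)
  then show "wd g (wderiv g)" by (rule weak_deriv_imp_wd[OF w g(2)])
qed

text \<open>The representative that \<open>wderiv\<close> picks for a difference agrees almost everywhere with the difference of
  the picked representatives.\<close>

lemma H1_norm_diff:
  assumes g: "H1_T g" "continuous_on UNIV g" and k: "H1_T k" "continuous_on UNIV k"
  shows "l2 T1 (\<lambda>x. g x - k x) \<le> H1_norm (\<lambda>x. g x - k x)"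
    "l2 T1 (\<lambda>x. wderiv g x - wderiv k x) \<le> H1_norm (\<lambda>x. g x - k x)"
proof -
  have w: "wd (\<lambda>x. g x - k x) (\<lambda>x. wderiv g x - wderiv k x)" by (rule wd_diff[OF H1_T_wd(1)[OF g] H1_T_wd(1)[OF k]])
  have p: "periodic1 (\<lambda>x. wderiv g x - wderiv k x)"
    using H1_T_wd(2)[OF g] H1_T_wd(2)[OF k] by (simp add: periodic1_def)
  note wk = wd_imp_weak_deriv[OF w p]
  note wk' = weak_deriv_wderiv[OF wk]
  have "l2 T1 (\<lambda>x. wderiv g x - wderiv k x) = l2 T1 (wderiv (\<lambda>x. g x - k x))"
    by (rule l2_cong_AE[OF weak_deriv_AE_unique[OF wk wk'] weak_deriv_measurable[OF wk] weak_deriv_measurable[OF wk']])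
  then have eq: "H1_norm (\<lambda>x. g x - k x) = sqrt ((l2 T1 (\<lambda>x. g x - k x))\<^sup>2 + (l2 T1 (\<lambda>x. wderiv g x - wderiv k x))\<^sup>2)"
    by (simp add: H1_norm_def L2_norm_T1)
  show "l2 T1 (\<lambda>x. g x - k x) \<le> H1_norm (\<lambda>x. g x - k x)" "l2 T1 (\<lambda>x. wderiv g x - wderiv k x) \<le> H1_norm (\<lambda>x. g x - k x)"
    unfolding eq by (rule real_le_rsqrt, simp)+
qed

lemma at_within_Icc_Ici: "s \<ge> 0 \<Longrightarrow> at s within {0..s + 1} = at s within {0..}" for s :: real
  by (rule at_within_nhd[of s "{..<s + 1}"]) auto

lemma C_H1_limits:
  assumes C: "\<And>T. T > 0 \<Longrightarrow> C_H1 T g" and cont: "\<And>t. t \<ge> 0 \<Longrightarrow> continuous_on UNIV (\<lambda>x. g x t)" and s: "s \<ge> 0"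
  shows "wd (\<lambda>x. g x s) (wderiv (\<lambda>x. g x s))"
    "L2lim T1 (\<lambda>t x. g x t) (\<lambda>x. g x s) (at s within {0..})"
    "L2lim T1 (\<lambda>t. wderiv (\<lambda>x. g x t)) (wderiv (\<lambda>x. g x s)) (at s within {0..})"
proof -
  have H: "H1_T (\<lambda>x. g x t)" if "t \<ge> 0" for t using C[of "t + 1"] that by (auto simp: C_H1_def)
  have w: "wd (\<lambda>x. g x t) (wderiv (\<lambda>x. g x t))" if "t \<ge> 0" for t by (rule H1_T_wd(1)[OF H[OF that] cont[OF that]])
  show "wd (\<lambda>x. g x s) (wderiv (\<lambda>x. g x s))" by (rule w[OF s])
  have "((\<lambda>t. H1_norm (\<lambda>x. g x t - g x s)) \<longlongrightarrow> 0) (at s within {0..s + 1})"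
    using C[of "s + 1"] s by (auto simp: C_H1_def)
  then have lim: "((\<lambda>t. H1_norm (\<lambda>x. g x t - g x s)) \<longlongrightarrow> 0) (at s within {0..})" by (simp add: at_within_Icc_Ici[OF s])
  have ev: "\<forall>\<^sub>F t in at s within {0..}. t \<ge> 0" unfolding eventually_at_filter by (rule always_eventually) simp
  show "L2lim T1 (\<lambda>t x. g x t) (\<lambda>x. g x s) (at s within {0..})"
    unfolding L2lim_def
  proof (intro conjI)
    show "sq_integrable T1 (\<lambda>x. g x s)" by (rule wdD(5)[OF w[OF s]])
    show "\<forall>\<^sub>F t in at s within {0..}. sq_integrable T1 (\<lambda>x. g x t)" using ev by eventually_elim (rule wdD(5)[OF w])
    show "((\<lambda>t. l2 T1 (\<lambda>x. g x t - g x s)) \<longlongrightarrow> 0) (at s within {0..})"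
    proof (rule tendsto_0_le_real[OF lim])
      show "\<forall>\<^sub>F t in at s within {0..}. l2 T1 (\<lambda>x. g x t - g x s) \<le> H1_norm (\<lambda>x. g x t - g x s)"
        using ev by eventually_elim (rule H1_norm_diff(1)[OF H cont H[OF s] cont[OF s]])
    qed simp
  qed
  show "L2lim T1 (\<lambda>t. wderiv (\<lambda>x. g x t)) (wderiv (\<lambda>x. g x s)) (at s within {0..})"
    unfolding L2lim_def
  proof (intro conjI)
    show "sq_integrable T1 (wderiv (\<lambda>x. g x s))" by (rule wdD(4)[OF w[OF s]])
    show "\<forall>\<^sub>F t in at s within {0..}. sq_integrable T1 (wderiv (\<lambda>x. g x t))" using ev by eventually_elim (rule wdD(4)[OF w])
    show "((\<lambda>t. l2 T1 (\<lambda>x. wderiv (\<lambda>x. g x t) x - wderiv (\<lambda>x. g x s) x)) \<longlongrightarrow> 0) (at s within {0..})"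
    proof (rule tendsto_0_le_real[OF lim])
      show "\<forall>\<^sub>F t in at s within {0..}. l2 T1 (\<lambda>x. wderiv (\<lambda>x. g x t) x - wderiv (\<lambda>x. g x s) x) \<le> H1_norm (\<lambda>x. g x t - g x s)"
        using ev by eventually_elim (rule H1_norm_diff(2)[OF H cont H[OF s] cont[OF s]])
    qed simp
  qed
qed

lemma continuous_on_Ici_limits:
  fixes g :: "real \<Rightarrow> real"
  assumes "\<And>s. s \<ge> 0 \<Longrightarrow> (g \<longlongrightarrow> g s) (at s within {0..})"
  shows "continuous_on {0..} g"
  using assms by (simp add: continuous_on_def)

lemma box_sets[measurable]: "({0..1} \<times> {-B..B} :: (real \<times> real) set) \<in> sets borel" "TxR \<in> sets (borel :: (real \<times> real) measure)"
  by (intro borel_closed closed_Times; simp)+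

lemma integral_QB: "integral\<^sup>L (QB B) H = (\<integral>z. indicator ({0..1} \<times> {-B..B}) z * H z \<partial>lborel)" for H :: "real \<times> real \<Rightarrow> real"
  using box_sets(1)[of B] by (simp add: integral_restrict_space)

lemma integrable_QB_iff: "integrable (QB B) H \<longleftrightarrow> integrable lborel (\<lambda>z. indicator ({0..1} \<times> {-B..B}) z * H z)" for H :: "real \<times> real \<Rightarrow> real"
  using box_sets(1)[of B] by (simp add: integrable_restrict_space)

lemma AE_QB: "(AE z in QB B. P z) \<longleftrightarrow> (AE z in lborel. z \<in> {0..1} \<times> {-B..B} \<longrightarrow> P z)"
  using box_sets(1)[of B] by (intro AE_restrict_space_iff) simp

lemma integral_TxR_QB:
  fixes G H :: "real \<times> real \<Rightarrow> real"
  assumes G: "G \<in> borel_measurable borel" and eq: "\<And>z. z \<in> {0..1} \<times> {-B..B} \<Longrightarrow> G z = H z"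
    and 0: "AE z in lborel. z \<in> TxR \<longrightarrow> \<bar>snd z\<bar> > B \<longrightarrow> G z = 0"
  shows "(LINT z:TxR|lborel. G z) = (\<integral>z. H z \<partial>QB B)"
proof -
  have "(LINT z:TxR|lborel. G z) = (\<integral>z. indicator ({0..1} \<times> {-B..B}) z * G z \<partial>lborel)"
    unfolding set_lebesgue_integral_def
  proof (rule integral_cong_AE)
    show "AE z in lborel. indicator TxR z *\<^sub>R G z = indicator ({0..1} \<times> {-B..B}) z * G z"
      using 0
    proof eventually_elim
      case (elim z)
      show ?case
      proof (cases "z \<in> TxR \<and> G z \<noteq> 0")
        case True
        then have "z \<in> {0..1} \<times> {-B..B}" using elim by (auto simp: mem_Times_iff)
        then show ?thesis using True by simp
      next
        case False
        then show ?thesis by (auto simp: indicator_def mem_Times_iff)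
      qed
    qed
  qed (use G in auto)
  also have "\<dots> = (\<integral>z. indicator ({0..1} \<times> {-B..B}) z * H z \<partial>lborel)"
    by (rule Bochner_Integration.integral_cong) (auto simp: indicator_def eq)
  finally show ?thesis by (simp add: integral_QB)
qed

lemma smooth_fst_snd:
  fixes \<phi> :: "real \<Rightarrow> real"
  assumes "smooth \<phi>"
  shows "smooth (\<lambda>z :: real \<times> 'a::euclidean_space. \<phi> (fst z))" "smooth (\<lambda>z :: 'a \<times> real. \<phi> (snd z))"
  by (rule smooth_compose[OF assms smooth_bounded_linear], simp add: bounded_linear_fst bounded_linear_snd)+

text \<open>Separated test functions suffice: a fixed function of space for each balance law, and an arbitrary
  function of time for \<open>du_Bois_Reymond\<close>.\<close>

lemma test_xt_product:
  assumes "test_x \<phi>" "smooth \<theta>" "0 < a" "\<And>t. t \<notin> {a..b} \<Longrightarrow> \<theta> t = 0"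
  shows "test_xt {0<..} (\<lambda>x t. \<phi> x * \<theta> t)"
  unfolding test_xt_def
proof (intro conjI)
  have "smooth (\<lambda>z :: real \<times> real. \<phi> (fst z) * \<theta> (snd z))"
    using assms(1,2) by (intro smooth_mult smooth_fst_snd) (simp_all add: test_x_def)
  then show "smooth (\<lambda>(x, t). \<phi> x * \<theta> t)" by (simp add: case_prod_beta')
  show "periodic1 (\<lambda>x t. \<phi> x * \<theta> t)" using assms(1) by (simp add: test_x_def periodic1_def)
  show "\<exists>a b. {a..b} \<subseteq> {0<..} \<and> (\<forall>x t. t \<notin> {a..b} \<longrightarrow> \<phi> x * \<theta> t = 0)"
    using assms(3,4) by (intro exI[of _ a] exI[of _ b]) auto
qed

lemma test_xvt_product:
  assumes "smooth P" "smooth \<theta>" "0 < a" "\<And>t. t \<notin> {a..b} \<Longrightarrow> \<theta> t = 0" "\<And>v. \<bar>v\<bar> > K \<Longrightarrow> P v = 0"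
  shows "test_xvt {0<..} (\<lambda>x v t. P v * \<theta> t)"
  unfolding test_xvt_def
proof (intro conjI)
  have "smooth (\<lambda>z :: real \<times> real \<times> real. P (fst (snd z)))"
    by (rule smooth_compose[OF assms(1) smooth_bounded_linear[OF bounded_linear_compose[OF bounded_linear_fst bounded_linear_snd]]])
  moreover have "smooth (\<lambda>z :: real \<times> real \<times> real. \<theta> (snd (snd z)))"
    by (rule smooth_compose[OF assms(2) smooth_bounded_linear[OF bounded_linear_compose[OF bounded_linear_snd bounded_linear_snd]]])
  ultimately have "smooth (\<lambda>z :: real \<times> real \<times> real. P (fst (snd z)) * \<theta> (snd (snd z)))" by (rule smooth_mult)
  then show "smooth (\<lambda>(x :: real, v, t). P v * \<theta> t)" by (simp add: case_prod_beta')
  show "periodic1 (\<lambda>x v t. P v * \<theta> t)" by (simp add: periodic1_def)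
  show "\<exists>a b R. {a..b} \<subseteq> {0<..} \<and> (\<forall>x v t. t \<notin> {a..b} \<or> \<bar>v\<bar> > R \<longrightarrow> P v * \<theta> t = 0)"
    using assms(3,4,5) by (intro exI[of _ a] exI[of _ b] exI[of _ K]) auto
qed

lemma deriv_mult_const:
  fixes g :: "real \<Rightarrow> real"
  assumes "smooth g"
  shows "deriv (\<lambda>s. c * g s) t = c * deriv g t" "deriv (\<lambda>s. g s * c) t = deriv g t * c"
proof -
  show "deriv (\<lambda>s. c * g s) t = c * deriv g t" by (rule DERIV_imp_deriv[OF DERIV_cmult[OF smoothD(1)[OF assms]]])
  show "deriv (\<lambda>s. g s * c) t = deriv g t * c" by (rule DERIV_imp_deriv[OF DERIV_cmult_right[OF smoothD(1)[OF assms]]])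
qed

text \<open>Test functions for the Vlasov equation have compact support in \<open>v\<close>; on the support of \<open>f\<close> this cutoff
  cannot be distinguished from the power, and it produces the moment balance.\<close>

lemma cutoff_power:
  fixes B c :: real
  obtains P where "smooth P" "\<And>v. \<bar>v\<bar> > \<bar>B\<bar> + 2 \<Longrightarrow> P v = 0" "\<And>v. v \<in> {-B..B} \<Longrightarrow> P v = (v - c) ^ k"
    "\<And>v. v \<in> {-B..B} \<Longrightarrow> deriv P v = real k * (v - c) ^ (k - 1)"
proof -
  define cut where "cut v = sstep (v + (\<bar>B\<bar> + 2)) * sstep ((\<bar>B\<bar> + 2) - v)" for v
  define P where "P v = (v - c) ^ k * cut v" for v
  have s: "smooth P" unfolding P_def cut_def
    by (intro smooth_mult smooth_power smooth_diff smooth_ident smooth_const)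
       (rule smooth_compose[OF sstep(1)], intro smooth_add smooth_diff smooth_ident smooth_const)+
  have cut0: "cut v = 0" if "\<bar>v\<bar> > \<bar>B\<bar> + 2" for v
  proof (cases "v > 0")
    case True then show ?thesis using that by (simp add: cut_def sstep(3))
  next
    case False then show ?thesis using that by (simp add: cut_def sstep(3))
  qed
  have cut1: "cut v = 1" if "v \<in> {-B-1<..<B+1}" for v
  proof -
    have "v + (\<bar>B\<bar> + 2) \<ge> 1" "(\<bar>B\<bar> + 2) - v \<ge> 1" using that by auto
    then show ?thesis by (simp add: cut_def sstep(4))
  qed
  show ?thesis
  proof (rule that[OF s])
    show "P v = 0" if "\<bar>v\<bar> > \<bar>B\<bar> + 2" for v using cut0[OF that] by (simp add: P_def)
    show "P v = (v - c) ^ k" if "v \<in> {-B..B}" for v using cut1[of v] that by (simp add: P_def)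
    show "deriv P v = real k * (v - c) ^ (k - 1)" if v: "v \<in> {-B..B}" for v
    proof (rule DERIV_imp_deriv)
      have "\<forall>\<^sub>F y in nhds v. y \<in> {-B-1<..<B+1}" by (rule eventually_nhds_in_open) (use v in auto)
      then have ev: "\<forall>\<^sub>F y in nhds v. P y = (y - c) ^ k" by eventually_elim (simp add: P_def cut1)
      have "((\<lambda>y. (y - c) ^ k) has_real_derivative real k * (v - c) ^ (k - 1)) (at v)"
        by (auto intro!: derivative_eq_intros)
      then show "(P has_real_derivative real k * (v - c) ^ (k - 1)) (at v)"
        by (subst DERIV_cong_ev[OF refl ev refl])
    qed
  qed
qed

lemma set_LINT_time_cong:
  fixes F G :: "real \<Rightarrow> real"
  assumes "\<And>t. t \<ge> 0 \<Longrightarrow> F t = G t" shows "(LINT t:{0..}|lborel. F t) = (LINT t:{0..}|lborel. G t)"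
  by (rule set_lebesgue_integral_cong) (use assms in auto)

text \<open>The three balance laws come from separated test functions and \<open>du_Bois_Reymond\<close>; the continuity
  in time that it requires is the continuity with values in \<open>H\<^sup>1\<close> and \<open>L\<^sup>1\<close>, since products of uniform
  limits with strong limits converge.  The initial conditions identify \<open>u\<^sub>s\<close> and the mean density with
  quantities of the flow at time 0.\<close>

lemma NSV_imp_flow:
  fixes \<gamma> \<beta> :: real and \<rho>0 u0 :: "real \<Rightarrow> real" and f0 :: "real \<Rightarrow> real \<Rightarrow> real"
    and \<rho> u :: "real \<Rightarrow> real \<Rightarrow> real" and f :: "real \<Rightarrow> real \<Rightarrow> real \<Rightarrow> real"
  assumes \<gamma>: "\<gamma> > 1" and \<beta>: "\<beta> \<ge> 0" and W\<rho>0: "W1inf_T \<rho>0" and Hu0: "H1_T u0" and Lf0: "Linf_TxR f0"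
    and sol: "NSV_global_weak_solution \<gamma> \<beta> \<rho>0 u0 f0 \<rho> u f"
  obtains B rm rp C0 where
    "nsv_flow \<gamma> \<beta> B rm rp (u_inf \<rho>0 u0 f0) C0 (\<lambda>t x. \<rho> x t) (\<lambda>t x. u x t)
       (\<lambda>t. wderiv (\<lambda>x. \<rho> x t)) (\<lambda>t. wderiv (\<lambda>x. u x t)) (\<lambda>t z. f (fst z) (snd z) t)"
    "mean_density \<rho>0 = (\<integral>x. \<rho> x 0 \<partial>T1)"
    "\<And>t. t \<ge> 0 \<Longrightarrow> (\<lambda>(x, v). f x v t) \<in> borel_measurable borel"
    "\<And>t. t \<ge> 0 \<Longrightarrow> set_integrable lborel TxR (\<lambda>(x, v). f x v t)"
    "\<And>t x v. t \<ge> 0 \<Longrightarrow> f (x + 1) v t = f x v t"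
    "\<And>t. t \<ge> 0 \<Longrightarrow> AE z in lborel. 0 \<le> f (fst z) (snd z) t"
    "\<And>t. t \<ge> 0 \<Longrightarrow> AE z in lborel. z \<in> TxR \<longrightarrow> \<bar>snd z\<bar> > B \<longrightarrow> f (fst z) (snd z) t = 0"
proof -
  define us where "us = u_inf \<rho>0 u0 f0"
  have ceq: "continuity_eq \<rho> u" and meq: "momentum_eq \<gamma> \<beta> \<rho> u f" and veq: "vlasov_eq \<rho> u f"
    and ic: "initial_cond \<rho>0 u0 f0 \<rho> u f" and reg: "regularity \<rho> u f" and ub: "uniform_bounds f0 \<rho> f"
    using sol by (auto simp: NSV_global_weak_solution_def)
  have c\<rho>: "continuous_on UNIV (\<lambda>x. \<rho> x t)" and cu: "continuous_on UNIV (\<lambda>x. u x t)" if "t \<ge> 0" for t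
    using reg that by (auto simp: regularity_def)
  have CH: "C_H1 T \<rho>" "C_H1 T u" and CL: "C_L1 T f" if "T > 0" for T using reg that by (auto simp: regularity_def)
  obtain rm rp C0 B where bd0: "rm > 0" "rp > 0" "C0 > 0" "B > 0"
    "\<forall>T>0. \<forall>t\<in>{0..T}. (\<forall>x. rm \<le> \<rho> x t \<and> \<rho> x t \<le> rp) \<and> H1_norm (\<lambda>x. \<rho> x t) \<le> C0 \<and>
        (AE (x, v) in lborel. 0 \<le> f x v t \<and> ereal (f x v t) \<le> ereal (exp (rp * T)) * Linf_norm (\<lambda>(x, v). f0 x v)) \<and>
        (AE x in lborel. ess_supp (\<lambda>v. f x v t) \<subseteq> {v. \<bar>v\<bar> \<le> B})"
    using ub unfolding uniform_bounds_def by blast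
  have bd: "rm \<le> \<rho> x t \<and> \<rho> x t \<le> rp" "H1_norm (\<lambda>x. \<rho> x t) \<le> C0"
     "AE z in lborel. 0 \<le> f (fst z) (snd z) t" "AE x in lborel. ess_supp (\<lambda>v. f x v t) \<subseteq> {v. \<bar>v\<bar> \<le> B}" if "t \<ge> 0" for t x
  proof -
    have t: "t \<in> {0..t+1}" "t + 1 > 0" using that by auto
    note b = bd0(5)[rule_format, OF t(2) t(1)]
    show "rm \<le> \<rho> x t \<and> \<rho> x t \<le> rp" "H1_norm (\<lambda>x. \<rho> x t) \<le> C0" "AE x in lborel. ess_supp (\<lambda>v. f x v t) \<subseteq> {v. \<bar>v\<bar> \<le> B}"
      using b by blast+
    have "AE (x, v) in lborel. 0 \<le> f x v t \<and> ereal (f x v t) \<le> ereal (exp (rp * (t + 1))) * Linf_norm (\<lambda>(x, v). f0 x v)"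
      using b by blast
    then show "AE z in lborel. 0 \<le> f (fst z) (snd z) t" by eventually_elim auto
  qed
  define F where "F t z = f (fst z) (snd z) t" for t :: real and z :: "real \<times> real"
  have L1f: "L1_TxR (\<lambda>x v. f x v t)" if "t \<ge> 0" for t using CL[of "t + 1"] that by (auto simp: C_L1_def)
  have fm: "(\<lambda>(x, v). f x v t) \<in> borel_measurable borel" and fi: "set_integrable lborel TxR (\<lambda>(x, v). f x v t)"
    and fp: "f (x + 1) v t = f x v t" if "t \<ge> 0" for t x v
    using L1f[OF that] by (auto simp: L1_TxR_def periodic1_def fun_eq_iff)
  have Fm: "F t \<in> borel_measurable borel" and Fi: "set_integrable lborel TxR (F t)" if "t \<ge> 0" for t
    using fm[OF that] fi[OF that] by (simp_all add: F_def[abs_def] case_prod_beta')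
  have fsupp: "AE z in lborel. \<bar>snd z\<bar> > B \<longrightarrow> F t z = 0" if t: "t \<ge> 0" for t
  proof (rule AE_lborel_prodI)
    have cl: "closed {v :: real. \<bar>v\<bar> \<le> B}" by (intro closed_Collect_le continuous_intros)
    show "AE x in lborel. AE v in lborel. \<bar>snd (x, v)\<bar> > B \<longrightarrow> F t (x, v) = 0"
      using bd(4)[OF t]
    proof eventually_elim
      case (elim x)
      from ess_supp_AE[OF elim cl] show ?case by eventually_elim (simp add: F_def not_le)
    qed
    have "{z. \<bar>snd z\<bar> > B \<longrightarrow> F t z = 0} = {z :: real \<times> real. \<bar>snd z\<bar> \<le> B} \<union> F t -` {0}" by auto
    moreover have "{z :: real \<times> real. \<bar>snd z\<bar> \<le> B} \<in> sets borel" by (intro borel_closed closed_Collect_le continuous_intros)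
    moreover have "F t -` {0} \<in> sets borel" using measurable_sets[OF Fm[OF t], of "{0}"] by simp
    ultimately show "{z. \<bar>snd z\<bar> > B \<longrightarrow> F t z = 0} \<in> sets borel" by simp
  qed
  have supp: "AE z in lborel. z \<in> TxR \<longrightarrow> \<bar>snd z\<bar> > B \<longrightarrow> F t z = 0" if "t \<ge> 0" for t
    using fsupp[OF that] by eventually_elim simp
  define R where "R t x = \<rho> x t" for t x :: real
  define U where "U t x = u x t" for t x :: real
  define Rx where "Rx t = wderiv (\<lambda>x. \<rho> x t)" for t
  define Ux where "Ux t = wderiv (\<lambda>x. u x t)" for t
  have wdR: "wd (R t) (Rx t)" and wdU: "wd (U t) (Ux t)" if "t \<ge> 0" for t
    unfolding R_def U_def Rx_def Ux_def
    by (rule C_H1_limits(1)[OF CH(1) c\<rho> that], assumption+) (rule C_H1_limits(1)[OF CH(2) cu that], assumption+)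
  have LR: "L2lim T1 R (R s) (at s within {0..})" and LRx: "L2lim T1 Rx (Rx s) (at s within {0..})" if "s \<ge> 0" for s
    unfolding R_def[abs_def] Rx_def[abs_def]
    by (rule C_H1_limits(2)[OF CH(1) c\<rho> that], assumption+) (rule C_H1_limits(3)[OF CH(1) c\<rho> that], assumption+)
  have LU: "L2lim T1 U (U s) (at s within {0..})" and LUx: "L2lim T1 Ux (Ux s) (at s within {0..})" if "s \<ge> 0" for s
    unfolding U_def[abs_def] Ux_def[abs_def]
    by (rule C_H1_limits(2)[OF CH(2) cu that], assumption+) (rule C_H1_limits(3)[OF CH(2) cu that], assumption+)
  have UR: "Ulim T1 R (R s) (at s within {0..})" if "s \<ge> 0" for s by (rule L2lim_wd_imp_Ulim[OF wdR that LR[OF that] LRx[OF that]])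
  have UU: "Ulim T1 U (U s) (at s within {0..})" if "s \<ge> 0" for s by (rule L2lim_wd_imp_Ulim[OF wdU that LU[OF that] LUx[OF that]])
  have cR: "continuous_on A (R t)" and cU: "continuous_on A (U t)" if "t \<ge> 0" for A t
    by (rule wdD(1)[OF wdR[OF that]], rule wdD(1)[OF wdU[OF that]])
  have Rb: "rm \<le> R t x \<and> R t x \<le> rp" if "t \<ge> 0" for t x using bd(1)[OF that] by (simp add: R_def)
  have F_int: "integrable (QB B) (F t)" if t: "t \<ge> 0" for t
    unfolding integrable_QB_iff
  proof (rule Bochner_Integration.integrable_bound)
    show "integrable lborel (\<lambda>z. indicator TxR z *\<^sub>R F t z)" using Fi[OF t] by (simp add: set_integrable_def)
    show "(\<lambda>z. indicator ({0..1} \<times> {-B..B}) z * F t z) \<in> borel_measurable lborel"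
      using borel_measurable_times[OF borel_measurable_indicator[OF box_sets(1)[of B]] Fm[OF t]] by simp
    show "AE z in lborel. norm (indicator ({0..1} \<times> {-B..B}) z * F t z) \<le> norm (indicator TxR z *\<^sub>R F t z)"
      by (rule AE_I2) (auto simp: indicator_def mem_Times_iff)
  qed
  have F0: "AE z in QB B. 0 \<le> F t z" if "t \<ge> 0" for t
    unfolding AE_QB using bd(3)[OF that] by eventually_elim (simp add: F_def)
  have ev: "\<forall>\<^sub>F t in at s within {0..}. t \<ge> 0" for s :: real unfolding eventually_at_filter by (rule always_eventually) simp
  have LF: "L1lim (QB B) F (F s) (at s within {0..})" if s: "s \<ge> 0" for s
    unfolding L1lim_def
  proof (intro conjI)
    show "integrable (QB B) (F s)" by (rule F_int[OF s])
    show "\<forall>\<^sub>F t in at s within {0..}. integrable (QB B) (F t)" using ev by eventually_elim (rule F_int)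
    have "((\<lambda>t. LINT (x, v):TxR|lborel. \<bar>f x v t - f x v s\<bar>) \<longlongrightarrow> 0) (at s within {0..s + 1})"
      using CL[of "s + 1"] s by (auto simp: C_L1_def)
    then have lim: "((\<lambda>t. LINT z:TxR|lborel. \<bar>F t z - F s z\<bar>) \<longlongrightarrow> 0) (at s within {0..})"
      by (simp add: at_within_Icc_Ici[OF s] F_def case_prod_beta')
    show "((\<lambda>t. \<integral>z. \<bar>F t z - F s z\<bar> \<partial>QB B) \<longlongrightarrow> 0) (at s within {0..})"
    proof (rule tendsto_0_le_real[OF lim])
      show "\<forall>\<^sub>F t in at s within {0..}. (\<integral>z. \<bar>F t z - F s z\<bar> \<partial>QB B) \<le> (LINT z:TxR|lborel. \<bar>F t z - F s z\<bar>)"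
        using ev
      proof eventually_elim
        case (elim t)
        have m: "(\<lambda>z. \<bar>F t z - F s z\<bar>) \<in> borel_measurable borel" using Fm[OF elim] Fm[OF s] by simp
        have "AE z in lborel. z \<in> TxR \<longrightarrow> \<bar>snd z\<bar> > B \<longrightarrow> \<bar>F t z - F s z\<bar> = 0"
          using supp[OF elim] supp[OF s] by eventually_elim simp
        from integral_TxR_QB[OF m refl this] show ?case by simp
      qed
    qed simp
  qed
  have Frel: "(\<lambda>z. R t (fst z) * (U t (fst z) - snd z)) \<in> borel_measurable borel"
    "continuous_on A (\<lambda>z. R t (fst z) * (U t (fst z) - snd z))" if t: "t \<ge> 0" for t and A
  proof -
    have c: "continuous_on A (\<lambda>z. R t (fst z) * (U t (fst z) - snd z))" for A
      by (intro continuous_intros continuous_on_compose2[OF cR[OF t, of UNIV]] continuous_on_compose2[OF cU[OF t, of UNIV]]) auto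
    then show "continuous_on A (\<lambda>z. R t (fst z) * (U t (fst z) - snd z))" .
    show "(\<lambda>z. R t (fst z) * (U t (fst z) - snd z)) \<in> borel_measurable borel"
      by (rule borel_measurable_continuous_onI[OF c])
  qed
  have URQ: "Ulim (QB B) (\<lambda>t z. R t (fst z) * (U t (fst z) - snd z)) (\<lambda>z. R s (fst z) * (U s (fst z) - snd z)) (at s within {0..})"
    if s: "s \<ge> 0" for s
  proof -
    have e1: "\<forall>\<^sub>F t in at s within {0..}. continuous_on {0..1} (R t)" using ev by eventually_elim (rule cR)
    have e2: "\<forall>\<^sub>F t in at s within {0..}. continuous_on {0..1} (U t)" using ev by eventually_elim (rule cU)
    have "continuous_on ({0..1} \<times> {-B..B}) (snd :: real \<times> real \<Rightarrow> real)" by (intro continuous_intros)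
    from Ulim_mult[OF Ulim_QB_fst[OF UR[OF s] cR[OF s] e1] Ulim_diff[OF Ulim_QB_fst[OF UU[OF s] cU[OF s] e2] Ulim_QB_const[OF this]]]
    show ?thesis .
  qed
  have mass_law: "((\<lambda>t. \<integral>x. R t x * \<phi> x \<partial>T1) has_real_derivative (\<integral>x. (R t x * U t x) * deriv \<phi> x \<partial>T1)) (at t within {0..})"
    if \<phi>: "test_x \<phi>" and t: "t \<ge> 0" for \<phi> t
  proof (rule du_Bois_Reymond[OF _ _ _ t])
    show "continuous_on {0..} (\<lambda>t. \<integral>x. R t x * \<phi> x \<partial>T1)"
      by (intro continuous_on_Ici_limits L1lim_integral T1.L2lim_imp_L1lim T1.Ulim_imp_L2lim
          Ulim_mult[OF UR Ulim_T1_const[OF test_xD(2)[OF \<phi>]]])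
    show "continuous_on {0..} (\<lambda>t. \<integral>x. (R t x * U t x) * deriv \<phi> x \<partial>T1)"
      by (intro continuous_on_Ici_limits L1lim_integral T1.L2lim_imp_L1lim T1.Ulim_imp_L2lim
          Ulim_mult[OF Ulim_mult[OF UR UU] Ulim_T1_const[OF test_xD(3)[OF \<phi>]]])
    fix \<theta> :: "real \<Rightarrow> real" and a b :: real
    assume \<theta>: "smooth \<theta>" "0 < a" "\<And>t. t \<notin> {a..b} \<Longrightarrow> \<theta> t = 0"
    have s\<phi>: "smooth \<phi>" using \<phi> by (simp add: test_x_def)
    have "(LINT t:{0..}|lborel. (\<integral>x. R t x * \<phi> x \<partial>T1) * deriv \<theta> t + (\<integral>x. (R t x * U t x) * deriv \<phi> x \<partial>T1) * \<theta> t)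
       = (LINT t:{0..}|lborel. LINT x:{0..1}|lborel.
        \<rho> x t * deriv (\<lambda>s. \<phi> x * \<theta> s) t + \<rho> x t * u x t * deriv (\<lambda>y. \<phi> y * \<theta> t) x)"
    proof (rule set_LINT_time_cong)
      fix t :: real assume t: "t \<ge> 0"
      have i: "integrable T1 (\<lambda>x. R t x * \<phi> x)" "integrable T1 (\<lambda>x. (R t x * U t x) * deriv \<phi> x)"
        by (intro T1.sq_integrable_integrable sq_integrable_T1_continuous continuous_intros cR[OF t] cU[OF t] test_xD(2)[OF \<phi>] test_xD(3)[OF \<phi>])+
      have "(LINT x:{0..1}|lborel. \<rho> x t * deriv (\<lambda>s. \<phi> x * \<theta> s) t + \<rho> x t * u x t * deriv (\<lambda>y. \<phi> y * \<theta> t) x)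
         = (\<integral>x. (R t x * \<phi> x) * deriv \<theta> t + ((R t x * U t x) * deriv \<phi> x) * \<theta> t \<partial>T1)"
        unfolding integral_T1[symmetric] deriv_mult_const[OF \<theta>(1)] deriv_mult_const[OF s\<phi>]
        by (rule Bochner_Integration.integral_cong) (simp_all add: R_def U_def mult.assoc)
      also have "\<dots> = (\<integral>x. R t x * \<phi> x \<partial>T1) * deriv \<theta> t + (\<integral>x. (R t x * U t x) * deriv \<phi> x \<partial>T1) * \<theta> t"
        using i by simp
      finally show "(\<integral>x. R t x * \<phi> x \<partial>T1) * deriv \<theta> t + (\<integral>x. (R t x * U t x) * deriv \<phi> x \<partial>T1) * \<theta> t
         = (LINT x:{0..1}|lborel. \<rho> x t * deriv (\<lambda>s. \<phi> x * \<theta> s) t + \<rho> x t * u x t * deriv (\<lambda>y. \<phi> y * \<theta> t) x)" ..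
    qed
    also have "\<dots> = 0" using ceq test_xt_product[OF \<phi> \<theta>] unfolding continuity_eq_def by blast
    finally show "(LINT t:{0..}|lborel. (\<integral>x. R t x * \<phi> x \<partial>T1) * deriv \<theta> t + (\<integral>x. (R t x * U t x) * deriv \<phi> x \<partial>T1) * \<theta> t) = 0" .
  qed
  define ga where "ga t x = R t x * (U t x)\<^sup>2 + R t x powr \<gamma> - (1 + R t x powr \<beta>) * Ux t x" for t x
  define gb where "gb t z = R t (fst z) * (U t (fst z) - snd z) * F t z" for t z
  have Rpos: "0 < R t x" if "t \<ge> 0" for t x using Rb[OF that, of x] bd0(1) by linarith
  have cRp: "continuous_on A (\<lambda>x. R t x powr c)" if t: "t \<ge> 0" for t c A
    by (intro continuous_on_powr cR[OF t] continuous_on_const) (use Rpos[OF t] in \<open>auto simp: less_imp_neq[symmetric]\<close>)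
  have URp: "Ulim T1 (\<lambda>t x. R t x powr c) (\<lambda>x. R s x powr c) (at s within {0..})" if s: "s \<ge> 0" for s c
    by (rule Ulim_compose[OF UR[OF s], where l=0 and c=rm])
       (use Rb[OF s] bd0(1) in \<open>auto intro!: continuous_on_powr continuous_on_id continuous_on_const\<close>)
  have Lga: "L2lim T1 ga (ga s) (at s within {0..})" if s: "s \<ge> 0" for s
  proof -
    have one: "continuous_on {0..1} (\<lambda>_::real. 1::real)" by (rule continuous_on_const)
    have "L2lim T1 (\<lambda>t x. (R t x * (U t x * U t x) + R t x powr \<gamma>) - (1 + R t x powr \<beta>) * Ux t x)
       (\<lambda>x. (R s x * (U s x * U s x) + R s x powr \<gamma>) - (1 + R s x powr \<beta>) * Ux s x) (at s within {0..})"
      by (rule L2lim_diff[OF T1.Ulim_imp_L2lim[OF Ulim_add[OF Ulim_mult[OF UR[OF s] Ulim_mult[OF UU[OF s] UU[OF s]]] URp[OF s]]]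
          L2lim_Ulim_mult[OF Ulim_add[OF Ulim_T1_const[OF one] URp[OF s]] LUx[OF s]]])
    then show ?thesis by (simp add: ga_def[abs_def] power2_eq_square)
  qed
  have sga: "sq_integrable T1 (ga t)" if "t \<ge> 0" for t using Lga[OF that] by (simp add: L2lim_def)
  have Lgb: "L1lim (QB B) gb (gb s) (at s within {0..})" if s: "s \<ge> 0" for s
    unfolding gb_def[abs_def] by (rule L1lim_Ulim_mult[OF URQ[OF s] LF[OF s]])
  have igb: "integrable (QB B) (gb t)" if "t \<ge> 0" for t using Lgb[OF that] by (simp add: L1lim_def)
  \<comment> \<open>Fubini: the inner velocity integral in the momentum equation becomes an integral over the box\<close>
  have drag: "integrable T1 (\<lambda>x. (LINT v|lborel. \<rho> x t * (u x t - v) * f x v t) * \<phi> x)"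
    "(\<integral>x. (LINT v|lborel. \<rho> x t * (u x t - v) * f x v t) * \<phi> x \<partial>T1) = (\<integral>z. \<phi> (fst z) * gb t z \<partial>QB B)"
    if t: "t \<ge> 0" and \<phi>: "test_x \<phi>" for t \<phi>
  proof -
    define k where "k z = indicator TxR z * (\<phi> (fst z) * gb t z)" for z
    have \<phi>m: "(\<lambda>z :: real \<times> real. \<phi> (fst z)) \<in> borel_measurable borel"
      by (intro borel_measurable_continuous_onI continuous_on_compose2[OF test_xD(2)[OF \<phi>, of UNIV]] continuous_intros) auto
    have gbm: "gb t \<in> borel_measurable borel" unfolding gb_def
      by (rule borel_measurable_times[OF Frel(1)[OF t] Fm[OF t]])
    have km: "k \<in> borel_measurable borel"
      unfolding k_def using \<phi>m gbm box_sets(2) by simp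
    have "integrable (QB B) (\<lambda>z. \<phi> (fst z) * gb t z)"
      by (rule integrable_QB_fst_mult[OF wd_test_x[OF \<phi>] igb[OF t]])
    then have i1: "integrable lborel (\<lambda>z. indicator ({0..1} \<times> {-B..B}) z * (\<phi> (fst z) * gb t z))" by (simp add: integrable_QB_iff)
    have ae: "AE z in lborel. indicator ({0..1} \<times> {-B..B}) z * (\<phi> (fst z) * gb t z) = k z"
      using fsupp[OF t]
    proof eventually_elim
      case (elim z)
      show ?case
      proof (cases "\<bar>snd z\<bar> > B")
        case True then show ?thesis using elim by (simp add: k_def gb_def)
      next
        case False then show ?thesis by (auto simp: k_def indicator_def mem_Times_iff)
      qed
    qed
    have ik: "integrable lborel k"
      by (rule integrable_cong_AE_imp[OF i1 _ ae]) (use km in simp)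
    then have ik': "integrable (lborel \<Otimes>\<^sub>M lborel) k" by (simp add: lborel_prod)
    have inner: "(LINT v|lborel. k (x, v)) = indicator {0..1} x * ((LINT v|lborel. \<rho> x t * (u x t - v) * f x v t) * \<phi> x)" for x
    proof -
      have k: "k (x, v) = (indicator {0..1} x * \<phi> x) * (\<rho> x t * (u x t - v) * f x v t)" for v
        by (simp add: k_def gb_def F_def R_def U_def indicator_def)
      show ?thesis unfolding k integral_mult_right_zero by (simp only: mult_ac)
    qed
    have "integrable lborel (\<lambda>x. LINT v|lborel. k (x, v))" by (rule lborel_pair.integrable_fst'[OF ik'])
    then show "integrable T1 (\<lambda>x. (LINT v|lborel. \<rho> x t * (u x t - v) * f x v t) * \<phi> x)"
      unfolding inner by (simp add: integrable_T1 set_integrable_def)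
    have "(\<integral>x. (LINT v|lborel. \<rho> x t * (u x t - v) * f x v t) * \<phi> x \<partial>T1) = (LINT x|lborel. LINT v|lborel. k (x, v))"
      unfolding inner by (simp add: integral_T1 set_lebesgue_integral_def)
    also have "\<dots> = (\<integral>z. k z \<partial>lborel)" using lborel_pair.integral_fst'[OF ik'] by (simp add: lborel_prod)
    also have "\<dots> = (\<integral>z. indicator ({0..1} \<times> {-B..B}) z * (\<phi> (fst z) * gb t z) \<partial>lborel)"
      by (rule integral_cong_AE) (use km i1 ae in \<open>auto simp: eq_commute\<close>)
    finally show "(\<integral>x. (LINT v|lborel. \<rho> x t * (u x t - v) * f x v t) * \<phi> x \<partial>T1) = (\<integral>z. \<phi> (fst z) * gb t z \<partial>QB B)"
      by (simp add: integral_QB)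
  qed
  have momentum_law: "((\<lambda>t. \<integral>x. (R t x * U t x) * \<phi> x \<partial>T1) has_real_derivative flux B (ga t) (gb t) \<phi> (deriv \<phi>)) (at t within {0..})"
    if \<phi>: "test_x \<phi>" and t: "t \<ge> 0" for \<phi> t
  proof (rule du_Bois_Reymond[OF _ _ _ t])
    show "continuous_on {0..} (\<lambda>t. \<integral>x. (R t x * U t x) * \<phi> x \<partial>T1)"
      by (intro continuous_on_Ici_limits L1lim_integral T1.L2lim_imp_L1lim T1.Ulim_imp_L2lim
          Ulim_mult[OF Ulim_mult[OF UR UU] Ulim_T1_const[OF test_xD(2)[OF \<phi>]]])
    show "continuous_on {0..} (\<lambda>t. flux B (ga t) (gb t) \<phi> (deriv \<phi>))"
      unfolding flux_def
      by (intro continuous_on_diff continuous_on_Ici_limits L1lim_integral L1lim_L2lim_mult[OF Lga L2lim_const[OF test_xD(8)[OF \<phi>]]]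
          L1lim_Ulim_mult[OF Ulim_QB_const[OF continuous_on_fst_QB[OF test_xD(2)[OF \<phi>]]] Lgb])
    fix \<theta> :: "real \<Rightarrow> real" and a b :: real
    assume \<theta>: "smooth \<theta>" "0 < a" "\<And>t. t \<notin> {a..b} \<Longrightarrow> \<theta> t = 0"
    have s\<phi>: "smooth \<phi>" using \<phi> by (simp add: test_x_def)
    let ?J = "\<lambda>x t. LINT v|lborel. \<rho> x t * (u x t - v) * f x v t"
    have "(LINT t:{0..}|lborel. (\<integral>x. (R t x * U t x) * \<phi> x \<partial>T1) * deriv \<theta> t + flux B (ga t) (gb t) \<phi> (deriv \<phi>) * \<theta> t)
       = (LINT t:{0..}|lborel. LINT x:{0..1}|lborel.
        \<rho> x t * u x t * deriv (\<lambda>s. \<phi> x * \<theta> s) t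
        + (\<rho> x t * (u x t)\<^sup>2 + \<rho> x t powr \<gamma> - viscosity \<beta> (\<rho> x t) * wderiv (\<lambda>y. u y t) x) * deriv (\<lambda>y. \<phi> y * \<theta> t) x
        - ?J x t * (\<phi> x * \<theta> t))"
    proof (rule set_LINT_time_cong)
      fix t :: real assume t: "t \<ge> 0"
      have i: "integrable T1 (\<lambda>x. (R t x * U t x) * \<phi> x)" "integrable T1 (\<lambda>x. ga t x * deriv \<phi> x)"
        by (intro T1.sq_integrable_integrable sq_integrable_T1_continuous continuous_intros cR[OF t] cU[OF t] test_xD(2)[OF \<phi>],
            rule sq_integrable_integrable_mult[OF sga[OF t] test_xD(8)[OF \<phi>]])
      have "(LINT x:{0..1}|lborel. \<rho> x t * u x t * deriv (\<lambda>s. \<phi> x * \<theta> s) t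
        + (\<rho> x t * (u x t)\<^sup>2 + \<rho> x t powr \<gamma> - viscosity \<beta> (\<rho> x t) * wderiv (\<lambda>y. u y t) x) * deriv (\<lambda>y. \<phi> y * \<theta> t) x
        - ?J x t * (\<phi> x * \<theta> t))
         = (\<integral>x. ((R t x * U t x) * \<phi> x) * deriv \<theta> t + (ga t x * deriv \<phi> x) * \<theta> t - (?J x t * \<phi> x) * \<theta> t \<partial>T1)"
        unfolding integral_T1[symmetric] deriv_mult_const[OF \<theta>(1)] deriv_mult_const[OF s\<phi>]
        by (rule Bochner_Integration.integral_cong) (simp_all add: R_def U_def ga_def Ux_def viscosity_def mult.assoc)
      also have "\<dots> = (\<integral>x. (R t x * U t x) * \<phi> x \<partial>T1) * deriv \<theta> t + (\<integral>x. ga t x * deriv \<phi> x \<partial>T1) * \<theta> t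
           - (\<integral>x. ?J x t * \<phi> x \<partial>T1) * \<theta> t"
        using i drag(1)[OF t \<phi>] by simp
      also have "\<dots> = (\<integral>x. (R t x * U t x) * \<phi> x \<partial>T1) * deriv \<theta> t + flux B (ga t) (gb t) \<phi> (deriv \<phi>) * \<theta> t"
        unfolding flux_def drag(2)[OF t \<phi>] by (simp add: left_diff_distrib)
      finally show "(\<integral>x. (R t x * U t x) * \<phi> x \<partial>T1) * deriv \<theta> t + flux B (ga t) (gb t) \<phi> (deriv \<phi>) * \<theta> t
         = (LINT x:{0..1}|lborel. \<rho> x t * u x t * deriv (\<lambda>s. \<phi> x * \<theta> s) t
        + (\<rho> x t * (u x t)\<^sup>2 + \<rho> x t powr \<gamma> - viscosity \<beta> (\<rho> x t) * wderiv (\<lambda>y. u y t) x) * deriv (\<lambda>y. \<phi> y * \<theta> t) x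
        - ?J x t * (\<phi> x * \<theta> t))" ..
    qed
    also have "\<dots> = 0" using meq test_xt_product[OF \<phi> \<theta>] unfolding momentum_eq_def by blast
    finally show "(LINT t:{0..}|lborel. (\<integral>x. (R t x * U t x) * \<phi> x \<partial>T1) * deriv \<theta> t + flux B (ga t) (gb t) \<phi> (deriv \<phi>) * \<theta> t) = 0" .
  qed
  have moment_law: "((\<lambda>t. \<integral>z. (snd z - us) ^ k * F t z \<partial>QB B) has_real_derivative
        (\<integral>z. (R t (fst z) * (U t (fst z) - snd z) * (real k * (snd z - us) ^ (k - 1))) * F t z \<partial>QB B)) (at t within {0..})"
    if t: "t \<ge> 0" for t k
  proof (rule du_Bois_Reymond[OF _ _ _ t])
    have cp: "continuous_on ({0..1} \<times> {-B..B}) (\<lambda>z. (snd z - us) ^ k)"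
      "continuous_on ({0..1} \<times> {-B..B}) (\<lambda>z. real k * (snd z - us) ^ (k - 1))" by (intro continuous_intros)+
    show "continuous_on {0..} (\<lambda>t. \<integral>z. (snd z - us) ^ k * F t z \<partial>QB B)"
      by (intro continuous_on_Ici_limits L1lim_integral L1lim_Ulim_mult[OF Ulim_QB_const[OF cp(1)] LF])
    show "continuous_on {0..} (\<lambda>t. \<integral>z. (R t (fst z) * (U t (fst z) - snd z) * (real k * (snd z - us) ^ (k - 1))) * F t z \<partial>QB B)"
      by (intro continuous_on_Ici_limits L1lim_integral L1lim_Ulim_mult[OF Ulim_mult[OF URQ Ulim_QB_const[OF cp(2)]] LF])
    fix \<theta> :: "real \<Rightarrow> real" and a b :: real
    assume \<theta>: "smooth \<theta>" "0 < a" "\<And>t. t \<notin> {a..b} \<Longrightarrow> \<theta> t = 0"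
    obtain P where P: "smooth P" "\<And>v. \<bar>v\<bar> > \<bar>B\<bar> + 2 \<Longrightarrow> P v = 0" "\<And>v. v \<in> {-B..B} \<Longrightarrow> P v = (v - us) ^ k"
      "\<And>v. v \<in> {-B..B} \<Longrightarrow> deriv P v = real k * (v - us) ^ (k - 1)" using cutoff_power[of B us k] by metis
    have "(LINT t:{0..}|lborel. (\<integral>z. (snd z - us) ^ k * F t z \<partial>QB B) * deriv \<theta> t
        + (\<integral>z. (R t (fst z) * (U t (fst z) - snd z) * (real k * (snd z - us) ^ (k - 1))) * F t z \<partial>QB B) * \<theta> t)
       = (LINT t:{0..}|lborel. LINT (x, v):TxR|lborel.
          f x v t * deriv (\<lambda>s. P v * \<theta> s) t + v * f x v t * deriv (\<lambda>y. P v * \<theta> t) x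
          + \<rho> x t * (u x t - v) * f x v t * deriv (\<lambda>w. P w * \<theta> t) v)"
    proof (rule set_LINT_time_cong)
      fix t :: real assume t: "t \<ge> 0"
      let ?H1 = "\<lambda>z. (snd z - us) ^ k * F t z"
      let ?H2 = "\<lambda>z. (R t (fst z) * (U t (fst z) - snd z) * (real k * (snd z - us) ^ (k - 1))) * F t z"
      define G where "G z = F t z * (P (snd z) * deriv \<theta> t) + (R t (fst z) * (U t (fst z) - snd z)) * F t z * (deriv P (snd z) * \<theta> t)" for z
      have i: "integrable (QB B) ?H1" "integrable (QB B) ?H2"
        by (rule integrable_QB_mult_continuous[OF cp(1) F_int[OF t]],
            rule integrable_QB_mult_continuous[OF continuous_on_mult[OF Frel(2)[OF t] cp(2)] F_int[OF t]])
      have Pm: "(\<lambda>z :: real \<times> real. P (snd z)) \<in> borel_measurable borel" "(\<lambda>z :: real \<times> real. deriv P (snd z)) \<in> borel_measurable borel"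
        by (intro borel_measurable_continuous_onI continuous_on_compose2[OF smoothD(3)[OF P(1), of UNIV]]
            continuous_on_compose2[OF smoothD(4)[OF P(1), of UNIV]] continuous_intros; simp)+
      have Gm: "G \<in> borel_measurable borel" unfolding G_def
        using Fm[OF t] Frel(1)[OF t] Pm by simp
      have "(\<lambda>(x, v). f x v t * deriv (\<lambda>s. P v * \<theta> s) t + v * f x v t * deriv (\<lambda>y. P v * \<theta> t) x
          + \<rho> x t * (u x t - v) * f x v t * deriv (\<lambda>w. P w * \<theta> t) v) = G"
        by (rule ext) (simp add: G_def F_def R_def U_def case_prod_beta' deriv_mult_const[OF \<theta>(1)] deriv_mult_const[OF P(1)])
      then have "(LINT (x, v):TxR|lborel. f x v t * deriv (\<lambda>s. P v * \<theta> s) t + v * f x v t * deriv (\<lambda>y. P v * \<theta> t) x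
          + \<rho> x t * (u x t - v) * f x v t * deriv (\<lambda>w. P w * \<theta> t) v) = (LINT z:TxR|lborel. G z)" by simp
      also have "\<dots> = (\<integral>z. ?H1 z * deriv \<theta> t + ?H2 z * \<theta> t \<partial>QB B)"
      proof (rule integral_TxR_QB[OF Gm])
        show "AE z in lborel. z \<in> TxR \<longrightarrow> \<bar>snd z\<bar> > B \<longrightarrow> G z = 0" using supp[OF t] by eventually_elim (simp add: G_def)
        fix z :: "real \<times> real" assume "z \<in> {0..1} \<times> {-B..B}"
        then have "snd z \<in> {-B..B}" by auto
        then show "G z = ?H1 z * deriv \<theta> t + ?H2 z * \<theta> t" by (simp add: G_def P(3,4) mult_ac)
      qed
      also have "\<dots> = (\<integral>z. ?H1 z \<partial>QB B) * deriv \<theta> t + (\<integral>z. ?H2 z \<partial>QB B) * \<theta> t" using i by simp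
      finally show "(\<integral>z. ?H1 z \<partial>QB B) * deriv \<theta> t + (\<integral>z. ?H2 z \<partial>QB B) * \<theta> t
        = (LINT (x, v):TxR|lborel. f x v t * deriv (\<lambda>s. P v * \<theta> s) t + v * f x v t * deriv (\<lambda>y. P v * \<theta> t) x
          + \<rho> x t * (u x t - v) * f x v t * deriv (\<lambda>w. P w * \<theta> t) v)" ..
    qed
    also have "\<dots> = 0" using veq test_xvt_product[OF P(1) \<theta> P(2)] unfolding vlasov_eq_def by blast
    finally show "(LINT t:{0..}|lborel. (\<integral>z. (snd z - us) ^ k * F t z \<partial>QB B) * deriv \<theta> t
        + (\<integral>z. (R t (fst z) * (U t (fst z) - snd z) * (real k * (snd z - us) ^ (k - 1))) * F t z \<partial>QB B) * \<theta> t) = 0" .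
  qed
  have \<rho>0m: "\<rho>0 \<in> borel_measurable borel" using W\<rho>0 by (simp add: W1inf_T_def Linf_T_def)
  have u0m: "u0 \<in> borel_measurable borel" using Hu0 by (simp add: H1_T_def L2_T_def)
  have f0m: "(\<lambda>z. f0 (fst z) (snd z)) \<in> borel_measurable borel" using Lf0 by (simp add: Linf_TxR_def case_prod_beta')
  have ic\<rho>: "AE x in lborel. \<rho> x 0 = \<rho>0 x" and icu: "AE x in lborel. u x 0 = u0 x"
    and icf: "AE z in lborel. f (fst z) (snd z) 0 = f0 (fst z) (snd z)"
    using ic by (auto simp: initial_cond_def case_prod_beta')
  have Rm: "R 0 \<in> borel_measurable borel" and Um: "U 0 \<in> borel_measurable borel"
    by (rule borel_measurable_continuous_onI[OF cR], simp, rule borel_measurable_continuous_onI[OF cU], simp)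
  have I1: "(LINT x:{0..1}|lborel. \<rho>0 x) = (\<integral>x. R 0 x \<partial>T1)"
    unfolding integral_T1
  proof (rule set_lebesgue_integral_cong_AE)
    show "AE x\<in>{0..1} in lborel. \<rho>0 x = R 0 x" using ic\<rho> by eventually_elim (simp add: R_def)
  qed (use \<rho>0m Rm in auto)
  have I2: "(LINT x:{0..1}|lborel. \<rho>0 x * u0 x) = (\<integral>x. R 0 x * U 0 x \<partial>T1)"
    unfolding integral_T1
  proof (rule set_lebesgue_integral_cong_AE)
    show "AE x\<in>{0..1} in lborel. \<rho>0 x * u0 x = R 0 x * U 0 x"
      using ic\<rho> icu by eventually_elim (simp add: R_def U_def)
  qed (use \<rho>0m Rm u0m Um in auto)
  have f00: "AE z in lborel. z \<in> TxR \<longrightarrow> \<bar>snd z\<bar> > B \<longrightarrow> F 0 z = 0" by (rule supp) simp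
  have I3: "(LINT (x, v):TxR|lborel. f0 x v) = (\<integral>z. F 0 z \<partial>QB B)"
  proof -
    have "(LINT (x, v):TxR|lborel. f0 x v) = (LINT z:TxR|lborel. F 0 z)"
    proof (rule set_lebesgue_integral_cong_AE)
      show "AE z\<in>TxR in lborel. (case z of (x, v) \<Rightarrow> f0 x v) = F 0 z"
        using icf by eventually_elim (simp add: F_def case_prod_beta')
    qed (use f0m Fm[of 0] box_sets(2) in \<open>auto simp: case_prod_beta'\<close>)
    also have "\<dots> = (\<integral>z. F 0 z \<partial>QB B)" by (rule integral_TxR_QB[OF Fm refl f00]) simp
    finally show ?thesis .
  qed
  have I4: "(LINT (x, v):TxR|lborel. v * f0 x v) = (\<integral>z. snd z * F 0 z \<partial>QB B)"
  proof -
    have sm: "(snd :: real \<times> real \<Rightarrow> real) \<in> borel_measurable borel" by (intro borel_measurable_continuous_onI continuous_intros)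
    have m: "(\<lambda>z. snd z * F 0 z) \<in> borel_measurable borel" by (rule borel_measurable_times[OF sm Fm]) simp
    have "(LINT (x, v):TxR|lborel. v * f0 x v) = (LINT z:TxR|lborel. snd z * F 0 z)"
    proof (rule set_lebesgue_integral_cong_AE)
      show "AE z\<in>TxR in lborel. (case z of (x, v) \<Rightarrow> v * f0 x v) = snd z * F 0 z"
        using icf by eventually_elim (simp add: F_def case_prod_beta')
    qed (use f0m sm m box_sets(2) in \<open>auto simp: case_prod_beta'\<close>)
    also have "\<dots> = (\<integral>z. snd z * F 0 z \<partial>QB B)"
    proof (rule integral_TxR_QB[OF m refl])
      show "AE z in lborel. z \<in> TxR \<longrightarrow> \<bar>snd z\<bar> > B \<longrightarrow> snd z * F 0 z = 0" using f00 by eventually_elim simp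
    qed
    finally show ?thesis .
  qed
  have us_eq: "us * ((\<integral>x. R 0 x \<partial>T1) + (\<integral>z. F 0 z \<partial>QB B)) = (\<integral>x. R 0 x * U 0 x \<partial>T1) + (\<integral>z. snd z * F 0 z \<partial>QB B)"
  proof -
    have "(\<integral>x. rm \<partial>T1) \<le> (\<integral>x. R 0 x \<partial>T1)"
      using T1.sq_integrable_integrable[OF wdD(5)[OF wdR[of 0]]] Rb[of 0] by (intro integral_mono) auto
    then have "rm \<le> (\<integral>x. R 0 x \<partial>T1)" by simp
    moreover have "0 \<le> (\<integral>z. F 0 z \<partial>QB B)" by (rule integral_nonneg_AE[OF F0]) simp
    ultimately have "(\<integral>x. R 0 x \<partial>T1) + (\<integral>z. F 0 z \<partial>QB B) > 0" using bd0(1) by linarith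
    then show ?thesis unfolding us_def u_inf_def I1 I2 I3 I4 by simp
  qed
  have flow: "nsv_flow \<gamma> \<beta> B rm rp us C0 R U Rx Ux F"
  proof
    show "l2 T1 (Rx t) \<le> C0" if "t \<ge> 0" for t
    proof -
      have "l2 T1 (Rx t) \<le> H1_norm (\<lambda>x. \<rho> x t)"
        unfolding H1_norm_def L2_norm_T1 Rx_def by (rule real_le_rsqrt) simp
      then show ?thesis using bd(2)[OF that] by linarith
    qed
    show "((\<lambda>t. \<integral>x. (R t x * U t x) * \<phi> x \<partial>T1) has_real_derivative
        flux B (\<lambda>x. R t x * (U t x)\<^sup>2 + R t x powr \<gamma> - (1 + R t x powr \<beta>) * Ux t x)
               (\<lambda>z. R t (fst z) * (U t (fst z) - snd z) * F t z) \<phi> (deriv \<phi>)) (at t within {0..})"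
      if "test_x \<phi>" "t \<ge> 0" for \<phi> t
      using momentum_law[OF that] unfolding ga_def[abs_def] gb_def[abs_def] .
  qed (fact \<gamma> \<beta> bd0(1) | rule wdR wdU Rb LR LRx LU LUx F_int F0 LF mass_law moment_law us_eq; assumption)+
  show ?thesis
  proof (rule that)
    show "nsv_flow \<gamma> \<beta> B rm rp (u_inf \<rho>0 u0 f0) C0 (\<lambda>t x. \<rho> x t) (\<lambda>t x. u x t)
       (\<lambda>t. wderiv (\<lambda>x. \<rho> x t)) (\<lambda>t. wderiv (\<lambda>x. u x t)) (\<lambda>t z. f (fst z) (snd z) t)"
      using flow unfolding us_def R_def[abs_def] U_def[abs_def] Rx_def[abs_def] Ux_def[abs_def] F_def[abs_def] .
    show "mean_density \<rho>0 = (\<integral>x. \<rho> x 0 \<partial>T1)" unfolding mean_density_def I1 by (simp add: R_def[abs_def])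
    show "AE z in lborel. z \<in> TxR \<longrightarrow> \<bar>snd z\<bar> > B \<longrightarrow> f (fst z) (snd z) t = 0" if "t \<ge> 0" for t
      using supp[OF that] by (simp add: F_def)
  qed (use fm fi fp bd(3) in auto)
qed

section \<open>Exponential alignment\<close>

theorem theorem1p2:
  fixes \<gamma> \<beta> R0 :: real
    and \<rho>0 u0 :: "real \<Rightarrow> real" and f0 :: "real \<Rightarrow> real \<Rightarrow> real"
    and \<rho> u :: "real \<Rightarrow> real \<Rightarrow> real" and f :: "real \<Rightarrow> real \<Rightarrow> real \<Rightarrow> real"
  assumes "\<gamma> > 1" and "\<beta> \<ge> 0" and "R0 > 0"
    and "(INF x. ereal (\<rho>0 x)) > 0" and "W1inf_T \<rho>0"
    and "H1_T u0"
    and "AE (x, v) in lborel. 0 \<le> f0 x v" and "Linf_TxR f0"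
    and "AE x in lborel. ess_supp (f0 x) \<subseteq> {v. \<bar>v\<bar> \<le> R0}"
    and "NSV_global_weak_solution \<gamma> \<beta> \<rho>0 u0 f0 \<rho> u f"
  shows "\<exists>C1>0. \<exists>lam>0. \<forall>t\<ge>0.
     C0_norm (\<lambda>x. \<rho> x t - mean_density \<rho>0) + L2_norm {0..1} (\<lambda>x. u x t - u_inf \<rho>0 u0 f0)
       \<le> C1 * exp (- lam * t) \<and>
     ereal (L2_norm TxR (\<lambda>(x, v). sqrt (f x v t) * (v - u_inf \<rho>0 u0 f0)))
       + W1 (kinetic_measure (\<lambda>x v. f x v t))
            (monokinetic_measure (\<lambda>x. num_density f x t) (u_inf \<rho>0 u0 f0))
       \<le> ereal (C1 * exp (- lam * t)) \<and>
     (AE x in lborel. ess_supp (\<lambda>v. f x v t) \<subseteq> {v. \<bar>v - u_inf \<rho>0 u0 f0\<bar> \<le> C1 * exp (- lam * t)})"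
proof -
  define us where "us = u_inf \<rho>0 u0 f0"
  obtain B rm rp C0 where flow: "nsv_flow \<gamma> \<beta> B rm rp us C0 (\<lambda>t x. \<rho> x t) (\<lambda>t x. u x t)
       (\<lambda>t. wderiv (\<lambda>x. \<rho> x t)) (\<lambda>t. wderiv (\<lambda>x. u x t)) (\<lambda>t z. f (fst z) (snd z) t)"
    and mean: "mean_density \<rho>0 = (\<integral>x. \<rho> x 0 \<partial>T1)"
    and fm: "\<And>t. t \<ge> 0 \<Longrightarrow> (\<lambda>(x, v). f x v t) \<in> borel_measurable borel"
    and fi: "\<And>t. t \<ge> 0 \<Longrightarrow> set_integrable lborel TxR (\<lambda>(x, v). f x v t)"
    and fp: "\<And>t x v. t \<ge> 0 \<Longrightarrow> f (x + 1) v t = f x v t"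
    and f0: "\<And>t. t \<ge> 0 \<Longrightarrow> AE z in lborel. 0 \<le> f (fst z) (snd z) t"
    and supp: "\<And>t. t \<ge> 0 \<Longrightarrow> AE z in lborel. z \<in> TxR \<longrightarrow> \<bar>snd z\<bar> > B \<longrightarrow> f (fst z) (snd z) t = 0"
    unfolding us_def
  proof (rule NSV_imp_flow[OF assms(1,2,5,6,8,10)], goal_cases)
    case (1 B rm rp C0)
    show ?case by (rule 1(1)[OF 1(2-8)])
  qed
  interpret N: nsv_flow \<gamma> \<beta> B rm rp us C0 "\<lambda>t x. \<rho> x t" "\<lambda>t x. u x t"
       "\<lambda>t. wderiv (\<lambda>x. \<rho> x t)" "\<lambda>t. wderiv (\<lambda>x. u x t)" "\<lambda>t z. f (fst z) (snd z) t" by (rule flow)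
  have rb: "N.rb = mean_density \<rho>0" by (simp add: N.rb_def mean)
  obtain C lam :: real where C: "C > 0" "lam > 0"
    "\<And>t x. t \<ge> 0 \<Longrightarrow> x \<in> {0..1} \<Longrightarrow> \<bar>\<rho> x t - N.rb\<bar> \<le> C * exp (- lam * t)"
    "\<And>t. t \<ge> 0 \<Longrightarrow> l2 T1 (\<lambda>x. u x t - us) \<le> C * exp (- lam * t)"
    "\<And>t. t \<ge> 0 \<Longrightarrow> AE z in QB B. f (fst z) (snd z) t \<noteq> 0 \<longrightarrow> \<bar>snd z - us\<bar> \<le> C * exp (- lam * t)"
  proof (rule N.exponential_decay, goal_cases)
    case (1 C lam)
    show ?case by (rule 1(1)[OF 1(2-6)])
  qed
  define C1 where "C1 = C * (2 + sqrt N.Mf + N.Mf)"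
  have Mf: "N.Mf \<ge> 0" by (rule N.Mf_nonneg)
  have C1: "C1 > 0" "2 * C \<le> C1" "C \<le> C1" using C(1) Mf by (auto simp: C1_def distrib_left intro!: mult_pos_pos add_pos_nonneg)
  show ?thesis
    unfolding us_def[symmetric]
  proof (rule exI[of _ C1], rule conjI[OF C1(1)], rule exI[of _ lam], rule conjI[OF C(2)], intro allI impI conjI)
    fix t :: real assume t: "t \<ge> 0"
    define r where "r = C * exp (- lam * t)"
    have r: "r \<ge> 0" using C(1) by (simp add: r_def)
    have "C0_norm (\<lambda>x. \<rho> x t - mean_density \<rho>0) \<le> r"
      unfolding C0_norm_def using C(3)[OF t] by (intro cSUP_least) (auto simp: rb r_def)
    moreover have "L2_norm {0..1} (\<lambda>x. u x t - us) \<le> r" using C(4)[OF t] by (simp add: L2_norm_T1 r_def)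
    moreover have "2 * r \<le> C1 * exp (- lam * t)" using mult_right_mono[OF C1(2), of "exp (- lam * t)"] by (simp add: r_def)
    ultimately show "C0_norm (\<lambda>x. \<rho> x t - mean_density \<rho>0) + L2_norm {0..1} (\<lambda>x. u x t - us) \<le> C1 * exp (- lam * t)" by linarith
    define F where "F z = f (fst z) (snd z) t" for z :: "real \<times> real"
    have Fm: "F \<in> borel_measurable borel" using fm[OF t] by (simp add: F_def[abs_def] case_prod_beta')
    have supp': "AE z in lborel. z \<in> TxR \<longrightarrow> \<bar>snd z\<bar> > B \<longrightarrow> F z = 0" using supp[OF t] by (simp add: F_def)
    have near: "AE z in QB B. F z \<noteq> 0 \<longrightarrow> \<bar>snd z - us\<bar> \<le> r" using C(5)[OF t] by (simp add: F_def r_def)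
    have F0: "AE z in QB B. 0 \<le> F z" using N.f_nonneg[OF t] by (simp add: F_def)
    have iF: "integrable (QB B) F" using N.f_int[OF t] by (simp add: F_def[abs_def])
    have MF: "(\<integral>z. F z \<partial>QB B) = N.Mf" using N.fmass_const[OF t] by (simp add: F_def)
    have moment: "(\<integral>z. k (snd z) * F z \<partial>QB B) \<le> K * N.Mf"
      if k: "continuous_on UNIV k" "\<And>v. \<bar>v - us\<bar> \<le> r \<Longrightarrow> k v \<le> K" for k :: "real \<Rightarrow> real" and K
    proof -
      have ck: "continuous_on ({0..1} \<times> {-B..B}) (\<lambda>z. k (snd z))"
        by (rule continuous_on_compose2[OF k(1)]) (auto intro!: continuous_intros)
      have "(\<integral>z. k (snd z) * F z \<partial>QB B) \<le> (\<integral>z. K * F z \<partial>QB B)"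
      proof (rule integral_mono_AE[OF integrable_QB_mult_continuous[OF ck iF] integrable_mult_right[OF iF]])
        show "AE z in QB B. k (snd z) * F z \<le> K * F z"
          using near F0
        proof eventually_elim
          case (elim z)
          show ?case
          proof (cases "F z = 0")
            case False
            then show ?thesis using elim k(2)[of "snd z"] by (intro mult_right_mono) auto
          qed simp
        qed
      qed
      then show ?thesis using MF by simp
    qed
    have sm: "(snd :: real \<times> real \<Rightarrow> real) \<in> borel_measurable borel" by (intro borel_measurable_continuous_onI continuous_intros)
    have L2: "L2_norm TxR (\<lambda>(x, v). sqrt (f x v t) * (v - us)) \<le> r * sqrt N.Mf"
    proof -
      define G where "G z = (sqrt (F z) * (snd z - us))\<^sup>2" for z
      have Gm: "G \<in> borel_measurable borel" unfolding G_def using Fm sm by simp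
      have "(LINT z:TxR|lborel. (case z of (x, v) \<Rightarrow> sqrt (f x v t) * (v - us))\<^sup>2) = (LINT z:TxR|lborel. G z)"
        by (simp add: G_def F_def case_prod_beta')
      also have "\<dots> = (\<integral>z. G z \<partial>QB B)"
      proof (rule integral_TxR_QB[OF Gm refl])
        show "AE z in lborel. z \<in> TxR \<longrightarrow> \<bar>snd z\<bar> > B \<longrightarrow> G z = 0" using supp' by eventually_elim (simp add: G_def)
      qed
      also have "\<dots> = (\<integral>z. (snd z - us)\<^sup>2 * F z \<partial>QB B)"
      proof (rule integral_cong_AE)
        show "AE z in QB B. G z = (snd z - us)\<^sup>2 * F z" using F0 by eventually_elim (simp add: G_def power_mult_distrib)
        show "G \<in> borel_measurable (QB B)" using Gm by (intro measurable_restrict_space1) simp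
        show "(\<lambda>z. (snd z - us)\<^sup>2 * F z) \<in> borel_measurable (QB B)"
          using Fm sm by (intro measurable_restrict_space1) simp
      qed
      also have "\<dots> \<le> r\<^sup>2 * N.Mf"
      proof (rule moment)
        show "(v - us)\<^sup>2 \<le> r\<^sup>2" if "\<bar>v - us\<bar> \<le> r" for v using power_mono[OF that, of 2] by simp
      qed (intro continuous_intros)
      finally have "L2_norm TxR (\<lambda>(x, v). sqrt (f x v t) * (v - us)) \<le> sqrt (r\<^sup>2 * N.Mf)" unfolding L2_norm_def by simp
      then show ?thesis using r by (simp add: real_sqrt_mult)
    qed
    have W: "W1 (kinetic_measure (\<lambda>x v. f x v t)) (monokinetic_measure (\<lambda>x. num_density f x t) us) \<le> ereal (r * N.Mf)"
    proof -
      have "W1 (kinetic_measure (\<lambda>x v. f x v t)) (monokinetic_measure (\<lambda>x. num_density f x t) us)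
          \<le> ereal (LINT z:TxR|lborel. \<bar>snd z - us\<bar> * f (fst z) (snd z) t)"
        using W1_monokinetic_le[OF fm[OF t] fi[OF t] f0[OF t] supp[OF t], of us] by (simp add: num_density_def[abs_def])
      also have "(LINT z:TxR|lborel. \<bar>snd z - us\<bar> * f (fst z) (snd z) t) = (\<integral>z. \<bar>snd z - us\<bar> * F z \<partial>QB B)"
      proof (rule integral_TxR_QB)
        show "(\<lambda>z. \<bar>snd z - us\<bar> * f (fst z) (snd z) t) \<in> borel_measurable borel"
          using Fm sm by (simp add: F_def[abs_def])
        show "AE z in lborel. z \<in> TxR \<longrightarrow> \<bar>snd z\<bar> > B \<longrightarrow> \<bar>snd z - us\<bar> * f (fst z) (snd z) t = 0"
          using supp[OF t] by eventually_elim simp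
      qed (simp add: F_def)
      also have "\<dots> \<le> r * N.Mf" by (rule moment) (intro continuous_intros)
      finally show ?thesis by simp
    qed
    have tot: "r * sqrt N.Mf + r * N.Mf \<le> C1 * exp (- lam * t)"
      using r by (simp add: C1_def r_def algebra_simps)
    have "ereal (L2_norm TxR (\<lambda>(x, v). sqrt (f x v t) * (v - us)))
       + W1 (kinetic_measure (\<lambda>x v. f x v t)) (monokinetic_measure (\<lambda>x. num_density f x t) us)
       \<le> ereal (r * sqrt N.Mf) + ereal (r * N.Mf)" by (rule add_mono[OF _ W]) (use L2 in simp)
    also have "\<dots> \<le> ereal (C1 * exp (- lam * t))" using tot by simp
    finally show "ereal (L2_norm TxR (\<lambda>(x, v). sqrt (f x v t) * (v - us)))
       + W1 (kinetic_measure (\<lambda>x v. f x v t)) (monokinetic_measure (\<lambda>x. num_density f x t) us)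
       \<le> ereal (C1 * exp (- lam * t))" .
    have rC: "r \<le> C1 * exp (- lam * t)" using mult_right_mono[OF C1(3), of "exp (- lam * t)"] by (simp add: r_def)
    define K where "K = {v. \<bar>v - us\<bar> \<le> C1 * exp (- lam * t)}"
    have K: "closed K" unfolding K_def by (intro closed_Collect_le continuous_intros)
    have "AE z in lborel. z \<in> TxR \<longrightarrow> snd z \<notin> K \<longrightarrow> F z = 0"
      using near[unfolded AE_QB] supp'
    proof eventually_elim
      case (elim z)
      show ?case
      proof (intro impI, rule ccontr)
        assume z: "z \<in> TxR" "snd z \<notin> K" "F z \<noteq> 0"
        then have "\<not> \<bar>snd z\<bar> > B" using elim by blast
        then have "z \<in> {0..1} \<times> {-B..B}" using z(1) by (auto simp: mem_Times_iff)
        then have "\<bar>snd z - us\<bar> \<le> r" using elim z(3) by blast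
        then show False using z(2) rC by (simp add: K_def)
      qed
    qed
    from AE_lborel_prodD[OF this]
    have ae: "AE x in lborel. x \<in> {0..1} \<longrightarrow> (AE v in lborel. v \<notin> K \<longrightarrow> f x v t = 0)"
      by eventually_elim (simp add: F_def)
    have "AE x in lborel. AE v in lborel. v \<notin> K \<longrightarrow> f x v t = 0"
      by (rule AE_periodic[OF ae]) (simp add: fp[OF t])
    then have "AE x in lborel. ess_supp (\<lambda>v. f x v t) \<subseteq> K" by eventually_elim (rule ess_supp_subsetI[OF _ K])
    then show "AE x in lborel. ess_supp (\<lambda>v. f x v t) \<subseteq> {v. \<bar>v - us\<bar> \<le> C1 * exp (- lam * t)}" by (simp add: K_def)
  qed
qed

end
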